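(* Let $\mathbb{F}$ be a field of characteristic $3$, let $\mathcal{K}$ be a quadratic étale $\mathbb{F}$-algebra, $a\in\mathcal{K}$ an element of norm $1$, let $(\mathcal{C},\cdot,n)$, $\mathcal{C}=\mathcal{K}\oplus\mathcal{W}$, be the split Cayley algebra constructed from $(\mathcal{K},a)$, and let $\tau=\tau_{\mathcal{K},a}$ be its associated order $3$ automorphism. Let $\mathbf{H}=\mathbf{Cent}_{\mathbf{Aut}(\mathcal{C},\cdot,n)}(\tau)$ be its centralizer. Then there is a short exact sequence $$1\rightarrow\bigl(\mathbf{K}\rtimes\boldsymbol{\mu}_{3[\mathcal{K}]}\bigr)\times\mathbf{N}\rightarrow\mathbf{H}\rightarrow\mathsf{C}_2\rightarrow 1,$$ where $\mathsf{C}_2$ is the constant group scheme of the cyclic group of order $2$, and: - $\boldsymbol{\mu}_{3[\mathcal{K}]}$ is the twisted form of $\boldsymbol{\mu}_3$ such that $\boldsymbol{\mu}_{3[\mathcal{K}]}(R)=\{r\in\mathcal{K}\otimes_{\mathbb{F}}R: r^3=1,\ n(r)=1\}$ for any unital commutative associative $\mathbb{F}$-algebra $R$ (with $n$ the $R$-extension of the generic norm of $\mathcal{K}$); it embeds in $\mathbf{H}$ by sending $r\in\boldsymbol{\mu}_{3[\mathcal{K}]}(R)$ to the automorphism of $\mathcal{C}\otimes_{\mathbb{F}}R$ that is the identity on $\mathcal{K}\otimes_{\mathbb{F}}R$ and $r$ times the identity on $\mathcal{W}\otimes_{\mathbb{F}}R$; - $\mathbf{K}$ is the abelian subgroup such that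 $\mathbf{K}(R)=\{\exp(\mathrm{ad}_x): x\in\mathrm{rad}(\mathrm{Fix}(\tau))\otimes_{\mathbb{F}}R\}$ for any $R$, so that $\mathbf{K}$ is isomorphic to $\mathbf{G}_a^2$; - $\mathbf{N}$ is the two-dimensional unipotent subgroup obtained as the kernel of the restriction map $\mathbf{H}\rightarrow\mathbf{Aut}(\mathrm{Fix}(\tau))$; it is also isomorphic to $\mathbf{G}_a^2$.
   Context: Algebraic groups are affine group schemes of finite type over $\mathbb{F}$, viewed as functors on unital commutative associative $\mathbb{F}$-algebras $R$. $\mathbf{Aut}(\mathcal{C},\cdot,n)(R)$ is the group of automorphisms of $\mathcal{C}\otimes_{\mathbb{F}}R$ over $R$, and the centralizer is scheme-theoretic. $\mathbf{G}_a$ is the additive group. Construction of $\mathcal{C}$ and $\tau_{\mathcal{K},a}$ ($\mathrm{char}\,\mathbb{F}=3$). Let $b\mapsto\bar b$ and $n$ be the conjugation and norm of the quadratic étale algebra $\mathcal{K}$, and $n(a)=1$. Let $\mathcal{W}$ be a free left $\mathcal{K}$-module with basis $w_1,w_2,w_3$, let $\sigma:\mathcal{W}\times\mathcal{W}\to\mathcal{K}$ be the hermitian form ($\mathcal{K}$-linear in the first variable, $\sigma(y,x)=\overline{\sigma(x,y)}$) with $\sigma(w_i,w_i)=0$, $\sigma(w_i,w_j)=-1$ for $i\neq j$, and let $\Phi:\mathcal{W}^3\to\mathcal{K}$ be the alternating $\mathcal{K}$-trilinear form with $\Phi(w_1,w_2,w_3)=a$. Define $x\times y\in\mathcal{W}$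 by $\sigma(z,x\times y)=\Phi(z,x,y)$ for all $z$. Then $\mathcal{C}=\mathcal{K}\oplus\mathcal{W}$ is a Cayley algebra ($8$-dimensional unital composition algebra), isomorphic to the split one, with $\mathcal{K}$ a subalgebra, $b\cdot x$ the module action and $x\cdot b=\bar b\cdot x$ for $b\in\mathcal{K}$, $x\in\mathcal{W}$, $x\cdot y=-\sigma(x,y)+x\times y$ for $x,y\in\mathcal{W}$, and norm extending that of $\mathcal{K}$ with $n(x)=\sigma(x,x)$ on $\mathcal{W}$ and $\mathcal{K}\perp\mathcal{W}$. $\tau_{\mathcal{K},a}$ is the identity on $\mathcal{K}$, $\mathcal{K}$-linear on $\mathcal{W}$, and maps $w_1\mapsto w_2\mapsto w_3\mapsto w_1$. $\mathrm{Fix}(\tau)=\{x\in\mathcal{C}:\tau(x)=x\}=\mathcal{K}\oplus\mathcal{K}\cdot(w_1+w_2+w_3)$ is an associative subalgebra and $\mathrm{rad}(\mathrm{Fix}(\tau))$ is its nilpotent radical. $\mathrm{ad}_x(y)=x\cdot y-y\cdot x$ (a derivation in characteristic $3$); for $x\in\mathrm{rad}(\mathrm{Fix}(\tau))\otimes R$ one has $\mathrm{ad}_x^3=0$ and $\exp(\mathrm{ad}_x)=\mathrm{id}+\mathrm{ad}_x+\frac12\mathrm{ad}_x^2$. *)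

theory Defs
  imports
    "HOL-Algebra.Algebra"
    "HOL-Algebra.Algebraic_Closure_Type"
    "HOL-Computational_Algebra.Computational_Algebra"
    "HOL-Library.Product_Plus"
begin

section \<open>Group functors on commutative algebras over a field\<close>

text \<open>
  The ground field is a type \<open>'f\<close>. A commutative algebra \<open>R\<close> is a record with carrier in a type
  \<open>'u\<close>, which plays the role of a universe. As soon as \<open>'u\<close> is infinite and at least as large
  as \<open>'f\<close>, it contains a copy of every finitely generated commutative algebra, so that (Yoneda)
  morphisms of affine schemes of finite type are the same as natural transformations of their
  functors of points on this universe.
\<close>

abbreviation comm_alg :: "('f::field, 'u) module \<Rightarrow> bool" where
  "comm_alg R \<equiv> algebra (ring_of_type_algebra :: 'f ring) R"

definition comm_alg_hom ::
    "('f::field, 'u) module \<Rightarrow> ('f, 'u) module \<Rightarrow> ('u \<Rightarrow> 'u) \<Rightarrow> bool" where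
  "comm_alg_hom R S f \<longleftrightarrow> comm_alg R \<and> comm_alg S \<and> f \<in> ring_hom R S \<and>
     (\<forall>c. \<forall>r \<in> carrier R. f (c \<odot>\<^bsub>R\<^esub> r) = c \<odot>\<^bsub>S\<^esub> f r)"

record ('f, 'u, 'g) grp_functor =
  pts :: "('f, 'u) module \<Rightarrow> 'g monoid"
  mor :: "('f, 'u) module \<Rightarrow> ('f, 'u) module \<Rightarrow> ('u \<Rightarrow> 'u) \<Rightarrow> 'g \<Rightarrow> 'g"

text \<open>
  Algebra homomorphisms are HOL functions on all of \<open>'u\<close>, of which only the values on the carrier
  matter; the last clause says that \<open>mor\<close> respects this.
\<close>

definition group_functor :: "('f::field, 'u, 'g) grp_functor \<Rightarrow> bool" where
  "group_functor G \<longleftrightarrow>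
     (\<forall>R. comm_alg R \<longrightarrow> group (pts G R)) \<and>
     (\<forall>R S f. comm_alg_hom R S f \<longrightarrow> mor G R S f \<in> hom (pts G R) (pts G S)) \<and>
     (\<forall>R. comm_alg R \<longrightarrow> (\<forall>x \<in> carrier (pts G R). mor G R R (\<lambda>r. r) x = x)) \<and>
     (\<forall>R S T f h. comm_alg_hom R S f \<longrightarrow> comm_alg_hom S T h \<longrightarrow>
        (\<forall>x \<in> carrier (pts G R). mor G R T (\<lambda>r. h (f r)) x = mor G S T h (mor G R S f x))) \<and>
     (\<forall>R S f f'. comm_alg_hom R S f \<longrightarrow> comm_alg_hom R S f' \<longrightarrow> (\<forall>r \<in> carrier R. f r = f' r) \<longrightarrow>
        (\<forall>x \<in> carrier (pts G R). mor G R S f x = mor G R S f' x))"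

definition functor_hom ::
    "('f::field, 'u, 'g) grp_functor \<Rightarrow> ('f, 'u, 'h) grp_functor \<Rightarrow>
     (('f, 'u) module \<Rightarrow> 'g \<Rightarrow> 'h) \<Rightarrow> bool" where
  "functor_hom G H t \<longleftrightarrow>
     (\<forall>R. comm_alg R \<longrightarrow> t R \<in> hom (pts G R) (pts H R)) \<and>
     (\<forall>R S f. comm_alg_hom R S f \<longrightarrow>
        (\<forall>x \<in> carrier (pts G R). t S (mor G R S f x) = mor H R S f (t R x)))"

definition functor_mono ::
    "('f::field, 'u, 'g) grp_functor \<Rightarrow> ('f, 'u, 'h) grp_functor \<Rightarrow>
     (('f, 'u) module \<Rightarrow> 'g \<Rightarrow> 'h) \<Rightarrow> bool" where
  "functor_mono G H t \<longleftrightarrow> functor_hom G H t \<and>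
     (\<forall>R. comm_alg R \<longrightarrow> inj_on (t R) (carrier (pts G R)))"

definition functor_isomorphic ::
    "('f::field, 'u, 'g) grp_functor \<Rightarrow> ('f, 'u, 'h) grp_functor \<Rightarrow> bool" where
  "functor_isomorphic G H \<longleftrightarrow> group_functor G \<and> group_functor H \<and>
     (\<exists>t. functor_hom G H t \<and> (\<forall>R. comm_alg R \<longrightarrow> t R \<in> iso (pts G R) (pts H R)))"

definition subgroup_functor ::
    "('f::field, 'u, 'g) grp_functor \<Rightarrow> ('f, 'u, 'g) grp_functor \<Rightarrow> bool" where
  "subgroup_functor G H \<longleftrightarrow> group_functor G \<and> group_functor H \<and>
     (\<forall>R. comm_alg R \<longrightarrow> subgroup (carrier (pts G R)) (pts H R) \<and>
        pts G R = (pts H R)\<lparr>carrier := carrier (pts G R)\<rparr>) \<and>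
     (\<forall>R S f. comm_alg_hom R S f \<longrightarrow> (\<forall>x \<in> carrier (pts G R). mor G R S f x = mor H R S f x))"

text \<open>
  The coordinate algebra of \<open>G\<close>, as the set of natural transformations from \<open>G\<close> to the affine line.
\<close>

definition regular_fun ::
    "('f::field, 'u, 'g) grp_functor \<Rightarrow> (('f, 'u) module \<Rightarrow> 'g \<Rightarrow> 'u) \<Rightarrow> bool" where
  "regular_fun G u \<longleftrightarrow>
     (\<forall>R. comm_alg R \<longrightarrow> (\<forall>x \<in> carrier (pts G R). u R x \<in> carrier R)) \<and>
     (\<forall>R S f. comm_alg_hom R S f \<longrightarrow>
        (\<forall>x \<in> carrier (pts G R). u S (mor G R S f x) = f (u R x)))"

text \<open>
  A homomorphism of affine group schemes is surjective (a quotient map) if its comorphism on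
  coordinate algebras is injective. This is not surjectivity on \<open>R\<close>-points.
\<close>

definition functor_quotient ::
    "('f::field, 'u, 'g) grp_functor \<Rightarrow> ('f, 'u, 'h) grp_functor \<Rightarrow>
     (('f, 'u) module \<Rightarrow> 'g \<Rightarrow> 'h) \<Rightarrow> bool" where
  "functor_quotient G Q p \<longleftrightarrow> functor_hom G Q p \<and>
     (\<forall>u v. regular_fun Q u \<longrightarrow> regular_fun Q v \<longrightarrow>
        (\<forall>R. comm_alg R \<longrightarrow> (\<forall>x \<in> carrier (pts G R). u R (p R x) = v R (p R x))) \<longrightarrow>
        (\<forall>R. comm_alg R \<longrightarrow> (\<forall>y \<in> carrier (pts Q R). u R y = v R y)))"

definition short_exact ::
    "('f::field, 'u, 'g) grp_functor \<Rightarrow> ('f, 'u, 'h) grp_functor \<Rightarrow> ('f, 'u, 'q) grp_functor \<Rightarrow>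
     (('f, 'u) module \<Rightarrow> 'g \<Rightarrow> 'h) \<Rightarrow> (('f, 'u) module \<Rightarrow> 'h \<Rightarrow> 'q) \<Rightarrow> bool" where
  "short_exact G H Q i p \<longleftrightarrow>
     group_functor G \<and> group_functor H \<and> group_functor Q \<and>
     functor_mono G H i \<and> functor_quotient H Q p \<and>
     (\<forall>R. comm_alg R \<longrightarrow> i R ` carrier (pts G R) = kernel (pts H R) (pts Q R) (p R))"

text \<open>
  \<open>G\<close> is a twisted form of \<open>G'\<close>: they become isomorphic over a field extension \<open>L\<close>.
  An \<open>L\<close>-algebra is an algebra \<open>R\<close> together with a homomorphism \<open>j\<close> from \<open>L\<close> to \<open>R\<close>.
\<close>

definition twisted_form ::
    "('f::field, 'u, 'g) grp_functor \<Rightarrow> ('f, 'u, 'h) grp_functor \<Rightarrow> bool" where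
  "twisted_form G G' \<longleftrightarrow> group_functor G \<and> group_functor G' \<and>
     (\<exists>L t. comm_alg L \<and> field L \<and>
        (\<forall>R j. comm_alg_hom L R j \<longrightarrow> t R j \<in> iso (pts G R) (pts G' R)) \<and>
        (\<forall>R S j k f. comm_alg_hom L R j \<longrightarrow> comm_alg_hom L S k \<longrightarrow> comm_alg_hom R S f \<longrightarrow>
           (\<forall>l \<in> carrier L. k l = f (j l)) \<longrightarrow>
           (\<forall>x \<in> carrier (pts G R). t S k (mor G R S f x) = mor G' R S f (t R j x))))"

definition add_square_functor :: "('f::field, 'u, 'u \<times> 'u) grp_functor" where
  "add_square_functor =
     \<lparr>pts = \<lambda>R. add_monoid R \<times>\<times> add_monoid R, mor = \<lambda>R S f. map_prod f f\<rparr>"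

definition mu3_functor :: "('f::field, 'u, 'u) grp_functor" where
  "mu3_functor =
     \<lparr>pts = \<lambda>R. \<lparr>carrier = {r \<in> carrier R. r \<otimes>\<^bsub>R\<^esub> r \<otimes>\<^bsub>R\<^esub> r = \<one>\<^bsub>R\<^esub>}, monoid.mult = monoid.mult R, one = \<one>\<^bsub>R\<^esub>\<rparr>,
      mor = \<lambda>R S f. f\<rparr>"

text \<open>
  The constant group scheme of a finite group \<open>G\<close>, represented by the algebra of all functions from
  \<open>G\<close> to the ground field: a homomorphism from that algebra to \<open>R\<close> is determined by the images
  \<open>e g\<close> of the characteristic functions of the elements \<open>g\<close>, which form a complete family of
  orthogonal idempotents.
\<close>

definition constant_functor :: "'g monoid \<Rightarrow> ('f::field, 'u, 'g \<Rightarrow> 'u) grp_functor" where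
  "constant_functor G =
     \<lparr>pts = \<lambda>R.
        \<lparr>carrier = {e \<in> carrier G \<rightarrow>\<^sub>E carrier R.
             (\<forall>g \<in> carrier G. \<forall>h \<in> carrier G. e g \<otimes>\<^bsub>R\<^esub> e h = (if g = h then e g else \<zero>\<^bsub>R\<^esub>)) \<and>
             finsum R e (carrier G) = \<one>\<^bsub>R\<^esub>},
         monoid.mult = (\<lambda>e e'. \<lambda>g \<in> carrier G.
             finsum R (\<lambda>(h, k). e h \<otimes>\<^bsub>R\<^esub> e' k)
               {(h, k) \<in> carrier G \<times> carrier G. h \<otimes>\<^bsub>G\<^esub> k = g}),
         one = (\<lambda>g \<in> carrier G. if g = \<one>\<^bsub>G\<^esub> then \<one>\<^bsub>R\<^esub> else \<zero>\<^bsub>R\<^esub>)\<rparr>,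
      mor = \<lambda>R S f e. \<lambda>g \<in> carrier G. f (e g)\<rparr>"

text \<open>
  Semidirect product of a subgroup functor \<open>K\<close> of \<open>H\<close> and a group functor \<open>M\<close> embedded in \<open>H\<close> by \<open>i\<close>,
  where \<open>M\<close> acts on \<open>K\<close> by conjugation inside \<open>H\<close>.
\<close>

definition semidirect_functor ::
    "('f::field, 'u, 'g) grp_functor \<Rightarrow> (('f, 'u) module \<Rightarrow> 'm \<Rightarrow> 'g) \<Rightarrow>
     ('f, 'u, 'g) grp_functor \<Rightarrow> ('f, 'u, 'm) grp_functor \<Rightarrow> ('f, 'u, 'g \<times> 'm) grp_functor" where
  "semidirect_functor H i K M =
     \<lparr>pts = \<lambda>R.
        \<lparr>carrier = carrier (pts K R) \<times> carrier (pts M R),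
         monoid.mult = (\<lambda>(k, r) (k', r').
             (k \<otimes>\<^bsub>pts K R\<^esub> (i R r \<otimes>\<^bsub>pts H R\<^esub> k' \<otimes>\<^bsub>pts H R\<^esub> inv\<^bsub>pts H R\<^esub> (i R r)), r \<otimes>\<^bsub>pts M R\<^esub> r')),
         one = (\<one>\<^bsub>pts K R\<^esub>, \<one>\<^bsub>pts M R\<^esub>)\<rparr>,
      mor = \<lambda>R S f. map_prod (mor K R S f) (mor M R S f)\<rparr>"

definition direct_functor ::
    "('f::field, 'u, 'g) grp_functor \<Rightarrow> ('f, 'u, 'h) grp_functor \<Rightarrow> ('f, 'u, 'g \<times> 'h) grp_functor" where
  "direct_functor G H =
     \<lparr>pts = \<lambda>R. pts G R \<times>\<times> pts H R, mor = \<lambda>R S f. map_prod (mor G R S f) (mor H R S f)\<rparr>"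


section \<open>Extension of scalars\<close>

text \<open>
  For a finite-dimensional space \<open>V\<close> with scalar multiplication \<open>s\<close> and basis \<open>B\<close>, the \<open>R\<close>-module
  \<open>V \<otimes> R\<close> is free with basis \<open>b \<otimes> 1\<close>, for \<open>b\<close> in \<open>B\<close>, and an element of it is encoded by its
  family of coordinates in \<open>R\<close>. Linear, bilinear and quadratic maps are extended accordingly.
\<close>

abbreviation coord :: "('f::field \<Rightarrow> 'v \<Rightarrow> 'v) \<Rightarrow> 'v::ab_group_add set \<Rightarrow> 'v \<Rightarrow> 'v \<Rightarrow> 'f" where
  "coord s B v b \<equiv> Modules.module.representation s B v b"

definition ext_carrier :: "'v set \<Rightarrow> ('f, 'u) module \<Rightarrow> ('v \<Rightarrow> 'u) set" where
  "ext_carrier B R = B \<rightarrow>\<^sub>E carrier R"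

definition ext_add :: "'v set \<Rightarrow> ('f, 'u) module \<Rightarrow> ('v \<Rightarrow> 'u) \<Rightarrow> ('v \<Rightarrow> 'u) \<Rightarrow> 'v \<Rightarrow> 'u" where
  "ext_add B R x y = (\<lambda>b \<in> B. x b \<oplus>\<^bsub>R\<^esub> y b)"

definition ext_diff :: "'v set \<Rightarrow> ('f, 'u) module \<Rightarrow> ('v \<Rightarrow> 'u) \<Rightarrow> ('v \<Rightarrow> 'u) \<Rightarrow> 'v \<Rightarrow> 'u" where
  "ext_diff B R x y = (\<lambda>b \<in> B. x b \<ominus>\<^bsub>R\<^esub> y b)"

definition ext_scale :: "'v set \<Rightarrow> ('f, 'u) module \<Rightarrow> 'u \<Rightarrow> ('v \<Rightarrow> 'u) \<Rightarrow> 'v \<Rightarrow> 'u" where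
  "ext_scale B R r x = (\<lambda>b \<in> B. r \<otimes>\<^bsub>R\<^esub> x b)"

definition pure_tensor ::
    "('f::field \<Rightarrow> 'v \<Rightarrow> 'v) \<Rightarrow> 'v::ab_group_add set \<Rightarrow> ('f, 'u) module \<Rightarrow> 'v \<Rightarrow> 'u \<Rightarrow> 'v \<Rightarrow> 'u" where
  "pure_tensor s B R v r = (\<lambda>b \<in> B. coord s B v b \<odot>\<^bsub>R\<^esub> r)"

definition ext_linear ::
    "'v set \<Rightarrow> ('f::field \<Rightarrow> 'w \<Rightarrow> 'w) \<Rightarrow> 'w::ab_group_add set \<Rightarrow> ('f, 'u) module \<Rightarrow>
     ('v \<Rightarrow> 'w) \<Rightarrow> ('v \<Rightarrow> 'u) \<Rightarrow> 'w \<Rightarrow> 'u" where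
  "ext_linear B s B' R f x = (\<lambda>c \<in> B'. finsum R (\<lambda>b. coord s B' (f b) c \<odot>\<^bsub>R\<^esub> x b) B)"

definition ext_bilinear ::
    "'v set \<Rightarrow> 'w set \<Rightarrow> ('f::field \<Rightarrow> 'x \<Rightarrow> 'x) \<Rightarrow> 'x::ab_group_add set \<Rightarrow> ('f, 'u) module \<Rightarrow>
     ('v \<Rightarrow> 'w \<Rightarrow> 'x) \<Rightarrow> ('v \<Rightarrow> 'u) \<Rightarrow> ('w \<Rightarrow> 'u) \<Rightarrow> 'x \<Rightarrow> 'u" where
  "ext_bilinear B1 B2 s B R m x y =
     (\<lambda>c \<in> B. finsum R (\<lambda>(b1, b2). coord s B (m b1 b2) c \<odot>\<^bsub>R\<^esub> (x b1 \<otimes>\<^bsub>R\<^esub> y b2)) (B1 \<times> B2))"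

text \<open>The characteristic is not 2, so \<open>q x\<close> is half of the polar form at \<open>(x, x)\<close>.\<close>

definition ext_quadratic ::
    "'v::ab_group_add set \<Rightarrow> ('f::field, 'u) module \<Rightarrow> ('v \<Rightarrow> 'f) \<Rightarrow> ('v \<Rightarrow> 'u) \<Rightarrow> 'u" where
  "ext_quadratic B R q x =
     finsum R (\<lambda>(b, c). ((q (b + c) - q b - q c) / 2) \<odot>\<^bsub>R\<^esub> (x b \<otimes>\<^bsub>R\<^esub> x c)) (B \<times> B)"

text \<open>The submodule \<open>U \<otimes> R\<close> of \<open>V \<otimes> R\<close>, for a subspace \<open>U\<close> of \<open>V\<close>.\<close>

definition ext_subspace ::
    "('f::field \<Rightarrow> 'v \<Rightarrow> 'v) \<Rightarrow> 'v::ab_group_add set \<Rightarrow> ('f, 'u) module \<Rightarrow> 'v set \<Rightarrow> ('v \<Rightarrow> 'u) set" where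
  "ext_subspace s B R U =
     {(\<lambda>b \<in> B. finsum R (\<lambda>v. pure_tensor s B R v (r v) b) T) | T r.
        finite T \<and> T \<subseteq> U \<and> r \<in> T \<rightarrow> carrier R}"

text \<open>
  For an algebra homomorphism \<open>f\<close> from \<open>R\<close> to \<open>S\<close>, the \<open>S\<close>-linear extension of an \<open>R\<close>-linear
  endomorphism \<open>g\<close> of \<open>V \<otimes> R\<close>.
\<close>

definition base_change ::
    "('f::field \<Rightarrow> 'v \<Rightarrow> 'v) \<Rightarrow> 'v::ab_group_add set \<Rightarrow> ('f, 'u) module \<Rightarrow> ('f, 'u) module \<Rightarrow>
     ('u \<Rightarrow> 'u) \<Rightarrow> (('v \<Rightarrow> 'u) \<Rightarrow> ('v \<Rightarrow> 'u)) \<Rightarrow> (('v \<Rightarrow> 'u) \<Rightarrow> ('v \<Rightarrow> 'u))" where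
  "base_change s B R S f g =
     (\<lambda>y \<in> ext_carrier B S. \<lambda>c \<in> B.
        finsum S (\<lambda>b. f (g (pure_tensor s B R b \<one>\<^bsub>R\<^esub>) c) \<otimes>\<^bsub>S\<^esub> y b) B)"

text \<open>The bijections of a submodule \<open>A\<close> of \<open>V \<otimes> R\<close> that preserve its \<open>R\<close>-algebra structure.\<close>

definition ext_algebra_auts ::
    "'v set \<Rightarrow> ('f, 'u) module \<Rightarrow> (('v \<Rightarrow> 'u) \<Rightarrow> ('v \<Rightarrow> 'u) \<Rightarrow> ('v \<Rightarrow> 'u)) \<Rightarrow> ('v \<Rightarrow> 'u) set \<Rightarrow>
     (('v \<Rightarrow> 'u) \<Rightarrow> ('v \<Rightarrow> 'u)) set" where
  "ext_algebra_auts B R m A =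
     {g \<in> Bij A.
        (\<forall>x \<in> A. \<forall>y \<in> A. g (ext_add B R x y) = ext_add B R (g x) (g y)) \<and>
        (\<forall>r \<in> carrier R. \<forall>x \<in> A. g (ext_scale B R r x) = ext_scale B R r (g x)) \<and>
        (\<forall>x \<in> A. \<forall>y \<in> A. g (m x y) = m (g x) (g y))}"


section \<open>Quadratic etale algebras\<close>

text \<open>
  Throughout, \<open>s\<close> is the scalar multiplication of the ground field on \<open>K\<close>, the ring on the type \<open>'k\<close>.
  A quadratic etale algebra is either split, or a separable field extension of degree 2.
\<close>

definition field_algebra :: "('f::field \<Rightarrow> 'k \<Rightarrow> 'k::comm_ring_1) \<Rightarrow> bool" where
  "field_algebra s \<longleftrightarrow> vector_space s \<and> (\<forall>c x y. s c (x * y) = s c x * y)"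

definition algebra_character :: "('f::field \<Rightarrow> 'k \<Rightarrow> 'k::comm_ring_1) \<Rightarrow> ('k \<Rightarrow> 'f) \<Rightarrow> bool" where
  "algebra_character s p \<longleftrightarrow> p 1 = 1 \<and> (\<forall>x y. p (x + y) = p x + p y) \<and>
     (\<forall>x y. p (x * y) = p x * p y) \<and> (\<forall>c x. p (s c x) = c * p x)"

definition split_quadratic :: "('f::field \<Rightarrow> 'k \<Rightarrow> 'k::comm_ring_1) \<Rightarrow> bool" where
  "split_quadratic s \<longleftrightarrow>
     (\<exists>p q. algebra_character s p \<and> algebra_character s q \<and> bij (\<lambda>x. (p x, q x)))"

definition separable_field_ext :: "('f::field \<Rightarrow> 'k \<Rightarrow> 'k::comm_ring_1) \<Rightarrow> bool" where
  "separable_field_ext s \<longleftrightarrow> (\<forall>x :: 'k. x \<noteq> 0 \<longrightarrow> (\<exists>y. x * y = 1)) \<and>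
     (\<forall>x. \<exists>P :: 'f poly. coprime P (pderiv P) \<and> poly (map_poly (\<lambda>c. s c 1) P) x = 0)"

definition quadratic_etale :: "('f::field \<Rightarrow> 'k \<Rightarrow> 'k::comm_ring_1) \<Rightarrow> bool" where
  "quadratic_etale s \<longleftrightarrow> field_algebra s \<and> vector_space.dim s (UNIV :: 'k set) = 2 \<and>
     (split_quadratic s \<or> separable_field_ext s)"

definition kbasis :: "('f::field \<Rightarrow> 'k \<Rightarrow> 'k::comm_ring_1) \<Rightarrow> 'k set" where
  "kbasis s = (SOME B. \<not> Modules.module.dependent s B \<and> Modules.module.span s B = UNIV)"

definition ktrace :: "('f::field \<Rightarrow> 'k \<Rightarrow> 'k::comm_ring_1) \<Rightarrow> 'k \<Rightarrow> 'f" where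
  "ktrace s x = (\<Sum>b \<in> kbasis s. coord s (kbasis s) (x * b) b)"

definition kconj :: "('f::field \<Rightarrow> 'k \<Rightarrow> 'k::comm_ring_1) \<Rightarrow> 'k \<Rightarrow> 'k" where
  "kconj s x = s (ktrace s x) 1 - x"

text \<open>The scalar \<open>c\<close> such that \<open>x = c 1\<close>.\<close>

definition kscalar :: "('f::field \<Rightarrow> 'k \<Rightarrow> 'k::comm_ring_1) \<Rightarrow> 'k \<Rightarrow> 'f" where
  "kscalar s x = (THE c. s c 1 = x)"

definition knorm :: "('f::field \<Rightarrow> 'k \<Rightarrow> 'k::comm_ring_1) \<Rightarrow> 'k \<Rightarrow> 'f" where
  "knorm s x = kscalar s (x * kconj s x)"


section \<open>The Cayley algebra and its automorphism of order 3\<close>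

text \<open>\<open>(x1, x2, x3)\<close> stands for \<open>x1 w1 + x2 w2 + x3 w3\<close>, and \<open>(b, x1, x2, x3)\<close> for \<open>b + x1 w1 + x2 w2 + x3 w3\<close>.\<close>

type_synonym 'k wspace = "'k \<times> 'k \<times> 'k"
type_synonym 'k cayley = "'k \<times> 'k \<times> 'k \<times> 'k"

definition wact :: "'k::comm_ring_1 \<Rightarrow> 'k wspace \<Rightarrow> 'k wspace" where
  "wact b = (\<lambda>(x1, x2, x3). (b * x1, b * x2, b * x3))"

definition wherm :: "('f::field \<Rightarrow> 'k \<Rightarrow> 'k::comm_ring_1) \<Rightarrow> 'k wspace \<Rightarrow> 'k wspace \<Rightarrow> 'k" where
  "wherm s = (\<lambda>(x1, x2, x3) (y1, y2, y3).
     - (x1 * kconj s y2 + x1 * kconj s y3 + x2 * kconj s y1 + x2 * kconj s y3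
        + x3 * kconj s y1 + x3 * kconj s y2))"

definition wvol :: "'k::comm_ring_1 \<Rightarrow> 'k wspace \<Rightarrow> 'k wspace \<Rightarrow> 'k wspace \<Rightarrow> 'k" where
  "wvol a = (\<lambda>(x1, x2, x3) (y1, y2, y3) (z1, z2, z3).
     a * (x1 * (y2 * z3 - y3 * z2) - x2 * (y1 * z3 - y3 * z1) + x3 * (y1 * z2 - y2 * z1)))"

definition wcross ::
    "('f::field \<Rightarrow> 'k \<Rightarrow> 'k::comm_ring_1) \<Rightarrow> 'k \<Rightarrow> 'k wspace \<Rightarrow> 'k wspace \<Rightarrow> 'k wspace" where
  "wcross s a x y = (THE v. \<forall>z. wherm s z v = wvol a z x y)"

definition cscale :: "('f::field \<Rightarrow> 'k \<Rightarrow> 'k::comm_ring_1) \<Rightarrow> 'f \<Rightarrow> 'k cayley \<Rightarrow> 'k cayley" where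
  "cscale s c = (\<lambda>(b, x1, x2, x3). (s c b, s c x1, s c x2, s c x3))"

definition cmult ::
    "('f::field \<Rightarrow> 'k \<Rightarrow> 'k::comm_ring_1) \<Rightarrow> 'k \<Rightarrow> 'k cayley \<Rightarrow> 'k cayley \<Rightarrow> 'k cayley" where
  "cmult s a = (\<lambda>(b, x) (c, y).
     (b * c - wherm s x y, wact b y + wact (kconj s c) x + wcross s a x y))"

definition cone :: "'k::comm_ring_1 cayley" where
  "cone = (1, 0, 0, 0)"

definition cnorm :: "('f::field \<Rightarrow> 'k \<Rightarrow> 'k::comm_ring_1) \<Rightarrow> 'k cayley \<Rightarrow> 'f" where
  "cnorm s = (\<lambda>(b, x). knorm s b + kscalar s (wherm s x x))"

definition ctau :: "'k::comm_ring_1 cayley \<Rightarrow> 'k cayley" where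
  "ctau = (\<lambda>(b, x1, x2, x3). (b, x3, x1, x2))"

definition cfix :: "'k::comm_ring_1 cayley set" where
  "cfix = {x. ctau x = x}"

text \<open>
  Nilpotent two-sided ideals of the associative algebra \<open>cfix\<close>; the nilpotent radical is the largest
  of them, hence their union.
\<close>

definition nilpotent_fix_ideal ::
    "('f::field \<Rightarrow> 'k \<Rightarrow> 'k::comm_ring_1) \<Rightarrow> 'k \<Rightarrow> 'k cayley set \<Rightarrow> bool" where
  "nilpotent_fix_ideal s a I \<longleftrightarrow> I \<subseteq> cfix \<and> Modules.module.subspace (cscale s) I \<and>
     (\<forall>x \<in> cfix. \<forall>y \<in> I. cmult s a x y \<in> I \<and> cmult s a y x \<in> I) \<and>
     (\<exists>n. \<forall>ys. length ys = n \<longrightarrow> set ys \<subseteq> I \<longrightarrow> foldr (cmult s a) ys cone = 0)"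

definition cradical :: "('f::field \<Rightarrow> 'k \<Rightarrow> 'k::comm_ring_1) \<Rightarrow> 'k \<Rightarrow> 'k cayley set" where
  "cradical s a = \<Union> {I. nilpotent_fix_ideal s a I}"

definition cbasis :: "('f::field \<Rightarrow> 'k \<Rightarrow> 'k::comm_ring_1) \<Rightarrow> 'k cayley set" where
  "cbasis s = (\<Union>b \<in> kbasis s. {(b, 0, 0, 0), (0, b, 0, 0), (0, 0, b, 0), (0, 0, 0, b)})"


section \<open>The group functors\<close>

type_synonym ('f, 'k, 'u) cayley_functor =
  "('f, 'u, ('k cayley \<Rightarrow> 'u) \<Rightarrow> ('k cayley \<Rightarrow> 'u)) grp_functor"

abbreviation KR :: "('f::field \<Rightarrow> 'k \<Rightarrow> 'k::comm_ring_1) \<Rightarrow> ('f, 'u) module \<Rightarrow> ('k \<Rightarrow> 'u) set" where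
  "KR s R \<equiv> ext_carrier (kbasis s) R"

definition KR_mult ::
    "('f::field \<Rightarrow> 'k \<Rightarrow> 'k::comm_ring_1) \<Rightarrow> ('f, 'u) module \<Rightarrow> ('k \<Rightarrow> 'u) \<Rightarrow> ('k \<Rightarrow> 'u) \<Rightarrow> 'k \<Rightarrow> 'u" where
  "KR_mult s R = ext_bilinear (kbasis s) (kbasis s) s (kbasis s) R (*)"

definition KR_one :: "('f::field \<Rightarrow> 'k \<Rightarrow> 'k::comm_ring_1) \<Rightarrow> ('f, 'u) module \<Rightarrow> 'k \<Rightarrow> 'u" where
  "KR_one s R = pure_tensor s (kbasis s) R 1 \<one>\<^bsub>R\<^esub>"

abbreviation CR :: "('f::field \<Rightarrow> 'k \<Rightarrow> 'k::comm_ring_1) \<Rightarrow> ('f, 'u) module \<Rightarrow> ('k cayley \<Rightarrow> 'u) set" where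
  "CR s R \<equiv> ext_carrier (cbasis s) R"

definition CR_mult ::
    "('f::field \<Rightarrow> 'k \<Rightarrow> 'k::comm_ring_1) \<Rightarrow> 'k \<Rightarrow> ('f, 'u) module \<Rightarrow>
     ('k cayley \<Rightarrow> 'u) \<Rightarrow> ('k cayley \<Rightarrow> 'u) \<Rightarrow> 'k cayley \<Rightarrow> 'u" where
  "CR_mult s a R = ext_bilinear (cbasis s) (cbasis s) (cscale s) (cbasis s) R (cmult s a)"

definition CR_tau ::
    "('f::field \<Rightarrow> 'k \<Rightarrow> 'k::comm_ring_1) \<Rightarrow> ('f, 'u) module \<Rightarrow> ('k cayley \<Rightarrow> 'u) \<Rightarrow> 'k cayley \<Rightarrow> 'u" where
  "CR_tau s R = ext_linear (cbasis s) (cscale s) (cbasis s) R ctau"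

definition aut_functor ::
    "('f::field \<Rightarrow> 'k \<Rightarrow> 'k::comm_ring_1) \<Rightarrow> 'k \<Rightarrow>
     ('f, 'k, 'u) cayley_functor" where
  "aut_functor s a =
     \<lparr>pts = \<lambda>R. (BijGroup (CR s R))\<lparr>carrier :=
          {g \<in> ext_algebra_auts (cbasis s) R (CR_mult s a R) (CR s R).
             \<forall>x \<in> CR s R. ext_quadratic (cbasis s) R (cnorm s) (g x) =
                           ext_quadratic (cbasis s) R (cnorm s) x}\<rparr>,
      mor = base_change (cscale s) (cbasis s)\<rparr>"

text \<open>
  The scheme-theoretic centralizer of \<open>ctau\<close>. As \<open>ctau\<close> is defined over the ground field, commuting
  with it over \<open>R\<close> implies commuting with it over all \<open>R\<close>-algebras.
\<close>

definition cent_functor ::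
    "('f::field \<Rightarrow> 'k \<Rightarrow> 'k::comm_ring_1) \<Rightarrow> 'k \<Rightarrow>
     ('f, 'k, 'u) cayley_functor" where
  "cent_functor s a =
     \<lparr>pts = \<lambda>R. (pts (aut_functor s a) R)\<lparr>carrier :=
          {g \<in> carrier (pts (aut_functor s a) R). \<forall>x \<in> CR s R. g (CR_tau s R x) = CR_tau s R (g x)}\<rparr>,
      mor = mor (aut_functor s a)\<rparr>"

definition mu_functor ::
    "('f::field \<Rightarrow> 'k \<Rightarrow> 'k::comm_ring_1) \<Rightarrow> ('f, 'u, 'k \<Rightarrow> 'u) grp_functor" where
  "mu_functor s =
     \<lparr>pts = \<lambda>R.
        \<lparr>carrier = {r \<in> KR s R. KR_mult s R r (KR_mult s R r r) = KR_one s R \<and>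
                               ext_quadratic (kbasis s) R (knorm s) r = \<one>\<^bsub>R\<^esub>},
         monoid.mult = KR_mult s R, one = KR_one s R\<rparr>,
      mor = \<lambda>R S f r. \<lambda>b \<in> kbasis s. f (r b)\<rparr>"

text \<open>The map that is the identity on \<open>K \<otimes> R\<close> and multiplication by \<open>r\<close> on \<open>W \<otimes> R\<close>.\<close>

definition mu_embed ::
    "('f::field \<Rightarrow> 'k \<Rightarrow> 'k::comm_ring_1) \<Rightarrow> ('f, 'u) module \<Rightarrow> ('k \<Rightarrow> 'u) \<Rightarrow>
     ('k cayley \<Rightarrow> 'u) \<Rightarrow> ('k cayley \<Rightarrow> 'u)" where
  "mu_embed s R r = (\<lambda>x \<in> CR s R. ext_add (cbasis s) R
     (ext_linear (cbasis s) (cscale s) (cbasis s) R (\<lambda>(b, w). (b, 0)) x)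
     (ext_bilinear (kbasis s) (cbasis s) (cscale s) (cbasis s) R (\<lambda>k (b, w). (0, wact k w)) r x))"

definition CR_ad ::
    "('f::field \<Rightarrow> 'k \<Rightarrow> 'k::comm_ring_1) \<Rightarrow> 'k \<Rightarrow> ('f, 'u) module \<Rightarrow>
     ('k cayley \<Rightarrow> 'u) \<Rightarrow> ('k cayley \<Rightarrow> 'u) \<Rightarrow> 'k cayley \<Rightarrow> 'u" where
  "CR_ad s a R x y = ext_diff (cbasis s) R (CR_mult s a R x y) (CR_mult s a R y x)"

definition exp_ad ::
    "('f::field \<Rightarrow> 'k \<Rightarrow> 'k::comm_ring_1) \<Rightarrow> 'k \<Rightarrow> ('f, 'u) module \<Rightarrow>
     ('k cayley \<Rightarrow> 'u) \<Rightarrow> ('k cayley \<Rightarrow> 'u) \<Rightarrow> ('k cayley \<Rightarrow> 'u)" where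
  "exp_ad s a R x = (\<lambda>y \<in> CR s R. ext_add (cbasis s) R (ext_add (cbasis s) R y (CR_ad s a R x y))
     (ext_scale (cbasis s) R ((1 / 2) \<odot>\<^bsub>R\<^esub> \<one>\<^bsub>R\<^esub>) (CR_ad s a R x (CR_ad s a R x y))))"

definition K_functor ::
    "('f::field \<Rightarrow> 'k \<Rightarrow> 'k::comm_ring_1) \<Rightarrow> 'k \<Rightarrow>
     ('f, 'k, 'u) cayley_functor" where
  "K_functor s a =
     \<lparr>pts = \<lambda>R. (pts (cent_functor s a) R)\<lparr>carrier :=
          exp_ad s a R ` ext_subspace (cscale s) (cbasis s) R (cradical s a)\<rparr>,
      mor = mor (cent_functor s a)\<rparr>"

abbreviation FixR ::
    "('f::field \<Rightarrow> 'k \<Rightarrow> 'k::comm_ring_1) \<Rightarrow> ('f, 'u) module \<Rightarrow> ('k cayley \<Rightarrow> 'u) set" where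
  "FixR s R \<equiv> ext_subspace (cscale s) (cbasis s) R cfix"

definition aut_fix ::
    "('f::field \<Rightarrow> 'k \<Rightarrow> 'k::comm_ring_1) \<Rightarrow> 'k \<Rightarrow> ('f, 'u) module \<Rightarrow>
     (('k cayley \<Rightarrow> 'u) \<Rightarrow> ('k cayley \<Rightarrow> 'u)) monoid" where
  "aut_fix s a R = (BijGroup (FixR s R))\<lparr>carrier :=
     ext_algebra_auts (cbasis s) R (CR_mult s a R) (FixR s R)\<rparr>"

definition N_functor ::
    "('f::field \<Rightarrow> 'k \<Rightarrow> 'k::comm_ring_1) \<Rightarrow> 'k \<Rightarrow>
     ('f, 'k, 'u) cayley_functor" where
  "N_functor s a =
     \<lparr>pts = \<lambda>R. (pts (cent_functor s a) R)\<lparr>carrier :=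
          kernel (pts (cent_functor s a) R) (aut_fix s a R) (\<lambda>g. restrict g (FixR s R))\<rparr>,
      mor = mor (cent_functor s a)\<rparr>"

text \<open>The homomorphism from \<open>(K \<rtimes> \<mu>) \<times> N\<close> given by the embeddings of the three factors.\<close>

definition KMN_embed ::
    "('f::field \<Rightarrow> 'k \<Rightarrow> 'k::comm_ring_1) \<Rightarrow> 'k \<Rightarrow> ('f, 'u) module \<Rightarrow>
     ((('k cayley \<Rightarrow> 'u) \<Rightarrow> ('k cayley \<Rightarrow> 'u)) \<times> ('k \<Rightarrow> 'u)) \<times> (('k cayley \<Rightarrow> 'u) \<Rightarrow> ('k cayley \<Rightarrow> 'u)) \<Rightarrow>
     ('k cayley \<Rightarrow> 'u) \<Rightarrow> ('k cayley \<Rightarrow> 'u)" where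
  "KMN_embed s a R = (\<lambda>((k, r), g).
     k \<otimes>\<^bsub>pts (cent_functor s a) R\<^esub> mu_embed s R r \<otimes>\<^bsub>pts (cent_functor s a) R\<^esub> g)"

end

theory Submission
  imports Defs
begin

text \<open>
  Over \<open>R\<close>, a point of the centralizer is an automorphism \<open>g\<close> of \<open>C \<otimes> R\<close> commuting with \<open>\<tau>\<close>. Write
  \<open>K = F[\<theta>]\<close> with \<open>\<theta>\<^sup>2\<close> a nonzero scalar. As \<open>g\<close> preserves the fixed algebra, \<open>g \<theta> = y \<theta> + z u\<close>, where
  \<open>u = w1 + w2 + w3\<close>, and \<open>y\<^sup>2 = 1\<close>; the map \<open>g \<mapsto> y\<close> is the projection to \<open>C2\<close>. If \<open>y = 1\<close>, composing with some
  \<open>exp (ad\<^bsub>x\<^esub>)\<close> gives \<open>g \<theta> = \<theta>\<close>; then \<open>g\<close> is \<open>K\<close>-linear on \<open>W\<close> and commutes with the cyclic shift, so it is a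
  circulant matrix, and the equations for a circulant matrix to be an automorphism force it to be a
  cube root of unity of norm 1 times a unipotent element of the form \<open>1 + s (\<tau> - 1) + t (\<tau> - 1)\<^sup>2\<close>.
  Conversely \<open>y = -1\<close> is attained over an algebraic closure, by the conjugation of \<open>K\<close> extended
  semilinearly to \<open>W\<close> and multiplied by \<open>r \<in> K\<close> with \<open>r\<^sup>3 a\<^sup>2 = 1\<close>.
\<close>

section \<open>Commutative rings of characteristic 3 with involution\<close>

text \<open>All computations take place in \<open>K \<otimes> R\<close>, whose elements form a
  carrier set and not a type; polynomial identities are therefore proved in a free commutative ring
  with involution and then evaluated. Characteristic 3 shapes the group. The Gram matrix of
  \<open>\<sigma>\<close> is \<open>1 - J\<close> with \<open>J\<close> the all-ones matrix, and
  \<open>J^2 = 3 J = 0\<close>, so \<open>\<sigma>\<close> is nondegenerate although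
  \<open>\<sigma>(u, u) = - 6 = 0\<close>; thus \<open>K u\<close> is a square-zero ideal of the
  fixed algebra and yields \<open>K_functor\<close>. Likewise
  \<open>(\<tau> - 1)^3 = \<tau>^3 - 1 = 0\<close> yields \<open>N_functor\<close>. The equation
  \<open>y^2 = 1\<close> comes from the norm: on \<open>K + K u\<close> it is the norm of the
  \<open>K\<close>-component, and its values at \<open>\<theta>\<close> and
  \<open>1 + \<theta>\<close> show that \<open>y \<theta>\<close> is skew with the same square as
  \<open>\<theta>\<close>. The value \<open>y = -1\<close> needs a cube root in
  \<open>K \<otimes> R\<close>, which may exist only after an extension; this is why exactness on
  the right is a statement about coordinate algebras, and why an algebraic closure has to be copied
  into the universe type. Throughout, \<open>1 / 2 = -1\<close>.\<close>

locale herm_ring = cring A for A :: "'x ring" (structure) +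
  fixes bar :: "'x \<Rightarrow> 'x" and a :: 'x
  assumes char_three: "\<one> \<oplus> \<one> \<oplus> \<one> = \<zero>"
    and bar_closed [simp, intro]: "x \<in> carrier A \<Longrightarrow> bar x \<in> carrier A"
    and bar_add: "\<lbrakk>x \<in> carrier A; y \<in> carrier A\<rbrakk> \<Longrightarrow> bar (x \<oplus> y) = bar x \<oplus> bar y"
    and bar_mult: "\<lbrakk>x \<in> carrier A; y \<in> carrier A\<rbrakk> \<Longrightarrow> bar (x \<otimes> y) = bar x \<otimes> bar y"
    and bar_one [simp]: "bar \<one> = \<one>"
    and bar_bar [simp]: "x \<in> carrier A \<Longrightarrow> bar (bar x) = x"
    and a_closed [simp, intro]: "a \<in> carrier A"
    and a_norm: "a \<otimes> bar a = \<one>"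
begin

lemma bar_zero [simp]: "bar \<zero> = \<zero>"
  using bar_add[of \<zero> \<zero>] by (metis add.l_cancel_one' bar_closed l_zero zero_closed)

lemma bar_minus: "x \<in> carrier A \<Longrightarrow> bar (\<ominus> x) = \<ominus> bar x"
  by (metis a_inv_closed add.inv_unique' bar_add bar_closed bar_zero l_neg r_neg)

end

section \<open>A free ring with involution, for deciding polynomial identities\<close>

datatype 'x herm_exp =
    HVar 'x | HZero | HOne | HUnit | HAdd "'x herm_exp" "'x herm_exp"
  | HMul "'x herm_exp" "'x herm_exp" | HNeg "'x herm_exp" | HBar "'x herm_exp"

primrec herm_eval :: "'x ring \<Rightarrow> ('x \<Rightarrow> 'x) \<Rightarrow> 'x \<Rightarrow> 'x herm_exp \<Rightarrow> 'x" where
  "herm_eval A bar a (HVar x) = (if x \<in> carrier A then x else \<zero>\<^bsub>A\<^esub>)"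
| "herm_eval A bar a HZero = \<zero>\<^bsub>A\<^esub>"
| "herm_eval A bar a HOne = \<one>\<^bsub>A\<^esub>"
| "herm_eval A bar a HUnit = a"
| "herm_eval A bar a (HAdd p q) = herm_eval A bar a p \<oplus>\<^bsub>A\<^esub> herm_eval A bar a q"
| "herm_eval A bar a (HMul p q) = herm_eval A bar a p \<otimes>\<^bsub>A\<^esub> herm_eval A bar a q"
| "herm_eval A bar a (HNeg p) = \<ominus>\<^bsub>A\<^esub> herm_eval A bar a p"
| "herm_eval A bar a (HBar p) = bar (herm_eval A bar a p)"

text \<open>The model given by the integers with trivial involution, unit 1 and all variables 0.
  Modulo 3 it separates 0 from 1 even when \<open>'x\<close> has a single element and so carries
  only the zero ring.\<close>

primrec herm_eval_int :: "'x herm_exp \<Rightarrow> int" where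
  "herm_eval_int (HVar x) = 0"
| "herm_eval_int HZero = 0"
| "herm_eval_int HOne = 1"
| "herm_eval_int HUnit = 1"
| "herm_eval_int (HAdd p q) = herm_eval_int p + herm_eval_int q"
| "herm_eval_int (HMul p q) = herm_eval_int p * herm_eval_int q"
| "herm_eval_int (HNeg p) = - herm_eval_int p"
| "herm_eval_int (HBar p) = herm_eval_int p"

text \<open>
  The quotient below is the free commutative ring of characteristic 3 with involution and a
  distinguished element of norm 1, on generators \<open>'x\<close>. It is a type of class \<open>comm_ring_1\<close> that maps
  onto every such ring with carrier in \<open>'x\<close>, so that identities can be proved in it without
  membership side conditions. The congruence modulo 3 only serves to make it nontrivial.
\<close>

definition herm_eq :: "'x herm_exp \<Rightarrow> 'x herm_exp \<Rightarrow> bool" where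
  "herm_eq p q \<longleftrightarrow> 3 dvd herm_eval_int p - herm_eval_int q \<and>
     (\<forall>A bar a. herm_ring A bar a \<longrightarrow> herm_eval A bar a p = herm_eval A bar a q)"

lemma (in herm_ring) herm_eval_closed [simp]: "herm_eval A bar a p \<in> carrier A"
  by (induction p) auto

quotient_type 'x herm_free = "'x herm_exp" / herm_eq
  by (rule equivpI) (auto simp: reflp_def symp_def transp_def herm_eq_def dvd_diff_commute
      intro: dvd_trans dest: dvd_add)

lemma three_dvd_mult_diff: "(3::int) dvd x - x' \<Longrightarrow> 3 dvd y - y' \<Longrightarrow> 3 dvd x * y - x' * y'"
proof -
  have e: "x * y - x' * y' = (x - x') * y + x' * (y - y')" by (simp add: algebra_simps)
  assume "3 dvd x - x'" "3 dvd y - y'"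
  then show ?thesis unfolding e by (intro dvd_add) auto
qed

instantiation herm_free :: (type) comm_ring_1
begin

lift_definition zero_herm_free :: "'a herm_free" is HZero .
lift_definition one_herm_free :: "'a herm_free" is HOne .
lift_definition plus_herm_free :: "'a herm_free \<Rightarrow> 'a herm_free \<Rightarrow> 'a herm_free" is HAdd
  by (auto simp: herm_eq_def algebra_simps dest: dvd_add)
lift_definition times_herm_free :: "'a herm_free \<Rightarrow> 'a herm_free \<Rightarrow> 'a herm_free" is HMul
  by (auto simp: herm_eq_def three_dvd_mult_diff)
lift_definition uminus_herm_free :: "'a herm_free \<Rightarrow> 'a herm_free" is HNeg
  by (auto simp: herm_eq_def algebra_simps dvd_diff_commute)
lift_definition minus_herm_free :: "'a herm_free \<Rightarrow> 'a herm_free \<Rightarrow> 'a herm_free"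
  is "\<lambda>p q. HAdd p (HNeg q)"
  by (auto simp: herm_eq_def algebra_simps) (smt (verit) dvd_diff)

instance
proof
  fix x y z :: "'a herm_free"
  note rules = cring.cring_simprules[OF herm_ring.axioms(1)] herm_ring.herm_eval_closed
  show "x * y * z = x * (y * z)" "x + y + z = x + (y + z)" "x + y = y + x" "x * y = y * x"
    "(x + y) * z = x * z + y * z" "0 + x = x" "1 * x = x" "- x + x = 0" "x - y = x + - y"
    "(0::'a herm_free) \<noteq> 1"
    by (transfer; simp add: herm_eq_def rules algebra_simps)+
qed

end

lift_definition hvar :: "'x \<Rightarrow> 'x herm_free" is HVar .
lift_definition hunit :: "'x herm_free" is HUnit .
lift_definition hbar :: "'x herm_free \<Rightarrow> 'x herm_free" is HBar
  by (auto simp: herm_eq_def)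

lemma hbar_simps [simp]:
  "hbar (x + y) = hbar x + hbar y" "hbar (x * y) = hbar x * hbar y" "hbar (- x) = - hbar x"
  "hbar (x - y) = hbar x - hbar y" "hbar 0 = 0" "hbar 1 = 1" "hbar (hbar x) = x"
  by (transfer; simp add: herm_eq_def herm_ring.bar_add herm_ring.bar_mult herm_ring.bar_minus
      herm_ring.bar_zero herm_ring.bar_one herm_ring.bar_bar herm_ring.herm_eval_closed
      cring.cring_simprules[OF herm_ring.axioms(1)])+

text \<open>The inverse of \<open>hunit\<close> is its conjugate. As an atom of its own it lets
  \<open>hbar\<close> be pushed down to the variables and gives monomials a normal form.\<close>

lift_definition hunit_inv :: "'x herm_free" is "HBar HUnit" .

lemma hbar_hunit [simp]: "hbar hunit = hunit_inv" "hbar hunit_inv = hunit"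
  by (transfer; simp add: herm_eq_def herm_ring.bar_bar herm_ring.a_closed)+

lemma hunit_norm: "hunit * hunit_inv = 1"
  by (transfer; simp add: herm_eq_def herm_ring.a_norm)

lemma hunit_norm_left: "hunit * (hunit_inv * x) = x"
  by (simp add: hunit_norm flip: mult.assoc)

lemma herm_free_char_three: "(3::'x herm_free) = 0"
proof -
  have "(1 + 1 + 1 :: 'x herm_free) = 0"
    by (transfer; simp add: herm_eq_def herm_ring.char_three)
  then show ?thesis by simp
qed

lemma herm_free_add3: "x + (x + x) = (0 :: 'x herm_free)"
  using arg_cong[OF herm_free_char_three, of "\<lambda>c. c * x"] by (simp add: algebra_simps)

lemma herm_free_add3_left: "x + (x + (x + y)) = (y :: 'x herm_free)"
  using herm_free_add3[of x] by (simp flip: add.assoc)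

lemma herm_free_uminus: "- x = x + (x :: 'x herm_free)"
  using herm_free_add3[of x] by (simp add: minus_unique)

text \<open>
  Ordered rewriting with the first collection and then with the second decides equality: negatives
  become doubles, so that like monomials end up next to each other and cancel in threes, and
  \<open>hunit\<close>, \<open>hunit_inv\<close> are adjacent in the term order.
\<close>

lemmas herm_expand = hbar_simps hbar_hunit hunit_norm hunit_norm_left diff_conv_add_uminus
  minus_add_distrib minus_minus mult_minus_left mult_minus_right minus_zero
  distrib_left distrib_right mult.assoc mult.commute mult.left_commute
  mult_1_left mult_1_right mult_zero_left mult_zero_right add_0_left add_0_right

lemmas herm_collect = herm_free_uminus add.assoc add.commute add.left_commute add_0_left add_0_right
  herm_free_add3 herm_free_add3_left

text \<open>Equivalent expressions are known to agree only in a genuine \<open>herm_ring\<close>;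
  the default zero makes evaluation well defined for all other arguments.\<close>

lift_definition herm_hom :: "'x ring \<Rightarrow> ('x \<Rightarrow> 'x) \<Rightarrow> 'x \<Rightarrow> 'x herm_free \<Rightarrow> 'x"
  is "\<lambda>A bar a p. if herm_ring A bar a then herm_eval A bar a p else \<zero>\<^bsub>A\<^esub>"
  by (auto simp: herm_eq_def)

lemma herm_hom_simps:
  assumes "herm_ring A bar a"
  shows "herm_hom A bar a (p + q) = herm_hom A bar a p \<oplus>\<^bsub>A\<^esub> herm_hom A bar a q"
    "herm_hom A bar a (p * q) = herm_hom A bar a p \<otimes>\<^bsub>A\<^esub> herm_hom A bar a q"
    "herm_hom A bar a (- p) = \<ominus>\<^bsub>A\<^esub> herm_hom A bar a p"
    "herm_hom A bar a (p - q) = herm_hom A bar a p \<ominus>\<^bsub>A\<^esub> herm_hom A bar a q"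
    "herm_hom A bar a (hbar p) = bar (herm_hom A bar a p)"
    "herm_hom A bar a 1 = \<one>\<^bsub>A\<^esub>" "herm_hom A bar a 0 = \<zero>\<^bsub>A\<^esub>" "herm_hom A bar a hunit_inv = bar a"
    "herm_hom A bar a p \<in> carrier A"
    "x \<in> carrier A \<Longrightarrow> herm_hom A bar a (hvar x) = x"
  using assms by (transfer; simp add: herm_ring.herm_eval_closed a_minus_def)+

context herm_ring
begin

abbreviation hev :: "'x herm_free \<Rightarrow> 'x" where
  "hev \<equiv> herm_hom A bar a"

text \<open>Oriented from the carrier to the free ring: ring operations are drawn inside a single
  \<open>hev\<close>, so a goal becomes \<open>hev p = hev q\<close> and it suffices that
  \<open>p = q\<close> in the free ring.\<close>

lemmas hev_simps = herm_hom_simps(1-8)[OF herm_ring_axioms, symmetric]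

lemma hev_closed [simp]: "hev p \<in> carrier A"
  using herm_hom_simps(9)[OF herm_ring_axioms] .

lemma hev_surj: "x \<in> carrier A \<Longrightarrow> \<exists>p. x = hev p"
  using herm_hom_simps(10)[OF herm_ring_axioms] by metis

end

section \<open>The Cayley algebra over a ring with involution\<close>

context herm_ring
begin

definition hsig :: "'x \<Rightarrow> 'x \<Rightarrow> 'x \<Rightarrow> 'x \<Rightarrow> 'x \<Rightarrow> 'x \<Rightarrow> 'x" where
  "hsig x1 x2 x3 y1 y2 y3 = \<ominus> (x1 \<otimes> bar y2 \<oplus> x1 \<otimes> bar y3 \<oplus> x2 \<otimes> bar y1 \<oplus> x2 \<otimes> bar y3
     \<oplus> x3 \<otimes> bar y1 \<oplus> x3 \<otimes> bar y2)"

text \<open>The first coordinate of the cross product; the others are obtained by cyclic shifts.\<close>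

definition hcross :: "'x \<Rightarrow> 'x \<Rightarrow> 'x \<Rightarrow> 'x \<Rightarrow> 'x \<Rightarrow> 'x \<Rightarrow> 'x" where
  "hcross x1 x2 x3 y1 y2 y3 = bar a \<otimes> bar ((x2 \<otimes> y3 \<ominus> x3 \<otimes> y2) \<oplus>
     ((x2 \<otimes> y3 \<ominus> x3 \<otimes> y2) \<oplus> (x3 \<otimes> y1 \<ominus> x1 \<otimes> y3) \<oplus> (x1 \<otimes> y2 \<ominus> x2 \<otimes> y1)))"

definition hcar :: "'x cayley set" where
  "hcar = carrier A \<times> carrier A \<times> carrier A \<times> carrier A"

definition hadd :: "'x cayley \<Rightarrow> 'x cayley \<Rightarrow> 'x cayley" where
  "hadd = (\<lambda>(b, x1, x2, x3) (c, y1, y2, y3). (b \<oplus> c, x1 \<oplus> y1, x2 \<oplus> y2, x3 \<oplus> y3))"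

definition hscale :: "'x \<Rightarrow> 'x cayley \<Rightarrow> 'x cayley" where
  "hscale r = (\<lambda>(b, x1, x2, x3). (r \<otimes> b, r \<otimes> x1, r \<otimes> x2, r \<otimes> x3))"

definition hmul :: "'x cayley \<Rightarrow> 'x cayley \<Rightarrow> 'x cayley" where
  "hmul = (\<lambda>(b, x1, x2, x3) (c, y1, y2, y3). (b \<otimes> c \<ominus> hsig x1 x2 x3 y1 y2 y3,
     b \<otimes> y1 \<oplus> bar c \<otimes> x1 \<oplus> hcross x1 x2 x3 y1 y2 y3,
     b \<otimes> y2 \<oplus> bar c \<otimes> x2 \<oplus> hcross x2 x3 x1 y2 y3 y1,
     b \<otimes> y3 \<oplus> bar c \<otimes> x3 \<oplus> hcross x3 x1 x2 y3 y1 y2))"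

definition htau :: "'x cayley \<Rightarrow> 'x cayley" where
  "htau = (\<lambda>(b, x1, x2, x3). (b, x3, x1, x2))"

definition hnorm :: "'x cayley \<Rightarrow> 'x" where
  "hnorm = (\<lambda>(b, x1, x2, x3). b \<otimes> bar b \<oplus> hsig x1 x2 x3 x1 x2 x3)"

text \<open>With \<open>S = x1 + x2 + x3\<close>, the terms \<open>k (bar b - b)\<close> and the one
  with \<open>bar a\<close> are the first-order part of the exponential, coming from the commutator
  with \<open>b\<close> and from twice a cross product; \<open>k (k bar S + bar k S)\<close> is half
  the square of the derivation.\<close>

definition hexp_coord :: "'x \<Rightarrow> 'x \<Rightarrow> 'x \<Rightarrow> 'x \<Rightarrow> 'x \<Rightarrow> 'x" where
  "hexp_coord k b x1 x2 x3 = x1 \<oplus> (k \<otimes> (bar b \<ominus> b)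
     \<oplus> k \<otimes> (k \<otimes> bar (x1 \<oplus> x2 \<oplus> x3) \<oplus> bar k \<otimes> (x1 \<oplus> x2 \<oplus> x3)))
     \<ominus> bar k \<otimes> bar a \<otimes> bar (x3 \<ominus> x2)"

text \<open>The exponential of the inner derivation given by \<open>k (w1 + w2 + w3)\<close>.\<close>

definition hexp :: "'x \<Rightarrow> 'x cayley \<Rightarrow> 'x cayley" where
  "hexp k = (\<lambda>(b, x1, x2, x3).
     (b \<oplus> (bar k \<otimes> (x1 \<oplus> x2 \<oplus> x3) \<ominus> k \<otimes> bar (x1 \<oplus> x2 \<oplus> x3)),
      hexp_coord k b x1 x2 x3, hexp_coord k b x2 x3 x1, hexp_coord k b x3 x1 x2))"

definition hmu :: "'x \<Rightarrow> 'x cayley \<Rightarrow> 'x cayley" where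
  "hmu r = (\<lambda>(b, x1, x2, x3). (b, r \<otimes> x1, r \<otimes> x2, r \<otimes> x3))"

text \<open>On \<open>W\<close> this is \<open>p + q \<tau> + r \<tau>^2\<close>, the general
  \<open>K\<close>-linear map that commutes with the cyclic shift.\<close>

definition hcirc :: "'x \<Rightarrow> 'x \<Rightarrow> 'x \<Rightarrow> 'x cayley \<Rightarrow> 'x cayley" where
  "hcirc p q r = (\<lambda>(b, x1, x2, x3). (b, p \<otimes> x1 \<oplus> r \<otimes> x2 \<oplus> q \<otimes> x3,
     q \<otimes> x1 \<oplus> p \<otimes> x2 \<oplus> r \<otimes> x3, r \<otimes> x1 \<oplus> q \<otimes> x2 \<oplus> p \<otimes> x3))"

text \<open>The \<open>K\<close>-linear map \<open>1 + s (\<tau> - 1) + t (\<tau> - 1)\<^sup>2\<close>, where \<open>t = s - s\<^sup>2 + q\<close>.\<close>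

definition hnil :: "'x \<Rightarrow> 'x \<Rightarrow> 'x cayley \<Rightarrow> 'x cayley" where
  "hnil s q = hcirc (\<one> \<ominus> s \<otimes> s \<oplus> q) (q \<ominus> s \<ominus> s \<otimes> s) (s \<ominus> s \<otimes> s \<oplus> q)"

text \<open>
  The automorphism that is the identity where \<open>y = 1\<close> and the conjugation where \<open>y = -1\<close>;
  recall that \<open>1/2 = -1\<close>.
\<close>

definition htwist :: "'x \<Rightarrow> 'x \<Rightarrow> 'x" where
  "htwist y b = (y \<ominus> \<one>) \<otimes> bar b \<ominus> (y \<oplus> \<one>) \<otimes> b"

definition hflip :: "'x \<Rightarrow> 'x \<Rightarrow> 'x cayley \<Rightarrow> 'x cayley" where
  "hflip y r = (\<lambda>(b, x1, x2, x3).
     (htwist y b, r \<otimes> htwist y x1, r \<otimes> htwist y x2, r \<otimes> htwist y x3))"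

text \<open>Points of the centralizer in terms of quadruples over \<open>K \<otimes> R\<close>. The
  ring \<open>R\<close> itself is visible only as the set of elements fixed by \<open>bar\<close>,
  so \<open>R\<close>-linearity is stated for those.\<close>

definition hcent :: "('x cayley \<Rightarrow> 'x cayley) \<Rightarrow> bool" where
  "hcent g \<longleftrightarrow> bij_betw g hcar hcar \<and>
     (\<forall>x \<in> hcar. \<forall>y \<in> hcar. g (hadd x y) = hadd (g x) (g y)) \<and>
     (\<forall>r \<in> carrier A. bar r = r \<longrightarrow> (\<forall>x \<in> hcar. g (hscale r x) = hscale r (g x))) \<and>
     (\<forall>x \<in> hcar. \<forall>y \<in> hcar. g (hmul x y) = hmul (g x) (g y)) \<and>
     (\<forall>x \<in> hcar. hnorm (g x) = hnorm x) \<and>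
     (\<forall>x \<in> hcar. g (htau x) = htau (g x))"

lemma hcar_iff [simp]: "(b, x1, x2, x3) \<in> hcar \<longleftrightarrow>
    b \<in> carrier A \<and> x1 \<in> carrier A \<and> x2 \<in> carrier A \<and> x3 \<in> carrier A"
  by (simp add: hcar_def)

lemmas h_defs = hsig_def hcross_def hadd_def hscale_def hmul_def htau_def hnorm_def hexp_coord_def
  hexp_def hmu_def hcirc_def hnil_def htwist_def hflip_def Let_def case_prod_conv

lemma hcar_hev:
  assumes "x \<in> hcar"
  obtains b x1 x2 x3 where "x = (hev b, hev x1, hev x2, hev x3)"
  using assms unfolding hcar_def by (auto dest!: hev_surj)

lemmas hev_hom = herm_hom_simps(1-8)[OF herm_ring_axioms]

lemma hcar_cases:
  assumes "x \<in> hcar"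
  obtains b x1 x2 x3 where "x = (b, x1, x2, x3)" "b \<in> carrier A" "x1 \<in> carrier A"
    "x2 \<in> carrier A" "x3 \<in> carrier A"
  using assms unfolding hcar_def by auto

lemma add_three: "x \<in> carrier A \<Longrightarrow> x \<oplus> x = \<ominus> x"
  by (drule hev_surj) (auto simp only: hev_simps herm_free_uminus)

lemma uminus_add_uminus: "x \<in> carrier A \<Longrightarrow> \<ominus> x \<ominus> x = x"
  using add_three[of "\<ominus> x"] by (simp add: minus_eq)

text \<open>The relation \<open>bar r = r\<close> cannot be imposed on a generator of the free ring.
  Since \<open>2 = -1\<close>, a symmetric \<open>r\<close> equals \<open>- r - bar r\<close>, which
  has the visibly symmetric shape \<open>p + hbar p\<close>.\<close>

lemma symmetric_hev:
  assumes "r \<in> carrier A" "bar r = r"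
  obtains p where "r = hev (p + hbar p)"
proof -
  obtain q where q: "r = hev q" using hev_surj assms by blast
  have "hev (- q + hbar (- q)) = \<ominus> r \<oplus> \<ominus> r"
    using assms(2) by (simp only: q hbar_simps hev_hom)
  also have "\<dots> = r" using assms by (simp add: add_three)
  finally show ?thesis using that by metis
qed

lemma h_closed [simp]:
  "\<lbrakk>x1 \<in> carrier A; x2 \<in> carrier A; x3 \<in> carrier A; y1 \<in> carrier A; y2 \<in> carrier A; y3 \<in> carrier A\<rbrakk>
    \<Longrightarrow> hsig x1 x2 x3 y1 y2 y3 \<in> carrier A"
  "\<lbrakk>x1 \<in> carrier A; x2 \<in> carrier A; x3 \<in> carrier A; y1 \<in> carrier A; y2 \<in> carrier A; y3 \<in> carrier A\<rbrakk>
    \<Longrightarrow> hcross x1 x2 x3 y1 y2 y3 \<in> carrier A"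
  "\<lbrakk>x \<in> hcar; y \<in> hcar\<rbrakk> \<Longrightarrow> hadd x y \<in> hcar"
  "\<lbrakk>x \<in> hcar; y \<in> hcar\<rbrakk> \<Longrightarrow> hmul x y \<in> hcar"
  "\<lbrakk>r \<in> carrier A; x \<in> hcar\<rbrakk> \<Longrightarrow> hscale r x \<in> hcar"
  "x \<in> hcar \<Longrightarrow> htau x \<in> hcar"
  "x \<in> hcar \<Longrightarrow> hnorm x \<in> carrier A"
  "\<lbrakk>r \<in> carrier A; x \<in> hcar\<rbrakk> \<Longrightarrow> hexp r x \<in> hcar"
  "\<lbrakk>r \<in> carrier A; x \<in> hcar\<rbrakk> \<Longrightarrow> hmu r x \<in> hcar"
  "\<lbrakk>p \<in> carrier A; q \<in> carrier A; r \<in> carrier A; x \<in> hcar\<rbrakk> \<Longrightarrow> hcirc p q r x \<in> hcar"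
  "\<lbrakk>p \<in> carrier A; q \<in> carrier A; x \<in> hcar\<rbrakk> \<Longrightarrow> hnil p q x \<in> hcar"
  "\<lbrakk>p \<in> carrier A; b \<in> carrier A\<rbrakk> \<Longrightarrow> htwist p b \<in> carrier A"
  "\<lbrakk>p \<in> carrier A; q \<in> carrier A; x \<in> hcar\<rbrakk> \<Longrightarrow> hflip p q x \<in> hcar"
  by (auto simp: hcar_def h_defs)

lemma hmul_add_left:
  assumes "x \<in> hcar" "y \<in> hcar" "z \<in> hcar"
  shows "hmul (hadd x y) z = hadd (hmul x z) (hmul y z)"
proof -
  obtain b x1 x2 x3 where x: "x = (hev b, hev x1, hev x2, hev x3)" by (rule hcar_hev[OF assms(1)])
  obtain c y1 y2 y3 where y: "y = (hev c, hev y1, hev y2, hev y3)" by (rule hcar_hev[OF assms(2)])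
  obtain d z1 z2 z3 where z: "z = (hev d, hev z1, hev z2, hev z3)" by (rule hcar_hev[OF assms(3)])
  \<comment> \<open>The pattern of all polynomial identities below: each coordinate is collected
    into one \<open>hev\<close>, which is then stripped, and both sides are brought to normal form
    in the free ring.\<close>
  show ?thesis unfolding x y z h_defs
    by (simp only: hev_simps) (intro arg_cong2[of _ _ _ _ Pair] arg_cong[of _ _ hev]; (simp only: herm_expand)?; (simp only: herm_collect)?)
qed

lemma hmul_add_right:
  assumes "x \<in> hcar" "y \<in> hcar" "z \<in> hcar"
  shows "hmul z (hadd x y) = hadd (hmul z x) (hmul z y)"
proof -
  obtain b x1 x2 x3 where x: "x = (hev b, hev x1, hev x2, hev x3)" by (rule hcar_hev[OF assms(1)])
  obtain c y1 y2 y3 where y: "y = (hev c, hev y1, hev y2, hev y3)" by (rule hcar_hev[OF assms(2)])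
  obtain d z1 z2 z3 where z: "z = (hev d, hev z1, hev z2, hev z3)" by (rule hcar_hev[OF assms(3)])
  show ?thesis unfolding x y z h_defs
    by (simp only: hev_simps) (intro arg_cong2[of _ _ _ _ Pair] arg_cong[of _ _ hev]; (simp only: herm_expand)?; (simp only: herm_collect)?)
qed

lemma hcar_split: "\<lbrakk>b \<in> carrier A; x1 \<in> carrier A; x2 \<in> carrier A; x3 \<in> carrier A\<rbrakk>
    \<Longrightarrow> (b, x1, x2, x3) = hadd (b, \<zero>, \<zero>, \<zero>) (\<zero>, x1, x2, x3)"
  by (simp add: hadd_def)

subsection \<open>The exponentials\<close>

lemma hexp_add:
  assumes "k \<in> carrier A" "x \<in> hcar" "y \<in> hcar"
  shows "hexp k (hadd x y) = hadd (hexp k x) (hexp k y)"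
proof -
  obtain k' where k: "k = hev k'" using assms hev_surj by blast
  obtain b x1 x2 x3 where x: "x = (hev b, hev x1, hev x2, hev x3)" by (rule hcar_hev[OF assms(2)])
  obtain c y1 y2 y3 where y: "y = (hev c, hev y1, hev y2, hev y3)" by (rule hcar_hev[OF assms(3)])
  show ?thesis unfolding k x y h_defs
    by (simp only: hev_simps) (intro arg_cong2[of _ _ _ _ Pair] arg_cong[of _ _ hev]; (simp only: herm_expand)?; (simp only: herm_collect)?)
qed

lemma hexp_scale:
  assumes "k \<in> carrier A" "x \<in> hcar" "r \<in> carrier A" "bar r = r"
  shows "hexp k (hscale r x) = hscale r (hexp k x)"
proof -
  obtain k' where k: "k = hev k'" using assms hev_surj by blast
  obtain p where r: "r = hev (p + hbar p)" by (rule symmetric_hev[OF assms(3,4)])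
  obtain b x1 x2 x3 where x: "x = (hev b, hev x1, hev x2, hev x3)" by (rule hcar_hev[OF assms(2)])
  show ?thesis unfolding k x r h_defs
    by (simp only: hev_simps) (intro arg_cong2[of _ _ _ _ Pair] arg_cong[of _ _ hev]; (simp only: herm_expand)?; (simp only: herm_collect)?)
qed

text \<open>For \<open>u = w1 + w2 + w3\<close> the elements \<open>k u\<close> and
  \<open>l u\<close> have product zero, so their inner derivations commute and the exponentials
  compose by adding the parameters.\<close>

lemma hexp_exp:
  assumes "k \<in> carrier A" "l \<in> carrier A" "x \<in> hcar"
  shows "hexp k (hexp l x) = hexp (k \<oplus> l) x"
proof -
  obtain k' where k: "k = hev k'" using assms hev_surj by blast
  obtain l' where l: "l = hev l'" using assms hev_surj by blast
  obtain b x1 x2 x3 where x: "x = (hev b, hev x1, hev x2, hev x3)" by (rule hcar_hev[OF assms(3)])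
  show ?thesis unfolding k x l h_defs
    by (simp only: hev_simps) (intro arg_cong2[of _ _ _ _ Pair] arg_cong[of _ _ hev]; (simp only: herm_expand)?; (simp only: herm_collect)?)
qed

lemma hexp_zero: "x \<in> hcar \<Longrightarrow> hexp \<zero> x = x"
  by (erule hcar_cases) (simp add: h_defs minus_eq)

lemma hexp_tau: "x \<in> hcar \<Longrightarrow> k \<in> carrier A \<Longrightarrow> hexp k (htau x) = htau (hexp k x)"
  by (erule hcar_cases) (simp add: hexp_def htau_def hexp_coord_def a_ac)

lemma hexp_norm:
  assumes "k \<in> carrier A" "x \<in> hcar"
  shows "hnorm (hexp k x) = hnorm x"
proof -
  obtain k' where k: "k = hev k'" using assms hev_surj by blast
  obtain b x1 x2 x3 where x: "x = (hev b, hev x1, hev x2, hev x3)" by (rule hcar_hev[OF assms(2)])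
  show ?thesis unfolding k x h_defs
    by (simp only: hev_simps) (rule arg_cong[of _ _ hev]; (simp only: herm_expand)?; (simp only: herm_collect)?)
qed

lemma hexp_mult_WW:
  assumes "k \<in> carrier A" "x1 \<in> carrier A" "x2 \<in> carrier A" "x3 \<in> carrier A"
    "y1 \<in> carrier A" "y2 \<in> carrier A" "y3 \<in> carrier A"
  shows "hexp k (hmul (\<zero>, x1, x2, x3) (\<zero>, y1, y2, y3)) =
    hmul (hexp k (\<zero>, x1, x2, x3)) (hexp k (\<zero>, y1, y2, y3))"
proof -
  obtain k' p1 p2 p3 q1 q2 q3 where e: "k = hev k'" "x1 = hev p1" "x2 = hev p2" "x3 = hev p3"
    "y1 = hev q1" "y2 = hev q2" "y3 = hev q3"
    using assms hev_surj by metis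
  show ?thesis unfolding e h_defs
    by (simp only: hev_simps) (intro arg_cong2[of _ _ _ _ Pair] arg_cong[of _ _ hev]; (simp only: herm_expand)?; (simp only: herm_collect)?)
qed

lemma hexp_mult_KK:
  assumes "k \<in> carrier A" "b \<in> carrier A" "c \<in> carrier A"
  shows "hexp k (hmul (b, \<zero>, \<zero>, \<zero>) (c, \<zero>, \<zero>, \<zero>)) =
    hmul (hexp k (b, \<zero>, \<zero>, \<zero>)) (hexp k (c, \<zero>, \<zero>, \<zero>))"
proof -
  obtain k' b' c' where e: "k = hev k'" "b = hev b'" "c = hev c'"
    using assms hev_surj by metis
  show ?thesis unfolding e h_defs
    by (simp only: hev_simps) (intro arg_cong2[of _ _ _ _ Pair] arg_cong[of _ _ hev]; (simp only: herm_expand)?; (simp only: herm_collect)?)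
qed

lemma hexp_mult_KW:
  assumes "k \<in> carrier A" "b \<in> carrier A" "y1 \<in> carrier A" "y2 \<in> carrier A" "y3 \<in> carrier A"
  shows "hexp k (hmul (b, \<zero>, \<zero>, \<zero>) (\<zero>, y1, y2, y3)) =
    hmul (hexp k (b, \<zero>, \<zero>, \<zero>)) (hexp k (\<zero>, y1, y2, y3))"
    "hexp k (hmul (\<zero>, y1, y2, y3) (b, \<zero>, \<zero>, \<zero>)) =
    hmul (hexp k (\<zero>, y1, y2, y3)) (hexp k (b, \<zero>, \<zero>, \<zero>))"
proof -
  obtain k' b' q1 q2 q3 where e: "k = hev k'" "b = hev b'"
    "y1 = hev q1" "y2 = hev q2" "y3 = hev q3"
    using assms hev_surj by metis
  show "hexp k (hmul (b, \<zero>, \<zero>, \<zero>) (\<zero>, y1, y2, y3)) =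
    hmul (hexp k (b, \<zero>, \<zero>, \<zero>)) (hexp k (\<zero>, y1, y2, y3))"
    "hexp k (hmul (\<zero>, y1, y2, y3) (b, \<zero>, \<zero>, \<zero>)) =
    hmul (hexp k (\<zero>, y1, y2, y3)) (hexp k (b, \<zero>, \<zero>, \<zero>))"
    unfolding e h_defs
    by (simp only: hev_simps, (intro arg_cong2[of _ _ _ _ Pair] arg_cong[of _ _ hev]; (simp only: herm_expand)?; (simp only: herm_collect)?))+
qed

text \<open>In characteristic 3 the vanishing of the cube of a derivation \<open>D\<close> does not
  by itself make its exponential multiplicative: the products of total order three and four in
  \<open>D\<close> are not governed by the Leibniz rule. The identity is therefore checked directly,
  split by biadditivity into the four kinds of products of \<open>K\<close> and
  \<open>W\<close>.\<close>

lemma hexp_mult: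
  assumes "k \<in> carrier A" "x \<in> hcar" "y \<in> hcar"
  shows "hexp k (hmul x y) = hmul (hexp k x) (hexp k y)"
proof -
  obtain b x1 x2 x3 where x: "x = (b, x1, x2, x3)" "b \<in> carrier A" "x1 \<in> carrier A"
    "x2 \<in> carrier A" "x3 \<in> carrier A" by (rule hcar_cases[OF assms(2)])
  obtain c y1 y2 y3 where y: "y = (c, y1, y2, y3)" "c \<in> carrier A" "y1 \<in> carrier A"
    "y2 \<in> carrier A" "y3 \<in> carrier A" by (rule hcar_cases[OF assms(3)])
  show ?thesis
    unfolding x(1) y(1) hcar_split[OF x(2-5)] hcar_split[OF y(2-5)]
    using x(2-5) y(2-5) assms(1)
    by (simp add: hmul_add_left hmul_add_right hexp_add hexp_mult_WW hexp_mult_KK hexp_mult_KW)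
qed

subsection \<open>The centralizer\<close>

lemma hcentI:
  assumes "\<And>x. x \<in> hcar \<Longrightarrow> g x \<in> hcar" "\<And>x. x \<in> hcar \<Longrightarrow> h x \<in> hcar"
    "\<And>x. x \<in> hcar \<Longrightarrow> h (g x) = x" "\<And>x. x \<in> hcar \<Longrightarrow> g (h x) = x"
    "\<And>x y. \<lbrakk>x \<in> hcar; y \<in> hcar\<rbrakk> \<Longrightarrow> g (hadd x y) = hadd (g x) (g y)"
    "\<And>r x. \<lbrakk>r \<in> carrier A; bar r = r; x \<in> hcar\<rbrakk> \<Longrightarrow> g (hscale r x) = hscale r (g x)"
    "\<And>x y. \<lbrakk>x \<in> hcar; y \<in> hcar\<rbrakk> \<Longrightarrow> g (hmul x y) = hmul (g x) (g y)"
    "\<And>x. x \<in> hcar \<Longrightarrow> hnorm (g x) = hnorm x"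
    "\<And>x. x \<in> hcar \<Longrightarrow> g (htau x) = htau (g x)"
  shows "hcent g"
  unfolding hcent_def using assms by (auto intro: bij_betw_byWitness[where f' = h])

lemma hcentD:
  assumes "hcent g"
  shows "\<And>x. x \<in> hcar \<Longrightarrow> g x \<in> hcar"
    "\<And>x y. \<lbrakk>x \<in> hcar; y \<in> hcar\<rbrakk> \<Longrightarrow> g (hadd x y) = hadd (g x) (g y)"
    "\<And>r x. \<lbrakk>r \<in> carrier A; bar r = r; x \<in> hcar\<rbrakk> \<Longrightarrow> g (hscale r x) = hscale r (g x)"
    "\<And>x y. \<lbrakk>x \<in> hcar; y \<in> hcar\<rbrakk> \<Longrightarrow> g (hmul x y) = hmul (g x) (g y)"
    "\<And>x. x \<in> hcar \<Longrightarrow> hnorm (g x) = hnorm x"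
    "\<And>x. x \<in> hcar \<Longrightarrow> g (htau x) = htau (g x)"
  using assms unfolding hcent_def by (auto dest: bij_betwE)

lemma hcent_compose: "\<lbrakk>hcent g; hcent h\<rbrakk> \<Longrightarrow> hcent (\<lambda>x. g (h x))"
  unfolding hcent_def using bij_betw_trans[of h hcar hcar g hcar]
  by (auto simp: o_def dest: bij_betwE)

lemma hcent_cong: "\<lbrakk>hcent g; \<And>x. x \<in> hcar \<Longrightarrow> g x = h x\<rbrakk> \<Longrightarrow> hcent h"
  unfolding hcent_def by (auto cong: bij_betw_cong)

lemma hcent_hexp: "k \<in> carrier A \<Longrightarrow> hcent (hexp k)"
  by (rule hcentI[where h = "hexp (\<ominus> k)"])
    (simp_all add: hexp_add hexp_scale hexp_exp hexp_mult hexp_norm hexp_tau l_neg r_neg hexp_zero)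

end

context herm_ring
begin

lemma hmu_simps:
  assumes "r \<in> carrier A" "x \<in> hcar" "y \<in> hcar"
  shows "hmu r (hadd x y) = hadd (hmu r x) (hmu r y)"
    and "p \<in> carrier A \<Longrightarrow> hmu r (hscale p x) = hscale p (hmu r x)"
    and "p \<in> carrier A \<Longrightarrow> hmu p (hmu r x) = hmu (p \<otimes> r) x"
    and "hmu \<one> x = x"
    and "hmu r (htau x) = htau (hmu r x)"
  using assms by (auto elim!: hcar_cases simp: hmu_def hadd_def hscale_def htau_def r_distr m_ac)

text \<open>The cross product is conjugate-linear in both arguments. Hence scaling \<open>W\<close>
  by \<open>r\<close> respects the product once \<open>r bar r = 1\<close> and
  \<open>(bar r)^2 = r\<close>; this is the origin of the two conditions that define
  \<open>mu_functor\<close>.\<close>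

lemma hsig_semilinear:
  assumes "r \<in> carrier A" "x1 \<in> carrier A" "x2 \<in> carrier A" "x3 \<in> carrier A"
    "y1 \<in> carrier A" "y2 \<in> carrier A" "y3 \<in> carrier A"
  shows "hsig (r \<otimes> x1) (r \<otimes> x2) (r \<otimes> x3) (r \<otimes> y1) (r \<otimes> y2) (r \<otimes> y3) =
      (r \<otimes> bar r) \<otimes> hsig x1 x2 x3 y1 y2 y3"
    and "hcross (r \<otimes> x1) (r \<otimes> x2) (r \<otimes> x3) (r \<otimes> y1) (r \<otimes> y2) (r \<otimes> y3) =
      (bar r \<otimes> bar r) \<otimes> hcross x1 x2 x3 y1 y2 y3"
proof -
  obtain r' p1 p2 p3 q1 q2 q3 where e: "r = hev r'" "x1 = hev p1" "x2 = hev p2" "x3 = hev p3"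
    "y1 = hev q1" "y2 = hev q2" "y3 = hev q3"
    using assms hev_surj by metis
  show "hsig (r \<otimes> x1) (r \<otimes> x2) (r \<otimes> x3) (r \<otimes> y1) (r \<otimes> y2) (r \<otimes> y3) =
      (r \<otimes> bar r) \<otimes> hsig x1 x2 x3 y1 y2 y3"
    "hcross (r \<otimes> x1) (r \<otimes> x2) (r \<otimes> x3) (r \<otimes> y1) (r \<otimes> y2) (r \<otimes> y3) =
      (bar r \<otimes> bar r) \<otimes> hcross x1 x2 x3 y1 y2 y3"
    unfolding e hsig_def hcross_def by (simp only: hev_simps, (rule arg_cong[of _ _ hev]; (simp only: herm_expand)?; (simp only: herm_collect)?))+
qed

lemma cube_root_of_unity:
  assumes "r \<in> carrier A" "r \<otimes> (r \<otimes> r) = \<one>" "r \<otimes> bar r = \<one>"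
  shows "r \<otimes> r = bar r" "bar r \<otimes> bar r = r"
proof -
  have "r \<otimes> r = r \<otimes> r \<otimes> (r \<otimes> bar r)" using assms by simp
  also have "\<dots> = r \<otimes> (r \<otimes> r) \<otimes> bar r" using assms(1) by (simp add: m_ac)
  finally show 1: "r \<otimes> r = bar r" using assms by simp
  show "bar r \<otimes> bar r = r" using arg_cong[OF 1, of bar] assms(1) by (simp add: bar_mult)
qed

lemma hcent_hmu:
  assumes r: "r \<in> carrier A" "r \<otimes> (r \<otimes> r) = \<one>" "r \<otimes> bar r = \<one>"
  shows "hcent (hmu r)"
proof (rule hcentI[where h = "hmu (bar r)"])
  note rr = cube_root_of_unity[OF assms]
  fix x y assume x: "x \<in> hcar" and y: "y \<in> hcar"
  from x r show "hmu (bar r) (hmu r x) = x" "hmu r (hmu (bar r) x) = x"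
    by (simp_all add: hmu_simps m_comm[of "bar r"])
  from x y r show "hmu r (hmul x y) = hmul (hmu r x) (hmu r y)"
    by (auto elim!: hcar_cases simp: hmu_def hmul_def hsig_semilinear rr r_distr m_lcomm)
  from x r show "hnorm (hmu r x) = hnorm x"
    by (auto elim!: hcar_cases simp: hmu_def hnorm_def hsig_semilinear)
qed (use r in \<open>simp_all add: hmu_simps\<close>)

lemma hcirc_simps:
  assumes "p \<in> carrier A" "q \<in> carrier A" "r \<in> carrier A" "x \<in> hcar" "y \<in> hcar"
  shows "hcirc p q r (hadd x y) = hadd (hcirc p q r x) (hcirc p q r y)"
    and "k \<in> carrier A \<Longrightarrow> hcirc p q r (hscale k x) = hscale k (hcirc p q r x)"
    and "hcirc p q r (htau x) = htau (hcirc p q r x)"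
  using assms by (auto elim!: hcar_cases
      simp: hcirc_def hadd_def hscale_def htau_def r_distr m_lcomm a_ac)

text \<open>Put \<open>N = \<tau> - 1\<close>, so that \<open>N^3 = 0\<close> and
  \<open>log \<tau> = N + N^2\<close>. On \<open>W\<close> the map \<open>hnil s q\<close> is
  \<open>exp (s log \<tau> + q N^2)\<close>; the exponents commute, so the parameters add. This also
  explains the correction \<open>s - s^2\<close> in the coefficient of \<open>N^2\<close>.\<close>

lemma hnil_hnil:
  assumes s: "s \<in> carrier A" "bar s = s" "q \<in> carrier A" "bar q = \<ominus> q"
    and t: "t \<in> carrier A" "bar t = t" "p \<in> carrier A" "bar p = \<ominus> p" and x: "x \<in> hcar"
  shows "hnil s q (hnil t p x) = hnil (s \<oplus> t) (q \<oplus> p) x"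
proof -
  obtain s' q' t' p' where e: "s = hev s'" "q = hev q'" "t = hev t'" "p = hev p'"
    using assms hev_surj by metis
  obtain b x1 x2 x3 where x: "x = (hev b, hev x1, hev x2, hev x3)" by (rule hcar_hev[OF x])
  show ?thesis unfolding e x h_defs by (simp only: hev_simps) (intro arg_cong2[of _ _ _ _ Pair] arg_cong[of _ _ hev]; (simp only: herm_expand)?; (simp only: herm_collect)?)
qed

lemma hnil_zero: "x \<in> hcar \<Longrightarrow> hnil \<zero> \<zero> x = x"
  by (erule hcar_cases) (simp add: h_defs minus_eq)

lemma bar_diff: "\<lbrakk>x \<in> carrier A; y \<in> carrier A\<rbrakk> \<Longrightarrow> bar (x \<ominus> y) = bar x \<ominus> bar y"
  by (simp add: minus_eq bar_add bar_minus)

text \<open>Conditions such as \<open>bar s = s\<close> or \<open>bar q = - q\<close> have no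
  counterpart in the free ring. They are applied first, in the concrete ring, once
  \<open>bar\<close> has been pushed to the atoms; what remains is an identity that holds
  freely.\<close>

lemmas bar_distribs = bar_add bar_mult bar_minus bar_diff bar_bar bar_one bar_zero
  add.m_closed m_closed minus_closed a_inv_closed one_closed zero_closed bar_closed a_closed

text \<open>The two parameters are treated one at a time, since \<open>hnil s q\<close> is the
  composite of \<open>hnil s \<zero>\<close> and \<open>hnil \<zero> q\<close>.\<close>

lemma hnil_mult_WW1:
  assumes s: "s \<in> carrier A" "bar s = s"
   and xy: "x1 \<in> carrier A" "x2 \<in> carrier A" "x3 \<in> carrier A"
    "y1 \<in> carrier A" "y2 \<in> carrier A" "y3 \<in> carrier A"
  shows "hnil s \<zero> (hmul (\<zero>, x1, x2, x3) (\<zero>, y1, y2, y3)) =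
    hmul (hnil s \<zero> (\<zero>, x1, x2, x3)) (hnil s \<zero> (\<zero>, y1, y2, y3))"
proof -
  obtain s' p1 p2 p3 q1 q2 q3 where e: "s = hev s'" "x1 = hev p1" "x2 = hev p2" "x3 = hev p3"
    "y1 = hev q1" "y2 = hev q2" "y3 = hev q3"
    using xy s hev_surj by metis
  show ?thesis unfolding h_defs
    by (simp only: bar_distribs s xy, simp only: e hev_simps) (intro arg_cong2[of _ _ _ _ Pair] arg_cong[of _ _ hev]; (simp only: herm_expand)?; (simp only: herm_collect)?)
qed

lemma hnil_mult_WW2:
  assumes s: "q \<in> carrier A" "bar q = \<ominus> q"
   and xy: "x1 \<in> carrier A" "x2 \<in> carrier A" "x3 \<in> carrier A"
    "y1 \<in> carrier A" "y2 \<in> carrier A" "y3 \<in> carrier A"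
  shows "hnil \<zero> q (hmul (\<zero>, x1, x2, x3) (\<zero>, y1, y2, y3)) =
    hmul (hnil \<zero> q (\<zero>, x1, x2, x3)) (hnil \<zero> q (\<zero>, y1, y2, y3))"
proof -
  obtain q' p1 p2 p3 q1 q2 q3 where e: "q = hev q'" "x1 = hev p1" "x2 = hev p2" "x3 = hev p3"
    "y1 = hev q1" "y2 = hev q2" "y3 = hev q3"
    using xy s hev_surj by metis
  show ?thesis unfolding h_defs
    by (simp only: bar_distribs s xy, simp only: e hev_simps) (intro arg_cong2[of _ _ _ _ Pair] arg_cong[of _ _ hev]; (simp only: herm_expand)?; (simp only: herm_collect)?)
qed

lemma hnil_mult_KW:
  assumes "s \<in> carrier A" "q \<in> carrier A" "b \<in> carrier A" "c \<in> carrier A"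
    "y1 \<in> carrier A" "y2 \<in> carrier A" "y3 \<in> carrier A"
  shows "hnil s q (hmul (b, \<zero>, \<zero>, \<zero>) (\<zero>, y1, y2, y3)) =
    hmul (hnil s q (b, \<zero>, \<zero>, \<zero>)) (hnil s q (\<zero>, y1, y2, y3))"
    and "hnil s q (hmul (\<zero>, y1, y2, y3) (b, \<zero>, \<zero>, \<zero>)) =
    hmul (hnil s q (\<zero>, y1, y2, y3)) (hnil s q (b, \<zero>, \<zero>, \<zero>))"
    and "hnil s q (hmul (b, \<zero>, \<zero>, \<zero>) (c, \<zero>, \<zero>, \<zero>)) =
    hmul (hnil s q (b, \<zero>, \<zero>, \<zero>)) (hnil s q (c, \<zero>, \<zero>, \<zero>))"
proof -
  obtain s' t' b' c' q1 q2 q3 where e: "s = hev s'" "q = hev t'" "b = hev b'" "c = hev c'"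
    "y1 = hev q1" "y2 = hev q2" "y3 = hev q3"
    using assms hev_surj by metis
  show "hnil s q (hmul (b, \<zero>, \<zero>, \<zero>) (\<zero>, y1, y2, y3)) =
    hmul (hnil s q (b, \<zero>, \<zero>, \<zero>)) (hnil s q (\<zero>, y1, y2, y3))"
    "hnil s q (hmul (\<zero>, y1, y2, y3) (b, \<zero>, \<zero>, \<zero>)) =
    hmul (hnil s q (\<zero>, y1, y2, y3)) (hnil s q (b, \<zero>, \<zero>, \<zero>))"
    "hnil s q (hmul (b, \<zero>, \<zero>, \<zero>) (c, \<zero>, \<zero>, \<zero>)) =
    hmul (hnil s q (b, \<zero>, \<zero>, \<zero>)) (hnil s q (c, \<zero>, \<zero>, \<zero>))"
    unfolding e h_defs
    by (simp only: hev_simps, (intro arg_cong2[of _ _ _ _ Pair] arg_cong[of _ _ hev]; (simp only: herm_expand)?; (simp only: herm_collect)?))+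
qed

lemma hnil_simps:
  assumes "s \<in> carrier A" "q \<in> carrier A" "x \<in> hcar" "y \<in> hcar"
  shows "hnil s q (hadd x y) = hadd (hnil s q x) (hnil s q y)"
    and "k \<in> carrier A \<Longrightarrow> hnil s q (hscale k x) = hscale k (hnil s q x)"
    and "hnil s q (htau x) = htau (hnil s q x)"
  using assms unfolding hnil_def by (simp_all add: hcirc_simps)

lemma mult_from_WW:
  assumes "\<And>x y. \<lbrakk>x \<in> hcar; y \<in> hcar\<rbrakk> \<Longrightarrow> g (hadd x y) = hadd (g x) (g y)"
    "\<And>x. x \<in> hcar \<Longrightarrow> g x \<in> hcar"
    "\<And>b c. \<lbrakk>b \<in> carrier A; c \<in> carrier A\<rbrakk> \<Longrightarrow> g (hmul (b, \<zero>, \<zero>, \<zero>) (c, \<zero>, \<zero>, \<zero>)) =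
      hmul (g (b, \<zero>, \<zero>, \<zero>)) (g (c, \<zero>, \<zero>, \<zero>))"
    "\<And>b y1 y2 y3. \<lbrakk>b \<in> carrier A; y1 \<in> carrier A; y2 \<in> carrier A; y3 \<in> carrier A\<rbrakk> \<Longrightarrow>
      g (hmul (b, \<zero>, \<zero>, \<zero>) (\<zero>, y1, y2, y3)) = hmul (g (b, \<zero>, \<zero>, \<zero>)) (g (\<zero>, y1, y2, y3))"
    "\<And>b y1 y2 y3. \<lbrakk>b \<in> carrier A; y1 \<in> carrier A; y2 \<in> carrier A; y3 \<in> carrier A\<rbrakk> \<Longrightarrow>
      g (hmul (\<zero>, y1, y2, y3) (b, \<zero>, \<zero>, \<zero>)) = hmul (g (\<zero>, y1, y2, y3)) (g (b, \<zero>, \<zero>, \<zero>))"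
    "\<And>x1 x2 x3 y1 y2 y3. \<lbrakk>x1 \<in> carrier A; x2 \<in> carrier A; x3 \<in> carrier A; y1 \<in> carrier A;
      y2 \<in> carrier A; y3 \<in> carrier A\<rbrakk> \<Longrightarrow>
      g (hmul (\<zero>, x1, x2, x3) (\<zero>, y1, y2, y3)) = hmul (g (\<zero>, x1, x2, x3)) (g (\<zero>, y1, y2, y3))"
    and "x \<in> hcar" "y \<in> hcar"
  shows "g (hmul x y) = hmul (g x) (g y)"
proof -
  obtain b x1 x2 x3 where x: "x = (b, x1, x2, x3)" "b \<in> carrier A" "x1 \<in> carrier A"
    "x2 \<in> carrier A" "x3 \<in> carrier A" by (rule hcar_cases[OF assms(7)])
  obtain c y1 y2 y3 where y: "y = (c, y1, y2, y3)" "c \<in> carrier A" "y1 \<in> carrier A"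
    "y2 \<in> carrier A" "y3 \<in> carrier A" by (rule hcar_cases[OF assms(8)])
  show ?thesis
    unfolding x(1) y(1) hcar_split[OF x(2-5)] hcar_split[OF y(2-5)]
    using x(2-5) y(2-5) by (simp add: hmul_add_left hmul_add_right assms(1-6))
qed

lemma hnil_norm:
  assumes s: "s \<in> carrier A" "bar s = s" "q \<in> carrier A" "bar q = \<ominus> q" and x: "x \<in> hcar"
  shows "hnorm (hnil s q x) = hnorm x"
proof -
  obtain b x1 x2 x3 where x: "x = (b, x1, x2, x3)" "b \<in> carrier A" "x1 \<in> carrier A"
    "x2 \<in> carrier A" "x3 \<in> carrier A" by (rule hcar_cases[OF x])
  obtain s' q' b' p1 p2 p3 where e: "s = hev s'" "q = hev q'" "b = hev b'" "x1 = hev p1"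
    "x2 = hev p2" "x3 = hev p3"
    using x(2-5) s hev_surj by metis
  show ?thesis unfolding x(1) h_defs
    by (simp only: bar_distribs s x(2-5), simp only: e hev_simps) (rule arg_cong[of _ _ hev]; (simp only: herm_expand)?; (simp only: herm_collect)?)
qed

lemma hcent_hnil:
  assumes s: "s \<in> carrier A" "bar s = s" "q \<in> carrier A" "bar q = \<ominus> q"
  shows "hcent (hnil s q)"
proof (rule hcentI[where h = "hnil (\<ominus> s) (\<ominus> q)"])
  fix x y assume x: "x \<in> hcar" and y: "y \<in> hcar"
  show "hnil s q (hnil (\<ominus> s) (\<ominus> q) x) = x" "hnil (\<ominus> s) (\<ominus> q) (hnil s q x) = x"
    using s x by (simp_all add: hnil_hnil bar_minus l_neg r_neg hnil_zero)
  have eq: "hnil s q z = hnil s \<zero> (hnil \<zero> q z)" if "z \<in> hcar" for z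
    using that s by (simp add: hnil_hnil)
  have "hnil s \<zero> (hmul x y) = hmul (hnil s \<zero> x) (hnil s \<zero> y)" if "x \<in> hcar" "y \<in> hcar" for x y
    by (rule mult_from_WW) (use that s in \<open>simp_all add: hnil_simps hnil_mult_KW hnil_mult_WW1\<close>)
  moreover have "hnil \<zero> q (hmul x y) = hmul (hnil \<zero> q x) (hnil \<zero> q y)"
    by (rule mult_from_WW) (use x y s in \<open>simp_all add: hnil_simps hnil_mult_KW hnil_mult_WW2\<close>)
  ultimately show "hnil s q (hmul x y) = hmul (hnil s q x) (hnil s q y)"
    using x y s by (simp add: eq)
qed (use s in \<open>simp_all add: hnil_simps hnil_norm\<close>)

subsection \<open>Semilinear automorphisms\<close>

lemma bar_hnorm: "x \<in> hcar \<Longrightarrow> bar (hnorm x) = hnorm x"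
  by (erule hcar_hev, simp only: h_defs hev_simps) (rule arg_cong[of _ _ hev]; (simp only: herm_expand)?; (simp only: herm_collect)?)

lemma htwist_simps:
  assumes y: "y \<in> carrier A" "bar y = y" "y \<otimes> y = \<one>" and b: "b \<in> carrier A" "c \<in> carrier A"
  shows "htwist y (b \<oplus> c) = htwist y b \<oplus> htwist y c"
    and "htwist y (b \<ominus> c) = htwist y b \<ominus> htwist y c"
    and "htwist y (\<ominus> b) = \<ominus> htwist y b"
    and "htwist y (b \<otimes> c) = htwist y b \<otimes> htwist y c"
    and "bar (htwist y b) = htwist y (bar b)"
    and "htwist y (htwist y b) = b"
    and "bar b = b \<Longrightarrow> htwist y b = b"
proof -
  obtain y' b' c' where e: "y = hev y'" "b = hev b'" "c = hev c'" using assms hev_surj by metis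
  show "htwist y (b \<oplus> c) = htwist y b \<oplus> htwist y c" "htwist y (b \<ominus> c) = htwist y b \<ominus> htwist y c"
    "htwist y (\<ominus> b) = \<ominus> htwist y b"
    unfolding e htwist_def by (simp only: hev_simps, (rule arg_cong[of _ _ hev]; (simp only: herm_expand)?; (simp only: herm_collect)?))+
  have "htwist y b \<otimes> htwist y c = htwist y (b \<otimes> c) \<oplus>
      (y \<otimes> y \<ominus> \<one>) \<otimes> (bar b \<otimes> bar c \<oplus> b \<otimes> c \<ominus> b \<otimes> bar c \<ominus> bar b \<otimes> c)"
    unfolding e htwist_def by (simp only: hev_simps, (rule arg_cong[of _ _ hev]; (simp only: herm_expand)?; (simp only: herm_collect)?))
  then show "htwist y (b \<otimes> c) = htwist y b \<otimes> htwist y c" using assms by (simp add: minus_eq r_neg)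
  show bar: "bar (htwist y b) = htwist y (bar b)"
    using assms by (simp add: htwist_def bar_diff bar_mult bar_add)
  have "htwist y (htwist y b) = (y \<ominus> \<one>) \<otimes> htwist y (bar b) \<ominus> (y \<oplus> \<one>) \<otimes> htwist y b"
    using bar by (simp add: htwist_def[of y "htwist y b"])
  also have "\<dots> = b \<oplus> (y \<otimes> y \<ominus> \<one>) \<otimes> (bar b \<ominus> b)"
    unfolding e htwist_def by (simp only: hev_simps, (rule arg_cong[of _ _ hev]; (simp only: herm_expand)?; (simp only: herm_collect)?))
  finally show "htwist y (htwist y b) = b" using assms by (simp add: minus_eq r_neg)
  have "(y \<ominus> \<one>) \<otimes> b \<ominus> (y \<oplus> \<one>) \<otimes> b = b"
    unfolding e htwist_def by (simp only: hev_simps, (rule arg_cong[of _ _ hev]; (simp only: herm_expand)?; (simp only: herm_collect)?))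
  then show "htwist y b = b" if "bar b = b" using that by (simp add: htwist_def)
qed

text \<open>Twisting replaces the constant \<open>a\<close> of the trilinear form by
  \<open>htwist y a\<close>, and multiplying \<open>W\<close> by \<open>r\<close> changes the
  constant by a cube. The condition on \<open>r^3 a\<close> balances the two, while
  \<open>r bar r = 1\<close> preserves the hermitian form.\<close>

lemma hcent_hflip:
  assumes y: "y \<in> carrier A" "bar y = y" "y \<otimes> y = \<one>"
    and r: "r \<in> carrier A" "r \<otimes> bar r = \<one>" "r \<otimes> (r \<otimes> r) \<otimes> a = htwist y a"
  shows "hcent (hflip y r)"
proof (rule hcentI[where h = "\<lambda>(b, x1, x2, x3).
    (htwist y b, htwist y (bar r \<otimes> x1), htwist y (bar r \<otimes> x2), htwist y (bar r \<otimes> x3))"])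
  note tw = htwist_simps[OF y]
  have r': "bar r \<otimes> (r \<otimes> z) = z" "r \<otimes> (bar r \<otimes> z) = z" if "z \<in> carrier A" for z
    using that r by (metis bar_closed l_one m_assoc m_comm)+
  fix x x' assume x: "x \<in> hcar" and x': "x' \<in> hcar"
  from x y r show "(case hflip y r x of (b, x1, x2, x3) \<Rightarrow>
    (htwist y b, htwist y (bar r \<otimes> x1), htwist y (bar r \<otimes> x2), htwist y (bar r \<otimes> x3))) = x"
    by (auto elim!: hcar_cases simp: hflip_def r' tw)
  from x y r show "hflip y r (case x of (b, x1, x2, x3) \<Rightarrow>
    (htwist y b, htwist y (bar r \<otimes> x1), htwist y (bar r \<otimes> x2), htwist y (bar r \<otimes> x3))) = x"
    by (auto elim!: hcar_cases simp: hflip_def r' tw(6))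
  from x y r show "(case x of (b, x1, x2, x3) \<Rightarrow>
    (htwist y b, htwist y (bar r \<otimes> x1), htwist y (bar r \<otimes> x2), htwist y (bar r \<otimes> x3))) \<in> hcar"
    by (auto elim!: hcar_cases)
  from x x' y r show "hflip y r (hadd x x') = hadd (hflip y r x) (hflip y r x')"
    by (auto elim!: hcar_cases simp: hflip_def hadd_def tw r_distr)
  from x y r show "hflip y r (hscale k x) = hscale k (hflip y r x)"
    if "k \<in> carrier A" "bar k = k" for k
    using that by (auto elim!: hcar_cases simp: hflip_def hscale_def tw m_lcomm)
  have sig: "hsig (htwist y x1) (htwist y x2) (htwist y x3) (htwist y y1) (htwist y y2) (htwist y y3)
      = htwist y (hsig x1 x2 x3 y1 y2 y3)"
    if "x1 \<in> carrier A" "x2 \<in> carrier A" "x3 \<in> carrier A" "y1 \<in> carrier A" "y2 \<in> carrier A"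
      "y3 \<in> carrier A" for x1 x2 x3 y1 y2 y3
    using that y by (simp add: hsig_def tw)
  \<comment> \<open>The condition on the cube of \<open>r\<close>, freed of one factor
    \<open>r\<close> by means of \<open>bar r\<close> and then conjugated: the shape in which it
    meets the factor \<open>bar a\<close> of the cross product.\<close>
  have ra: "bar r \<otimes> bar r \<otimes> bar a = r \<otimes> htwist y (bar a)"
  proof -
    have "r \<otimes> (r \<otimes> a) = bar r \<otimes> htwist y a"
      using r by (simp add: r'  m_assoc flip: r(3))
    then have "bar (r \<otimes> (r \<otimes> a)) = bar (bar r \<otimes> htwist y a)" by simp
    then show ?thesis using r y by (simp add: bar_mult tw m_assoc)
  qed
  have cross: "bar r \<otimes> bar r \<otimes> hcross (htwist y x1) (htwist y x2) (htwist y x3)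
      (htwist y y1) (htwist y y2) (htwist y y3) = r \<otimes> htwist y (hcross x1 x2 x3 y1 y2 y3)"
    if "x1 \<in> carrier A" "x2 \<in> carrier A" "x3 \<in> carrier A" "y1 \<in> carrier A" "y2 \<in> carrier A"
      "y3 \<in> carrier A" for x1 x2 x3 y1 y2 y3
  proof -
    define D where "D = (x2 \<otimes> y3 \<ominus> x3 \<otimes> y2) \<oplus>
     ((x2 \<otimes> y3 \<ominus> x3 \<otimes> y2) \<oplus> (x3 \<otimes> y1 \<ominus> x1 \<otimes> y3) \<oplus> (x1 \<otimes> y2 \<ominus> x2 \<otimes> y1))"
    have D: "D \<in> carrier A" using that by (simp add: D_def)
    have 1: "hcross (htwist y x1) (htwist y x2) (htwist y x3)
      (htwist y y1) (htwist y y2) (htwist y y3) = bar a \<otimes> bar (htwist y D)"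
      unfolding D_def hcross_def using that y by (simp only: tw bar_distribs h_closed)
    have 2: "hcross x1 x2 x3 y1 y2 y3 = bar a \<otimes> bar D" by (simp add: D_def hcross_def)
    have "bar r \<otimes> bar r \<otimes> (bar a \<otimes> bar (htwist y D)) = (bar r \<otimes> bar r \<otimes> bar a) \<otimes> htwist y (bar D)"
      using D y r by (simp add: tw m_assoc)
    then show ?thesis using D y r by (simp add: 1 2 ra tw m_assoc)
  qed
  from x x' y r show "hflip y r (hmul x x') = hmul (hflip y r x) (hflip y r x')"
    by (auto elim!: hcar_cases simp: hflip_def hmul_def hsig_semilinear sig cross tw r_distr m_lcomm)
  have "hnorm (hflip y r x) = htwist y (hnorm x)" using x y r
    by (auto elim!: hcar_cases simp: hflip_def hnorm_def hsig_semilinear sig tw)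
  then show "hnorm (hflip y r x) = hnorm x"
    using htwist_simps(7)[OF y _ zero_closed] x by (simp add: bar_hnorm)
  from x y r show "hflip y r (htau x) = htau (hflip y r x)"
    by (auto elim!: hcar_cases simp: hflip_def htau_def)
qed (use y r in simp_all)

end

section \<open>Structure of the centralizer, given an invertible skew element\<close>

locale herm_ring_skew = herm_ring A bar a for A :: "'x ring" (structure) and bar a +
  fixes th th' :: 'x
  assumes th_closed [simp, intro]: "th \<in> carrier A" and th'_closed [simp, intro]: "th' \<in> carrier A"
    and bar_th [simp]: "bar th = \<ominus> th" and th_inv [simp]: "th \<otimes> th' = \<one>"
begin

lemma th_inv' [simp]: "th' \<otimes> th = \<one>" "z \<in> carrier A \<Longrightarrow> th \<otimes> (th' \<otimes> z) = z"
  "z \<in> carrier A \<Longrightarrow> th' \<otimes> (th \<otimes> z) = z"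
  using th_inv by (metis m_comm th'_closed th_closed, metis l_one m_assoc th'_closed th_closed,
      metis l_one m_assoc m_comm th'_closed th_closed)

lemma bar_th' [simp]: "bar th' = \<ominus> th'"
proof -
  have "\<ominus> th \<otimes> bar th' = \<one>" using bar_mult[of th th'] by simp
  then have "th' \<otimes> (\<ominus> th \<otimes> bar th') = th'" by simp
  moreover have "th' \<otimes> (\<ominus> th \<otimes> bar th') = \<ominus> bar th'" by (simp add: l_minus r_minus)
  ultimately show ?thesis by (metis bar_closed minus_minus th'_closed)
qed

lemma th_cancel: "\<lbrakk>x \<otimes> th = y \<otimes> th; x \<in> carrier A; y \<in> carrier A\<rbrakk> \<Longrightarrow> x = y"
  by (metis m_assoc r_one th'_closed th_closed th_inv)

lemma th_decomp:
  assumes "x \<in> carrier A"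
  obtains b c where "b \<in> carrier A" "c \<in> carrier A" "bar b = b" "bar c = c" "x = b \<oplus> c \<otimes> th"
\<comment> \<open>The halves \<open>(x + bar x) / 2\<close> and \<open>(x - bar x) / 2\<close>, with
  \<open>1 / 2 = -1\<close>; dividing the skew half by \<open>th\<close> makes it symmetric.\<close>
proof (rule that[of "\<ominus> (x \<oplus> bar x)" "\<ominus> (x \<ominus> bar x) \<otimes> th'"])
  obtain x' where e: "x = hev x'" using assms hev_surj by blast
  have "\<ominus> (x \<oplus> bar x) \<oplus> \<ominus> (x \<ominus> bar x) = x"
    unfolding e by (simp only: hev_simps) (rule arg_cong[of _ _ hev]; (simp only: herm_expand)?; (simp only: herm_collect)?)
  then show "x = \<ominus> (x \<oplus> bar x) \<oplus> \<ominus> (x \<ominus> bar x) \<otimes> th' \<otimes> th" using assms by (simp add: m_assoc)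
  show "bar (\<ominus> (x \<ominus> bar x) \<otimes> th') = \<ominus> (x \<ominus> bar x) \<otimes> th'" using assms
    by (simp add: bar_mult bar_minus bar_diff) (simp add: l_minus r_minus minus_eq minus_add a_comm l_distr)
qed (use assms in \<open>simp_all add: bar_minus bar_add a_comm\<close>)

definition hK :: "'x \<Rightarrow> 'x cayley" where "hK b = (b, \<zero>, \<zero>, \<zero>)"
definition hU :: "'x \<Rightarrow> 'x cayley" where "hU x = (\<zero>, x, x, x)"

lemma hKU_closed [simp]: "b \<in> carrier A \<Longrightarrow> hK b \<in> hcar" "b \<in> carrier A \<Longrightarrow> hU b \<in> hcar"
  by (simp_all add: hK_def hU_def)

text \<open>On the fixed algebra only a shear remains: the quadratic term and the change of the
  \<open>K\<close>-component involve the coordinate sum \<open>3 x = 0\<close>, and the cross term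
  involves differences of equal coordinates.\<close>

lemma hexp_hK: "\<lbrakk>k \<in> carrier A; b \<in> carrier A; x \<in> carrier A\<rbrakk> \<Longrightarrow>
   hexp k (b, x, x, x) = (b, x \<oplus> k \<otimes> (bar b \<ominus> b), x \<oplus> k \<otimes> (bar b \<ominus> b), x \<oplus> k \<otimes> (bar b \<ominus> b))"
  apply (drule hev_surj)+
  apply (clarsimp)
  apply (simp only: h_defs hev_simps)
  by (intro arg_cong2[of _ _ _ _ Pair] arg_cong[of _ _ hev]; (simp only: herm_expand)?; (simp only: herm_collect)?)

text \<open>Because \<open>bar th - th = - 2 th = th\<close>. An exponential can thus add any
  multiple of \<open>u = w1 + w2 + w3\<close> to \<open>th\<close>, which is how the radical
  component of \<open>g th\<close> is removed later.\<close>

lemma hexp_th: "\<lbrakk>k \<in> carrier A\<rbrakk> \<Longrightarrow> hexp k (hK th) = (th, k \<otimes> th, k \<otimes> th, k \<otimes> th)"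
  unfolding hK_def by (simp add: hexp_hK uminus_add_uminus)

lemma hcent_one:
  assumes "hcent g" shows "g (hK \<one>) = hK \<one>"
proof -
  have 1: "hmul x (hK \<one>) = x" "hmul (hK \<one>) x = x" if "x \<in> hcar" for x
    using that by (auto elim!: hcar_cases simp: hmul_def hK_def hsig_def hcross_def minus_eq)
  obtain x where x: "x \<in> hcar" "g x = hK \<one>"
    using assms unfolding hcent_def bij_betw_def by (metis hKU_closed(1) image_iff one_closed)
  have "g (hK \<one>) = hmul (g (hK \<one>)) (g x)" using 1 assms x by (simp add: hcentD(1))
  also have "\<dots> = g (hmul (hK \<one>) x)" using hcentD(4)[OF assms, of "hK \<one>" x] x by simp
  also have "\<dots> = g x" using 1 x by simp
  finally show ?thesis using x by simp
qed

lemma htau_fixed: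
  assumes "htau x = x" "x \<in> hcar"
  obtains b z where "x = (b, z, z, z)" "b \<in> carrier A" "z \<in> carrier A"
  using assms by (auto elim!: hcar_cases simp: htau_def)

text \<open>The image of \<open>th\<close> is fixed by the shift, and there the norm is that of the
  \<open>K\<close>-component \<open>b\<close>. Preserving the norms of \<open>th\<close> and of
  \<open>\<one> + th\<close> preserves norm and trace, so \<open>b\<close> is skew with
  \<open>b^2 = th^2\<close>, and \<open>y = b / th\<close>.\<close>

lemma hcent_th:
  assumes g: "hcent g"
  obtains y z where "g (hK th) = (y \<otimes> th, z, z, z)" "y \<in> carrier A" "z \<in> carrier A"
    "bar y = y" "y \<otimes> y = \<one>"
proof -
  have "htau (g (hK th)) = g (hK th)" using g by (simp flip: hcentD(6)) (simp add: htau_def hK_def)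
  then obtain b z where bz: "g (hK th) = (b, z, z, z)" "b \<in> carrier A" "z \<in> carrier A"
    using g htau_fixed by (metis hKU_closed(1) hcentD(1) th_closed)
  \<comment> \<open>At \<open>(z, z, z)\<close> the hermitian form is
    \<open>- 6 z bar z = 0\<close>.\<close>
  have nz: "hnorm (c, z, z, z) = c \<otimes> bar c" if c: "c \<in> carrier A" for c
  proof -
    obtain c' z' where e: "c = hev c'" "z = hev z'" using hev_surj[OF c] hev_surj[OF bz(3)] by blast
    show ?thesis unfolding e h_defs by (simp only: hev_simps) (rule arg_cong[of _ _ hev]; (simp only: herm_expand)?; (simp only: herm_collect)?)
  qed
  have n0: "hnorm (hK c) = c \<otimes> bar c" if "c \<in> carrier A" for c
    using that by (simp add: hnorm_def hsig_def hK_def)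
  have 1: "b \<otimes> bar b = th \<otimes> bar th" using hcentD(5)[OF g, of "hK th"] bz by (simp add: nz n0)
  have "g (hadd (hK \<one>) (hK th)) = hadd (hK \<one>) (b, z, z, z)" using g by (simp add: hcentD hcent_one bz)
  then have "g (hK (\<one> \<oplus> th)) = (\<one> \<oplus> b, z, z, z)" using bz by (simp add: hadd_def hK_def)
  then have 2: "(\<one> \<oplus> b) \<otimes> bar (\<one> \<oplus> b) = (\<one> \<oplus> th) \<otimes> bar (\<one> \<oplus> th)"
    using hcentD(5)[OF g, of "hK (\<one> \<oplus> th)"] bz by (simp add: nz n0)
  \<comment> \<open>The trace of \<open>c\<close>, recovered from norms alone.\<close>
  have ident: "c \<oplus> bar c = (\<one> \<oplus> c) \<otimes> bar (\<one> \<oplus> c) \<ominus> c \<otimes> bar c \<ominus> \<one>" if c: "c \<in> carrier A" for c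
  proof -
    obtain c' where e: "c = hev c'" using hev_surj[OF c] by blast
    show ?thesis unfolding e by (simp only: hev_simps) (rule arg_cong[of _ _ hev]; (simp only: herm_expand)?; (simp only: herm_collect)?)
  qed
  have "b \<oplus> bar b = th \<oplus> bar th" unfolding ident[OF bz(2)] ident[OF th_closed] 1 2 ..
  then have "bar b \<oplus> b = \<zero>" using bz(2) by (simp add: a_comm r_neg)
  then have bb: "bar b = \<ominus> b" using bz(2) by (simp add: minus_equality)
  have "\<ominus> (b \<otimes> b) = \<ominus> (th \<otimes> th)" using 1 bz(2) bb by (simp add: r_minus)
  then have b2: "b \<otimes> b = th \<otimes> th" using bz(2) by (metis m_closed minus_minus th_closed)
  show ?thesis
  proof (rule that[of "b \<otimes> th'" z])
    show "b \<otimes> th' \<otimes> (b \<otimes> th') = \<one>"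
    proof -
      have "b \<otimes> th' \<otimes> (b \<otimes> th') = (b \<otimes> b) \<otimes> (th' \<otimes> th')" using bz(2) by (simp add: m_ac)
      then show ?thesis by (simp add: b2 m_assoc)
    qed
  qed (use bz bb in \<open>simp_all add: m_assoc bar_mult l_minus r_minus\<close>)
qed

lemma hcent_fix_K:
  assumes g: "hcent g" and th: "g (hK th) = hK th" and b: "b \<in> carrier A"
  shows "g (hK b) = hK b"
proof -
  obtain c d where cd: "c \<in> carrier A" "d \<in> carrier A" "bar c = c" "bar d = d" "b = c \<oplus> d \<otimes> th"
    by (rule th_decomp[OF b])
  have e: "hK b = hadd (hscale c (hK \<one>)) (hscale d (hK th))"
    using cd by (simp add: hadd_def hscale_def hK_def)
  show ?thesis unfolding e using g cd(1-4) by (simp add: hcentD hcent_one th)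
qed

text \<open>\<open>W\<close> consists of the elements that anticommute with \<open>th\<close>, so
  \<open>g\<close> preserves it. Left multiplication by \<open>K\<close> is part of the product and
  \<open>K\<close> is fixed pointwise, so \<open>g\<close> is \<open>K\<close>-linear on
  \<open>W\<close>; commuting with the shift, it is determined by the image \<open>(p, q, r)\<close>
  of \<open>w1\<close>.\<close>

lemma hcent_circulant:
  assumes g: "hcent g" and th: "g (hK th) = hK th"
  obtains p q r where "p \<in> carrier A" "q \<in> carrier A" "r \<in> carrier A"
    "\<And>x. x \<in> hcar \<Longrightarrow> g x = hcirc p q r x"
proof -
  note K = hcent_fix_K[OF g th]
  have W: "\<exists>y1 y2 y3. g (\<zero>, x1, x2, x3) = (\<zero>, y1, y2, y3) \<and> y1 \<in> carrier A \<and> y2 \<in> carrier A \<and> y3 \<in> carrier A"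
    if x: "x1 \<in> carrier A" "x2 \<in> carrier A" "x3 \<in> carrier A" for x1 x2 x3
  proof -
    obtain c y1 y2 y3 where y: "g (\<zero>, x1, x2, x3) = (c, y1, y2, y3)" "c \<in> carrier A"
      "y1 \<in> carrier A" "y2 \<in> carrier A" "y3 \<in> carrier A"
      using hcentD(1)[OF g, of "(\<zero>, x1, x2, x3)"] x by (auto elim: hcar_cases)
    have "hadd (hmul (\<zero>, x1, x2, x3) (hK th)) (hmul (hK th) (\<zero>, x1, x2, x3)) = hK \<zero>"
      using x by (simp add: hmul_def hK_def hadd_def hsig_def hcross_def minus_eq l_minus l_neg)
    then have "g (hadd (hmul (\<zero>, x1, x2, x3) (hK th)) (hmul (hK th) (\<zero>, x1, x2, x3))) = hK \<zero>"
      by (simp add: K)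
    then have "hadd (hmul (c, y1, y2, y3) (hK th)) (hmul (hK th) (c, y1, y2, y3)) = hK \<zero>"
      using x g by (simp add: hcentD y th)
    \<comment> \<open>The \<open>K\<close>-component contributes \<open>2 c th = - c th\<close> to
      the anticommutator, and \<open>th\<close> is invertible.\<close>
    then have "c \<otimes> th \<oplus> th \<otimes> c = \<zero>" using y(2-5) by (simp add: hmul_def hK_def hadd_def hsig_def minus_eq)
    then have "\<ominus> c \<otimes> th = \<zero> \<otimes> th" using y(2) add_three[of "c \<otimes> th"] by (simp add: m_comm[of th] l_minus)
    then have "c = \<zero>" using y(2) th_cancel by (metis a_inv_closed minus_minus minus_zero zero_closed)
    then show ?thesis using y by blast
  qed
  obtain p q r where p: "g (\<zero>, \<one>, \<zero>, \<zero>) = (\<zero>, p, q, r)" "p \<in> carrier A" "q \<in> carrier A" "r \<in> carrier A"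
    using W[of \<one> \<zero> \<zero>] by auto
  have p2: "g (\<zero>, \<zero>, \<one>, \<zero>) = (\<zero>, r, p, q)"
    using hcentD(6)[OF g, of "(\<zero>, \<one>, \<zero>, \<zero>)"] p by (simp add: htau_def)
  have p3: "g (\<zero>, \<zero>, \<zero>, \<one>) = (\<zero>, q, r, p)"
    using hcentD(6)[OF g, of "(\<zero>, \<zero>, \<one>, \<zero>)"] p2 by (simp add: htau_def)
  have KW: "hmul (hK c) (\<zero>, y1, y2, y3) = (\<zero>, c \<otimes> y1, c \<otimes> y2, c \<otimes> y3)"
    if "c \<in> carrier A" "y1 \<in> carrier A" "y2 \<in> carrier A" "y3 \<in> carrier A" for c y1 y2 y3
    using that by (simp add: hmul_def hK_def hsig_def hcross_def minus_eq)
  have "g x = hcirc p q r x" if "x \<in> hcar" for x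
  proof -
    obtain b x1 x2 x3 where x: "x = (b, x1, x2, x3)" "b \<in> carrier A" "x1 \<in> carrier A"
      "x2 \<in> carrier A" "x3 \<in> carrier A" by (rule hcar_cases[OF \<open>x \<in> hcar\<close>])
    have e: "x = hadd (hK b) (hadd (hmul (hK x1) (\<zero>, \<one>, \<zero>, \<zero>)) (hadd (hmul (hK x2) (\<zero>, \<zero>, \<one>, \<zero>))
       (hmul (hK x3) (\<zero>, \<zero>, \<zero>, \<one>))))"
      using x by (simp add: KW) (simp add: hadd_def hK_def)
    have "g x = hadd (hK b) (hadd (hmul (hK x1) (\<zero>, p, q, r)) (hadd (hmul (hK x2) (\<zero>, r, p, q))
       (hmul (hK x3) (\<zero>, q, r, p))))"
      unfolding e using x(2-5) g by (simp add: hcentD K p p2 p3)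
    then show ?thesis using x p(2-4) by (simp add: KW) (simp add: hadd_def hK_def hcirc_def m_comm a_assoc)
  qed
  then show ?thesis using p that by blast
qed

lemma bar_a_cancel: "\<lbrakk>bar a \<otimes> x = bar a \<otimes> y; x \<in> carrier A; y \<in> carrier A\<rbrakk> \<Longrightarrow> x = y"
  by (metis a_closed a_norm bar_closed l_one m_assoc)

text \<open>Here \<open>d\<close> is the eigenvalue of the circulant on
  \<open>u = w1 + w2 + w3\<close>. Two products suffice:
  \<open>u w1 = - 1 + bar a (w2 - w3)\<close>, whose \<open>K\<close>-component yields
  \<open>d bar d = 1\<close> and whose first \<open>W\<close>-coordinate yields the relation for
  \<open>r - q\<close>; and \<open>u (w2 - w1) = - bar a u\<close>, which yields
  \<open>(bar d)^2 = d\<close>.\<close>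

lemma hcirc_hcent_relations:
  assumes p: "p \<in> carrier A" "q \<in> carrier A" "r \<in> carrier A" and g: "hcent (hcirc p q r)"
  defines "d \<equiv> p \<oplus> q \<oplus> r"
  shows "d \<otimes> bar d = \<one>" "bar d \<otimes> bar d = d" "bar d \<otimes> bar (r \<ominus> q) = r \<ominus> q"
proof -
  obtain p' q' r' where e: "p = hev p'" "q = hev q'" "r = hev r'"
    using hev_surj[OF p(1)] hev_surj[OF p(2)] hev_surj[OF p(3)] by blast
  have d: "d \<in> carrier A" using p by (simp add: d_def)
  have 1: "hcirc p q r (hmul (\<zero>, \<one>, \<one>, \<one>) (\<zero>, \<one>, \<zero>, \<zero>)) =
      hmul (hcirc p q r (\<zero>, \<one>, \<one>, \<one>)) (hcirc p q r (\<zero>, \<one>, \<zero>, \<zero>))"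
    by (rule hcentD(4)[OF g]) simp_all
  have "fst (hcirc p q r (hmul (\<zero>, \<one>, \<one>, \<one>) (\<zero>, \<one>, \<zero>, \<zero>))) = \<ominus> \<one>"
    unfolding e h_defs fst_conv by (simp only: hev_simps) (rule arg_cong[of _ _ hev]; (simp only: herm_expand)?; (simp only: herm_collect)?)
  moreover have "fst (hmul (hcirc p q r (\<zero>, \<one>, \<one>, \<one>)) (hcirc p q r (\<zero>, \<one>, \<zero>, \<zero>))) = \<ominus> (d \<otimes> bar d)"
    unfolding d_def e h_defs fst_conv by (simp only: hev_simps) (rule arg_cong[of _ _ hev]; (simp only: herm_expand)?; (simp only: herm_collect)?)
  ultimately have "\<ominus> (d \<otimes> bar d) = \<ominus> \<one>" using 1 by simp
  then show "d \<otimes> bar d = \<one>" using d by (metis bar_closed m_closed minus_minus one_closed)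
  have "fst (snd (hcirc p q r (hmul (\<zero>, \<one>, \<one>, \<one>) (\<zero>, \<one>, \<zero>, \<zero>)))) = bar a \<otimes> (r \<ominus> q)"
    unfolding e h_defs fst_conv snd_conv by (simp only: hev_simps) (rule arg_cong[of _ _ hev]; (simp only: herm_expand)?; (simp only: herm_collect)?)
  moreover have "fst (snd (hmul (hcirc p q r (\<zero>, \<one>, \<one>, \<one>)) (hcirc p q r (\<zero>, \<one>, \<zero>, \<zero>)))) =
      bar a \<otimes> (bar d \<otimes> bar (r \<ominus> q))"
    unfolding d_def e h_defs fst_conv snd_conv by (simp only: hev_simps) (rule arg_cong[of _ _ hev]; (simp only: herm_expand)?; (simp only: herm_collect)?)
  ultimately have "bar a \<otimes> (bar d \<otimes> bar (r \<ominus> q)) = bar a \<otimes> (r \<ominus> q)" using 1 by metis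
  then show "bar d \<otimes> bar (r \<ominus> q) = r \<ominus> q" by (rule bar_a_cancel) (use d p in simp_all)
  have 2: "hcirc p q r (hmul (\<zero>, \<one>, \<one>, \<one>) (\<zero>, \<ominus> \<one>, \<one>, \<zero>)) =
      hmul (hcirc p q r (\<zero>, \<one>, \<one>, \<one>)) (hcirc p q r (\<zero>, \<ominus> \<one>, \<one>, \<zero>))"
    by (rule hcentD(4)[OF g]) simp_all
  have "fst (snd (hcirc p q r (hmul (\<zero>, \<one>, \<one>, \<one>) (\<zero>, \<ominus> \<one>, \<one>, \<zero>)))) = bar a \<otimes> \<ominus> d"
    unfolding d_def e h_defs fst_conv snd_conv by (simp only: hev_simps) (rule arg_cong[of _ _ hev]; (simp only: herm_expand)?; (simp only: herm_collect)?)
  moreover have "fst (snd (hmul (hcirc p q r (\<zero>, \<one>, \<one>, \<one>)) (hcirc p q r (\<zero>, \<ominus> \<one>, \<one>, \<zero>)))) =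
      bar a \<otimes> \<ominus> (bar d \<otimes> bar d)"
    unfolding d_def e h_defs fst_conv snd_conv by (simp only: hev_simps) (rule arg_cong[of _ _ hev]; (simp only: herm_expand)?; (simp only: herm_collect)?)
  ultimately have "bar a \<otimes> \<ominus> (bar d \<otimes> bar d) = bar a \<otimes> \<ominus> d" using 2 by metis
  then have "\<ominus> (bar d \<otimes> bar d) = \<ominus> d" by (rule bar_a_cancel) (use d in simp_all)
  then show "bar d \<otimes> bar d = d" using d by (metis bar_closed m_closed minus_minus)
qed

text \<open>The factors are split off from the left: \<open>hexp k\<close> accounts for the radical
  part of \<open>g th\<close>, the eigenvalue on \<open>w1 + w2 + w3\<close> for
  \<open>hmu r\<close>, and what remains is a circulant with coefficient sum 1, hence
  unipotent.\<close>

lemma hcent_structure: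
  assumes g: "hcent g" and z: "g (hK th) = (th, z, z, z)" "z \<in> carrier A"
  obtains k r s q where "k \<in> carrier A" "r \<in> carrier A" "s \<in> carrier A" "q \<in> carrier A"
    "r \<otimes> (r \<otimes> r) = \<one>" "r \<otimes> bar r = \<one>" "bar s = s" "bar q = \<ominus> q"
    "\<And>x. x \<in> hcar \<Longrightarrow> g x = hexp k (hmu r (hnil s q x))"
proof -
  \<comment> \<open>Chosen so that \<open>hexp k\<close> and \<open>g\<close> agree at
    \<open>th\<close>.\<close>
  define k where "k = z \<otimes> th'"
  have k: "k \<in> carrier A" using z by (simp add: k_def)
  define h where "h = (\<lambda>x. hexp (\<ominus> k) (g x))"
  have h: "hcent h" unfolding h_def using k by (simp add: hcent_compose[OF hcent_hexp g])
  have "(th, z, z, z) = hexp k (hK th)" using z by (simp add: hexp_th k_def m_assoc)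
  then have hth: "h (hK th) = hK th" using k by (simp add: h_def z hexp_exp l_neg hexp_zero)
  obtain p q r where p: "p \<in> carrier A" "q \<in> carrier A" "r \<in> carrier A"
    and hc: "\<And>x. x \<in> hcar \<Longrightarrow> h x = hcirc p q r x"
    using hcent_circulant[OF h hth] by blast
  define d where "d = p \<oplus> q \<oplus> r"
  have d: "d \<in> carrier A" using p by (simp add: d_def)
  note rel = hcirc_hcent_relations[OF p hcent_cong[OF h hc], folded d_def]
  have d3: "d \<otimes> (d \<otimes> d) = \<one>"
  proof -
    have "d \<otimes> (d \<otimes> d) = (d \<otimes> (bar d \<otimes> bar d)) \<otimes> d" using rel(2) d by (simp add: m_ac)
    also have "\<dots> = (d \<otimes> bar d) \<otimes> (d \<otimes> bar d)" using d by (simp add: m_ac)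
    finally show ?thesis using rel(1) by simp
  qed
  have "bar d \<otimes> d = \<one>" using rel(1) d m_comm by simp
  then have bd: "bar d \<in> carrier A" "bar d \<otimes> (bar d \<otimes> bar d) = \<one>" "bar d \<otimes> bar (bar d) = \<one>"
    using d rel(2) by simp_all
  define n where "n = (\<lambda>x. hmu (bar d) (h x))"
  have n: "hcent n" unfolding n_def by (rule hcent_compose[OF hcent_hmu[OF bd] h])
  \<comment> \<open>A circulant \<open>p + q \<tau> + r \<tau>^2\<close> with coefficient sum 1
    equals \<open>1 + s (\<tau> - 1) + t (\<tau> - 1)^2\<close> for \<open>t = r\<close> and
    \<open>s = q - r\<close>; here all coefficients carry the factor \<open>bar d\<close>.\<close>
  define t where "t = bar d \<otimes> r"
  define s where "s = bar d \<otimes> (q \<ominus> r)"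
  \<comment> \<open>Solves \<open>t = s - s^2 + u\<close>, the parametrization used by
    \<open>hnil\<close>.\<close>
  define u where "u = t \<ominus> s \<oplus> s \<otimes> s"
  have st: "s \<in> carrier A" "t \<in> carrier A" "u \<in> carrier A" using p d by (simp_all add: s_def t_def u_def)
  have sbar: "bar s = s"
  proof -
    have "d \<otimes> d = bar d" using cube_root_of_unity(1)[OF d d3 rel(1)] .
    have qr: "q \<ominus> r = \<ominus> (r \<ominus> q)" using p by (simp add: minus_eq minus_add a_comm)
    have 1: "bar d \<otimes> bar (q \<ominus> r) = q \<ominus> r"
      unfolding qr using rel(3) p d by (simp add: bar_minus r_minus)
    have "bar s = (d \<otimes> d) \<otimes> (bar d \<otimes> bar (q \<ominus> r))"
    proof -
      have "(d \<otimes> d) \<otimes> (bar d \<otimes> bar (q \<ominus> r)) = (d \<otimes> bar d) \<otimes> (d \<otimes> bar (q \<ominus> r))"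
        using p d by (simp add: m_ac)
      then show ?thesis using p d rel(1) by (simp add: s_def bar_mult)
    qed
    then show ?thesis by (simp add: 1 \<open>d \<otimes> d = bar d\<close> s_def)
  qed
  have dp: "bar d \<otimes> q = s \<oplus> t" "bar d \<otimes> p = \<one> \<ominus> s \<oplus> t"
  proof -
    obtain p' q' r' where e: "p = hev p'" "q = hev q'" "r = hev r'"
      using hev_surj[OF p(1)] hev_surj[OF p(2)] hev_surj[OF p(3)] by blast
    show "bar d \<otimes> q = s \<oplus> t"
      unfolding s_def t_def d_def e by (simp only: hev_simps) (rule arg_cong[of _ _ hev]; (simp only: herm_expand)?; (simp only: herm_collect)?)
    have "bar d \<otimes> p = d \<otimes> bar d \<ominus> s \<oplus> t"
      unfolding s_def t_def d_def e by (simp only: hev_simps) (rule arg_cong[of _ _ hev]; (simp only: herm_expand)?; (simp only: herm_collect)?)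
    then show "bar d \<otimes> p = \<one> \<ominus> s \<oplus> t" using rel(1) by simp
  qed
  have nx: "n x = hcirc (\<one> \<ominus> s \<oplus> t) (s \<oplus> t) t x" if "x \<in> hcar" for x
    using that p d unfolding n_def
    by (auto elim!: hcar_cases simp: hc hmu_def hcirc_def r_distr simp flip: dp t_def m_assoc)
  have coeffs: "\<one> \<ominus> s \<otimes> s \<oplus> u = \<one> \<ominus> s \<oplus> t" "u \<ominus> s \<ominus> s \<otimes> s = s \<oplus> t" "s \<ominus> s \<otimes> s \<oplus> u = t"
  proof -
    obtain s' t' where e: "s = hev s'" "t = hev t'" using hev_surj st by blast
    show "\<one> \<ominus> s \<otimes> s \<oplus> u = \<one> \<ominus> s \<oplus> t" "u \<ominus> s \<ominus> s \<otimes> s = s \<oplus> t" "s \<ominus> s \<otimes> s \<oplus> u = t"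
      unfolding u_def e by (simp only: hev_simps, (rule arg_cong[of _ _ hev]; (simp only: herm_expand)?; (simp only: herm_collect)?))+
  qed
  have nn: "n x = hnil s u x" if "x \<in> hcar" for x
    using nx[OF that] by (simp only: hnil_def coeffs)
  have "bar u = \<ominus> u"
  proof -
    \<comment> \<open>The vector \<open>w1\<close> is isotropic, and so is its image under
      \<open>n\<close>; this is precisely the skewness of \<open>u\<close>.\<close>
    have "hnorm (n (\<zero>, \<one>, \<zero>, \<zero>)) = hnorm (\<zero>, \<one>, \<zero>, \<zero>)" using n by (simp add: hcentD)
    then have 0: "hnorm (\<zero>, \<one> \<ominus> s \<oplus> t, s \<oplus> t, t) = \<zero>"
      using st by (simp add: nx) (simp add: hcirc_def hnorm_def hsig_def)
    have "hnorm (\<zero>, \<one> \<ominus> s \<oplus> t, s \<oplus> t, t) = t \<oplus> bar t \<oplus> s \<ominus> s \<otimes> s"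
    proof -
      obtain s' t' where e: "s = hev s'" "t = hev t'" using hev_surj st by blast
      show ?thesis unfolding h_defs
        by (simp only: bar_distribs sbar st, simp only: e hev_simps) (rule arg_cong[of _ _ hev]; (simp only: herm_expand)?; (simp only: herm_collect)?)
    qed
    moreover have "bar u \<oplus> u = t \<oplus> bar t \<oplus> s \<ominus> s \<otimes> s"
    proof -
      obtain s' t' where e: "s = hev s'" "t = hev t'" using hev_surj st by blast
      show ?thesis unfolding u_def
        by (simp only: bar_distribs sbar st, simp only: e hev_simps) (rule arg_cong[of _ _ hev]; (simp only: herm_expand)?; (simp only: herm_collect)?)
    qed
    ultimately have "bar u \<oplus> u = \<zero>" using 0 by simp
    then show ?thesis using st by (simp add: minus_equality)
  qed
  moreover have "g x = hexp k (hmu d (hnil s u x))" if "x \<in> hcar" for x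
  proof -
    have hx: "h x \<in> hcar" using hcentD(1)[OF h that] .
    have "hmu d (hnil s u x) = h x" using that hx d rel(1) by (simp flip: nn) (simp add: n_def hmu_simps)
    then show ?thesis using that g k by (simp add: h_def hexp_exp r_neg hexp_zero hcentD)
  qed
  ultimately show ?thesis using that[of k d s u] k d st d3 rel(1) sbar by blast
qed

end

section \<open>Extension of scalars\<close>

locale comm_alg_over = fixes R :: "('f::field, 'u) module" (structure)
  assumes comm_alg: "comm_alg R"
begin

sublocale cring R
  using comm_alg algebra.M_cring by blast

lemma smult_simps [simp]:
  "x \<in> carrier R \<Longrightarrow> c \<odot> x \<in> carrier R"
  "x \<in> carrier R \<Longrightarrow> (1::'f) \<odot> x = x"
  "x \<in> carrier R \<Longrightarrow> (0::'f) \<odot> x = \<zero>"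
  "c \<odot> \<zero> = \<zero>"
proof -
  interpret algebra "ring_of_type_algebra :: 'f ring" R by (rule comm_alg)
  show "x \<in> carrier R \<Longrightarrow> c \<odot> x \<in> carrier R" "x \<in> carrier R \<Longrightarrow> (1::'f) \<odot> x = x"
    "x \<in> carrier R \<Longrightarrow> (0::'f) \<odot> x = \<zero>" "c \<odot> \<zero> = \<zero>"
    using smult_closed[of c x] smult_one[of x] smult_l_null[of x] smult_r_null[of c]
    by (simp_all add: ring_of_type_algebra_def)
qed

lemma smult_distrib':
  "x \<in> carrier R \<Longrightarrow> (c + d) \<odot> x = c \<odot> x \<oplus> d \<odot> x"
  "\<lbrakk>x \<in> carrier R; y \<in> carrier R\<rbrakk> \<Longrightarrow> c \<odot> (x \<oplus> y) = c \<odot> x \<oplus> c \<odot> y"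
  "x \<in> carrier R \<Longrightarrow> (c * d) \<odot> x = c \<odot> (d \<odot> x)"
  "\<lbrakk>x \<in> carrier R; y \<in> carrier R\<rbrakk> \<Longrightarrow> (c \<odot> x) \<otimes> y = c \<odot> (x \<otimes> y)"
proof -
  interpret algebra "ring_of_type_algebra :: 'f ring" R by (rule comm_alg)
  show "x \<in> carrier R \<Longrightarrow> (c + d) \<odot> x = c \<odot> x \<oplus> d \<odot> x"
    "\<lbrakk>x \<in> carrier R; y \<in> carrier R\<rbrakk> \<Longrightarrow> c \<odot> (x \<oplus> y) = c \<odot> x \<oplus> c \<odot> y"
    "x \<in> carrier R \<Longrightarrow> (c * d) \<odot> x = c \<odot> (d \<odot> x)"
    "\<lbrakk>x \<in> carrier R; y \<in> carrier R\<rbrakk> \<Longrightarrow> (c \<odot> x) \<otimes> y = c \<odot> (x \<otimes> y)"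
    using smult_l_distr[of c d x] smult_r_distr[of c x y] smult_assoc1[of c d x] smult_assoc2[of c]
    by (simp_all add: ring_of_type_algebra_def)
qed

lemma smult_right: "\<lbrakk>x \<in> carrier R; y \<in> carrier R\<rbrakk> \<Longrightarrow> x \<otimes> (c \<odot> y) = c \<odot> (x \<otimes> y)"
  using smult_distrib'(4)[of y x c] by (simp add: m_comm)

lemmas smult_distrib = smult_distrib' smult_right

lemma smult_uminus: "x \<in> carrier R \<Longrightarrow> (- c) \<odot> x = \<ominus> (c \<odot> x)"
  using smult_distrib(1)[of x "- c" c] by (simp add: minus_equality)

end

section \<open>Coordinates with respect to a finite basis\<close>

locale fin_basis = vector_space s for s :: "'f::field \<Rightarrow> 'v \<Rightarrow> 'v::ab_group_add" +
  fixes B :: "'v set"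
  assumes finite_basis [simp, intro]: "finite B" and indep: "independent B" and spanning: "span B = UNIV"
begin

lemma repr_add: "representation B (v + w) b = representation B v b + representation B w b"
  using representation_add[OF indep, of w v] spanning by (auto simp: fun_eq_iff)

lemma repr_scale: "representation B (s c v) b = c * representation B v b"
  using representation_scale[OF indep, of v c] spanning by (auto simp: fun_eq_iff)

lemma repr_basis: "b \<in> B \<Longrightarrow> representation B b c = (if c = b then 1 else 0)"
  using representation_basis[OF indep] by simp

lemma repr_eqI:
  assumes "\<And>b. b \<in> B \<Longrightarrow> representation B v b = representation B w b"
  shows "v = w"
proof -
  have sum: "(\<Sum>b\<in>B. s (representation B u b) b) = u" for u
    by (rule sum_representation_eq) (simp_all add: indep spanning)
  have "v = (\<Sum>b\<in>B. s (representation B v b) b)" by (simp only: sum)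
  also have "\<dots> = (\<Sum>b\<in>B. s (representation B w b) b)" by (intro sum.cong) (simp_all add: assms)
  finally show ?thesis by (simp only: sum)
qed

lemma basis_induct [case_names zero step]:
  assumes "P 0" "\<And>c b v. b \<in> B \<Longrightarrow> P v \<Longrightarrow> P (s c b + v)"
  shows "P v"
  using span_induct_alt[of v B P] assms spanning by auto

end

locale ext_space = V: fin_basis s B + comm_alg_over R
  for s :: "'f::field \<Rightarrow> 'v \<Rightarrow> 'v::ab_group_add" and B and R :: "('f, 'u) module" (structure)
begin

abbreviation "VR \<equiv> ext_carrier B R"
abbreviation "add_ext \<equiv> ext_add B R"
abbreviation "scale_ext \<equiv> ext_scale B R"

definition ext_zero :: "'v \<Rightarrow> 'u" where "ext_zero = (\<lambda>b \<in> B. \<zero>)"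
definition pt :: "'v \<Rightarrow> 'v \<Rightarrow> 'u" where "pt v = pure_tensor s B R v \<one>"

lemma extD [simp]: "x \<in> VR \<Longrightarrow> b \<in> B \<Longrightarrow> x b \<in> carrier R"
  by (auto simp: ext_carrier_def)

lemma ext_eqI: "x \<in> VR \<Longrightarrow> y \<in> VR \<Longrightarrow> (\<And>b. b \<in> B \<Longrightarrow> x b = y b) \<Longrightarrow> x = y"
  by (auto simp: ext_carrier_def intro: PiE_ext)

lemma ext_closed [simp]:
  "x \<in> VR \<Longrightarrow> y \<in> VR \<Longrightarrow> add_ext x y \<in> VR"
  "r \<in> carrier R \<Longrightarrow> x \<in> VR \<Longrightarrow> scale_ext r x \<in> VR"
  "ext_zero \<in> VR" "pt v \<in> VR"
  "x \<in> VR \<Longrightarrow> y \<in> VR \<Longrightarrow> ext_diff B R x y \<in> VR"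
  by (auto simp: ext_carrier_def ext_add_def ext_scale_def ext_zero_def pt_def pure_tensor_def ext_diff_def)

lemma pt_basis: "b \<in> B \<Longrightarrow> pt b = (\<lambda>c \<in> B. if c = b then \<one> else \<zero>)"
  by (auto simp: pt_def pure_tensor_def V.repr_basis)

lemma pt_add: "pt (v + w) = add_ext (pt v) (pt w)"
  by (auto simp: pt_def pure_tensor_def ext_add_def V.repr_add smult_distrib)

lemma pt_scale: "pt (s c v) = scale_ext (c \<odot> \<one>) (pt v)"
  unfolding pt_def pure_tensor_def ext_scale_def
  by (intro restrict_ext) (simp add: V.repr_scale smult_distrib'(3,4))

lemma pt_zero: "pt 0 = ext_zero"
  by (auto simp: pt_def pure_tensor_def ext_zero_def V.representation_zero)

lemma pure_tensor_eq: "r \<in> carrier R \<Longrightarrow> pure_tensor s B R v r = scale_ext r (pt v)"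
  unfolding pt_def pure_tensor_def ext_scale_def
  by (intro restrict_ext) (simp add: smult_distrib)

lemma scale_zero: "x \<in> VR \<Longrightarrow> scale_ext \<zero> x = ext_zero" "r \<in> carrier R \<Longrightarrow> scale_ext r ext_zero = ext_zero"
  by (rule ext_eqI, simp, simp, simp add: ext_scale_def ext_zero_def)+

lemma add_zero: "x \<in> VR \<Longrightarrow> add_ext x ext_zero = x" "x \<in> VR \<Longrightarrow> add_ext ext_zero x = x"
  by (rule ext_eqI, simp, simp, simp add: ext_add_def ext_zero_def)+

text \<open>Every \<open>x\<close> is the sum of the tensors \<open>b \<otimes> 1\<close> with
  coefficients \<open>x b\<close>. By this induction an identity between multilinear maps over
  \<open>R\<close> needs to be checked on basis vectors only.\<close>

lemma ext_induct [consumes 1, case_names add scale zero basis]: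
  assumes x: "x \<in> VR"
    and add: "\<And>x y. \<lbrakk>x \<in> VR; y \<in> VR; P x; P y\<rbrakk> \<Longrightarrow> P (add_ext x y)"
    and scale: "\<And>r x. \<lbrakk>r \<in> carrier R; x \<in> VR; P x\<rbrakk> \<Longrightarrow> P (scale_ext r x)"
    and zero: "P ext_zero"
    and basis: "\<And>b. b \<in> B \<Longrightarrow> P (pt b)"
  shows "P x"
proof -
  \<comment> \<open>The partial sum of \<open>x\<close> over a set \<open>D\<close> of basis
    vectors, padded by zero.\<close>
  have P: "P (\<lambda>b \<in> B. if b \<in> D then x b else \<zero>)" if "D \<subseteq> B" for D
    using finite_subset[OF that V.finite_basis] that
  proof (induction D rule: finite_induct)
    case empty
    then show ?case using zero by (simp add: ext_zero_def restrict_def)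
  next
    case (insert d D)
    have eq: "(\<lambda>b \<in> B. if b \<in> insert d D then x b else \<zero>) =
        add_ext (scale_ext (x d) (pt d)) (\<lambda>b \<in> B. if b \<in> D then x b else \<zero>)"
      using insert x by (auto simp: ext_add_def ext_scale_def pt_basis)
    have Y: "(\<lambda>b \<in> B. if b \<in> D then x b else \<zero>) \<in> VR" using x by (auto simp: ext_carrier_def)
    have PY: "P (\<lambda>b \<in> B. if b \<in> D then x b else \<zero>)" by (rule insert.IH) (use insert.prems in simp)
    show ?case unfolding eq
      by (rule add[OF _ Y _ PY]) (use insert.prems x in \<open>auto intro: scale basis\<close>)
  qed
  have "(\<lambda>b \<in> B. if b \<in> B then x b else \<zero>) = x"
    using x by (intro ext_eqI) (auto simp: ext_carrier_def PiE_iff)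
  with P[of B] show ?thesis by (simp only:)
qed

lemma bil_closed [simp]:
  "\<lbrakk>x \<in> ext_carrier B1 R; y \<in> ext_carrier B2 R\<rbrakk> \<Longrightarrow> ext_bilinear B1 B2 s B R m x y \<in> VR"
  unfolding ext_bilinear_def ext_carrier_def by (auto intro!: finsum_closed simp: PiE_iff)

lemma bil_add_left:
  assumes "x \<in> ext_carrier B1 R" "x' \<in> ext_carrier B1 R" "y \<in> ext_carrier B2 R"
  shows "ext_bilinear B1 B2 s B R m (ext_add B1 R x x') y =
    add_ext (ext_bilinear B1 B2 s B R m x y) (ext_bilinear B1 B2 s B R m x' y)"
proof -
  have "finsum R (\<lambda>(b1, b2). coord s B (m b1 b2) c \<odot> (ext_add B1 R x x' b1 \<otimes> y b2)) (B1 \<times> B2) =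
    finsum R (\<lambda>z. (case z of (b1, b2) \<Rightarrow> coord s B (m b1 b2) c \<odot> (x b1 \<otimes> y b2)) \<oplus>
      (case z of (b1, b2) \<Rightarrow> coord s B (m b1 b2) c \<odot> (x' b1 \<otimes> y b2))) (B1 \<times> B2)" for c
    using assms by (intro finsum_cong')
      (auto simp: ext_add_def ext_carrier_def PiE_iff l_distr smult_distrib)
  also have "\<dots> c = finsum R (\<lambda>(b1, b2). coord s B (m b1 b2) c \<odot> (x b1 \<otimes> y b2)) (B1 \<times> B2) \<oplus>
    finsum R (\<lambda>(b1, b2). coord s B (m b1 b2) c \<odot> (x' b1 \<otimes> y b2)) (B1 \<times> B2)" for c
    using assms by (intro finsum_addf) (auto simp: ext_carrier_def PiE_iff)
  finally show ?thesis unfolding ext_bilinear_def ext_add_def[of B] by (intro restrict_ext) simp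
qed

lemma bil_add_right:
  assumes "y \<in> ext_carrier B2 R" "y' \<in> ext_carrier B2 R" "x \<in> ext_carrier B1 R"
  shows "ext_bilinear B1 B2 s B R m x (ext_add B2 R y y') =
    add_ext (ext_bilinear B1 B2 s B R m x y) (ext_bilinear B1 B2 s B R m x y')"
proof -
  have "finsum R (\<lambda>(b1, b2). coord s B (m b1 b2) c \<odot> (x b1 \<otimes> ext_add B2 R y y' b2)) (B1 \<times> B2) =
    finsum R (\<lambda>z. (case z of (b1, b2) \<Rightarrow> coord s B (m b1 b2) c \<odot> (x b1 \<otimes> y b2)) \<oplus>
      (case z of (b1, b2) \<Rightarrow> coord s B (m b1 b2) c \<odot> (x b1 \<otimes> y' b2))) (B1 \<times> B2)" for c
    using assms by (intro finsum_cong')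
      (auto simp: ext_add_def ext_carrier_def PiE_iff r_distr smult_distrib)
  also have "\<dots> c = finsum R (\<lambda>(b1, b2). coord s B (m b1 b2) c \<odot> (x b1 \<otimes> y b2)) (B1 \<times> B2) \<oplus>
    finsum R (\<lambda>(b1, b2). coord s B (m b1 b2) c \<odot> (x b1 \<otimes> y' b2)) (B1 \<times> B2)" for c
    using assms by (intro finsum_addf) (auto simp: ext_carrier_def PiE_iff)
  finally show ?thesis unfolding ext_bilinear_def ext_add_def[of B] by (intro restrict_ext) simp
qed

lemma bil_scale:
  assumes "finite B1" "finite B2" "x \<in> ext_carrier B1 R" "r \<in> carrier R" "y \<in> ext_carrier B2 R"
  shows "ext_bilinear B1 B2 s B R m (ext_scale B1 R r x) y = scale_ext r (ext_bilinear B1 B2 s B R m x y)"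
    and "ext_bilinear B1 B2 s B R m x (ext_scale B2 R r y) = scale_ext r (ext_bilinear B1 B2 s B R m x y)"
proof -
  have 1: "r \<otimes> finsum R (\<lambda>(b1, b2). coord s B (m b1 b2) c \<odot> (x b1 \<otimes> y b2)) (B1 \<times> B2) =
    finsum R (\<lambda>z. r \<otimes> (case z of (b1, b2) \<Rightarrow> coord s B (m b1 b2) c \<odot> (x b1 \<otimes> y b2))) (B1 \<times> B2)" for c
    using assms by (intro finsum_rdistr) (auto simp: ext_carrier_def PiE_iff)
  have "finsum R (\<lambda>(b1, b2). coord s B (m b1 b2) c \<odot> (ext_scale B1 R r x b1 \<otimes> y b2)) (B1 \<times> B2) =
    finsum R (\<lambda>z. r \<otimes> (case z of (b1, b2) \<Rightarrow> coord s B (m b1 b2) c \<odot> (x b1 \<otimes> y b2))) (B1 \<times> B2)" for c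
    using assms by (intro finsum_cong') (auto simp: ext_scale_def ext_carrier_def PiE_iff m_assoc smult_distrib)
  then show "ext_bilinear B1 B2 s B R m (ext_scale B1 R r x) y = scale_ext r (ext_bilinear B1 B2 s B R m x y)"
    unfolding ext_bilinear_def ext_scale_def[of B] by (intro restrict_ext) (simp add: 1)
  have "finsum R (\<lambda>(b1, b2). coord s B (m b1 b2) c \<odot> (x b1 \<otimes> ext_scale B2 R r y b2)) (B1 \<times> B2) =
    finsum R (\<lambda>z. r \<otimes> (case z of (b1, b2) \<Rightarrow> coord s B (m b1 b2) c \<odot> (x b1 \<otimes> y b2))) (B1 \<times> B2)" for c
    using assms by (intro finsum_cong') (auto simp: ext_scale_def ext_carrier_def PiE_iff m_lcomm smult_distrib)
  then show "ext_bilinear B1 B2 s B R m x (ext_scale B2 R r y) = scale_ext r (ext_bilinear B1 B2 s B R m x y)"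
    unfolding ext_bilinear_def ext_scale_def[of B] by (intro restrict_ext) (simp add: 1)
qed

text \<open>The Kronecker families stand for the tensors \<open>b1 \<otimes> 1\<close> and
  \<open>b2 \<otimes> 1\<close>; only the basis of the target space is fixed by the locale.\<close>

lemma bil_pt_basis:
  assumes "finite B1" "finite B2" "b1 \<in> B1" "b2 \<in> B2"
  shows "ext_bilinear B1 B2 s B R m (\<lambda>c \<in> B1. if c = b1 then \<one> else \<zero>) (\<lambda>c \<in> B2. if c = b2 then \<one> else \<zero>) =
    pt (m b1 b2)"
proof -
  have "finsum R (\<lambda>(c1, c2). coord s B (m c1 c2) c \<odot>
      ((\<lambda>c \<in> B1. if c = b1 then \<one> else \<zero>) c1 \<otimes> (\<lambda>c \<in> B2. if c = b2 then \<one> else \<zero>) c2)) (B1 \<times> B2) =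
     finsum R (\<lambda>z. if (b1, b2) = z then coord s B (m (fst z) (snd z)) c \<odot> \<one> else \<zero>) (B1 \<times> B2)" for c
    using assms by (intro finsum_cong') (auto split: if_splits)
  also have "\<dots> c = coord s B (m b1 b2) c \<odot> \<one>" for c
    using finsum_singleton[of "(b1, b2)" "B1 \<times> B2" "\<lambda>z. coord s B (m (fst z) (snd z)) c \<odot> \<one>"] assms by auto
  finally show ?thesis unfolding ext_bilinear_def pt_def pure_tensor_def by simp
qed

lemma lin_closed [simp]: "x \<in> ext_carrier B1 R \<Longrightarrow> ext_linear B1 s B R m x \<in> VR"
  unfolding ext_linear_def ext_carrier_def by (auto intro!: finsum_closed simp: PiE_iff)

lemma lin_add:
  assumes "x \<in> ext_carrier B1 R" "x' \<in> ext_carrier B1 R"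
  shows "ext_linear B1 s B R m (ext_add B1 R x x') = add_ext (ext_linear B1 s B R m x) (ext_linear B1 s B R m x')"
proof -
  have "finsum R (\<lambda>b. coord s B (m b) c \<odot> ext_add B1 R x x' b) B1 =
    finsum R (\<lambda>b. coord s B (m b) c \<odot> x b \<oplus> coord s B (m b) c \<odot> x' b) B1" for c
    using assms by (intro finsum_cong') (auto simp: ext_add_def ext_carrier_def PiE_iff smult_distrib)
  also have "\<dots> c = finsum R (\<lambda>b. coord s B (m b) c \<odot> x b) B1 \<oplus> finsum R (\<lambda>b. coord s B (m b) c \<odot> x' b) B1" for c
    using assms by (intro finsum_addf) (auto simp: ext_carrier_def PiE_iff)
  finally show ?thesis unfolding ext_linear_def ext_add_def[of B] by (intro restrict_ext) simp
qed

lemma lin_scale: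
  assumes "finite B1" "x \<in> ext_carrier B1 R" "r \<in> carrier R"
  shows "ext_linear B1 s B R m (ext_scale B1 R r x) = scale_ext r (ext_linear B1 s B R m x)"
proof -
  have "finsum R (\<lambda>b. coord s B (m b) c \<odot> ext_scale B1 R r x b) B1 =
    finsum R (\<lambda>b. r \<otimes> (coord s B (m b) c \<odot> x b)) B1" for c
    using assms by (intro finsum_cong') (auto simp: ext_scale_def ext_carrier_def PiE_iff smult_distrib)
  also have "\<dots> c = r \<otimes> finsum R (\<lambda>b. coord s B (m b) c \<odot> x b) B1" for c
    using assms by (intro finsum_rdistr[symmetric]) (auto simp: ext_carrier_def PiE_iff)
  finally show ?thesis unfolding ext_linear_def ext_scale_def[of B] by (intro restrict_ext) simp
qed

lemma lin_pt_basis: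
  assumes "finite B1" "b1 \<in> B1"
  shows "ext_linear B1 s B R m (\<lambda>c \<in> B1. if c = b1 then \<one> else \<zero>) = pt (m b1)"
proof -
  have "finsum R (\<lambda>b. coord s B (m b) c \<odot> (\<lambda>c \<in> B1. if c = b1 then \<one> else \<zero>) b) B1 =
     finsum R (\<lambda>b. if b1 = b then coord s B (m b) c \<odot> \<one> else \<zero>) B1" for c
    using assms by (intro finsum_cong') (auto split: if_splits)
  also have "\<dots> c = coord s B (m b1) c \<odot> \<one>" for c
    using finsum_singleton[of b1 B1 "\<lambda>b. coord s B (m b) c \<odot> \<one>"] assms by auto
  finally show ?thesis unfolding ext_linear_def pt_def pure_tensor_def by simp
qed

end

text \<open>The extension is defined through basis vectors; linearity of \<open>m\<close> carries
  the formula to every \<open>v \<otimes> 1\<close>, so that identities in the ground space pass to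
  tensors without reference to coordinates.\<close>

lemma ext_linear_pt:
  assumes "ext_space s1 B1 R" "ext_space s B R"
    and add: "\<And>v w. m (v + w) = m v + m w" and scale: "\<And>c v. m (s1 c v) = s c (m v)"
  shows "ext_linear B1 s B R m (ext_space.pt s1 B1 R v) = ext_space.pt s B R (m v)"
proof -
  interpret S1: ext_space s1 B1 R by fact
  interpret ext_space s B R by fact
  show ?thesis
  proof (induction v rule: S1.V.basis_induct)
    case zero
    have "m 0 = 0" using add[of 0 0] by simp
    then show ?case
      using lin_scale[of B1 "S1.ext_zero" "\<zero>\<^bsub>R\<^esub>" m] by (simp add: S1.pt_zero pt_zero S1.scale_zero scale_zero)
  next
    case (step c b v)
    then show ?case
      by (simp add: S1.pt_add S1.pt_scale add scale pt_add pt_scale lin_add lin_scale)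
        (simp add: S1.pt_basis lin_pt_basis)
  qed
qed

lemma ext_bilinear_pt:
  assumes "ext_space s1 B1 R" "ext_space s2 B2 R" "ext_space s B R"
    and add1: "\<And>v v' w. m (v + v') w = m v w + m v' w" and scale1: "\<And>c v w. m (s1 c v) w = s c (m v w)"
    and add2: "\<And>v w w'. m v (w + w') = m v w + m v w'" and scale2: "\<And>c v w. m v (s2 c w) = s c (m v w)"
  shows "ext_bilinear B1 B2 s B R m (ext_space.pt s1 B1 R v) (ext_space.pt s2 B2 R w) =
    ext_space.pt s B R (m v w)"
proof -
  interpret S1: ext_space s1 B1 R by fact
  interpret S2: ext_space s2 B2 R by fact
  interpret ext_space s B R by fact
  have m0: "m 0 w = 0" "m v 0 = 0" for v w using add1[of 0 0 w] add2[of v 0 0] by simp_all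
  have 0: "ext_bilinear B1 B2 s B R m (S1.pt b) (S2.pt b') = pt (m b b')" if "b \<in> B1" "b' \<in> B2" for b b'
    using that by (simp only: S1.pt_basis S2.pt_basis bil_pt_basis S1.V.finite_basis S2.V.finite_basis)
  have cl: "c \<odot>\<^bsub>R\<^esub> \<one>\<^bsub>R\<^esub> \<in> carrier R" for c by simp
  have 1: "ext_bilinear B1 B2 s B R m (S1.pt b) (S2.pt w) = pt (m b w)" if b: "b \<in> B1" for b
  proof (induction w rule: S2.V.basis_induct)
    case zero
    show ?case using bil_scale(2)[of B1 B2 "S1.pt b" "\<zero>\<^bsub>R\<^esub>" "S2.ext_zero" m]
      by (simp add: S2.pt_zero m0 pt_zero S2.scale_zero scale_zero)
  next
    case (step c b2 w)
    have "ext_bilinear B1 B2 s B R m (S1.pt b) (S2.pt (s2 c b2 + w)) =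
        add_ext (scale_ext (c \<odot>\<^bsub>R\<^esub> \<one>\<^bsub>R\<^esub>) (ext_bilinear B1 B2 s B R m (S1.pt b) (S2.pt b2)))
          (ext_bilinear B1 B2 s B R m (S1.pt b) (S2.pt w))"
      by (simp only: S2.pt_add S2.pt_scale bil_add_right bil_scale S1.ext_closed S2.ext_closed cl
          S1.V.finite_basis S2.V.finite_basis)
    also have "\<dots> = pt (m b (s2 c b2 + w))"
      by (simp only: 0[OF b step(1)] step(2) add2 scale2 pt_add pt_scale)
    finally show ?case .
  qed
  show ?thesis
  proof (induction v rule: S1.V.basis_induct)
    case zero
    show ?case using bil_scale(1)[of B1 B2 "S1.ext_zero" "\<zero>\<^bsub>R\<^esub>" "S2.pt w" m]
      by (simp add: S1.pt_zero m0 pt_zero S1.scale_zero scale_zero)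
  next
    case (step c b v)
    have "ext_bilinear B1 B2 s B R m (S1.pt (s1 c b + v)) (S2.pt w) =
        add_ext (scale_ext (c \<odot>\<^bsub>R\<^esub> \<one>\<^bsub>R\<^esub>) (ext_bilinear B1 B2 s B R m (S1.pt b) (S2.pt w)))
          (ext_bilinear B1 B2 s B R m (S1.pt v) (S2.pt w))"
      by (simp only: S1.pt_add S1.pt_scale bil_add_left bil_scale S1.ext_closed S2.ext_closed cl
          S1.V.finite_basis S2.V.finite_basis)
    also have "\<dots> = pt (m (s1 c b + v) w)"
      by (simp only: 1[OF step(1)] step(2) add1 scale1 pt_add pt_scale)
    finally show ?case .
  qed
qed

section \<open>Quadratic etale algebras in characteristic 3\<close>

locale quad_etale =
  fixes s :: "'f::field \<Rightarrow> 'k \<Rightarrow> 'k::comm_ring_1"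
  assumes char3: "CHAR('f) = 3" and etale: "quadratic_etale s"
begin

lemma vs: "vector_space s" and s_mult: "s c (x * y) = s c x * y"
  using etale by (auto simp: quadratic_etale_def field_algebra_def)

sublocale vector_space s by (rule vs)

lemma s_mult': "s c (x * y) = x * s c y"
  using s_mult[of c y x] by (simp add: mult.commute)

lemma kbasis_props: "independent (kbasis s)" "span (kbasis s) = UNIV" "card (kbasis s) = 2"
  "finite (kbasis s)"
proof -
  obtain B where "independent B" "UNIV \<subseteq> span B"
    using basis_exists[of UNIV] by blast
  then have "\<exists>B. independent B \<and> span B = UNIV" by blast
  from someI_ex[OF this] show 1: "independent (kbasis s)" "span (kbasis s) = UNIV"
    unfolding kbasis_def by auto
  have "card (kbasis s) = dim (UNIV :: 'k set)"
    using dim_eq_card[of "kbasis s" UNIV] 1 by simp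
  then show "card (kbasis s) = 2" using etale by (simp add: quadratic_etale_def)
  then show "finite (kbasis s)" by (metis card.infinite zero_neq_numeral)
qed

sublocale K: fin_basis s "kbasis s"
  by unfold_locales (use kbasis_props in auto)

lemma three_f: "(3::'f) = 0"
  using char3 by (metis of_nat_CHAR of_nat_numeral)

lemma three: "(3::'k) = 0"
proof -
  have "s (1 + 1 + 1) 1 = 1 + 1 + (1::'k)" by (simp only: scale_left_distrib scale_one)
  moreover have "(1 + 1 + 1 :: 'f) = 3" by simp
  ultimately show ?thesis using three_f by simp
qed

lemma triple: "x + x + x = (0::'k)"
proof -
  have "3 * x = x + x + x" by simp
  then show ?thesis by (simp only: three mult_zero_left)
qed

lemma two_f: "(2::'f) = - 1" using three_f by (metis add_eq_0_iff add.commute one_add_one numeral_Bit1 numeral_One)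

lemma s_inj: "s c 1 = s d 1 \<Longrightarrow> c = d"
  by (simp add: scale_cancel_right)

text \<open>Etaleness enters as reducedness: in the split case both characters kill
  \<open>x\<close>, and a field has no nilpotent elements.\<close>

lemma square_zero: "x * x = 0 \<Longrightarrow> x = (0::'k)"
proof -
  assume x: "x * x = 0"
  consider "split_quadratic s" | "separable_field_ext s"
    using etale by (auto simp: quadratic_etale_def)
  then show "x = 0"
  proof cases
    case 1
    then obtain p q where pq: "algebra_character s p" "algebra_character s q" "bij (\<lambda>x. (p x, q x))"
      by (auto simp: split_quadratic_def)
    have 0: "p 0 = 0" "q 0 = 0" using pq(1,2) unfolding algebra_character_def
      by (metis add_cancel_right_left add_0)+
    have "p (x * x) = p x * p x" "q (x * x) = q x * q x" using pq(1,2) by (auto simp: algebra_character_def)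
    then have "p x = 0" "q x = 0" using x 0 by simp_all
    then show ?thesis using pq(3) 0 by (auto simp: bij_def inj_def)
  next
    case 2
    show ?thesis
    proof (rule ccontr)
      assume "x \<noteq> 0"
      then obtain y where "x * y = 1" using 2 by (auto simp: separable_field_ext_def)
      then have "x * (x * y) = x" by simp
      then show False using x \<open>x \<noteq> 0\<close> by (simp flip: mult.assoc)
    qed
  qed
qed

text \<open>Completing the square: if \<open>x^2 = \<alpha> + \<beta> x\<close>, then
  \<open>t = x - \<beta> / 2 = x + \<beta>\<close> has the scalar square
  \<open>\<alpha> + \<beta>^2\<close>, which is nonzero because \<open>K\<close> is reduced.\<close>

lemma generator_exists:
  "\<exists>t d. t * t = s d 1 \<and> d \<noteq> 0 \<and> (\<forall>x. \<exists>m n. x = s m 1 + s n t) \<and> (\<forall>c. t \<noteq> s c 1)"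
proof -
  interpret F: finite_dimensional_vector_space s "kbasis s"
    by unfold_locales (use kbasis_props in auto)
  obtain x where x: "\<And>c. x \<noteq> s c 1"
  proof (rule ccontr)
    assume "\<not> thesis"
    then have all: "\<exists>c. y = s c 1" for y using that by blast
    then have "UNIV \<subseteq> span {1::'k}" by (metis insertI1 span_base span_scale subsetI)
    then have "dim (UNIV::'k set) \<le> card {1::'k}" by (intro span_card_ge_dim) auto
    then show False using etale by (simp add: quadratic_etale_def)
  qed
  have "x \<notin> span {1}"
    using x by (auto simp: span_singleton)
  then have ind: "independent {x, 1}" "x \<noteq> 1"
    using x[of 1] by (auto simp: independent_insert span_empty dependent_single)
  have sp: "UNIV \<subseteq> span {x, 1}"
    by (rule F.card_ge_dim_independent) (use ind etale in \<open>auto simp: quadratic_etale_def\<close>)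
  have rep: "\<exists>m n. y = s m 1 + s n x" for y
  proof -
    have "y \<in> span {x, 1}" using sp by auto
    then obtain k l where "y - s k x = s l 1" by (auto simp: span_insert span_singleton)
    then show ?thesis by (metis add.commute diff_add_cancel)
  qed
  obtain \<alpha> \<beta> where ab: "x * x = s \<alpha> 1 + s \<beta> x" using rep by blast
  define t where "t = x + s \<beta> 1"
  have sx: "s c 1 * y = s c y" "y * s c 1 = s c y" for c y using s_mult[of c 1 y] s_mult'[of c y 1] by simp_all
  have "t * t = x * x + (s \<beta> x + s \<beta> x) + s (\<beta> * \<beta>) 1"
    by (simp add: t_def distrib_left distrib_right sx add_ac scale_right_distrib)
  also have "\<dots> = s \<alpha> 1 + s (\<beta> * \<beta>) 1 + (s \<beta> x + s \<beta> x + s \<beta> x)"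
    by (simp add: ab add_ac)
  finally have t2: "t * t = s (\<alpha> + \<beta> * \<beta>) 1" by (simp add: three scale_left_distrib)
  have nt: "t \<noteq> s c 1" for c
  proof
    assume "t = s c 1"
    then have "x = s (c - \<beta>) 1" by (simp add: t_def scale_left_diff_distrib eq_diff_eq)
    then show False using x by blast
  qed
  have d: "\<alpha> + \<beta> * \<beta> \<noteq> 0"
  proof
    assume "\<alpha> + \<beta> * \<beta> = 0"
    then have "t = 0" using t2 square_zero[of t] by simp
    then show False using nt[of 0] by simp
  qed
  have "\<exists>m n. y = s m 1 + s n t" for y
  proof -
    obtain m n where "y = s m 1 + s n x" using rep by blast
    then have "y = s (m - n * \<beta>) 1 + s n t"
      by (simp add: t_def scale_right_distrib scale_left_diff_distrib)
    then show ?thesis by blast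
  qed
  then show ?thesis using t2 d nt by blast
qed

lemma ktrace_add: "ktrace s (x + y) = ktrace s x + ktrace s y"
  by (simp add: ktrace_def distrib_right K.repr_add sum.distrib)

lemma ktrace_scale: "ktrace s (s c x) = c * ktrace s x"
  by (simp add: ktrace_def K.repr_scale sum_distrib_left flip: s_mult)

lemma ktrace_one: "ktrace s 1 = - 1"
proof -
  have "ktrace s 1 = (\<Sum>b\<in>kbasis s. 1)"
    unfolding ktrace_def by (intro sum.cong) (simp_all add: K.repr_basis)
  then show ?thesis using kbasis_props by (simp add: two_f)
qed

text \<open>A 2 by 2 matrix with scalar square and nonzero trace is scalar: its square has
  off-diagonal entries \<open>q (p + u)\<close> and \<open>r (p + u)\<close>, and comparing the
  diagonal entries gives \<open>(p - u) (p + u) = 0\<close>. Multiplication by \<open>t\<close> is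
  not scalar.\<close>

lemma ktrace_sqrt:
  assumes t: "t * t = s d 1" and nt: "\<And>c. t \<noteq> s c 1"
  shows "ktrace s t = 0"
proof -
  obtain b1 b2 where b: "kbasis s = {b1, b2}" "b1 \<noteq> b2" using kbasis_props(3) by (auto simp: card_2_iff)
  let ?r = "representation (kbasis s)"
  have rep: "v = s (?r v b1) b1 + s (?r v b2) b2" for v
  proof -
    have "(\<Sum>c\<in>{b1, b2}. s (?r v c) c) = v"
      by (rule sum_representation_eq) (use kbasis_props(1,2) b in auto)
    then show ?thesis using b(2) by simp
  qed
  have m: "b1 \<in> kbasis s" "b2 \<in> kbasis s" using b(1) by simp_all
  have rb: "?r b1 b1 = 1" "?r b1 b2 = 0" "?r b2 b1 = 0" "?r b2 b2 = 1"
    using K.repr_basis[OF m(1)] K.repr_basis[OF m(2)] b(2) by simp_all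
  define p q r u where "p = ?r (t * b1) b1" and "q = ?r (t * b1) b2"
    and "r = ?r (t * b2) b1" and "u = ?r (t * b2) b2"
  have e: "t * b1 = s p b1 + s q b2" "t * b2 = s r b1 + s u b2"
    using rep unfolding p_def q_def r_def u_def by blast+
  have sd: "t * (t * y) = s d y" for y using t s_mult[of d 1 y] by (simp flip: mult.assoc)
  have "t * (t * b1) = s (p * p + q * r) b1 + s (q * (p + u)) b2"
  proof -
    have "t * (s p b1 + s q b2) = s p (t * b1) + s q (t * b2)" by (simp only: distrib_left s_mult')
    also have "\<dots> = s p (s p b1 + s q b2) + s q (s r b1 + s u b2)" by (simp only: e)
    finally show ?thesis unfolding e(1)
      by (simp add: scale_right_distrib scale_left_distrib distrib_left add_ac mult_ac)
  qed
  then have "?r (s d b1) c = ?r (s (p * p + q * r) b1 + s (q * (p + u)) b2) c" for c by (simp add: sd)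
  from this[of b1] this[of b2] have 1: "d = p * p + q * r" "q * (p + u) = 0"
    by (simp_all add: K.repr_add K.repr_scale rb)
  have "t * (t * b2) = s (r * (p + u)) b1 + s (u * u + q * r) b2"
  proof -
    have "t * (s r b1 + s u b2) = s r (t * b1) + s u (t * b2)" by (simp only: distrib_left s_mult')
    also have "\<dots> = s r (s p b1 + s q b2) + s u (s r b1 + s u b2)" by (simp only: e)
    finally show ?thesis unfolding e(2)
      by (simp add: scale_right_distrib scale_left_distrib distrib_left add_ac mult_ac)
  qed
  then have "?r (s d b2) c = ?r (s (r * (p + u)) b1 + s (u * u + q * r) b2) c" for c by (simp add: sd)
  from this[of b1] this[of b2] have 2: "d = u * u + q * r" "r * (p + u) = 0"
    by (simp_all add: K.repr_add K.repr_scale rb)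
  have "p + u = 0"
  proof (rule ccontr)
    assume pu: "p + u \<noteq> 0"
    then have qr: "q = 0" "r = 0" using 1 2 by auto
    then have "(p - u) * (p + u) = 0" using 1 2 by (simp add: algebra_simps)
    then have "p = u" using pu by simp
    then have tb: "t * b1 = s p b1" "t * b2 = s p b2" using e qr by simp_all
    have "t = t * (s (?r 1 b1) b1 + s (?r 1 b2) b2)" using rep[of 1] by simp
    also have "\<dots> = s p (s (?r 1 b1) b1 + s (?r 1 b2) b2)"
      by (simp only: distrib_left tb scale_right_distrib s_mult'[symmetric] scale_scale mult.commute[of p])
    also have "\<dots> = s p 1" using rep[of 1] by simp
    finally show False using nt by blast
  qed
  then show ?thesis by (simp add: ktrace_def b p_def u_def)
qed

text \<open>The trace-zero generator, written \<open>\<theta>\<close> in the overview. It is chosen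
  once over the ground field, so that base change carries it to itself.\<close>

definition kgen :: 'k where
  "kgen = (SOME t. \<exists>d. t * t = s d 1 \<and> d \<noteq> 0 \<and> (\<forall>x. \<exists>m n. x = s m 1 + s n t) \<and> (\<forall>c. t \<noteq> s c 1))"

definition kdisc :: 'f where "kdisc = (SOME d. kgen * kgen = s d 1)"

lemma kgen: "kgen * kgen = s kdisc 1" "kdisc \<noteq> 0" "\<exists>m n. x = s m 1 + s n kgen" "kgen \<noteq> s c 1"
proof -
  have 1: "\<exists>d. kgen * kgen = s d 1 \<and> d \<noteq> 0 \<and> (\<forall>x. \<exists>m n. x = s m 1 + s n kgen) \<and> (\<forall>c. kgen \<noteq> s c 1)"
    unfolding kgen_def by (rule someI_ex) (rule generator_exists)
  then show 2: "kgen * kgen = s kdisc 1" unfolding kdisc_def by (auto intro: someI)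
  from 1 show "kdisc \<noteq> 0" "\<exists>m n. x = s m 1 + s n kgen" "kgen \<noteq> s c 1"
    using 2 s_inj by metis+
qed

lemma kconj_decomp: "kconj s (s m 1 + s n kgen) = s m 1 - s n kgen"
proof -
  have "ktrace s kgen = 0" by (rule ktrace_sqrt[OF kgen(1) kgen(4)])
  then have "ktrace s (s m 1 + s n kgen) = 2 * m"
    by (simp add: ktrace_add ktrace_scale ktrace_one two_f)
  moreover have "s (2 * m) 1 = s m 1 + s m 1" by (simp only: mult_2 scale_left_distrib)
  ultimately show ?thesis by (simp only: kconj_def) simp
qed

lemma kconj_simps [simp]:
  "kconj s (x + y) = kconj s x + kconj s y" "kconj s (s c x) = s c (kconj s x)" 
  "kconj s (x - y) = kconj s x - kconj s y" "kconj s (- x) = - kconj s x" "kconj s 0 = 0"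
  "kconj s 1 = 1" "kconj s kgen = - kgen" "kconj s (kconj s x) = x"
proof -
  show add: "kconj s (x + y) = kconj s x + kconj s y" for x y
    by (simp add: kconj_def ktrace_add scale_left_distrib)
  show sc: "kconj s (s c x) = s c (kconj s x)" for c x
    by (simp add: kconj_def ktrace_scale scale_right_diff_distrib)
  show neg: "kconj s (- x) = - kconj s x" for x using sc[of "- 1" x] by simp
  show "kconj s (x - y) = kconj s x - kconj s y" using add[of x "- y"] by (simp add: neg)
  show "kconj s 0 = 0" using sc[of 0 x] by simp
  show one: "kconj s 1 = 1" using kconj_decomp[of 1 0] by simp
  show g: "kconj s kgen = - kgen" using kconj_decomp[of 0 1] by simp
  obtain m n where x: "x = s m 1 + s n kgen" using kgen(3) by blast
  show "kconj s (kconj s x) = x" using kconj_decomp[of m n] kconj_decomp[of m "- n"] by (simp add: x)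
qed

lemma sx: "s c 1 * y = s c y" "y * s c 1 = s c y"
  using s_mult[of c 1 y] s_mult'[of c y 1] by simp_all

lemma mult_decomp:
  "(s m 1 + s n kgen) * (s p 1 + s q kgen) = s (m * p + n * q * kdisc) 1 + s (m * q + n * p) kgen"
proof -
  have "s n kgen * s q kgen = s (n * q) (kgen * kgen)"
    unfolding s_mult[of n kgen "s q kgen", symmetric] s_mult'[of q kgen kgen, symmetric] by simp
  then have "s n kgen * s q kgen = s (n * q * kdisc) 1" by (simp add: kgen(1))
  then show ?thesis by (simp add: distrib_left distrib_right sx scale_left_distrib add_ac mult_ac)
qed

lemma kconj_mult [simp]: "kconj s (x * y) = kconj s x * kconj s y"
proof -
  obtain m n where x: "x = s m 1 + s n kgen" using kgen(3) by blast
  obtain p q where y: "y = s p 1 + s q kgen" using kgen(3) by blast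
  have "kconj s x * kconj s y = (s m 1 + s (- n) kgen) * (s p 1 + s (- q) kgen)"
    unfolding x y kconj_decomp by simp
  then show ?thesis unfolding mult_decomp x y kconj_decomp by (simp add: scale_left_diff_distrib flip: scale_minus_left)
qed

text \<open>In \<open>m + n \<theta>\<close> conjugation changes the sign of \<open>n\<close>, and 2
  is invertible. So \<open>kscalar\<close> is meaningful on norms and on the values of the hermitian
  form at pairs \<open>(x, x)\<close>.\<close>

lemma kconj_fixed: "kconj s x = x \<Longrightarrow> s (kscalar s x) 1 = x"
proof -
  assume a: "kconj s x = x"
  obtain m n where x: "x = s m 1 + s n kgen" using kgen(3) by blast
  have "s n kgen + s n kgen = 0" using a kconj_decomp[of m n] unfolding x by (simp add: diff_eq_eq add.assoc)
  then have "s (2 * n) kgen = 0" by (simp only: mult_2 scale_left_distrib)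
  then have "n = 0" using kgen(4)[of 0] by (simp add: two_f)
  then have x: "x = s m 1" using x by simp
  have "kscalar s x = m" unfolding kscalar_def x using s_inj by blast
  then show ?thesis using x by simp
qed

lemma knorm: "s (knorm s x) 1 = x * kconj s x"
  unfolding knorm_def by (rule kconj_fixed) (simp add: mult.commute)

lemma wherm_kconj: "kconj s (wherm s x y) = wherm s y x"
  by (cases x rule: prod_cases3; cases y rule: prod_cases3) (simp add: wherm_def algebra_simps)

lemma cnorm: "s (cnorm s (b, x)) 1 = b * kconj s b + wherm s x x"
  by (simp add: cnorm_def scale_left_distrib knorm kconj_fixed[OF wherm_kconj])

text \<open>The Gram matrix of the hermitian form is \<open>1 - J\<close>, where \<open>J\<close>
  has all entries 1; as \<open>J^2 = 3 J = 0\<close>, its inverse is \<open>1 + J\<close>. So each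
  of the minors \<open>c1\<close>, \<open>c2\<close>, \<open>c3\<close> is increased by their sum
  \<open>c\<close> before being scaled by \<open>a\<close> and conjugated.\<close>

lemma wcross_eq:
  "wcross s a (x1, x2, x3) (y1, y2, y3) =
   (let c1 = x2 * y3 - x3 * y2; c2 = x3 * y1 - x1 * y3; c3 = x1 * y2 - x2 * y1; c = c1 + c2 + c3 in
    (kconj s (a * (c1 + c)), kconj s (a * (c2 + c)), kconj s (a * (c3 + c))))"
proof -
  define c1 c2 c3 where "c1 = x2 * y3 - x3 * y2" and "c2 = x3 * y1 - x1 * y3" and "c3 = x1 * y2 - x2 * y1"
  define c where "c = c1 + c2 + c3"
  have vol: "wvol a (z1, z2, z3) (x1, x2, x3) (y1, y2, y3) = a * (z1 * c1 + z2 * c2 + z3 * c3)" for z1 z2 z3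
    by (simp add: wvol_def c1_def c2_def c3_def algebra_simps)
  show ?thesis unfolding wcross_def Let_def c1_def[symmetric] c2_def[symmetric] c3_def[symmetric] c_def[symmetric]
  proof (rule the_equality)
    have "wherm s (z1, z2, z3) (kconj s (a * (c1 + c)), kconj s (a * (c2 + c)), kconj s (a * (c3 + c))) =
        a * (z1 * c1 + z2 * c2 + z3 * c3) - 3 * (a * c * (z1 + z2 + z3))" for z1 z2 z3
      by (simp add: wherm_def c_def algebra_simps)
    then show "\<forall>z. wherm s z (kconj s (a * (c1 + c)), kconj s (a * (c2 + c)), kconj s (a * (c3 + c))) =
        wvol a z (x1, x2, x3) (y1, y2, y3)"
      by (simp add: vol three)
    fix v assume v: "\<forall>z. wherm s z v = wvol a z (x1, x2, x3) (y1, y2, y3)"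
    obtain v1 v2 v3 where v': "v = (v1, v2, v3)" by (cases v rule: prod_cases3)
    \<comment> \<open>Evaluation at the three basis vectors determines each conjugated coordinate up
      to \<open>T\<close>; summing gives \<open>T - 3 T = a c\<close>, and hence \<open>T\<close>
      itself.\<close>
    define T where "T = kconj s v1 + kconj s v2 + kconj s v3"
    have e: "kconj s v1 - T = a * c1" "kconj s v2 - T = a * c2" "kconj s v3 - T = a * c3"
      using v[rule_format, of "(1, 0, 0)"] v[rule_format, of "(0, 1, 0)"] v[rule_format, of "(0, 0, 1)"]
      by (simp_all add: vol) (simp_all add: v' wherm_def T_def)
    have "a * c = (kconj s v1 - T) + (kconj s v2 - T) + (kconj s v3 - T)"
      unfolding e c_def by (simp add: algebra_simps)
    also have "\<dots> = T - 3 * T" by (simp add: T_def algebra_simps)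
    finally have "T = a * c" by (simp add: three)
    then have "kconj s v1 = a * (c1 + c)" "kconj s v2 = a * (c2 + c)" "kconj s v3 = a * (c3 + c)"
      using e by (simp_all add: algebra_simps)
    then have "kconj s (kconj s v1) = kconj s (a * (c1 + c))" "kconj s (kconj s v2) = kconj s (a * (c2 + c))"
      "kconj s (kconj s v3) = kconj s (a * (c3 + c))" by (simp_all only:)
    then show "v = (kconj s (a * (c1 + c)), kconj s (a * (c2 + c)), kconj s (a * (c3 + c)))"
      unfolding v' kconj_simps(8) by (simp only:)
  qed
qed

end

section \<open>A basis of the Cayley algebra from four copies of a basis of K\<close>

definition cinj :: "nat \<Rightarrow> 'k::comm_ring_1 \<Rightarrow> 'k cayley" where
  "cinj j b = (if j = 0 then (b, 0, 0, 0) else if j = 1 then (0, b, 0, 0)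
     else if j = 2 then (0, 0, b, 0) else (0, 0, 0, b))"

definition ccoord :: "nat \<Rightarrow> 'k::comm_ring_1 cayley \<Rightarrow> 'k" where
  "ccoord j = (\<lambda>(b, x1, x2, x3). if j = 0 then b else if j = 1 then x1 else if j = 2 then x2 else x3)"

lemma less_four: "j < 4 \<longleftrightarrow> j = 0 \<or> j = 1 \<or> j = 2 \<or> j = (3::nat)"
  by auto

lemma lessThan_four: "{..<4::nat} = {0, 1, 2, 3}"
  by auto

lemma ccoord_cinj: "\<lbrakk>i < 4; j < 4\<rbrakk> \<Longrightarrow> ccoord i (cinj j b) = (if i = j then b else 0)"
  by (auto simp: less_four ccoord_def cinj_def)

lemma cinj_eq_iff: "\<lbrakk>i < 4; j < 4; b \<noteq> 0\<rbrakk> \<Longrightarrow> cinj i b = cinj j c \<longleftrightarrow> i = j \<and> b = c"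
  by (auto simp: less_four cinj_def)

lemma ccoord_add: "ccoord j (v + w) = ccoord j v + ccoord j w"
  by (cases v rule: prod_cases4; cases w rule: prod_cases4) (auto simp: ccoord_def)

lemma ccoord_scale: "ccoord j (cscale s c v) = s c (ccoord j v)"
  by (cases v rule: prod_cases4) (auto simp: ccoord_def cscale_def)

lemma ccoord_zero: "ccoord j 0 = 0"
  by (auto simp: ccoord_def zero_prod_def)

lemma ccoord_sum: "ccoord j (sum f I) = (\<Sum>i\<in>I. ccoord j (f i))"
  by (induction I rule: infinite_finite_induct) (auto simp: ccoord_add ccoord_zero)

lemma cbasis_eq: "cbasis s = (\<lambda>(j, b). cinj j b) ` ({..<4} \<times> kbasis s)"
  by (auto simp: cbasis_def cinj_def lessThan_four image_iff)

context quad_etale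
begin

lemma kbasis_nonzero: "b \<in> kbasis s \<Longrightarrow> b \<noteq> 0"
  using kbasis_props(1) dependent_zero by metis

lemma cbasis_inj: "inj_on (\<lambda>(j, b). cinj j b) ({..<4} \<times> kbasis s)"
  by (auto simp: inj_on_def cinj_eq_iff dest: kbasis_nonzero)

lemma cscale_vs: "vector_space (cscale s)"
  by unfold_locales (auto simp: cscale_def scale_right_distrib scale_left_distrib)

lemma cbasis_sum: "(\<Sum>v\<in>cbasis s. f v) = (\<Sum>j<4. \<Sum>b\<in>kbasis s. f (cinj j b))"
  unfolding cbasis_eq
  by (subst sum.reindex[OF cbasis_inj]) (simp add: sum.cartesian_product case_prod_unfold o_def)

lemma cbasis_fin_basis: "fin_basis (cscale s) (cbasis s)"
proof -
  interpret C: vector_space "cscale s" by (rule cscale_vs)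
  have fin: "finite (cbasis s)" by (simp add: cbasis_eq kbasis_props)
  have "C.independent (cbasis s)"
  proof (rule C.independent_if_scalars_zero[OF fin])
    fix f v assume sum0: "(\<Sum>x\<in>cbasis s. cscale s (f x) x) = 0" and "v \<in> cbasis s"
    then obtain j b where jb: "v = cinj j b" "j < 4" "b \<in> kbasis s" by (auto simp: cbasis_eq)
    have "0 = ccoord j (\<Sum>x\<in>cbasis s. cscale s (f x) x)" by (simp add: sum0 ccoord_zero)
    also have "\<dots> = (\<Sum>i<4. \<Sum>b\<in>kbasis s. if i = j then s (f (cinj j b)) b else 0)"
      using jb(2) by (auto simp: ccoord_sum ccoord_scale cbasis_sum ccoord_cinj intro!: sum.cong)
    also have "\<dots> = (\<Sum>i<4. if i = j then (\<Sum>b\<in>kbasis s. s (f (cinj j b)) b) else 0)"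
      by (intro sum.cong) auto
    also have "\<dots> = (\<Sum>b\<in>kbasis s. s (f (cinj j b)) b)" using jb(2) by simp
    finally show "f v = 0"
      using independentD[OF kbasis_props(1,4) subset_refl _ jb(3), of "\<lambda>b. f (cinj j b)"] jb(1) by simp
  qed
  moreover have "C.span (cbasis s) = UNIV"
  proof -
    have 1: "cinj j x \<in> C.span (cbasis s)" if j: "j < 4" for j x
    proof (induction x rule: K.basis_induct)
      case zero
      have "cinj j 0 = (0 :: 'k cayley)" by (simp add: cinj_def zero_prod_def)
      then show ?case by (simp add: C.span_zero)
    next
      case (step c b x)
      have "cinj j (s c b + x) = cscale s c (cinj j b) + cinj j x" by (simp add: cinj_def cscale_def)
      moreover have "cinj j b \<in> cbasis s" using step j by (auto simp: cbasis_eq)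
      ultimately show ?case using step by (simp add: C.span_add C.span_scale C.span_base)
    qed
    have 2: "(\<Sum>j<4. cinj j (ccoord j v)) = v" for v :: "'k cayley"
      by (cases v rule: prod_cases4) (simp add: lessThan_four cinj_def ccoord_def)
    have "(\<Sum>j<4. cinj j (ccoord j v)) \<in> C.span (cbasis s)" for v
      by (rule C.span_sum) (simp add: 1)
    then have "v \<in> C.span (cbasis s)" for v unfolding 2 .
    then show ?thesis by auto
  qed
  ultimately show ?thesis using fin by unfold_locales
qed

sublocale C: fin_basis "cscale s" "cbasis s" by (rule cbasis_fin_basis)

lemma repr_cbasis:
  assumes "j < 4" "b \<in> kbasis s"
  shows "C.representation (cbasis s) v (cinj j b) = representation (kbasis s) (ccoord j v) b"
proof (induction v rule: C.basis_induct)
  case zero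
  then show ?case by (simp add: C.representation_zero representation_zero ccoord_zero)
next
  case (step c w v)
  then obtain i b' where w: "w = cinj i b'" "i < 4" "b' \<in> kbasis s" by (auto simp: cbasis_eq)
  have "C.representation (cbasis s) w (cinj j b) = representation (kbasis s) (ccoord j w) b"
    using w assms kbasis_nonzero[of b]
    by (auto simp: C.repr_basis[OF step(1), unfolded w] K.repr_basis ccoord_cinj cinj_eq_iff representation_zero)
  then show ?case using step by (simp add: C.repr_add C.repr_scale K.repr_add K.repr_scale ccoord_add ccoord_scale)
qed

end

section \<open>K over an algebra R as a ring with involution\<close>

locale etale_over = E: quad_etale s + comm_alg_over R
  for s :: "'f::field \<Rightarrow> 'k \<Rightarrow> 'k::comm_ring_1" and R :: "('f, 'u) module" (structure) +
  fixes a :: 'k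
  assumes norm_a: "knorm s a = 1"
begin

sublocale KE: ext_space s "kbasis s" R ..
sublocale CE: ext_space "cscale s" "cbasis s" R ..

text \<open>Packaged as a ring so that \<open>herm_ring\<close>, and with it all the identities
  proved there, can be instantiated at \<open>K \<otimes> R\<close>.\<close>

definition KRing :: "('k \<Rightarrow> 'u) ring" where
  "KRing = \<lparr>carrier = KR s R, monoid.mult = KR_mult s R, one = KR_one s R,
     ring.zero = KE.ext_zero, add = ext_add (kbasis s) R\<rparr>"

definition kbar :: "('k \<Rightarrow> 'u) \<Rightarrow> 'k \<Rightarrow> 'u" where
  "kbar = ext_linear (kbasis s) s (kbasis s) R (kconj s)"

lemma KR_mult_pt: "KR_mult s R (KE.pt v) (KE.pt w) = KE.pt (v * w)"
  unfolding KR_mult_def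
  by (rule ext_bilinear_pt) (simp_all add: KE.ext_space_axioms distrib_left distrib_right flip: E.s_mult E.s_mult')

lemma KR_mult_closed [simp]: "x \<in> KR s R \<Longrightarrow> y \<in> KR s R \<Longrightarrow> KR_mult s R x y \<in> KR s R"
  unfolding KR_mult_def by simp

lemma KR_mult_add:
  "\<lbrakk>x \<in> KR s R; x' \<in> KR s R; y \<in> KR s R\<rbrakk> \<Longrightarrow>
    KR_mult s R (KE.add_ext x x') y = KE.add_ext (KR_mult s R x y) (KR_mult s R x' y)"
  "\<lbrakk>x \<in> KR s R; x' \<in> KR s R; y \<in> KR s R\<rbrakk> \<Longrightarrow>
    KR_mult s R y (KE.add_ext x x') = KE.add_ext (KR_mult s R y x) (KR_mult s R y x')"
  unfolding KR_mult_def by (simp_all add: KE.bil_add_left KE.bil_add_right)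

lemma KR_mult_scale:
  "\<lbrakk>x \<in> KR s R; r \<in> carrier R; y \<in> KR s R\<rbrakk> \<Longrightarrow>
    KR_mult s R (KE.scale_ext r x) y = KE.scale_ext r (KR_mult s R x y)"
  "\<lbrakk>x \<in> KR s R; r \<in> carrier R; y \<in> KR s R\<rbrakk> \<Longrightarrow>
    KR_mult s R x (KE.scale_ext r y) = KE.scale_ext r (KR_mult s R x y)"
  unfolding KR_mult_def by (simp_all add: KE.bil_scale)

lemma KR_zero: "x \<in> KR s R \<Longrightarrow> KR_mult s R KE.ext_zero x = KE.ext_zero"
  "x \<in> KR s R \<Longrightarrow> KR_mult s R x KE.ext_zero = KE.ext_zero"
  using KR_mult_scale(1)[of KE.ext_zero "\<zero>" x] KR_mult_scale(2)[of x "\<zero>" KE.ext_zero]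
  by (simp_all add: KE.scale_zero)

lemma KR_mult_comm:
  assumes "x \<in> KR s R" "y \<in> KR s R" shows "KR_mult s R x y = KR_mult s R y x"
  using assms(1)
proof (induction x rule: KE.ext_induct)
  case (basis b)
  from assms(2) show ?case
    by (induction y rule: KE.ext_induct)
      (simp_all add: KR_mult_add KR_mult_scale KR_zero KR_mult_pt mult.commute)
qed (use assms in \<open>simp_all add: KR_mult_add KR_mult_scale KR_zero\<close>)

lemma KR_mult_assoc:
  assumes "x \<in> KR s R" "y \<in> KR s R" "z \<in> KR s R"
  shows "KR_mult s R (KR_mult s R x y) z = KR_mult s R x (KR_mult s R y z)"
  using assms(1)
proof (induction x rule: KE.ext_induct)
  case (basis b)
  from assms(2) show ?case
  proof (induction y rule: KE.ext_induct)
    case (basis c)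
    from assms(3) show ?case
      by (induction z rule: KE.ext_induct)
        (simp_all add: KR_mult_add KR_mult_scale KR_zero KR_mult_pt mult.assoc)
  qed (use assms in \<open>simp_all add: KR_mult_add KR_mult_scale KR_zero\<close>)
qed (use assms in \<open>simp_all add: KR_mult_add KR_mult_scale KR_zero\<close>)

lemma KR_one_pt: "KR_one s R = KE.pt 1"
  by (simp add: KR_one_def KE.pt_def)

lemma KR_mult_one: "x \<in> KR s R \<Longrightarrow> KR_mult s R (KR_one s R) x = x"
  by (induction x rule: KE.ext_induct)
    (simp_all add: KR_mult_add KR_mult_scale KR_zero KR_mult_pt KR_one_pt)

lemma KR_cring: "cring KRing"
proof (rule cringI)
  show "abelian_group KRing"
  proof (rule abelian_groupI)
    fix x y z assume "x \<in> carrier KRing" "y \<in> carrier KRing" "z \<in> carrier KRing"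
    then show "x \<oplus>\<^bsub>KRing\<^esub> y \<oplus>\<^bsub>KRing\<^esub> z = x \<oplus>\<^bsub>KRing\<^esub> (y \<oplus>\<^bsub>KRing\<^esub> z)"
      "x \<oplus>\<^bsub>KRing\<^esub> y = y \<oplus>\<^bsub>KRing\<^esub> x"
      by (auto simp: KRing_def ext_add_def a_ac intro!: restrict_ext)
  next
    fix x assume "x \<in> carrier KRing"
    then have x: "x \<in> KR s R" by (simp add: KRing_def)
    have "KE.add_ext (KE.scale_ext (\<ominus> \<one>) x) x = KE.ext_zero"
      using x by (auto simp: ext_add_def ext_scale_def KE.ext_zero_def l_minus l_neg intro!: restrict_ext)
    then show "\<exists>y\<in>carrier KRing. y \<oplus>\<^bsub>KRing\<^esub> x = \<zero>\<^bsub>KRing\<^esub>" using x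
      by (intro bexI[of _ "KE.scale_ext (\<ominus> \<one>) x"]) (simp_all add: KRing_def)
  qed (auto simp: KRing_def KE.add_zero)
  show "comm_monoid KRing"
    by (rule comm_monoidI)
      (simp_all add: KRing_def KR_mult_assoc KR_mult_one KR_one_pt KR_mult_one[unfolded KR_one_pt], rule KR_mult_comm)
qed (auto simp: KRing_def KR_mult_add)

lemma kbar_pt: "kbar (KE.pt v) = KE.pt (kconj s v)"
  unfolding kbar_def by (rule ext_linear_pt) (simp_all add: KE.ext_space_axioms)

lemma kbar_simps:
  "x \<in> KR s R \<Longrightarrow> kbar x \<in> KR s R"
  "\<lbrakk>x \<in> KR s R; y \<in> KR s R\<rbrakk> \<Longrightarrow> kbar (KE.add_ext x y) = KE.add_ext (kbar x) (kbar y)"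
  "\<lbrakk>x \<in> KR s R; r \<in> carrier R\<rbrakk> \<Longrightarrow> kbar (KE.scale_ext r x) = KE.scale_ext r (kbar x)"
  "kbar KE.ext_zero = KE.ext_zero"
proof -
  show 1: "x \<in> KR s R \<Longrightarrow> kbar x \<in> KR s R"
    "\<lbrakk>x \<in> KR s R; y \<in> KR s R\<rbrakk> \<Longrightarrow> kbar (KE.add_ext x y) = KE.add_ext (kbar x) (kbar y)"
    and 2: "\<And>x r. \<lbrakk>x \<in> KR s R; r \<in> carrier R\<rbrakk> \<Longrightarrow> kbar (KE.scale_ext r x) = KE.scale_ext r (kbar x)"
    by (simp_all add: kbar_def KE.lin_add KE.lin_scale)
  show "kbar KE.ext_zero = KE.ext_zero"
    using 2[of KE.ext_zero "\<zero>"] by (simp add: KE.scale_zero kbar_def)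
qed

lemma kbar_kbar: "x \<in> KR s R \<Longrightarrow> kbar (kbar x) = x"
  by (induction x rule: KE.ext_induct) (simp_all add: kbar_simps kbar_pt)

lemma kbar_mult:
  assumes "x \<in> KR s R" "y \<in> KR s R" shows "kbar (KR_mult s R x y) = KR_mult s R (kbar x) (kbar y)"
  using assms(1)
proof (induction x rule: KE.ext_induct)
  case (basis b)
  from assms(2) show ?case
    by (induction y rule: KE.ext_induct)
      (simp_all add: KR_mult_add KR_mult_scale KR_zero KR_mult_pt kbar_simps kbar_pt)
qed (use assms in \<open>simp_all add: KR_mult_add KR_mult_scale KR_zero kbar_simps\<close>)

sublocale H: herm_ring KRing kbar "KE.pt a"
proof -
  interpret K: cring KRing by (rule KR_cring)
  have "KE.pt 1 \<oplus>\<^bsub>KRing\<^esub> KE.pt 1 \<oplus>\<^bsub>KRing\<^esub> KE.pt 1 = KE.pt (1 + 1 + 1)"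
    unfolding KE.pt_add by (simp add: KRing_def)
  also have "\<dots> = \<zero>\<^bsub>KRing\<^esub>" by (simp only: E.triple) (simp add: KRing_def KE.pt_zero)
  finally have 3: "KE.pt 1 \<oplus>\<^bsub>KRing\<^esub> KE.pt 1 \<oplus>\<^bsub>KRing\<^esub> KE.pt 1 = \<zero>\<^bsub>KRing\<^esub>" .
  have "s 1 1 = a * kconj s a" using E.knorm[of a] norm_a by simp
  then have a: "a * kconj s a = 1" by simp
  show "herm_ring KRing kbar (KE.pt a)"
    by unfold_locales (use 3 a in \<open>simp_all add: KRing_def kbar_simps kbar_pt kbar_kbar kbar_mult KR_one_pt KR_mult_pt\<close>)
qed

lemma pt_hom:
  "KE.pt v \<oplus>\<^bsub>KRing\<^esub> KE.pt w = KE.pt (v + w)" "KE.pt v \<otimes>\<^bsub>KRing\<^esub> KE.pt w = KE.pt (v * w)"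
  "kbar (KE.pt v) = KE.pt (kconj s v)" "\<one>\<^bsub>KRing\<^esub> = KE.pt 1" "\<zero>\<^bsub>KRing\<^esub> = KE.pt 0"
  "\<ominus>\<^bsub>KRing\<^esub> KE.pt v = KE.pt (- v)" "KE.pt v \<ominus>\<^bsub>KRing\<^esub> KE.pt w = KE.pt (v - w)"
proof -
  show 1: "KE.pt v \<oplus>\<^bsub>KRing\<^esub> KE.pt w = KE.pt (v + w)" for v w by (simp add: KRing_def KE.pt_add)
  show "KE.pt v \<otimes>\<^bsub>KRing\<^esub> KE.pt w = KE.pt (v * w)" by (simp add: KRing_def KR_mult_pt)
  show "\<one>\<^bsub>KRing\<^esub> = KE.pt 1" and 0: "\<zero>\<^bsub>KRing\<^esub> = KE.pt 0"
    by (simp_all add: KRing_def KR_one_pt KE.pt_zero)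
  have c: "KE.pt v \<in> carrier KRing" for v by (simp add: KRing_def)
  show 2: "\<ominus>\<^bsub>KRing\<^esub> KE.pt v = KE.pt (- v)" for v
    by (rule H.minus_equality) (simp_all add: 1 0 c)
  show "KE.pt v \<ominus>\<^bsub>KRing\<^esub> KE.pt w = KE.pt (v - w)" by (simp add: H.minus_eq 1 2)
qed (rule kbar_pt)

end

context etale_over
begin

lemma carrier_KRing [simp]: "carrier KRing = KR s R"
  by (simp add: KRing_def)

lemmas H_closed [simp] = H.m_closed[unfolded carrier_KRing] H.add.m_closed[unfolded carrier_KRing]
  H.a_inv_closed[unfolded carrier_KRing] H.minus_closed[unfolded carrier_KRing]
  H.bar_closed[unfolded carrier_KRing] H.one_closed[unfolded carrier_KRing]
  H.zero_closed[unfolded carrier_KRing]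

lemma add_KRing: "x \<oplus>\<^bsub>KRing\<^esub> y = KE.add_ext x y"
  and mult_KRing: "x \<otimes>\<^bsub>KRing\<^esub> y = KR_mult s R x y"
  and one_KRing: "\<one>\<^bsub>KRing\<^esub> = KE.pt 1"
  and zero_KRing: "\<zero>\<^bsub>KRing\<^esub> = KE.ext_zero"
  by (simp_all add: KRing_def KR_one_pt)

lemma kgen_inv: "E.kgen * s (1 / E.kdisc) E.kgen = 1"
  using E.kgen(1,2) by (simp flip: E.s_mult')

sublocale HS: herm_ring_skew KRing kbar "KE.pt a" "KE.pt E.kgen" "KE.pt (s (1 / E.kdisc) E.kgen)"
  by unfold_locales (use kgen_inv in \<open>simp_all add: pt_hom\<close>)

text \<open>The structure map of \<open>K \<otimes> R\<close> as an \<open>R\<close>-algebra; it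
  turns scalar multiplication by \<open>R\<close> into ring multiplication.\<close>

definition iota :: "'u \<Rightarrow> 'k \<Rightarrow> 'u" where "iota r = KE.scale_ext r (KE.pt 1)"

lemma iota_closed [simp]: "r \<in> carrier R \<Longrightarrow> iota r \<in> KR s R"
  by (simp add: iota_def)

lemma iota_mult: "r \<in> carrier R \<Longrightarrow> x \<in> KR s R \<Longrightarrow> iota r \<otimes>\<^bsub>KRing\<^esub> x = KE.scale_ext r x"
  using H.l_one[of x] by (simp add: iota_def mult_KRing one_KRing KR_mult_scale)

lemma kbar_iota [simp]: "r \<in> carrier R \<Longrightarrow> kbar (iota r) = iota r"
  by (simp add: iota_def kbar_simps kbar_pt)

lemma iota_hom:
  "\<lbrakk>r \<in> carrier R; t \<in> carrier R\<rbrakk> \<Longrightarrow> iota (r \<oplus> t) = iota r \<oplus>\<^bsub>KRing\<^esub> iota t"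
  "\<lbrakk>r \<in> carrier R; t \<in> carrier R\<rbrakk> \<Longrightarrow> iota (r \<otimes> t) = iota r \<otimes>\<^bsub>KRing\<^esub> iota t"
  "iota \<one> = \<one>\<^bsub>KRing\<^esub>" "iota \<zero> = \<zero>\<^bsub>KRing\<^esub>"
  "r \<in> carrier R \<Longrightarrow> iota (\<ominus> r) = \<ominus>\<^bsub>KRing\<^esub> iota r"
  "\<lbrakk>r \<in> carrier R; t \<in> carrier R\<rbrakk> \<Longrightarrow> iota (r \<ominus> t) = iota r \<ominus>\<^bsub>KRing\<^esub> iota t"
proof -
  show add: "iota (r \<oplus> t) = iota r \<oplus>\<^bsub>KRing\<^esub> iota t" if "r \<in> carrier R" "t \<in> carrier R" for r t
    using that by (auto simp: iota_def add_KRing ext_add_def ext_scale_def l_distr intro!: restrict_ext)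
  show "iota (r \<otimes> t) = iota r \<otimes>\<^bsub>KRing\<^esub> iota t" if "r \<in> carrier R" "t \<in> carrier R" for r t
    using that by (auto simp: iota_mult) (auto simp: iota_def ext_scale_def m_assoc intro!: restrict_ext)
  show "iota \<one> = \<one>\<^bsub>KRing\<^esub>"
    unfolding iota_def one_KRing by (rule KE.ext_eqI, simp, simp, simp add: ext_scale_def)
  show z: "iota \<zero> = \<zero>\<^bsub>KRing\<^esub>"
    by (simp add: iota_def zero_KRing KE.scale_zero)
  show m: "iota (\<ominus> r) = \<ominus>\<^bsub>KRing\<^esub> iota r" if "r \<in> carrier R" for r
  proof (rule H.minus_equality[symmetric])
    show "iota (\<ominus> r) \<oplus>\<^bsub>KRing\<^esub> iota r = \<zero>\<^bsub>KRing\<^esub>" using add[of "\<ominus> r" r] z that by (simp add: l_neg)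
  qed (use that in simp_all)
  show "iota (r \<ominus> t) = iota r \<ominus>\<^bsub>KRing\<^esub> iota t" if "r \<in> carrier R" "t \<in> carrier R" for r t
    using that by (simp add: minus_eq H.minus_eq add m)
qed

text \<open>Some coordinate of 1 in \<open>K\<close> is a nonzero element of the ground field, and
  such a scalar can be divided out in any \<open>R\<close>.\<close>

lemma iota_inj: "\<lbrakk>iota r = iota t; r \<in> carrier R; t \<in> carrier R\<rbrakk> \<Longrightarrow> r = t"
proof -
  assume e: "iota r = iota t" and c: "r \<in> carrier R" "t \<in> carrier R"
  have "\<exists>b \<in> kbasis s. E.representation (kbasis s) 1 b \<noteq> 0"
  proof (rule ccontr)
    assume "\<not> ?thesis"
    then have "E.representation (kbasis s) 1 b = E.representation (kbasis s) 0 b" if "b \<in> kbasis s" for b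
      using that by (auto simp: E.representation_zero)
    then have "1 = (0::'k)" by (rule E.K.repr_eqI)
    then show False by simp
  qed
  then obtain b where b: "b \<in> kbasis s" "E.representation (kbasis s) 1 b \<noteq> 0" by blast
  let ?c = "E.representation (kbasis s) 1 b"
  have "iota q b = ?c \<odot> q" if "q \<in> carrier R" for q
    using b that by (simp add: iota_def ext_scale_def KE.pt_def pure_tensor_def smult_distrib)
  then have "?c \<odot> r = ?c \<odot> t" using e c by metis
  then have "(1 / ?c) \<odot> (?c \<odot> r) = (1 / ?c) \<odot> (?c \<odot> t)" by simp
  then show "r = t" using b(2) c by (simp flip: smult_distrib(3))
qed

lemma KR_decomp:
  assumes "x \<in> KR s R"
  shows "\<exists>m \<in> carrier R. \<exists>n \<in> carrier R. x = iota m \<oplus>\<^bsub>KRing\<^esub> iota n \<otimes>\<^bsub>KRing\<^esub> KE.pt E.kgen"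
  using assms
proof (induction x rule: KE.ext_induct)
  case (add x y)
  then obtain m n m' n' where c: "m \<in> carrier R" "n \<in> carrier R" "m' \<in> carrier R" "n' \<in> carrier R"
    and e: "x = iota m \<oplus>\<^bsub>KRing\<^esub> iota n \<otimes>\<^bsub>KRing\<^esub> KE.pt E.kgen" "y = iota m' \<oplus>\<^bsub>KRing\<^esub> iota n' \<otimes>\<^bsub>KRing\<^esub> KE.pt E.kgen"
    by blast
  have "KE.add_ext x y = iota (m \<oplus> m') \<oplus>\<^bsub>KRing\<^esub> iota (n \<oplus> n') \<otimes>\<^bsub>KRing\<^esub> KE.pt E.kgen"
    unfolding e add_KRing[symmetric] using c by (simp add: iota_hom H.l_distr H.a_ac)
  then show ?case using c by (meson add.m_closed)
next
  case (scale r x)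
  then obtain m n where c: "m \<in> carrier R" "n \<in> carrier R"
    and e: "x = iota m \<oplus>\<^bsub>KRing\<^esub> iota n \<otimes>\<^bsub>KRing\<^esub> KE.pt E.kgen" by blast
  have "KE.scale_ext r x = iota (r \<otimes> m) \<oplus>\<^bsub>KRing\<^esub> iota (r \<otimes> n) \<otimes>\<^bsub>KRing\<^esub> KE.pt E.kgen"
    using scale c unfolding iota_mult[OF scale(1,2), symmetric] by (simp add: e iota_hom H.r_distr H.m_assoc)
  then show ?case using c scale(1) by (meson m_closed)
next
  case zero
  have "KE.ext_zero = iota \<zero> \<oplus>\<^bsub>KRing\<^esub> iota \<zero> \<otimes>\<^bsub>KRing\<^esub> KE.pt E.kgen"
    unfolding iota_hom by (simp add: zero_KRing mult_KRing KR_zero add_KRing KE.add_zero)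
  then show ?case by (meson zero_closed)
next
  case (basis b)
  obtain m n where "b = s m 1 + s n E.kgen" using E.kgen(3) by blast
  then have "KE.pt b = iota (m \<odot> \<one>) \<oplus>\<^bsub>KRing\<^esub> iota (n \<odot> \<one>) \<otimes>\<^bsub>KRing\<^esub> KE.pt E.kgen"
    by (simp add: iota_mult) (simp add: iota_def KE.pt_add KE.pt_scale add_KRing)
  then show ?case by (meson one_closed smult_simps(1))
qed

text \<open>For \<open>x = m + n \<theta>\<close> symmetry means
  \<open>n \<theta> = - n \<theta>\<close>, and 2 is invertible. Being fixed by the involution thus
  characterises \<open>R\<close> inside \<open>K \<otimes> R\<close>, which justifies the linearity
  clause of \<open>hcent\<close>.\<close>

lemma symmetric_iota:
  assumes "x \<in> KR s R" "kbar x = x"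
  obtains r where "r \<in> carrier R" "x = iota r"
proof -
  obtain m n where c: "m \<in> carrier R" "n \<in> carrier R"
    and e: "x = iota m \<oplus>\<^bsub>KRing\<^esub> iota n \<otimes>\<^bsub>KRing\<^esub> KE.pt E.kgen"
    using KR_decomp[OF assms(1)] by blast
  let ?y = "iota n \<otimes>\<^bsub>KRing\<^esub> KE.pt E.kgen"
  have y: "?y \<in> carrier KRing" using c H.m_closed[of "iota n" "KE.pt E.kgen"] by simp
  have "kbar x = iota m \<oplus>\<^bsub>KRing\<^esub> \<ominus>\<^bsub>KRing\<^esub> ?y"
    using c unfolding e by (simp add: H.bar_add H.bar_mult H.r_minus)
  then have "iota m \<oplus>\<^bsub>KRing\<^esub> \<ominus>\<^bsub>KRing\<^esub> ?y = iota m \<oplus>\<^bsub>KRing\<^esub> ?y" using assms(2) e by simp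
  then have "\<ominus>\<^bsub>KRing\<^esub> ?y = ?y" using c y by (metis H.a_inv_closed H.add.l_cancel carrier_KRing iota_closed)
  then have "?y = \<zero>\<^bsub>KRing\<^esub>" using H.add_three[OF y] H.r_neg[OF y] H.uminus_add_uminus[OF y]
    by (metis H.minus_eq H.add_three y)
  then show ?thesis using that[of m] c e by simp
qed

subsection \<open>Coordinates\<close>

definition uc :: "nat \<Rightarrow> ('k cayley \<Rightarrow> 'u) \<Rightarrow> 'k \<Rightarrow> 'u" where
  "uc j x = (\<lambda>b \<in> kbasis s. x (cinj j b))"

definition upk :: "('k cayley \<Rightarrow> 'u) \<Rightarrow> ('k \<Rightarrow> 'u) cayley" where
  "upk x = (uc 0 x, uc 1 x, uc 2 x, uc 3 x)"

text \<open>A vector of \<open>cbasis\<close> has exactly one nonzero entry, and that entry tells to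
  which copy of \<open>K\<close> the vector belongs; the last branch is the fourth copy.\<close>

definition pk :: "('k \<Rightarrow> 'u) cayley \<Rightarrow> 'k cayley \<Rightarrow> 'u" where
  "pk = (\<lambda>(x0, x1, x2, x3). \<lambda>(c0, c1, c2, c3) \<in> cbasis s.
     if c0 \<noteq> 0 then x0 c0 else if c1 \<noteq> 0 then x1 c1 else if c2 \<noteq> 0 then x2 c2 else x3 c3)"

lemma cinj_in [simp]: "j < 4 \<Longrightarrow> b \<in> kbasis s \<Longrightarrow> cinj j b \<in> cbasis s"
  by (auto simp: cbasis_eq)

lemma uc_closed [simp]: "x \<in> CR s R \<Longrightarrow> j < 4 \<Longrightarrow> uc j x \<in> KR s R"
  by (auto simp: uc_def ext_carrier_def PiE_iff)

lemma upk_closed [simp]: "x \<in> CR s R \<Longrightarrow> upk x \<in> H.hcar"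
  by (simp add: upk_def)

lemma pk_cinj: 
  assumes "b \<in> kbasis s"
  shows "pk (x0, x1, x2, x3) (cinj 0 b) = x0 b" "pk (x0, x1, x2, x3) (cinj 1 b) = x1 b"
    "pk (x0, x1, x2, x3) (cinj 2 b) = x2 b" "pk (x0, x1, x2, x3) (cinj 3 b) = x3 b"
  using cinj_in[of 0 b] cinj_in[of 1 b] cinj_in[of 2 b] cinj_in[of 3 b] assms E.kbasis_nonzero[of b]
  by (simp_all add: pk_def cinj_def)

lemma pk_closed [simp]: "x \<in> H.hcar \<Longrightarrow> pk x \<in> CR s R"
proof -
  assume "x \<in> H.hcar"
  then obtain x0 x1 x2 x3 where x: "x = (x0, x1, x2, x3)" "x0 \<in> KR s R" "x1 \<in> KR s R" "x2 \<in> KR s R" "x3 \<in> KR s R"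
    by (auto elim: H.hcar_cases)
  have "pk x v \<in> carrier R" if "v \<in> cbasis s" for v
  proof -
    obtain j b where "v = cinj j b" "j < 4" "b \<in> kbasis s" using \<open>v \<in> cbasis s\<close> by (auto simp: cbasis_eq)
    then show ?thesis using x(2-5) by (auto simp: less_four pk_cinj x(1) simp flip: One_nat_def)
  qed
  then show "pk x \<in> CR s R" unfolding ext_carrier_def x(1) by (auto simp: pk_def)
qed

lemma upk_pk [simp]: "x \<in> H.hcar \<Longrightarrow> upk (pk x) = x"
proof -
  assume "x \<in> H.hcar"
  then obtain x0 x1 x2 x3 where x: "x = (x0, x1, x2, x3)" "x0 \<in> KR s R" "x1 \<in> KR s R" "x2 \<in> KR s R" "x3 \<in> KR s R"
    by (auto elim: H.hcar_cases)
  have "(\<lambda>b \<in> kbasis s. y b) = y" if "y \<in> KR s R" for y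
    using that by (auto simp: ext_carrier_def intro: extensional_restrict)
  then show ?thesis using x(2-5) by (simp add: x(1) upk_def uc_def pk_cinj del: One_nat_def cong: restrict_cong)
qed

lemma upk_inj: "\<lbrakk>upk x = upk y; x \<in> CR s R; y \<in> CR s R\<rbrakk> \<Longrightarrow> x = y"
proof (rule CE.ext_eqI)
  fix v assume e: "upk x = upk y" and "v \<in> cbasis s"
  then obtain j b where v: "v = cinj j b" "j < 4" "b \<in> kbasis s" by (auto simp: cbasis_eq)
  have "uc j x = uc j y" using e v(2) by (auto simp: upk_def less_four)
  then show "x v = y v" using v by (metis restrict_apply' uc_def)
qed

lemma pk_upk [simp]: "x \<in> CR s R \<Longrightarrow> pk (upk x) = x"
  by (rule upk_inj) simp_all

lemma upk_add: "\<lbrakk>x \<in> CR s R; y \<in> CR s R\<rbrakk> \<Longrightarrow> upk (CE.add_ext x y) = H.hadd (upk x) (upk y)"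
  by (auto simp: upk_def H.hadd_def add_KRing uc_def ext_add_def intro!: restrict_ext)

lemma upk_scale: "\<lbrakk>r \<in> carrier R; x \<in> CR s R\<rbrakk> \<Longrightarrow> upk (CE.scale_ext r x) = H.hscale (iota r) (upk x)"
  by (simp add: upk_def H.hscale_def iota_mult) (auto simp: uc_def ext_scale_def intro!: restrict_ext)

lemma upk_diff: "\<lbrakk>x \<in> CR s R; y \<in> CR s R\<rbrakk> \<Longrightarrow>
    upk (ext_diff (cbasis s) R x y) = H.hadd (upk x) (H.hscale (\<ominus>\<^bsub>KRing\<^esub> \<one>\<^bsub>KRing\<^esub>) (upk y))"
proof -
  assume xy: "x \<in> CR s R" "y \<in> CR s R"
  have "ext_diff (cbasis s) R x y = CE.add_ext x (CE.scale_ext (\<ominus> \<one>) y)"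
    using xy by (auto simp: ext_diff_def ext_add_def ext_scale_def minus_eq l_minus intro!: restrict_ext)
  then show ?thesis using xy by (simp add: upk_add upk_scale iota_hom)
qed

lemma upk_pt: "upk (CE.pt v) = (KE.pt (ccoord 0 v), KE.pt (ccoord 1 v), KE.pt (ccoord 2 v), KE.pt (ccoord 3 v))"
  by (auto simp: upk_def uc_def CE.pt_def KE.pt_def pure_tensor_def E.repr_cbasis simp del: One_nat_def intro!: restrict_ext)

lemma upk_zero: "upk CE.ext_zero = (\<zero>\<^bsub>KRing\<^esub>, \<zero>\<^bsub>KRing\<^esub>, \<zero>\<^bsub>KRing\<^esub>, \<zero>\<^bsub>KRing\<^esub>)"
  by (auto simp: upk_def uc_def zero_KRing CE.ext_zero_def KE.ext_zero_def intro!: restrict_ext)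

end

context quad_etale
begin

text \<open>The formula of \<open>wcross_eq\<close> one coordinate at a time, in the shape of
  \<open>hcross\<close>, so that the products over the field and over \<open>R\<close> can be
  compared term by term.\<close>

definition kcross :: "'k \<Rightarrow> 'k \<Rightarrow> 'k \<Rightarrow> 'k \<Rightarrow> 'k \<Rightarrow> 'k \<Rightarrow> 'k \<Rightarrow> 'k" where
  "kcross a x1 x2 x3 y1 y2 y3 = kconj s a * kconj s ((x2 * y3 - x3 * y2) +
     ((x2 * y3 - x3 * y2) + (x3 * y1 - x1 * y3) + (x1 * y2 - x2 * y1)))"

lemma cmult_explicit:
  "cmult s a (b, x1, x2, x3) (c, y1, y2, y3) =
    (b * c - wherm s (x1, x2, x3) (y1, y2, y3),
     b * y1 + kconj s c * x1 + kcross a x1 x2 x3 y1 y2 y3,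
     b * y2 + kconj s c * x2 + kcross a x2 x3 x1 y2 y3 y1,
     b * y3 + kconj s c * x3 + kcross a x3 x1 x2 y3 y1 y2)"
proof -
  have "wcross s a (x1, x2, x3) (y1, y2, y3) =
      (kcross a x1 x2 x3 y1 y2 y3, kcross a x2 x3 x1 y2 y3 y1, kcross a x3 x1 x2 y3 y1 y2)"
    unfolding wcross_eq Let_def kcross_def kconj_mult[of a]
    by (intro arg_cong2[of _ _ _ _ Pair] arg_cong2[of _ _ _ _ times] arg_cong[of _ _ "kconj s"] refl)
      (simp_all only: add_ac)
  then show ?thesis by (simp add: cmult_def wact_def)
qed

end

context etale_over
begin

lemma CR_mult_closed [simp]: "x \<in> CR s R \<Longrightarrow> y \<in> CR s R \<Longrightarrow> CR_mult s a R x y \<in> CR s R"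
  unfolding CR_mult_def by simp

lemma CR_mult_add:
  "\<lbrakk>x \<in> CR s R; x' \<in> CR s R; y \<in> CR s R\<rbrakk> \<Longrightarrow>
    CR_mult s a R (CE.add_ext x x') y = CE.add_ext (CR_mult s a R x y) (CR_mult s a R x' y)"
  "\<lbrakk>x \<in> CR s R; x' \<in> CR s R; y \<in> CR s R\<rbrakk> \<Longrightarrow>
    CR_mult s a R y (CE.add_ext x x') = CE.add_ext (CR_mult s a R y x) (CR_mult s a R y x')"
  unfolding CR_mult_def by (simp_all add: CE.bil_add_left CE.bil_add_right)

lemma CR_mult_scale:
  "\<lbrakk>x \<in> CR s R; r \<in> carrier R; y \<in> CR s R\<rbrakk> \<Longrightarrow>
    CR_mult s a R (CE.scale_ext r x) y = CE.scale_ext r (CR_mult s a R x y)"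
  "\<lbrakk>x \<in> CR s R; r \<in> carrier R; y \<in> CR s R\<rbrakk> \<Longrightarrow>
    CR_mult s a R x (CE.scale_ext r y) = CE.scale_ext r (CR_mult s a R x y)"
  unfolding CR_mult_def by (simp_all add: CE.bil_scale)

lemma CR_mult_zero: "x \<in> CR s R \<Longrightarrow> CR_mult s a R CE.ext_zero x = CE.ext_zero"
  "x \<in> CR s R \<Longrightarrow> CR_mult s a R x CE.ext_zero = CE.ext_zero"
  using CR_mult_scale(1)[of CE.ext_zero "\<zero>" x] CR_mult_scale(2)[of x "\<zero>" CE.ext_zero]
  by (simp_all add: CE.scale_zero)

lemma CR_mult_pt: "\<lbrakk>v \<in> cbasis s; w \<in> cbasis s\<rbrakk> \<Longrightarrow>
    CR_mult s a R (CE.pt v) (CE.pt w) = CE.pt (cmult s a v w)"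
  unfolding CR_mult_def by (simp only: CE.pt_basis CE.bil_pt_basis E.C.finite_basis)

lemma hscale_mult:
  assumes "r \<in> carrier KRing" "kbar r = r" "x \<in> H.hcar" "y \<in> H.hcar"
  shows "H.hmul (H.hscale r x) y = H.hscale r (H.hmul x y)"
    and "H.hmul x (H.hscale r y) = H.hscale r (H.hmul x y)"
proof -
  obtain p where r: "r = H.hev (p + hbar p)" by (rule H.symmetric_hev[OF assms(1,2)])
  obtain b x1 x2 x3 where x: "x = (H.hev b, H.hev x1, H.hev x2, H.hev x3)" by (rule H.hcar_hev[OF assms(3)])
  obtain c y1 y2 y3 where y: "y = (H.hev c, H.hev y1, H.hev y2, H.hev y3)" by (rule H.hcar_hev[OF assms(4)])
  show "H.hmul (H.hscale r x) y = H.hscale r (H.hmul x y)"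
    "H.hmul x (H.hscale r y) = H.hscale r (H.hmul x y)"
    unfolding x y r H.h_defs by (simp only: H.hev_simps, (intro arg_cong2[of _ _ _ _ Pair] arg_cong[of _ _ H.hev]; (simp only: herm_expand)?; (simp only: herm_collect)?))+
qed

lemma hzero_mult: "x \<in> H.hcar \<Longrightarrow> H.hmul (upk CE.ext_zero) x = upk CE.ext_zero"
  "x \<in> H.hcar \<Longrightarrow> H.hmul x (upk CE.ext_zero) = upk CE.ext_zero"
  by (auto elim!: H.hcar_cases simp: upk_zero H.hmul_def H.hsig_def H.hcross_def H.minus_eq)

lemma upk_mult_pt: "v \<in> cbasis s \<Longrightarrow> w \<in> cbasis s \<Longrightarrow>
  upk (CR_mult s a R (CE.pt v) (CE.pt w)) = H.hmul (upk (CE.pt v)) (upk (CE.pt w))"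
proof -
  assume vw: "v \<in> cbasis s" "w \<in> cbasis s"
  obtain b x1 x2 x3 where v: "v = (b, x1, x2, x3)" by (cases v rule: prod_cases4)
  obtain c y1 y2 y3 where w: "w = (c, y1, y2, y3)" by (cases w rule: prod_cases4)
  have "upk (CR_mult s a R (CE.pt v) (CE.pt w)) = upk (CE.pt (cmult s a v w))" using vw by (simp add: CR_mult_pt)
  also have "\<dots> = H.hmul (upk (CE.pt v)) (upk (CE.pt w))"
    unfolding v w E.cmult_explicit upk_pt
    by (simp only: H.hmul_def H.hsig_def H.hcross_def pt_hom ccoord_def wherm_def E.kcross_def
        case_prod_conv if_True if_False) simp
  finally show ?thesis .
qed

text \<open>Both sides are bilinear over \<open>R\<close>, and on basis tensors the two products are
  the same expression, because \<open>KE.pt\<close> is a ring homomorphism compatible with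
  conjugation.\<close>

lemma upk_mult:
  assumes "x \<in> CR s R" "y \<in> CR s R"
  shows "upk (CR_mult s a R x y) = H.hmul (upk x) (upk y)"
  using assms(1)
proof (induction x rule: CE.ext_induct)
  case (basis v)
  from assms(2) show ?case
    by (induction y rule: CE.ext_induct)
      (simp_all add: CR_mult_add CR_mult_scale CR_mult_zero upk_add upk_scale H.hmul_add_right
        hscale_mult hzero_mult upk_mult_pt basis)
qed (use assms in \<open>simp_all add: CR_mult_add CR_mult_scale CR_mult_zero upk_add upk_scale
  H.hmul_add_left hscale_mult hzero_mult\<close>)

lemma CR_tau_simps:
  "x \<in> CR s R \<Longrightarrow> CR_tau s R x \<in> CR s R"
  "\<lbrakk>x \<in> CR s R; y \<in> CR s R\<rbrakk> \<Longrightarrow> CR_tau s R (CE.add_ext x y) = CE.add_ext (CR_tau s R x) (CR_tau s R y)"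
  "\<lbrakk>r \<in> carrier R; x \<in> CR s R\<rbrakk> \<Longrightarrow> CR_tau s R (CE.scale_ext r x) = CE.scale_ext r (CR_tau s R x)"
  "v \<in> cbasis s \<Longrightarrow> CR_tau s R (CE.pt v) = CE.pt (ctau v)"
  unfolding CR_tau_def by (simp_all add: CE.lin_add CE.lin_scale)
    (simp only: CE.pt_basis CE.lin_pt_basis E.C.finite_basis)

lemma htau_simps:
  "\<lbrakk>x \<in> H.hcar; y \<in> H.hcar\<rbrakk> \<Longrightarrow> H.htau (H.hadd x y) = H.hadd (H.htau x) (H.htau y)"
  "H.htau (H.hscale r x) = H.hscale r (H.htau x)"
  by (auto elim!: H.hcar_cases simp: H.htau_def H.hadd_def H.hscale_def split: prod.splits)

lemma CR_tau_zero: "CR_tau s R CE.ext_zero = CE.ext_zero"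
  using CR_tau_simps(3)[of "\<zero>" CE.ext_zero] by (simp add: CE.scale_zero CR_tau_simps)

lemma upk_tau: "x \<in> CR s R \<Longrightarrow> upk (CR_tau s R x) = H.htau (upk x)"
proof (induction x rule: CE.ext_induct)
  case (basis v)
  then show ?case by (cases v rule: prod_cases4)
    (simp add: CR_tau_simps, simp add: upk_pt ctau_def H.htau_def ccoord_def)
next
  case zero
  show ?case by (simp add: CR_tau_zero upk_zero H.htau_def)
qed (simp_all add: CR_tau_simps upk_add upk_scale htau_simps)

subsection \<open>The norm\<close>

text \<open>With the ground field as a space of basis \<open>{1}\<close>, scalar-valued forms become
  a case of the vector-valued bilinear maps already treated.\<close>

lemma field_fin_basis: "fin_basis ((*) :: 'f \<Rightarrow> 'f \<Rightarrow> 'f) {1}"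
proof -
  interpret F: vector_space "(*) :: 'f \<Rightarrow> 'f \<Rightarrow> 'f" by unfold_locales (simp_all add: algebra_simps)
  show ?thesis
    by unfold_locales (auto simp: F.span_singleton F.dependent_single intro: range_eqI[of _ _ "_ * 1"])
qed

sublocale F: fin_basis "(*) :: 'f \<Rightarrow> 'f \<Rightarrow> 'f" "{1}" by (rule field_fin_basis)
sublocale FE: ext_space "(*) :: 'f \<Rightarrow> 'f \<Rightarrow> 'f" "{1}" R ..

lemma field_repr: "F.representation {1} v 1 = v"
  using F.repr_scale[of v 1 1] F.repr_basis[of 1 1] by simp

text \<open>Half of the polar form. Unlike the quadratic form it is additive in each argument, so
  that induction over tensors applies; the quadratic form is recovered on the diagonal.\<close>

definition polar :: "'v set \<Rightarrow> ('v::ab_group_add \<Rightarrow> 'f) \<Rightarrow> ('v \<Rightarrow> 'u) \<Rightarrow> ('v \<Rightarrow> 'u) \<Rightarrow> 'u" where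
  "polar B q x y = ext_bilinear B B (*) {1} R (\<lambda>b c. (q (b + c) - q b - q c) / 2) x y 1"

lemma ext_quadratic_polar: "ext_quadratic B R q x = polar B q x x"
  by (simp add: polar_def ext_bilinear_def ext_quadratic_def field_repr)

lemma polar_simps:
  assumes "finite B"
  shows "\<lbrakk>x \<in> ext_carrier B R; y \<in> ext_carrier B R\<rbrakk> \<Longrightarrow> polar B q x y \<in> carrier R"
    "\<lbrakk>x \<in> ext_carrier B R; x' \<in> ext_carrier B R; y \<in> ext_carrier B R\<rbrakk> \<Longrightarrow>
      polar B q (ext_add B R x x') y = polar B q x y \<oplus> polar B q x' y"
    "\<lbrakk>x \<in> ext_carrier B R; x' \<in> ext_carrier B R; y \<in> ext_carrier B R\<rbrakk> \<Longrightarrow>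
      polar B q y (ext_add B R x x') = polar B q y x \<oplus> polar B q y x'"
    "\<lbrakk>r \<in> carrier R; x \<in> ext_carrier B R; y \<in> ext_carrier B R\<rbrakk> \<Longrightarrow>
      polar B q (ext_scale B R r x) y = r \<otimes> polar B q x y"
    "\<lbrakk>r \<in> carrier R; x \<in> ext_carrier B R; y \<in> ext_carrier B R\<rbrakk> \<Longrightarrow>
      polar B q x (ext_scale B R r y) = r \<otimes> polar B q x y"
    "\<lbrakk>b \<in> B; c \<in> B\<rbrakk> \<Longrightarrow> polar B q (\<lambda>e \<in> B. if e = b then \<one> else \<zero>) (\<lambda>e \<in> B. if e = c then \<one> else \<zero>) =
      ((q (b + c) - q b - q c) / 2) \<odot> \<one>"
proof -
  show "\<lbrakk>x \<in> ext_carrier B R; y \<in> ext_carrier B R\<rbrakk> \<Longrightarrow> polar B q x y \<in> carrier R"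
    unfolding polar_def by (rule FE.extD) simp_all
  show "\<lbrakk>x \<in> ext_carrier B R; x' \<in> ext_carrier B R; y \<in> ext_carrier B R\<rbrakk> \<Longrightarrow>
      polar B q (ext_add B R x x') y = polar B q x y \<oplus> polar B q x' y"
    unfolding polar_def by (simp add: FE.bil_add_left) (simp add: ext_add_def)
  show "\<lbrakk>x \<in> ext_carrier B R; x' \<in> ext_carrier B R; y \<in> ext_carrier B R\<rbrakk> \<Longrightarrow>
      polar B q y (ext_add B R x x') = polar B q y x \<oplus> polar B q y x'"
    unfolding polar_def by (simp add: FE.bil_add_right) (simp add: ext_add_def)
  show "\<lbrakk>r \<in> carrier R; x \<in> ext_carrier B R; y \<in> ext_carrier B R\<rbrakk> \<Longrightarrow>
      polar B q (ext_scale B R r x) y = r \<otimes> polar B q x y"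
    unfolding polar_def using assms by (simp add: FE.bil_scale) (simp add: ext_scale_def)
  show "\<lbrakk>r \<in> carrier R; x \<in> ext_carrier B R; y \<in> ext_carrier B R\<rbrakk> \<Longrightarrow>
      polar B q x (ext_scale B R r y) = r \<otimes> polar B q x y"
    unfolding polar_def using assms by (simp add: FE.bil_scale) (simp add: ext_scale_def)
  show "\<lbrakk>b \<in> B; c \<in> B\<rbrakk> \<Longrightarrow> polar B q (\<lambda>e \<in> B. if e = b then \<one> else \<zero>) (\<lambda>e \<in> B. if e = c then \<one> else \<zero>) =
      ((q (b + c) - q b - q c) / 2) \<odot> \<one>"
    unfolding polar_def using assms
    by (simp only: FE.bil_pt_basis) (simp add: FE.pt_def pure_tensor_def field_repr)
qed

text \<open>Half of the polar form of the norm, the outer sign being the factor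
  \<open>1 / 2 = -1\<close>.\<close>

definition hpol :: "('k \<Rightarrow> 'u) cayley \<Rightarrow> ('k \<Rightarrow> 'u) cayley \<Rightarrow> ('k \<Rightarrow> 'u)" where
  "hpol x y = \<ominus>\<^bsub>KRing\<^esub> (H.hnorm (H.hadd x y) \<ominus>\<^bsub>KRing\<^esub> H.hnorm x \<ominus>\<^bsub>KRing\<^esub> H.hnorm y)"

lemma hpol_simps:
  assumes "x \<in> H.hcar" "y \<in> H.hcar" "z \<in> H.hcar"
  shows "hpol (H.hadd x y) z = hpol x z \<oplus>\<^bsub>KRing\<^esub> hpol y z"
    and "hpol z (H.hadd x y) = hpol z x \<oplus>\<^bsub>KRing\<^esub> hpol z y"
    and "hpol x x = H.hnorm x"
proof -
  obtain b x1 x2 x3 where x: "x = (H.hev b, H.hev x1, H.hev x2, H.hev x3)" by (rule H.hcar_hev[OF assms(1)])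
  obtain c y1 y2 y3 where y: "y = (H.hev c, H.hev y1, H.hev y2, H.hev y3)" by (rule H.hcar_hev[OF assms(2)])
  obtain d z1 z2 z3 where z: "z = (H.hev d, H.hev z1, H.hev z2, H.hev z3)" by (rule H.hcar_hev[OF assms(3)])
  show "hpol (H.hadd x y) z = hpol x z \<oplus>\<^bsub>KRing\<^esub> hpol y z"
    "hpol z (H.hadd x y) = hpol z x \<oplus>\<^bsub>KRing\<^esub> hpol z y" "hpol x x = H.hnorm x"
    unfolding x y z hpol_def H.h_defs by (simp only: H.hev_simps, (rule arg_cong[of _ _ H.hev]; (simp only: herm_expand)?; (simp only: herm_collect)?))+
qed

lemma hpol_scale:
  assumes "r \<in> carrier KRing" "kbar r = r" "x \<in> H.hcar" "y \<in> H.hcar"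
  shows "hpol (H.hscale r x) y = r \<otimes>\<^bsub>KRing\<^esub> hpol x y" "hpol x (H.hscale r y) = r \<otimes>\<^bsub>KRing\<^esub> hpol x y"
proof -
  obtain p where r: "r = H.hev (p + hbar p)" by (rule H.symmetric_hev[OF assms(1,2)])
  obtain b x1 x2 x3 where x: "x = (H.hev b, H.hev x1, H.hev x2, H.hev x3)" by (rule H.hcar_hev[OF assms(3)])
  obtain c y1 y2 y3 where y: "y = (H.hev c, H.hev y1, H.hev y2, H.hev y3)" by (rule H.hcar_hev[OF assms(4)])
  show "hpol (H.hscale r x) y = r \<otimes>\<^bsub>KRing\<^esub> hpol x y" "hpol x (H.hscale r y) = r \<otimes>\<^bsub>KRing\<^esub> hpol x y"
    unfolding x y r hpol_def H.h_defs by (simp only: H.hev_simps, (rule arg_cong[of _ _ H.hev]; (simp only: herm_expand)?; (simp only: herm_collect)?))+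
qed

end

section \<open>Submodules generated by a subspace\<close>

context ext_space
begin

abbreviation "esub \<equiv> ext_subspace s B R"

lemma esub_step:
  assumes y: "y \<in> esub U" and v: "v \<in> U" and r: "r \<in> carrier R"
  shows "add_ext (scale_ext r (pt v)) y \<in> esub U"
proof -
  obtain T r' where T: "finite T" "T \<subseteq> U" "r' \<in> T \<rightarrow> carrier R"
    and y: "y = (\<lambda>b \<in> B. finsum R (\<lambda>v. pure_tensor s B R v (r' v) b) T)"
    using y unfolding ext_subspace_def by auto
  have pc: "pure_tensor s B R w c b \<in> carrier R" if "c \<in> carrier R" "b \<in> B" for w c b
    using that by (simp add: pure_tensor_def)
  define T0 where "T0 = T - {v}"
  \<comment> \<open>The coefficient that \<open>v\<close> already has in the given sum, or zero; the
    new term is merged with it, since the sum is indexed by distinct vectors.\<close>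
  define c where "c = (if v \<in> T then r' v else \<zero>)"
  define r'' where "r'' = r'(v := r \<oplus> c)"
  have c: "c \<in> carrier R" using T by (auto simp: c_def)
  have T0: "finite T0" "v \<notin> T0" "insert v T \<subseteq> U" "insert v T = insert v T0" using T v by (auto simp: T0_def)
  have rc: "r' w \<in> carrier R" if "w \<in> T0" for w using T that by (auto simp: T0_def)
  have ty: "finsum R (\<lambda>v. pure_tensor s B R v (r' v) b) T =
      pure_tensor s B R v c b \<oplus> finsum R (\<lambda>v. pure_tensor s B R v (r' v) b) T0" if b: "b \<in> B" for b
  proof (cases "v \<in> T")
    case True
    then have "T = insert v T0" by (auto simp: T0_def)
    then show ?thesis using T0(1,2) True T rc c b
      by (simp add: finsum_insert pc c_def Pi_def)
  next
    case False
    then have "T = T0" by (auto simp: T0_def)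
    then show ?thesis using False b T rc by (simp add: c_def pc pure_tensor_def[of s B R v] finsum_closed Pi_def)
  qed
  have tn: "finsum R (\<lambda>v. pure_tensor s B R v (r'' v) b) (insert v T0) =
      pure_tensor s B R v (r \<oplus> c) b \<oplus> finsum R (\<lambda>v. pure_tensor s B R v (r' v) b) T0" if b: "b \<in> B" for b
  proof -
    have "finsum R (\<lambda>v. pure_tensor s B R v (r'' v) b) T0 = finsum R (\<lambda>v. pure_tensor s B R v (r' v) b) T0"
      using T0 rc b by (intro finsum_cong') (auto simp: r''_def pc)
    moreover have "finsum R (\<lambda>v. pure_tensor s B R v (r'' v) b) (insert v T0) =
        pure_tensor s B R v (r'' v) b \<oplus> finsum R (\<lambda>v. pure_tensor s B R v (r'' v) b) T0"
      by (rule finsum_insert) (use T0 rc b c r in \<open>auto simp: r''_def intro!: pc\<close>)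
    ultimately show ?thesis by (simp add: r''_def)
  qed
  have "add_ext (scale_ext r (pt v)) y = (\<lambda>b \<in> B. finsum R (\<lambda>v. pure_tensor s B R v (r'' v) b) (insert v T))"
    unfolding T0(4) ext_add_def
  proof (intro restrict_ext)
    fix b assume b: "b \<in> B"
    have f: "finsum R (\<lambda>v. pure_tensor s B R v (r' v) b) T0 \<in> carrier R"
      using rc b by (auto intro!: finsum_closed pc)
    have "y b = pure_tensor s B R v c b \<oplus> finsum R (\<lambda>v. pure_tensor s B R v (r' v) b) T0"
      using b ty by (simp add: y)
    moreover have "pure_tensor s B R v (r \<oplus> c) b = scale_ext r (pt v) b \<oplus> pure_tensor s B R v c b"
      using b r c by (simp add: pure_tensor_def ext_scale_def pt_def smult_distrib)
    ultimately show "scale_ext r (pt v) b \<oplus> y b = finsum R (\<lambda>v. pure_tensor s B R v (r'' v) b) (insert v T0)"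
      unfolding tn[OF b] using f b c r by (simp add: a_assoc pc)
  qed
  moreover have "r'' \<in> insert v T \<rightarrow> carrier R" using T c r by (auto simp: r''_def)
  ultimately show ?thesis unfolding ext_subspace_def using T T0 by blast
qed

lemma esub_zero: "ext_zero \<in> esub U"
  unfolding ext_subspace_def ext_zero_def
  by (rule CollectI, rule exI[of _ "{}"]) simp

lemma esub_induct [consumes 1, case_names zero step]:
  assumes x: "x \<in> esub U" and zero: "P ext_zero"
    and step: "\<And>v r x. \<lbrakk>v \<in> U; r \<in> carrier R; x \<in> VR; x \<in> esub U; P x\<rbrakk> \<Longrightarrow> P (add_ext (scale_ext r (pt v)) x)"
  shows "P x"
proof -
  obtain T r where T: "finite T" "T \<subseteq> U" "r \<in> T \<rightarrow> carrier R"
    and x: "x = (\<lambda>b \<in> B. finsum R (\<lambda>v. pure_tensor s B R v (r v) b) T)"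
    using x unfolding ext_subspace_def by auto
  have pc: "pure_tensor s B R w c b \<in> carrier R" if "c \<in> carrier R" "b \<in> B" for w c b
    using that by (simp add: pure_tensor_def)
  show ?thesis unfolding x using T
  proof (induction T rule: finite_induct)
    case empty
    then show ?case using zero by (simp add: ext_zero_def restrict_def)
  next
    case (insert v T)
    let ?x = "(\<lambda>b \<in> B. finsum R (\<lambda>v. pure_tensor s B R v (r v) b) T)"
    have r: "r w \<in> carrier R" if "w \<in> insert v T" for w using insert that by auto
    have "(\<lambda>b \<in> B. finsum R (\<lambda>v. pure_tensor s B R v (r v) b) (insert v T)) =
      add_ext (scale_ext (r v) (pt v)) ?x"
      unfolding ext_add_def using insert(1,2) r
      by (intro restrict_ext) (simp add: finsum_insert pc Pi_def pure_tensor_eq[symmetric])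
    moreover have "?x \<in> VR" using r by (auto simp: ext_carrier_def intro!: finsum_closed pc)
    moreover have "?x \<in> esub U" using insert unfolding ext_subspace_def by blast
    moreover have "P ?x" by (rule insert.IH) (use insert in auto)
    ultimately show ?case using step[of v "r v" ?x] insert r by simp
  qed
qed

lemma esub_closed: "x \<in> esub U \<Longrightarrow> x \<in> VR"
  by (induction x rule: esub_induct) simp_all

lemma ext_assoc:
  assumes "x \<in> VR" "y \<in> VR" "z \<in> VR"
  shows "add_ext (add_ext x y) z = add_ext x (add_ext y z)"
    and "r \<in> carrier R \<Longrightarrow> scale_ext r (add_ext x y) = add_ext (scale_ext r x) (scale_ext r y)"
    and "\<lbrakk>r \<in> carrier R; t \<in> carrier R\<rbrakk> \<Longrightarrow> scale_ext r (scale_ext t x) = scale_ext (r \<otimes> t) x"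
    and "scale_ext \<one> x = x"
proof -
  show "add_ext (add_ext x y) z = add_ext x (add_ext y z)"
    using assms by (auto simp: ext_add_def a_assoc intro!: restrict_ext)
  show "r \<in> carrier R \<Longrightarrow> scale_ext r (add_ext x y) = add_ext (scale_ext r x) (scale_ext r y)"
    using assms by (auto simp: ext_add_def ext_scale_def r_distr intro!: restrict_ext)
  show "\<lbrakk>r \<in> carrier R; t \<in> carrier R\<rbrakk> \<Longrightarrow> scale_ext r (scale_ext t x) = scale_ext (r \<otimes> t) x"
    using assms by (auto simp: ext_scale_def m_assoc intro!: restrict_ext)
  show "scale_ext \<one> x = x"
    by (rule ext_eqI) (use assms in simp, use assms in simp, use assms in \<open>simp add: ext_scale_def\<close>)
qed

lemma esub_add: "x \<in> esub U \<Longrightarrow> y \<in> esub U \<Longrightarrow> add_ext x y \<in> esub U"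
proof (induction x rule: esub_induct)
  case (step v r x)
  then show ?case by (simp add: ext_assoc(1) esub_closed esub_step)
qed (simp add: add_zero esub_closed)

lemma esub_scale: "x \<in> esub U \<Longrightarrow> t \<in> carrier R \<Longrightarrow> scale_ext t x \<in> esub U"
proof (induction x rule: esub_induct)
  case (step v r x)
  then show ?case by (simp add: ext_assoc(2,3) esub_step)
qed (simp add: scale_zero esub_zero)

lemma esub_pt: "v \<in> U \<Longrightarrow> pt v \<in> esub U"
  using esub_step[OF esub_zero, of v U "\<one>"] by (simp add: ext_assoc(4)[of _ "pt v" "pt v"] add_zero)

end

section \<open>The fixed algebra and its radical\<close>

context quad_etale
begin

lemma cfix_eq: "cfix = {(b, x, x, x) |b x :: 'k. True}"
  by (auto simp: cfix_def ctau_def)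

text \<open>On multiples of \<open>u = w1 + w2 + w3\<close> the hermitian form is a multiple of 6,
  hence zero, and the cross product vanishes because all minors do. So \<open>K u\<close> squares to
  zero, and the fixed algebra is a twisted form of the dual numbers over \<open>K\<close>.\<close>

lemma cmult_fix:
  "cmult s a (b, x, x, x) (c, y, y, y) = (b * c, b * y + kconj s c * x, b * y + kconj s c * x, b * y + kconj s c * x)"
proof -
  have "wherm s (x, x, x) (y, y, y) = - 3 * (2 * (x * kconj s y))"
    by (simp add: wherm_def algebra_simps)
  then show ?thesis by (simp add: cmult_explicit kcross_def three)
qed

lemma pow_zero: "b ^ n = 0 \<Longrightarrow> b = (0::'k)"
proof -
  assume "b ^ n = 0"
  then have "b ^ (2 ^ n) = 0" by (metis less_exp order_less_imp_le le_iff_add mult_zero_left power_add)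
  moreover have "b ^ (2 ^ m) = 0 \<Longrightarrow> b = 0" for m
  proof (induction m)
    case (Suc m)
    then have "b ^ (2 ^ m) * b ^ (2 ^ m) = 0" by (simp add: mult_2 flip: power_add)
    then show ?case using Suc.IH square_zero[of "b ^ (2 ^ m)"] by simp
  qed simp
  ultimately show "b = 0" by blast
qed

text \<open>The \<open>m\<close>-th power of \<open>(b, x, x, x)\<close> has
  \<open>K\<close>-component \<open>b^m\<close>, and \<open>K\<close> is reduced; conversely, the
  elements with \<open>b = 0\<close> form an ideal of square zero.\<close>

lemma cradical_eq: "cradical s a = {(0, x, x, x) |x :: 'k. True}"
proof
  show "cradical s a \<subseteq> {(0, x, x, x) |x :: 'k. True}"
  proof
    fix v assume "v \<in> cradical s a"
    then obtain I n where I: "v \<in> I" "I \<subseteq> cfix"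
      "\<And>ys. length ys = n \<Longrightarrow> set ys \<subseteq> I \<Longrightarrow> foldr (cmult s a) ys cone = 0"
      unfolding cradical_def nilpotent_fix_ideal_def by blast
    obtain b x where v: "v = (b, x, x, x)" using I(1,2) by (auto simp: cfix_eq)
    have "\<exists>y. foldr (cmult s a) (replicate m v) cone = (b ^ m, y, y, y)" for m
      by (induction m) (auto simp: cone_def v cmult_fix)
    then obtain y where "foldr (cmult s a) (replicate n v) cone = (b ^ n, y, y, y)" by blast
    moreover have "foldr (cmult s a) (replicate n v) cone = 0" by (rule I(3)) (use I(1) in auto)
    ultimately have "b ^ n = 0" by (simp add: zero_prod_def)
    then show "v \<in> {(0, x, x, x) |x :: 'k. True}" using pow_zero v by blast
  qed
  have "nilpotent_fix_ideal s a {(0, x, x, x) |x :: 'k. True}"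
    unfolding nilpotent_fix_ideal_def
  proof (intro conjI ballI)
    show "C.subspace {(0, x, x, x) |x :: 'k. True}"
      by (auto simp: C.subspace_def zero_prod_def cscale_def)
    show "\<exists>n. \<forall>ys. length ys = n \<longrightarrow> set ys \<subseteq> {(0, x, x, x) |x :: 'k. True} \<longrightarrow> foldr (cmult s a) ys cone = 0"
      \<comment> \<open>Two factors suffice since the ideal has square zero; the fold ends in the
        unit element.\<close>
      by (rule exI[of _ 2]) (auto simp: numeral_2_eq_2 length_Suc_conv cone_def cmult_fix zero_prod_def)
  qed (auto simp: cfix_eq cmult_fix)
  then show "{(0, x, x, x) |x :: 'k. True} \<subseteq> cradical s a"
    unfolding cradical_def by blast
qed

end

context etale_over
begin

lemma hadd_pt: "H.hadd (upk (CE.pt v)) (upk (CE.pt w)) = upk (CE.pt (v + w))"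
  by (simp add: upk_add CE.pt_add)

lemma hnorm_pt: "H.hnorm (upk (CE.pt v)) = KE.pt (s (cnorm s v) 1)"
proof -
  obtain b x1 x2 x3 where v: "v = (b, x1, x2, x3)" by (cases v rule: prod_cases4)
  show ?thesis unfolding v E.cnorm
    by (simp add: upk_pt ccoord_def H.hnorm_def H.hsig_def pt_hom wherm_def)
qed

lemma iota_pt: "iota (c \<odot> \<one>) = KE.pt (s c 1)"
  by (simp add: iota_def KE.pt_scale)

lemma s_half: "s (c / 2) x = - s c x"
  by (simp add: E.two_f)

lemma iota_polar_pt: "\<lbrakk>v \<in> cbasis s; w \<in> cbasis s\<rbrakk> \<Longrightarrow>
    iota (polar (cbasis s) (cnorm s) (CE.pt v) (CE.pt w)) = hpol (upk (CE.pt v)) (upk (CE.pt w))"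
  by (simp only: CE.pt_basis polar_simps(6) E.C.finite_basis iota_pt s_half)
    (simp only: hpol_def hadd_pt hnorm_pt pt_hom E.scale_left_diff_distrib flip: CE.pt_basis)

lemma hpol_closed [simp]: "x \<in> H.hcar \<Longrightarrow> y \<in> H.hcar \<Longrightarrow> hpol x y \<in> KR s R"
  using H.h_closed(7) by (simp add: hpol_def)

lemma hpol_zero:
  assumes "x \<in> H.hcar"
  shows "hpol (upk CE.ext_zero) x = \<zero>\<^bsub>KRing\<^esub>" "hpol x (upk CE.ext_zero) = \<zero>\<^bsub>KRing\<^esub>"
proof -
  have e: "H.hscale (iota \<zero>) (upk CE.ext_zero) = upk CE.ext_zero"
    using upk_scale[of "\<zero>" CE.ext_zero] by (simp add: CE.scale_zero)
  have "hpol (H.hscale (iota \<zero>) (upk CE.ext_zero)) x = iota \<zero> \<otimes>\<^bsub>KRing\<^esub> hpol (upk CE.ext_zero) x"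
    "hpol x (H.hscale (iota \<zero>) (upk CE.ext_zero)) = iota \<zero> \<otimes>\<^bsub>KRing\<^esub> hpol x (upk CE.ext_zero)"
    by (rule hpol_scale; use assms in simp)+
  then show "hpol (upk CE.ext_zero) x = \<zero>\<^bsub>KRing\<^esub>" "hpol x (upk CE.ext_zero) = \<zero>\<^bsub>KRing\<^esub>"
    unfolding e unfolding iota_hom using assms by simp_all
qed

lemma iota_polar:
  assumes "x \<in> CR s R" "y \<in> CR s R"
  shows "iota (polar (cbasis s) (cnorm s) x y) = hpol (upk x) (upk y)"
proof -
  note fin = E.C.finite_basis
  note rules = polar_simps[OF fin] iota_hom upk_add upk_scale hpol_simps(1,2) hpol_scale hpol_zero
  have z: "polar (cbasis s) (cnorm s) CE.ext_zero z = \<zero>" "polar (cbasis s) (cnorm s) z CE.ext_zero = \<zero>"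
    if "z \<in> CR s R" for z
    using polar_simps(4)[OF fin, of "\<zero>" CE.ext_zero z] polar_simps(5)[OF fin, of "\<zero>" z CE.ext_zero] that
    by (simp_all add: CE.scale_zero polar_simps[OF fin])
  show ?thesis using assms(1)
  proof (induction x rule: CE.ext_induct)
    case (basis v)
    from assms(2) show ?case
      by (induction y rule: CE.ext_induct) (simp_all add: rules z iota_polar_pt basis)
  qed (use assms in \<open>simp_all add: rules z\<close>)
qed

lemma iota_cnorm: "x \<in> CR s R \<Longrightarrow> iota (ext_quadratic (cbasis s) R (cnorm s) x) = H.hnorm (upk x)"
  by (simp add: ext_quadratic_polar iota_polar hpol_simps(3)[of _ "upk x" "upk x"])

lemma cnorm_closed: "x \<in> CR s R \<Longrightarrow> ext_quadratic (cbasis s) R (cnorm s) x \<in> carrier R"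
  by (simp add: ext_quadratic_polar polar_simps)

lemma cnorm_eq_iff: "\<lbrakk>x \<in> CR s R; y \<in> CR s R\<rbrakk> \<Longrightarrow>
   ext_quadratic (cbasis s) R (cnorm s) x = ext_quadratic (cbasis s) R (cnorm s) y \<longleftrightarrow>
   H.hnorm (upk x) = H.hnorm (upk y)"
  by (metis cnorm_closed iota_cnorm iota_inj)

text \<open>Stated for a general \<open>U\<close> because it serves both the fixed algebra and its
  radical.\<close>

lemma diagonal_esub:
  assumes U: "\<And>k. (0, k, k, k) \<in> U" and z: "z \<in> KR s R"
  shows "pk (\<zero>\<^bsub>KRing\<^esub>, z, z, z) \<in> CE.esub U" (is "?B z \<in> _")
  using z
proof (induction z rule: KE.ext_induct)
  case (add x y)
  have "?B (KE.add_ext x y) = CE.add_ext (?B x) (?B y)"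
    by (rule upk_inj) (use add in \<open>simp_all add: upk_add H.hadd_def add_KRing[symmetric]\<close>)
  then show ?case using add by (simp add: CE.esub_add)
next
  case (scale r x)
  have "?B (KE.scale_ext r x) = CE.scale_ext r (?B x)"
    by (rule upk_inj) (use scale in \<open>simp_all add: upk_scale H.hscale_def iota_mult[symmetric]\<close>)
  then show ?case using scale by (simp add: CE.esub_scale)
next
  case zero
  have "?B KE.ext_zero = CE.ext_zero" by (rule upk_inj) (simp_all add: upk_zero zero_KRing[symmetric])
  then show ?case by (simp add: CE.esub_zero)
next
  case (basis b)
  have "?B (KE.pt b) = CE.pt (0, b, b, b)" by (rule upk_inj) (simp_all add: upk_pt ccoord_def pt_hom)
  then show ?case by (simp add: CE.esub_pt U)
qed

lemma FixR_iff: "x \<in> FixR s R \<longleftrightarrow> x \<in> CR s R \<and> (\<exists>b \<in> KR s R. \<exists>z \<in> KR s R. upk x = (b, z, z, z))"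
proof
  show "x \<in> FixR s R \<Longrightarrow> x \<in> CR s R \<and> (\<exists>b \<in> KR s R. \<exists>z \<in> KR s R. upk x = (b, z, z, z))"
  proof (induction x rule: CE.esub_induct)
    case zero
    then show ?case by (auto simp: upk_zero)
  next
    case (step v r x)
    then obtain b z where bz: "b \<in> KR s R" "z \<in> KR s R" "upk x = (b, z, z, z)" by blast
    obtain c y where v: "v = (c, y, y, y)" using step(1) by (auto simp: E.cfix_eq)
    have "upk (CE.add_ext (CE.scale_ext r (CE.pt v)) x) =
      (let w = iota r \<otimes>\<^bsub>KRing\<^esub> KE.pt y \<oplus>\<^bsub>KRing\<^esub> z in (iota r \<otimes>\<^bsub>KRing\<^esub> KE.pt c \<oplus>\<^bsub>KRing\<^esub> b, w, w, w))"
      using step by (simp add: upk_add upk_scale bz upk_pt) (simp add: v ccoord_def H.hadd_def H.hscale_def Let_def)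
    then show ?case using step bz by (auto simp: Let_def)
  qed
next
  assume "x \<in> CR s R \<and> (\<exists>b \<in> KR s R. \<exists>z \<in> KR s R. upk x = (b, z, z, z))"
  then obtain b z where x: "x \<in> CR s R" and bz: "b \<in> KR s R" "z \<in> KR s R" "upk x = (b, z, z, z)" by blast
  let ?A = "\<lambda>b. pk (b, \<zero>\<^bsub>KRing\<^esub>, \<zero>\<^bsub>KRing\<^esub>, \<zero>\<^bsub>KRing\<^esub>)" and ?B = "\<lambda>z. pk (\<zero>\<^bsub>KRing\<^esub>, z, z, z)"
  have "?A b \<in> FixR s R" using bz(1)
  proof (induction b rule: KE.ext_induct)
    case (add x y)
    have "?A (KE.add_ext x y) = CE.add_ext (?A x) (?A y)"
      by (rule upk_inj) (use add in \<open>simp_all add: upk_add H.hadd_def add_KRing[symmetric]\<close>)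
    then show ?case using add by (simp add: CE.esub_add)
  next
    case (scale r x)
    have "?A (KE.scale_ext r x) = CE.scale_ext r (?A x)"
      by (rule upk_inj) (use scale in \<open>simp_all add: upk_scale H.hscale_def iota_mult[symmetric]\<close>)
    then show ?case using scale by (simp add: CE.esub_scale)
  next
    case zero
    have "?A KE.ext_zero = CE.ext_zero" by (rule upk_inj) (simp_all add: upk_zero zero_KRing[symmetric])
    then show ?case by (simp add: CE.esub_zero)
  next
    case (basis b)
    have "?A (KE.pt b) = CE.pt (b, 0, 0, 0)" by (rule upk_inj) (simp_all add: upk_pt ccoord_def pt_hom)
    then show ?case by (simp add: CE.esub_pt E.cfix_eq)
  qed
  moreover have "?B z \<in> FixR s R"
    by (rule diagonal_esub) (use bz in \<open>auto simp: E.cfix_eq\<close>)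
  moreover have "x = CE.add_ext (?A b) (?B z)"
    by (rule upk_inj) (use x bz in \<open>simp_all add: upk_add H.hadd_def\<close>)
  ultimately show "x \<in> FixR s R" by (simp add: CE.esub_add)
qed

end

section \<open>Exponentials as series in the commutator, and their conjugates\<close>

context herm_ring
begin

definition hcomm :: "'x cayley \<Rightarrow> 'x cayley \<Rightarrow> 'x cayley" where
  "hcomm x y = hadd (hmul x y) (hscale (\<ominus> \<one>) (hmul y x))"

lemma hcomm_closed [simp]: "x \<in> hcar \<Longrightarrow> y \<in> hcar \<Longrightarrow> hcomm x y \<in> hcar"
  by (simp add: hcomm_def)

text \<open>Identifies the closed formula for \<open>hexp\<close> with
  \<open>1 + ad + ad^2 / 2\<close>, the coefficient \<open>1 / 2\<close> being
  \<open>-1\<close>.\<close>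

lemma hexp_hcomm:
  assumes "k \<in> carrier A" "y \<in> hcar"
  shows "hexp k y = hadd (hadd y (hcomm (\<zero>, k, k, k) y))
    (hscale (\<ominus> \<one>) (hcomm (\<zero>, k, k, k) (hcomm (\<zero>, k, k, k) y)))"
proof -
  obtain k' where k: "k = hev k'" using assms hev_surj by blast
  obtain b x1 x2 x3 where y: "y = (hev b, hev x1, hev x2, hev x3)" by (rule hcar_hev[OF assms(2)])
  show ?thesis unfolding k y hcomm_def h_defs
    by (simp only: hev_simps) (intro arg_cong2[of _ _ _ _ Pair] arg_cong[of _ _ hev]; (simp only: herm_expand)?; (simp only: herm_collect)?)
qed

lemma hcent_inv:
  assumes "hcent g"
  shows "hcent (inv_into hcar g)"
proof -
  have g: "bij_betw g hcar hcar" using assms by (simp add: hcent_def)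
  let ?h = "inv_into hcar g"
  have h: "?h x \<in> hcar" "g (?h x) = x" if "x \<in> hcar" for x
    using that g by (auto simp: bij_betw_def inv_into_into f_inv_into_f)
  have hg: "?h (g x) = x" if "x \<in> hcar" for x using that g by (simp add: bij_betw_inv_into_left)
  note D = hcentD[OF assms]
  show ?thesis
  proof (rule hcentI[where h = g])
    fix x y assume xy: "x \<in> hcar" "y \<in> hcar"
    show "?h (hadd x y) = hadd (?h x) (?h y)"
      using hg[of "hadd (?h x) (?h y)"] xy h by (simp add: D)
    show "?h (hmul x y) = hmul (?h x) (?h y)"
      using hg[of "hmul (?h x) (?h y)"] xy h by (simp add: D)
    show "hnorm (?h x) = hnorm x" using D(5)[of "?h x"] xy h by simp
    show "?h (htau x) = htau (?h x)" using hg[of "htau (?h x)"] xy h by (simp add: D)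
  next
    fix r x assume "r \<in> carrier A" "bar r = r" "x \<in> hcar"
    then show "?h (hscale r x) = hscale r (?h x)"
      using hg[of "hscale r (?h x)"] h by (simp add: D)
  qed (use h hg D in auto)
qed

lemma hcent_id: "hcent (\<lambda>x. x)"
  by (rule hcentI[where h = "\<lambda>x. x"]) simp_all

text \<open>An automorphism carries commutators to commutators, and \<open>hexp\<close> is a
  polynomial in them. This gives both the action of the cube roots of unity on
  \<open>K_functor\<close> and the commuting of \<open>K_functor\<close> with
  \<open>N_functor\<close>.\<close>

lemma hcent_hexp_conj:
  assumes g: "hcent g" and k: "k \<in> carrier A" "k' \<in> carrier A" "g (\<zero>, k, k, k) = (\<zero>, k', k', k')" and x: "x \<in> hcar"
  shows "g (hexp k x) = hexp k' (g x)"
proof -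
  have c: "g (hcomm u v) = hcomm (g u) (g v)" if "u \<in> hcar" "v \<in> hcar" for u v
    using that g by (simp add: hcomm_def hcentD bar_minus)
  have u: "(\<zero>, k, k, k) \<in> hcar" using k by simp
  show ?thesis using g x u k hcentD(1)[OF g x]
    by (simp add: hexp_hcomm hcentD bar_minus c)
qed

lemma hcirc_hmu:
  assumes "p \<in> carrier A" "q \<in> carrier A" "r \<in> carrier A" "u \<in> carrier A" "x \<in> hcar"
  shows "hcirc p q r (hmu u x) = hmu u (hcirc p q r x)"
  using assms by (auto elim!: hcar_cases simp: hcirc_def hmu_def r_distr m_lcomm)

lemma hnil_hmu:
  assumes "s \<in> carrier A" "q \<in> carrier A" "u \<in> carrier A" "x \<in> hcar"
  shows "hnil s q (hmu u x) = hmu u (hnil s q x)"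
  using assms unfolding hnil_def by (simp add: hcirc_hmu)

end

context herm_ring_skew
begin

lemma hmul_fix:
  assumes "b \<in> carrier A" "c \<in> carrier A" "x \<in> carrier A" "y \<in> carrier A"
  shows "hmul (b, x, x, x) (c, y, y, y) =
    (b \<otimes> c, b \<otimes> y \<oplus> bar c \<otimes> x, b \<otimes> y \<oplus> bar c \<otimes> x, b \<otimes> y \<oplus> bar c \<otimes> x)"
proof -
  obtain b' c' x' y' where e: "b = hev b'" "c = hev c'" "x = hev x'" "y = hev y'"
    using assms hev_surj by metis
  show ?thesis unfolding e h_defs by (simp only: hev_simps) (intro arg_cong2[of _ _ _ _ Pair] arg_cong[of _ _ hev]; (simp only: herm_expand)?; (simp only: herm_collect)?)
qed

text \<open>A multiple of \<open>w1 + w2 + w3\<close> is fixed by the shift and anticommutes with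
  \<open>th\<close>. Its image anticommutes with \<open>g th\<close>, whose
  \<open>K\<close>-component \<open>y th\<close> is invertible, so the image has no
  \<open>K\<close>-component: the radical is preserved.\<close>

lemma hcent_hU:
  assumes g: "hcent g" and z: "z \<in> carrier A"
  obtains w where "g (hU z) = hU w" "w \<in> carrier A"
proof -
  obtain y v where y: "g (hK th) = (y \<otimes> th, v, v, v)" "y \<in> carrier A" "v \<in> carrier A" "y \<otimes> y = \<one>"
    using hcent_th[OF g] by metis
  have "htau (g (hU z)) = g (hU z)" using g z by (simp flip: hcentD(6)) (simp add: htau_def hU_def)
  then obtain b w where bw: "g (hU z) = (b, w, w, w)" "b \<in> carrier A" "w \<in> carrier A"
    using htau_fixed[OF _ hcentD(1)[OF g hKU_closed(2)[OF z]]] by metis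
  have "hadd (hmul (hK th) (hU z)) (hmul (hU z) (hK th)) = hK \<zero>"
    using z by (simp add: hK_def hU_def hmul_fix) (simp add: hadd_def l_minus r_neg)
  then have "g (hadd (hmul (hK th) (hU z)) (hmul (hU z) (hK th))) = g (hK \<zero>)" by simp
  moreover have "g (hK \<zero>) = hK \<zero>"
  proof -
    have "hK \<zero> = hscale \<zero> (hK \<one>)" by (simp add: hK_def hscale_def)
    then show ?thesis using g by (simp add: hcentD hcent_one)
  qed
  ultimately have "hadd (hmul (y \<otimes> th, v, v, v) (b, w, w, w)) (hmul (b, w, w, w) (y \<otimes> th, v, v, v)) = hK \<zero>"
    using g z by (simp add: hcentD bw(1) y(1))
  then have "y \<otimes> th \<otimes> b \<oplus> b \<otimes> (y \<otimes> th) = \<zero>"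
    using y bw by (simp add: hmul_fix) (simp add: hadd_def hK_def)
  then have "y \<otimes> th \<otimes> b \<oplus> y \<otimes> th \<otimes> b = \<zero>" using y bw by (simp add: m_comm)
  then have "\<ominus> (y \<otimes> th \<otimes> b) = \<zero>" using add_three[of "y \<otimes> th \<otimes> b"] y bw by simp
  then have 0: "y \<otimes> th \<otimes> b = \<zero>" using y bw by (metis m_closed minus_minus minus_zero th_closed)
  have "b = y \<otimes> y \<otimes> (th' \<otimes> th) \<otimes> b" using y bw by simp
  also have "\<dots> = y \<otimes> th' \<otimes> (y \<otimes> th \<otimes> b)" using y(2) bw(2) by (simp add: m_ac del: th_inv th_inv')
  finally have "b = \<zero>" using 0 y by simp
  then show ?thesis using that bw by (simp add: hU_def)
qed

lemma hnil_hK: "\<lbrakk>s \<in> carrier A; q \<in> carrier A; b \<in> carrier A; z \<in> carrier A\<rbrakk> \<Longrightarrow> hnil s q (b, z, z, z) = (b, z, z, z)"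
proof -
  assume c: "s \<in> carrier A" "q \<in> carrier A" "b \<in> carrier A" "z \<in> carrier A"
  obtain s' q' b' z' where e: "s = hev s'" "q = hev q'" "b = hev b'" "z = hev z'"
    using c hev_surj by metis
  show ?thesis unfolding e h_defs by (simp only: hev_simps) (intro arg_cong2[of _ _ _ _ Pair] arg_cong[of _ _ hev]; (simp only: herm_expand)?; (simp only: herm_collect)?)
qed

text \<open>The values at \<open>th\<close>, at \<open>w1 + w2 + w3\<close> and at \<open>w1\<close>
  recover \<open>k\<close>, then \<open>r\<close>, then the pair \<open>s\<close>, \<open>q\<close>;
  hence the decomposition is unique.\<close>

lemma structure_values:
  assumes "k \<in> carrier A" "r \<in> carrier A" "s \<in> carrier A" "q \<in> carrier A"
  shows "hexp k (hmu r (hnil s q (hK th))) = (th, k \<otimes> th, k \<otimes> th, k \<otimes> th)"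
    and "hexp k (hmu r (hnil s q (hU \<one>))) = hU r"
    and "hnil s q (\<zero>, \<one>, \<zero>, \<zero>) =
      (\<zero>, \<one> \<ominus> s \<otimes> s \<oplus> q, q \<ominus> s \<ominus> s \<otimes> s, s \<ominus> s \<otimes> s \<oplus> q)"
proof -
  have "hmu r (hnil s q (hK th)) = hK th" using assms by (simp add: hK_def hnil_hK) (simp add: hmu_def)
  then show "hexp k (hmu r (hnil s q (hK th))) = (th, k \<otimes> th, k \<otimes> th, k \<otimes> th)"
    using assms by (simp add: hexp_th)
  show "hexp k (hmu r (hnil s q (hU \<one>))) = hU r" using assms
    by (simp add: hU_def hnil_hK) (simp add: hmu_def hexp_hK minus_eq)
  show "hnil s q (\<zero>, \<one>, \<zero>, \<zero>) =
      (\<zero>, \<one> \<ominus> s \<otimes> s \<oplus> q, q \<ominus> s \<ominus> s \<otimes> s, s \<ominus> s \<otimes> s \<oplus> q)"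
    using assms by (simp add: hnil_def hcirc_def)
qed

lemma hnil_inj:
  assumes "s \<in> carrier A" "q \<in> carrier A" "s' \<in> carrier A" "q' \<in> carrier A"
    and "hnil s q (\<zero>, \<one>, \<zero>, \<zero>) = hnil s' q' (\<zero>, \<one>, \<zero>, \<zero>)"
  shows "s = s' \<and> q = q'"
proof -
  have eq: "s = (\<one> \<ominus> s \<otimes> s \<oplus> q) \<ominus> (q \<ominus> s \<ominus> s \<otimes> s) \<ominus> \<one>"
    "q = (\<one> \<ominus> s \<otimes> s \<oplus> q) \<ominus> \<one> \<oplus> s \<otimes> s" if sq: "s \<in> carrier A" "q \<in> carrier A" for s q
  proof -
    obtain s' q' where e: "s = hev s'" "q = hev q'" using hev_surj[OF sq(1)] hev_surj[OF sq(2)] by blast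
    show "s = (\<one> \<ominus> s \<otimes> s \<oplus> q) \<ominus> (q \<ominus> s \<ominus> s \<otimes> s) \<ominus> \<one>" "q = (\<one> \<ominus> s \<otimes> s \<oplus> q) \<ominus> \<one> \<oplus> s \<otimes> s"
      unfolding e by (simp only: hev_simps, (rule arg_cong[of _ _ hev]; (simp only: herm_expand)?; (simp only: herm_collect)?))+
  qed
  have 1: "\<one> \<ominus> s \<otimes> s \<oplus> q = \<one> \<ominus> s' \<otimes> s' \<oplus> q'" "q \<ominus> s \<ominus> s \<otimes> s = q' \<ominus> s' \<ominus> s' \<otimes> s'"
    using assms(5) unfolding structure_values(3)[OF one_closed one_closed assms(1,2)]
      structure_values(3)[OF one_closed one_closed assms(3,4)] by simp_all
  have s: "s = s'"
    by (subst eq(1)[OF assms(1,2)], subst eq(1)[OF assms(3,4)]) (simp only: 1)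
  show ?thesis
    by (rule conjI[OF s], subst eq(2)[OF assms(1,2)], subst eq(2)[OF assms(3,4)]) (simp only: s 1[unfolded s])
qed

text \<open>As \<open>th\<close> is skew, the twist sends it to \<open>- 2 y th = y th\<close>: the
  flip realises the sign \<open>y\<close>.\<close>

lemma hflip_th: "y \<in> carrier A \<Longrightarrow> r \<in> carrier A \<Longrightarrow> hflip y r (hK th) = (y \<otimes> th, \<zero>, \<zero>, \<zero>)"
proof -
  assume y: "y \<in> carrier A" and r: "r \<in> carrier A"
  obtain y' t' where e: "y = hev y'" "th = hev t'" using hev_surj[OF y] hev_surj[OF th_closed] by blast
  have "(y \<ominus> \<one>) \<otimes> \<ominus> th \<ominus> (y \<oplus> \<one>) \<otimes> th = y \<otimes> th"
    unfolding e by (simp only: hev_simps) (rule arg_cong[of _ _ hev]; (simp only: herm_expand)?; (simp only: herm_collect)?)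
  then show ?thesis using y r by (simp add: hflip_def hK_def htwist_def minus_eq)
qed

end

context etale_over
begin

subsection \<open>Points of the group functors\<close>

abbreviation HG where "HG \<equiv> pts (cent_functor s a) R"

text \<open>Together with \<open>low\<close> this passes between maps on quadruples and maps on
  coordinate families. Only \<open>lift\<close> restricts its domain, because the members of
  \<open>Bij\<close> are extensional.\<close>

definition lift :: "(('k \<Rightarrow> 'u) cayley \<Rightarrow> ('k \<Rightarrow> 'u) cayley) \<Rightarrow> ('k cayley \<Rightarrow> 'u) \<Rightarrow> 'k cayley \<Rightarrow> 'u" where
  "lift h = (\<lambda>x \<in> CR s R. pk (h (upk x)))"

definition low :: "(('k cayley \<Rightarrow> 'u) \<Rightarrow> 'k cayley \<Rightarrow> 'u) \<Rightarrow> ('k \<Rightarrow> 'u) cayley \<Rightarrow> ('k \<Rightarrow> 'u) cayley" where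
  "low g V = upk (g (pk V))"

lemma upk_bij: "bij_betw upk (CR s R) H.hcar"
  by (rule bij_betw_byWitness[where f' = pk]) auto

lemma pk_bij: "bij_betw pk H.hcar (CR s R)"
  by (rule bij_betw_byWitness[where f' = upk]) auto

lemma pk_hom:
  "\<lbrakk>V \<in> H.hcar; W \<in> H.hcar\<rbrakk> \<Longrightarrow> pk (H.hadd V W) = CE.add_ext (pk V) (pk W)"
  "\<lbrakk>V \<in> H.hcar; W \<in> H.hcar\<rbrakk> \<Longrightarrow> pk (H.hmul V W) = CR_mult s a R (pk V) (pk W)"
  "\<lbrakk>r \<in> carrier R; V \<in> H.hcar\<rbrakk> \<Longrightarrow> pk (H.hscale (iota r) V) = CE.scale_ext r (pk V)"
  "V \<in> H.hcar \<Longrightarrow> pk (H.htau V) = CR_tau s R (pk V)"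
  by (rule upk_inj; simp add: upk_add upk_mult upk_scale upk_tau CR_tau_simps)+

lemma cent_carrier:
  "g \<in> carrier HG \<longleftrightarrow> g \<in> Bij (CR s R) \<and>
    (\<forall>x \<in> CR s R. \<forall>y \<in> CR s R. g (CE.add_ext x y) = CE.add_ext (g x) (g y)) \<and>
    (\<forall>r \<in> carrier R. \<forall>x \<in> CR s R. g (CE.scale_ext r x) = CE.scale_ext r (g x)) \<and>
    (\<forall>x \<in> CR s R. \<forall>y \<in> CR s R. g (CR_mult s a R x y) = CR_mult s a R (g x) (g y)) \<and>
    (\<forall>x \<in> CR s R. ext_quadratic (cbasis s) R (cnorm s) (g x) = ext_quadratic (cbasis s) R (cnorm s) x) \<and>
    (\<forall>x \<in> CR s R. g (CR_tau s R x) = CR_tau s R (g x))"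
  by (auto simp: cent_functor_def aut_functor_def ext_algebra_auts_def)

lemma centD:
  assumes "g \<in> carrier HG"
  shows "g \<in> Bij (CR s R)" "g \<in> extensional (CR s R)" "x \<in> CR s R \<Longrightarrow> g x \<in> CR s R"
    "\<lbrakk>x \<in> CR s R; y \<in> CR s R\<rbrakk> \<Longrightarrow> g (CE.add_ext x y) = CE.add_ext (g x) (g y)"
    "\<lbrakk>r \<in> carrier R; x \<in> CR s R\<rbrakk> \<Longrightarrow> g (CE.scale_ext r x) = CE.scale_ext r (g x)"
    "\<lbrakk>x \<in> CR s R; y \<in> CR s R\<rbrakk> \<Longrightarrow> g (CR_mult s a R x y) = CR_mult s a R (g x) (g y)"
    "x \<in> CR s R \<Longrightarrow> ext_quadratic (cbasis s) R (cnorm s) (g x) = ext_quadratic (cbasis s) R (cnorm s) x"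
    "x \<in> CR s R \<Longrightarrow> g (CR_tau s R x) = CR_tau s R (g x)"
  using assms unfolding cent_carrier by (auto simp: Bij_def dest: bij_betwE)

lemma hcent_low: "g \<in> carrier HG \<Longrightarrow> H.hcent (low g)"
proof -
  assume g: "g \<in> carrier HG"
  note D = centD[OF g]
  have "bij_betw g (CR s R) (CR s R)" using D(1) by (simp add: Bij_def)
  then have "bij_betw (upk \<circ> (g \<circ> pk)) H.hcar H.hcar"
    using bij_betw_trans[OF bij_betw_trans[OF pk_bij] upk_bij] by simp
  moreover have "low g = upk \<circ> (g \<circ> pk)" by (simp add: low_def fun_eq_iff)
  ultimately have 1: "bij_betw (low g) H.hcar H.hcar" by simp
  have 2: "low g (H.hscale r V) = H.hscale r (low g V)"
    if r: "r \<in> KR s R" "kbar r = r" and V: "V \<in> H.hcar" for r V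
  proof -
    obtain t where t: "t \<in> carrier R" "r = iota t" by (rule symmetric_iota[OF r])
    then show ?thesis using V by (simp add: low_def pk_hom D upk_scale)
  qed
  have 3: "H.hnorm (low g V) = H.hnorm V" if "V \<in> H.hcar" for V
    using cnorm_eq_iff[of "g (pk V)" "pk V"] that by (simp add: D low_def)
  show ?thesis unfolding H.hcent_def
    by (intro conjI ballI allI impI 1 2 3) (simp_all add: low_def pk_hom D upk_add upk_mult upk_tau)
qed

lemma lift_in: "H.hcent h \<Longrightarrow> lift h \<in> carrier HG"
proof -
  assume h: "H.hcent h"
  note D = H.hcentD[OF h]
  have "bij_betw (pk \<circ> (h \<circ> upk)) (CR s R) (CR s R)"
    using bij_betw_trans[OF bij_betw_trans[OF upk_bij] pk_bij] h by (simp add: H.hcent_def)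
  then have "bij_betw (lift h) (CR s R) (CR s R)"
    by (simp add: lift_def cong: bij_betw_cong)
  then have "lift h \<in> Bij (CR s R)" by (simp add: Bij_def lift_def)
  then show ?thesis unfolding cent_carrier
    by (auto simp: lift_def upk_add upk_scale upk_mult upk_tau CR_tau_simps D pk_hom cnorm_eq_iff)
qed

lemma low_lift: "H.hcent h \<Longrightarrow> V \<in> H.hcar \<Longrightarrow> low (lift h) V = h V"
  by (simp add: low_def lift_def H.hcentD)

lemma lift_low: "g \<in> carrier HG \<Longrightarrow> lift (low g) = g"
  using centD(2,3)[of g] by (auto simp: lift_def low_def fun_eq_iff extensional_def)

lemma lift_cong: "(\<And>V. V \<in> H.hcar \<Longrightarrow> h V = h' V) \<Longrightarrow> lift h = lift h'"
  unfolding lift_def by (rule restrict_ext) simp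

lemma cent_mult: "\<lbrakk>g \<in> carrier HG; h \<in> carrier HG\<rbrakk> \<Longrightarrow> g \<otimes>\<^bsub>HG\<^esub> h = compose (CR s R) g h"
  using centD(1)[of g] centD(1)[of h] by (simp add: cent_functor_def aut_functor_def BijGroup_def)

lemma cent_one: "\<one>\<^bsub>HG\<^esub> = lift (\<lambda>V. V)"
  by (auto simp: cent_functor_def aut_functor_def BijGroup_def lift_def)

lemma compose_lift: "\<lbrakk>H.hcent g; H.hcent h\<rbrakk> \<Longrightarrow> compose (CR s R) (lift g) (lift h) = lift (\<lambda>V. g (h V))"
  by (auto simp: compose_def lift_def H.hcentD)

lemma lift_mult: "\<lbrakk>H.hcent g; H.hcent h\<rbrakk> \<Longrightarrow> lift g \<otimes>\<^bsub>HG\<^esub> lift h = lift (\<lambda>V. g (h V))"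
  by (simp add: cent_mult lift_in compose_lift)

lemma cent_mult_lift: "\<lbrakk>g \<in> carrier HG; h \<in> carrier HG\<rbrakk> \<Longrightarrow> g \<otimes>\<^bsub>HG\<^esub> h = lift (\<lambda>V. low g (low h V))"
  using lift_mult[OF hcent_low hcent_low] by (simp add: lift_low)

lemma low_mult: "\<lbrakk>g \<in> carrier HG; h \<in> carrier HG; V \<in> H.hcar\<rbrakk> \<Longrightarrow> low (g \<otimes>\<^bsub>HG\<^esub> h) V = low g (low h V)"
  by (simp add: cent_mult_lift low_lift H.hcent_compose hcent_low)

lemma cent_group: "group HG"
proof (rule groupI)
  fix g h k assume g: "g \<in> carrier HG" and h: "h \<in> carrier HG" and k: "k \<in> carrier HG"
  show "g \<otimes>\<^bsub>HG\<^esub> h \<in> carrier HG"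
    using g h by (simp add: cent_mult_lift lift_in H.hcent_compose hcent_low)
  show "g \<otimes>\<^bsub>HG\<^esub> h \<otimes>\<^bsub>HG\<^esub> k = g \<otimes>\<^bsub>HG\<^esub> (h \<otimes>\<^bsub>HG\<^esub> k)"
    using g h k by (simp add: cent_mult_lift lift_in H.hcent_compose hcent_low low_lift H.hcentD cong: lift_cong)
next
  show "\<one>\<^bsub>HG\<^esub> \<in> carrier HG" by (simp add: cent_one lift_in H.hcent_id)
next
  fix g assume g: "g \<in> carrier HG"
  show "\<one>\<^bsub>HG\<^esub> \<otimes>\<^bsub>HG\<^esub> g = g"
    using lift_mult[OF H.hcent_id hcent_low[OF g]] g by (simp add: cent_one lift_low)
  let ?h = "inv_into H.hcar (low g)"
  have h: "H.hcent ?h" by (rule H.hcent_inv[OF hcent_low[OF g]])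
  have "lift ?h \<otimes>\<^bsub>HG\<^esub> lift (low g) = \<one>\<^bsub>HG\<^esub>"
    unfolding cent_one using hcent_low[OF g] h
    by (auto simp: lift_mult H.hcent_def bij_betw_inv_into_left intro!: lift_cong)
  then show "\<exists>h \<in> carrier HG. h \<otimes>\<^bsub>HG\<^esub> g = \<one>\<^bsub>HG\<^esub>"
    using lift_in[OF h] g by (auto simp: lift_low)
qed

subsection \<open>The subgroups\<close>

lemma upk_ad: "\<lbrakk>x \<in> CR s R; y \<in> CR s R\<rbrakk> \<Longrightarrow> upk (CR_ad s a R x y) = H.hcomm (upk x) (upk y)"
  by (simp add: CR_ad_def upk_diff upk_mult H.hcomm_def)

lemma CR_ad_closed [simp]: "\<lbrakk>x \<in> CR s R; y \<in> CR s R\<rbrakk> \<Longrightarrow> CR_ad s a R x y \<in> CR s R"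
  by (simp add: CR_ad_def)

lemma exp_ad_lift:
  assumes "x \<in> CR s R" "upk x = (\<zero>\<^bsub>KRing\<^esub>, z, z, z)" "z \<in> KR s R"
  shows "exp_ad s a R x = lift (H.hexp z)"
proof -
  have h: "(1 / 2) \<odot> \<one> = \<ominus> \<one>" by (simp add: E.two_f smult_uminus)
  have "upk (CE.add_ext (CE.add_ext y (CR_ad s a R x y))
     (CE.scale_ext ((1 / 2) \<odot> \<one>) (CR_ad s a R x (CR_ad s a R x y)))) = H.hexp z (upk y)"
    if "y \<in> CR s R" for y
    using that assms unfolding h by (simp add: H.hexp_hcomm upk_add upk_scale upk_ad iota_hom)
  then have "CE.add_ext (CE.add_ext y (CR_ad s a R x y))
     (CE.scale_ext ((1 / 2) \<odot> \<one>) (CR_ad s a R x (CR_ad s a R x y))) = pk (H.hexp z (upk y))"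
    if "y \<in> CR s R" for y
    using that assms by (intro upk_inj) simp_all
  then show ?thesis by (auto simp: exp_ad_def lift_def)
qed

lemma radR_iff: "x \<in> CE.esub (cradical s a) \<longleftrightarrow> x \<in> CR s R \<and> (\<exists>z \<in> KR s R. upk x = (\<zero>\<^bsub>KRing\<^esub>, z, z, z))"
proof
  show "x \<in> CE.esub (cradical s a) \<Longrightarrow> x \<in> CR s R \<and> (\<exists>z \<in> KR s R. upk x = (\<zero>\<^bsub>KRing\<^esub>, z, z, z))"
  proof (induction x rule: CE.esub_induct)
    case zero
    then show ?case by (auto simp: upk_zero intro!: bexI[of _ "\<zero>\<^bsub>KRing\<^esub>"])
  next
    case (step v r x)
    then obtain z where bz: "z \<in> KR s R" "upk x = (\<zero>\<^bsub>KRing\<^esub>, z, z, z)" by blast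
    obtain y where v: "v = (0, y, y, y)" using step(1) by (auto simp: E.cradical_eq)
    have "upk (CE.add_ext (CE.scale_ext r (CE.pt v)) x) =
      (let w = iota r \<otimes>\<^bsub>KRing\<^esub> KE.pt y \<oplus>\<^bsub>KRing\<^esub> z in (\<zero>\<^bsub>KRing\<^esub>, w, w, w))"
      using step by (simp add: upk_add upk_scale bz upk_pt)
        (simp add: v ccoord_def H.hadd_def H.hscale_def Let_def flip: pt_hom(5))
    then show ?case using step bz by (auto simp: Let_def)
  qed
next
  assume "x \<in> CR s R \<and> (\<exists>z \<in> KR s R. upk x = (\<zero>\<^bsub>KRing\<^esub>, z, z, z))"
  then obtain z where x: "x \<in> CR s R" and z: "z \<in> KR s R" "upk x = (\<zero>\<^bsub>KRing\<^esub>, z, z, z)" by blast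
  have "pk (\<zero>\<^bsub>KRing\<^esub>, z, z, z) \<in> CE.esub (cradical s a)"
    by (rule diagonal_esub) (use z in \<open>auto simp: E.cradical_eq\<close>)
  then show "x \<in> CE.esub (cradical s a)" using x z(2) pk_upk by metis
qed

lemma K_carrier: "carrier (pts (K_functor s a) R) = (\<lambda>z. lift (H.hexp z)) ` KR s R"
proof -
  have "exp_ad s a R ` CE.esub (cradical s a) = (\<lambda>z. lift (H.hexp z)) ` KR s R"
  proof (intro equalityI subsetI)
    fix g assume "g \<in> exp_ad s a R ` CE.esub (cradical s a)"
    then show "g \<in> (\<lambda>z. lift (H.hexp z)) ` KR s R" by (auto simp: radR_iff exp_ad_lift)
  next
    fix g assume "g \<in> (\<lambda>z. lift (H.hexp z)) ` KR s R"
    then obtain z where z: "z \<in> KR s R" "g = lift (H.hexp z)" by blast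
    let ?x = "pk (\<zero>\<^bsub>KRing\<^esub>, z, z, z)"
    have "?x \<in> CE.esub (cradical s a)" "g = exp_ad s a R ?x"
      using z exp_ad_lift[of ?x z] by (simp_all add: radR_iff)
    then show "g \<in> exp_ad s a R ` CE.esub (cradical s a)" by blast
  qed
  then show ?thesis by (simp add: K_functor_def)
qed

lemma mu_embed_lift:
  assumes r: "r \<in> KR s R"
  shows "mu_embed s R r = lift (H.hmu r)"
proof -
  let ?L = "ext_linear (cbasis s) (cscale s) (cbasis s) R (\<lambda>(b, w). (b, 0))"
  let ?M = "ext_bilinear (kbasis s) (cbasis s) (cscale s) (cbasis s) R (\<lambda>k (b, w). (0, wact k w))"
  let ?P = "\<lambda>V :: ('k \<Rightarrow> 'u) cayley. (fst V, \<zero>\<^bsub>KRing\<^esub>, \<zero>\<^bsub>KRing\<^esub>, \<zero>\<^bsub>KRing\<^esub>)"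
  let ?Q = "\<lambda>r V. H.hmu r (\<zero>\<^bsub>KRing\<^esub>, snd V)"
  note fin = E.C.finite_basis E.K.finite_basis
  have L: "upk (?L x) = ?P (upk x)" if "x \<in> CR s R" for x
    using that
  proof (induction x rule: CE.ext_induct)
    case (basis v)
    have "?L (CE.pt v) = CE.pt (fst v, 0)"
      using basis by (simp only: CE.pt_basis CE.lin_pt_basis fin) (simp add: case_prod_unfold)
    then show ?case by (cases v rule: prod_cases4) (simp add: upk_pt ccoord_def pt_hom zero_prod_def)
  next
    case zero
    have "?L CE.ext_zero = CE.ext_zero"
      using CE.lin_scale[OF fin(1), of CE.ext_zero "\<zero>" "\<lambda>(b, w). (b, 0)"] by (simp add: CE.scale_zero)
    then show ?case by (simp add: upk_zero)
  next
    case (add x y)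
    then show ?case by (simp add: CE.lin_add upk_add) (simp add: H.hadd_def upk_def)
  next
    case (scale r x)
    then show ?case by (simp add: CE.lin_scale fin upk_scale) (simp add: H.hscale_def upk_def)
  qed
  have Mz: "?M KE.ext_zero x = CE.ext_zero" "y \<in> KR s R \<Longrightarrow> ?M y CE.ext_zero = CE.ext_zero" if "x \<in> CR s R" for x y
    using CE.bil_scale(1)[OF fin(2,1), of KE.ext_zero "\<zero>" x "\<lambda>k (b, w). (0, wact k w)"]
      CE.bil_scale(2)[OF fin(2,1), of y "\<zero>" CE.ext_zero "\<lambda>k (b, w). (0, wact k w)"] that
    by (simp_all add: CE.scale_zero KE.scale_zero)
  have M: "upk (?M r x) = ?Q r (upk x)" if x: "x \<in> CR s R" for x
    using r
  proof (induction r rule: KE.ext_induct)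
    case (basis k)
    from x show ?case
    proof (induction x rule: CE.ext_induct)
      case (basis v)
      have "?M (KE.pt k) (CE.pt v) = CE.pt (0, wact k (snd v))"
        using basis \<open>k \<in> kbasis s\<close>
        by (simp only: CE.pt_basis KE.pt_basis CE.bil_pt_basis fin) (simp add: case_prod_unfold)
      then show ?case by (cases v rule: prod_cases4) (simp add: upk_pt ccoord_def pt_hom wact_def H.hmu_def)
    next
      case zero
      show ?case using Mz x by (simp add: upk_zero H.hmu_def)
    next
      case (add x y)
      then show ?case
        by (simp add: CE.bil_add_right upk_add) (simp add: H.hadd_def upk_def H.hmu_def H.r_distr)
    next
      case (scale r x)
      then show ?case
        by (simp add: CE.bil_scale fin upk_scale) (simp add: H.hscale_def upk_def H.hmu_def H.m_lcomm)
    qed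
  next
    case zero
    show ?case unfolding Mz(1)[OF x] upk_zero using x by (simp add: H.hmu_def upk_def flip: zero_KRing)
  next
    case (add r r')
    then show ?case using x
      by (simp add: CE.bil_add_left upk_add) (simp add: H.hadd_def upk_def H.hmu_def H.l_distr flip: add_KRing)
  next
    case (scale t r)
    then show ?case using x
      by (simp add: CE.bil_scale fin upk_scale) (simp add: H.hscale_def upk_def H.hmu_def H.m_assoc flip: iota_mult)
  qed
  have "pk (H.hmu r (upk x)) = CE.add_ext (?L x) (?M r x)" if x: "x \<in> CR s R" for x
  proof (rule upk_inj)
    obtain x0 x1 x2 x3 where e: "upk x = (x0, x1, x2, x3)" "x0 \<in> carrier KRing" "x1 \<in> carrier KRing"
      "x2 \<in> carrier KRing" "x3 \<in> carrier KRing" by (rule H.hcar_cases[OF upk_closed[OF x]])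
    then have "upk (CE.add_ext (?L x) (?M r x)) = H.hmu r (upk x)" using x r
      by (simp add: upk_add L M) (simp add: H.hadd_def H.hmu_def)
    then show "upk (pk (H.hmu r (upk x))) = upk (CE.add_ext (?L x) (?M r x))"
      using x r by simp
  qed (use x r in simp_all)
  then show ?thesis by (auto simp: mu_embed_def lift_def)
qed

end

context etale_over
begin

abbreviation "theta \<equiv> KE.pt E.kgen"

lemma knorm_pt: "H.hnorm (HS.hK (KE.pt v)) = KE.pt (s (knorm s v) 1)"
  unfolding E.knorm by (simp add: HS.hK_def H.hnorm_def H.hsig_def pt_hom flip: pt_hom(5))

lemma hK_hom: "\<lbrakk>x \<in> KR s R; y \<in> KR s R\<rbrakk> \<Longrightarrow> HS.hK (KE.add_ext x y) = H.hadd (HS.hK x) (HS.hK y)"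
  "\<lbrakk>r \<in> carrier R; x \<in> KR s R\<rbrakk> \<Longrightarrow> HS.hK (KE.scale_ext r x) = H.hscale (iota r) (HS.hK x)"
  by (simp_all add: HS.hK_def H.hadd_def H.hscale_def iota_mult[symmetric] flip: add_KRing)

lemma hK_zero: "HS.hK KE.ext_zero = upk CE.ext_zero"
  by (simp add: HS.hK_def upk_zero zero_KRing)

lemma hK_closed [simp]: "x \<in> KR s R \<Longrightarrow> HS.hK x \<in> H.hcar" "x \<in> KR s R \<Longrightarrow> HS.hU x \<in> H.hcar"
  using HS.hKU_closed[of x] by simp_all

lemma iota_kpolar_pt: "\<lbrakk>v \<in> kbasis s; w \<in> kbasis s\<rbrakk> \<Longrightarrow>
    iota (polar (kbasis s) (knorm s) (KE.pt v) (KE.pt w)) = hpol (HS.hK (KE.pt v)) (HS.hK (KE.pt w))"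
  by (simp only: KE.pt_basis polar_simps(6) E.K.finite_basis iota_pt s_half)
    (simp only: hpol_def hK_hom[symmetric] KE.ext_closed KE.pt_add[symmetric] knorm_pt pt_hom
      E.scale_left_diff_distrib flip: KE.pt_basis)

lemma iota_kpolar:
  assumes "x \<in> KR s R" "y \<in> KR s R"
  shows "iota (polar (kbasis s) (knorm s) x y) = hpol (HS.hK x) (HS.hK y)"
proof -
  note fin = E.K.finite_basis
  note rules = polar_simps[OF fin] iota_hom hK_hom hpol_simps(1,2) hpol_scale hpol_zero hK_zero
  have z: "polar (kbasis s) (knorm s) KE.ext_zero z = \<zero>" "polar (kbasis s) (knorm s) z KE.ext_zero = \<zero>"
    if "z \<in> KR s R" for z
    using polar_simps(4)[OF fin, of "\<zero>" KE.ext_zero z] polar_simps(5)[OF fin, of "\<zero>" z KE.ext_zero] that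
    by (simp_all add: KE.scale_zero polar_simps[OF fin])
  show ?thesis using assms(1)
  proof (induction x rule: KE.ext_induct)
    case (basis v)
    from assms(2) show ?case
      by (induction y rule: KE.ext_induct) (simp_all add: rules z iota_kpolar_pt basis)
  qed (use assms in \<open>simp_all add: rules z\<close>)
qed

text \<open>\<open>K\<close> is viewed inside the Cayley algebra, so that the polar form
  \<open>hpol\<close> of the larger norm serves again.\<close>

lemma iota_knorm: "x \<in> KR s R \<Longrightarrow> iota (ext_quadratic (kbasis s) R (knorm s) x) = x \<otimes>\<^bsub>KRing\<^esub> kbar x"
  by (simp add: ext_quadratic_polar iota_kpolar hpol_simps(3)[of _ "HS.hK x" "HS.hK x"])
    (simp add: HS.hK_def H.hnorm_def H.hsig_def)

lemma mu_carrier: "r \<in> carrier (pts (mu_functor s) R) \<longleftrightarrow> r \<in> KR s R \<and>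
    r \<otimes>\<^bsub>KRing\<^esub> (r \<otimes>\<^bsub>KRing\<^esub> r) = \<one>\<^bsub>KRing\<^esub> \<and> r \<otimes>\<^bsub>KRing\<^esub> kbar r = \<one>\<^bsub>KRing\<^esub>"
proof -
  have "ext_quadratic (kbasis s) R (knorm s) r = \<one> \<longleftrightarrow> r \<otimes>\<^bsub>KRing\<^esub> kbar r = \<one>\<^bsub>KRing\<^esub>" if "r \<in> KR s R"
    using iota_knorm[OF that] iota_hom(3) iota_inj[of "ext_quadratic (kbasis s) R (knorm s) r" "\<one>"] that
    by (auto simp: ext_quadratic_polar polar_simps)
  then show ?thesis by (auto simp: mu_functor_def mult_KRing one_KRing KR_one_pt)
qed

lemma mu_mult: "r \<otimes>\<^bsub>pts (mu_functor s) R\<^esub> t = r \<otimes>\<^bsub>KRing\<^esub> t"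
  and mu_one: "\<one>\<^bsub>pts (mu_functor s) R\<^esub> = \<one>\<^bsub>KRing\<^esub>"
  by (simp_all add: mu_functor_def mult_KRing one_KRing KR_one_pt)

lemma mu_group: "group (pts (mu_functor s) R)"
proof (rule groupI)
  fix r t u assume r: "r \<in> carrier (pts (mu_functor s) R)" and t: "t \<in> carrier (pts (mu_functor s) R)"
    and u: "u \<in> carrier (pts (mu_functor s) R)"
  have rt: "r \<in> KR s R" "t \<in> KR s R" "u \<in> KR s R" using r t u by (simp_all add: mu_carrier)
  have "(r \<otimes>\<^bsub>KRing\<^esub> t) \<otimes>\<^bsub>KRing\<^esub> ((r \<otimes>\<^bsub>KRing\<^esub> t) \<otimes>\<^bsub>KRing\<^esub> (r \<otimes>\<^bsub>KRing\<^esub> t)) =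
      (r \<otimes>\<^bsub>KRing\<^esub> (r \<otimes>\<^bsub>KRing\<^esub> r)) \<otimes>\<^bsub>KRing\<^esub> (t \<otimes>\<^bsub>KRing\<^esub> (t \<otimes>\<^bsub>KRing\<^esub> t))"
    "(r \<otimes>\<^bsub>KRing\<^esub> t) \<otimes>\<^bsub>KRing\<^esub> kbar (r \<otimes>\<^bsub>KRing\<^esub> t) = (r \<otimes>\<^bsub>KRing\<^esub> kbar r) \<otimes>\<^bsub>KRing\<^esub> (t \<otimes>\<^bsub>KRing\<^esub> kbar t)"
    using rt by (simp_all add: H.m_ac H.bar_mult)
  then show "r \<otimes>\<^bsub>pts (mu_functor s) R\<^esub> t \<in> carrier (pts (mu_functor s) R)"
    using r t by (simp add: mu_carrier mu_mult)
  show "r \<otimes>\<^bsub>pts (mu_functor s) R\<^esub> t \<otimes>\<^bsub>pts (mu_functor s) R\<^esub> u =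
      r \<otimes>\<^bsub>pts (mu_functor s) R\<^esub> (t \<otimes>\<^bsub>pts (mu_functor s) R\<^esub> u)"
    using rt by (simp add: mu_mult H.m_assoc)
next
  show "\<one>\<^bsub>pts (mu_functor s) R\<^esub> \<in> carrier (pts (mu_functor s) R)" by (simp add: mu_carrier mu_one)
next
  fix r assume r: "r \<in> carrier (pts (mu_functor s) R)"
  then have r': "r \<in> KR s R" "r \<otimes>\<^bsub>KRing\<^esub> (r \<otimes>\<^bsub>KRing\<^esub> r) = \<one>\<^bsub>KRing\<^esub>" "r \<otimes>\<^bsub>KRing\<^esub> kbar r = \<one>\<^bsub>KRing\<^esub>"
    by (simp_all add: mu_carrier)
  show "\<one>\<^bsub>pts (mu_functor s) R\<^esub> \<otimes>\<^bsub>pts (mu_functor s) R\<^esub> r = r"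
    using r' by (simp add: mu_one mu_mult)
  have c: "kbar r \<otimes>\<^bsub>KRing\<^esub> r = \<one>\<^bsub>KRing\<^esub>" using r' by (simp add: H.m_comm)
  moreover have "kbar r \<in> carrier (pts (mu_functor s) R)"
    using r' c H.cube_root_of_unity(2)[of r] by (simp add: mu_carrier)
  ultimately show "\<exists>t \<in> carrier (pts (mu_functor s) R). t \<otimes>\<^bsub>pts (mu_functor s) R\<^esub> r = \<one>\<^bsub>pts (mu_functor s) R\<^esub>"
    by (auto simp: mu_mult mu_one)
qed

lemma hcent_hmu': "r \<in> carrier (pts (mu_functor s) R) \<Longrightarrow> H.hcent (H.hmu r)"
  by (rule H.hcent_hmu) (simp_all add: mu_carrier)

lemma hcent_hexp': "z \<in> KR s R \<Longrightarrow> H.hcent (H.hexp z)"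
  by (rule H.hcent_hexp) simp

text \<open>The symmetric elements of \<open>K \<otimes> R\<close> come from \<open>R\<close> and
  the skew ones from \<open>R \<theta>\<close>, so the two parameters of \<open>hnil\<close> amount
  to a free pair in \<open>R\<close>; this is the coordinate system on
  \<open>N_functor\<close>.\<close>

definition nilp :: "'u \<Rightarrow> 'u \<Rightarrow> ('k \<Rightarrow> 'u) cayley \<Rightarrow> ('k \<Rightarrow> 'u) cayley" where
  "nilp m n = H.hnil (iota m) (iota n \<otimes>\<^bsub>KRing\<^esub> theta)"

lemma skew_theta: "n \<in> carrier R \<Longrightarrow> kbar (iota n \<otimes>\<^bsub>KRing\<^esub> theta) = \<ominus>\<^bsub>KRing\<^esub> (iota n \<otimes>\<^bsub>KRing\<^esub> theta)"
  by (simp add: H.bar_mult H.r_minus)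

lemma skew_iota:
  assumes "q \<in> KR s R" "kbar q = \<ominus>\<^bsub>KRing\<^esub> q"
  obtains n where "n \<in> carrier R" "q = iota n \<otimes>\<^bsub>KRing\<^esub> theta"
proof -
  let ?t' = "KE.pt (s (1 / E.kdisc) E.kgen)"
  have "kbar (q \<otimes>\<^bsub>KRing\<^esub> ?t') = q \<otimes>\<^bsub>KRing\<^esub> ?t'"
    using assms HS.bar_th' by (simp add: H.bar_mult H.l_minus H.r_minus)
  then obtain n where n: "n \<in> carrier R" "q \<otimes>\<^bsub>KRing\<^esub> ?t' = iota n"
    using symmetric_iota[of "q \<otimes>\<^bsub>KRing\<^esub> ?t'"] assms by (metis H_closed(1) KE.ext_closed(4))
  have "q = (q \<otimes>\<^bsub>KRing\<^esub> ?t') \<otimes>\<^bsub>KRing\<^esub> theta"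
    using assms HS.th_inv' by (simp add: H.m_assoc)
  then show ?thesis using that n by simp
qed

lemma theta_cancel: "\<lbrakk>x \<otimes>\<^bsub>KRing\<^esub> theta = y \<otimes>\<^bsub>KRing\<^esub> theta; x \<in> KR s R; y \<in> KR s R\<rbrakk> \<Longrightarrow> x = y"
  using HS.th_cancel[of x y] by simp

lemma hcent_nilp: "m \<in> carrier R \<Longrightarrow> n \<in> carrier R \<Longrightarrow> H.hcent (nilp m n)"
  unfolding nilp_def by (rule H.hcent_hnil) (simp_all add: skew_theta)

lemma nilp_nilp:
  "\<lbrakk>m \<in> carrier R; n \<in> carrier R; m' \<in> carrier R; n' \<in> carrier R; V \<in> H.hcar\<rbrakk> \<Longrightarrow>
    nilp m n (nilp m' n' V) = nilp (m \<oplus> m') (n \<oplus> n') V"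
  unfolding nilp_def by (simp add: H.hnil_hnil skew_theta iota_hom H.l_distr)

lemma cent_structure:
  assumes g: "g \<in> carrier HG" and y: "fst (low g (HS.hK theta)) = theta"
  obtains z r m n where "z \<in> KR s R" "r \<in> carrier (pts (mu_functor s) R)" "m \<in> carrier R" "n \<in> carrier R"
    "g = lift (\<lambda>V. H.hexp z (H.hmu r (nilp m n V)))"
proof -
  obtain y v where "low g (HS.hK theta) = (y \<otimes>\<^bsub>KRing\<^esub> theta, v, v, v)" "v \<in> carrier KRing"
    using HS.hcent_th[OF hcent_low[OF g]] by metis
  then have v: "low g (HS.hK theta) = (theta, v, v, v)" "v \<in> carrier KRing" using y by simp_all
  obtain z r t q where zr: "z \<in> carrier KRing" "r \<in> carrier KRing" "t \<in> carrier KRing" "q \<in> carrier KRing"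
    "r \<otimes>\<^bsub>KRing\<^esub> (r \<otimes>\<^bsub>KRing\<^esub> r) = \<one>\<^bsub>KRing\<^esub>" "r \<otimes>\<^bsub>KRing\<^esub> kbar r = \<one>\<^bsub>KRing\<^esub>" "kbar t = t"
    "kbar q = \<ominus>\<^bsub>KRing\<^esub> q"
    and e: "\<And>V. V \<in> H.hcar \<Longrightarrow> low g V = H.hexp z (H.hmu r (H.hnil t q V))"
    using HS.hcent_structure[OF hcent_low[OF g] v] by metis
  obtain m where m: "m \<in> carrier R" "t = iota m" using symmetric_iota[of t] zr by auto
  obtain n where n: "n \<in> carrier R" "q = iota n \<otimes>\<^bsub>KRing\<^esub> theta" using skew_iota[of q] zr by auto
  have "g = lift (low g)" using g by (simp add: lift_low)
  also have "\<dots> = lift (\<lambda>V. H.hexp z (H.hmu r (nilp m n V)))"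
    by (rule lift_cong) (simp add: e nilp_def m n)
  finally show ?thesis using that zr m n by (simp add: mu_carrier)
qed

lemma nilp_fixes: "\<lbrakk>m \<in> carrier R; n \<in> carrier R; b \<in> KR s R; z \<in> KR s R\<rbrakk> \<Longrightarrow> nilp m n (b, z, z, z) = (b, z, z, z)"
  unfolding nilp_def using HS.hnil_hK[of "iota m" "iota n \<otimes>\<^bsub>KRing\<^esub> theta" b z] by simp

lemma structure_unique:
  assumes c: "z \<in> KR s R" "r \<in> carrier (pts (mu_functor s) R)" "m \<in> carrier R" "n \<in> carrier R"
    and c': "z' \<in> KR s R" "r' \<in> carrier (pts (mu_functor s) R)" "m' \<in> carrier R" "n' \<in> carrier R"
    and eq: "lift (\<lambda>V. H.hexp z (H.hmu r (nilp m n V))) = lift (\<lambda>V. H.hexp z' (H.hmu r' (nilp m' n' V)))"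
  shows "z = z' \<and> r = r' \<and> m = m' \<and> n = n'"
proof -
  have ce: "H.hcent (\<lambda>V. H.hexp z (H.hmu r (nilp m n V)))"
    if "z \<in> KR s R" "r \<in> carrier (pts (mu_functor s) R)" "m \<in> carrier R" "n \<in> carrier R" for z r m n
    by (rule H.hcent_compose[OF hcent_hexp' H.hcent_compose[OF hcent_hmu' hcent_nilp]]) (use that in simp_all)
  have e: "H.hexp z (H.hmu r (nilp m n V)) = H.hexp z' (H.hmu r' (nilp m' n' V))" if "V \<in> H.hcar" for V
    using low_lift[OF ce[OF c] that] low_lift[OF ce[OF c'] that] eq by simp
  have r: "r \<in> KR s R" "r' \<in> KR s R" using c c' by (simp_all add: mu_carrier)
  have "z \<otimes>\<^bsub>KRing\<^esub> theta = z' \<otimes>\<^bsub>KRing\<^esub> theta"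
    using e[of "HS.hK theta"] HS.structure_values(1)[of z r "iota m" "iota n \<otimes>\<^bsub>KRing\<^esub> theta"]
      HS.structure_values(1)[of z' r' "iota m'" "iota n' \<otimes>\<^bsub>KRing\<^esub> theta"] c c' r by (simp add: nilp_def)
  then have z: "z = z'" using theta_cancel c c' by blast
  have "HS.hU r = HS.hU r'"
    using e[of "HS.hU \<one>\<^bsub>KRing\<^esub>"] HS.structure_values(2)[of z r "iota m" "iota n \<otimes>\<^bsub>KRing\<^esub> theta"]
      HS.structure_values(2)[of z' r' "iota m'" "iota n' \<otimes>\<^bsub>KRing\<^esub> theta"] c c' r by (simp add: nilp_def)
  then have r': "r = r'" by (simp add: HS.hU_def)
  let ?W = "(\<zero>\<^bsub>KRing\<^esub>, \<one>\<^bsub>KRing\<^esub>, \<zero>\<^bsub>KRing\<^esub>, \<zero>\<^bsub>KRing\<^esub>)"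
  have W: "?W \<in> H.hcar" by simp
  \<comment> \<open>With \<open>z\<close> and \<open>r\<close> identified, the common factor is
    cancelled by its injectivity, and only the unipotent factors remain to be compared.\<close>
  have inj: "inj_on (\<lambda>V. H.hexp z (H.hmu r V)) H.hcar"
    using H.hcent_compose[OF hcent_hexp'[OF c(1)] hcent_hmu'[OF c(2)]] by (simp add: H.hcent_def bij_betw_def)
  have "nilp m n ?W = nilp m' n' ?W"
    using inj_onD[OF inj, of "nilp m n ?W" "nilp m' n' ?W"] e[OF W] z r' W
      H.hcentD(1)[OF hcent_nilp[OF c(3,4)] W] H.hcentD(1)[OF hcent_nilp[OF c'(3,4)] W] by simp
  then have mn: "iota m = iota m'" "iota n \<otimes>\<^bsub>KRing\<^esub> theta = iota n' \<otimes>\<^bsub>KRing\<^esub> theta"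
    using HS.hnil_inj[of "iota m" "iota n \<otimes>\<^bsub>KRing\<^esub> theta" "iota m'" "iota n' \<otimes>\<^bsub>KRing\<^esub> theta"] c c'
    by (simp_all add: nilp_def)
  then show ?thesis using z r' iota_inj theta_cancel c c' by (metis iota_closed)
qed

text \<open>In the normal form, fixing \<open>theta\<close> forces the exponential parameter to
  vanish, and fixing \<open>w1 + w2 + w3\<close> forces the cube root of unity to be 1. Conversely,
  \<open>\<tau> - 1\<close> kills the multiples of that vector.\<close>

lemma N_carrier: "carrier (pts (N_functor s a) R) = {lift (nilp m n) |m n. m \<in> carrier R \<and> n \<in> carrier R}"
proof -
  have pkF: "pk (b, z, z, z) \<in> FixR s R" if "b \<in> KR s R" "z \<in> KR s R" for b z
    using that by (simp add: FixR_iff)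
  have "g \<in> carrier (pts (N_functor s a) R) \<longleftrightarrow> g \<in> carrier HG \<and> (\<forall>x \<in> FixR s R. g x = x)" for g
    by (auto simp: N_functor_def kernel_def aut_fix_def BijGroup_def fun_eq_iff restrict_def)
  moreover have "g \<in> carrier HG \<and> (\<forall>x \<in> FixR s R. g x = x) \<longleftrightarrow>
      (\<exists>m n. g = lift (nilp m n) \<and> m \<in> carrier R \<and> n \<in> carrier R)" for g
  proof
    assume "\<exists>m n. g = lift (nilp m n) \<and> m \<in> carrier R \<and> n \<in> carrier R"
    then obtain m n where mn: "m \<in> carrier R" "n \<in> carrier R" "g = lift (nilp m n)" by blast
    have "g x = x" if xF: "x \<in> FixR s R" for x
    proof -
      obtain b z where x: "x \<in> CR s R" "b \<in> KR s R" "z \<in> KR s R" "upk x = (b, z, z, z)"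
        using xF[unfolded FixR_iff] by blast
      then have "g x = pk (upk x)" using mn by (simp add: lift_def nilp_fixes)
      then show ?thesis using pk_upk[OF x(1)] by (simp only:)
    qed
    then show "g \<in> carrier HG \<and> (\<forall>x \<in> FixR s R. g x = x)" using mn lift_in[OF hcent_nilp] by blast
  next
    assume "g \<in> carrier HG \<and> (\<forall>x \<in> FixR s R. g x = x)"
    then have g: "g \<in> carrier HG" and gx: "\<And>x. x \<in> FixR s R \<Longrightarrow> g x = x" by blast+
    have lf: "low g (b, z, z, z) = (b, z, z, z)" if "b \<in> KR s R" "z \<in> KR s R" for b z
      using gx[OF pkF[OF that]] that by (simp add: low_def)
    have th: "low g (HS.hK theta) = HS.hK theta" using lf[of theta "\<zero>\<^bsub>KRing\<^esub>"] by (simp add: HS.hK_def)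
    then have "fst (low g (HS.hK theta)) = theta" by (simp add: HS.hK_def)
    from cent_structure[OF g this] obtain z r m n where zr: "z \<in> KR s R"
      "r \<in> carrier (pts (mu_functor s) R)" "m \<in> carrier R" "n \<in> carrier R"
      "g = lift (\<lambda>V. H.hexp z (H.hmu r (nilp m n V)))" by metis
    have r: "r \<in> KR s R" using zr by (simp add: mu_carrier)
    have lg: "low g V = H.hexp z (H.hmu r (nilp m n V))" if "V \<in> H.hcar" for V
      unfolding zr(5) by (rule low_lift[OF H.hcent_compose[OF hcent_hexp' H.hcent_compose[OF hcent_hmu' hcent_nilp]]])
        (use zr that in simp_all)
    have "z \<otimes>\<^bsub>KRing\<^esub> theta = \<zero>\<^bsub>KRing\<^esub> \<otimes>\<^bsub>KRing\<^esub> theta"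
      using th lg[of "HS.hK theta"] HS.structure_values(1)[of z r "iota m" "iota n \<otimes>\<^bsub>KRing\<^esub> theta"] zr r
      by (simp add: nilp_def) (simp add: HS.hK_def)
    then have z: "z = \<zero>\<^bsub>KRing\<^esub>" using theta_cancel[of z "\<zero>\<^bsub>KRing\<^esub>"] zr by simp
    have "HS.hU \<one>\<^bsub>KRing\<^esub> = HS.hU r"
      using lf[of "\<zero>\<^bsub>KRing\<^esub>" "\<one>\<^bsub>KRing\<^esub>"] lg[of "HS.hU \<one>\<^bsub>KRing\<^esub>"]
        HS.structure_values(2)[of z r "iota m" "iota n \<otimes>\<^bsub>KRing\<^esub> theta"] zr r
      by (simp add: nilp_def) (simp add: HS.hU_def)
    then have r1: "r = \<one>\<^bsub>KRing\<^esub>" by (simp add: HS.hU_def)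
    have "H.hexp z (H.hmu r (nilp m n V)) = nilp m n V" if "V \<in> H.hcar" for V
    proof -
      note W = H.hcentD(1)[OF hcent_nilp[OF zr(3,4)] that]
      show ?thesis unfolding z r1 using H.hmu_simps(4)[OF H.one_closed W W] W by (simp add: H.hexp_zero)
    qed
    then have "g = lift (nilp m n)" unfolding zr(5) by (intro lift_cong) simp
    then show "\<exists>m n. g = lift (nilp m n) \<and> m \<in> carrier R \<and> n \<in> carrier R" using zr by blast
  qed
  ultimately show ?thesis by blast
qed

end

section \<open>Base change\<close>

locale etale_hom = A: etale_over s R a + B: etale_over s S a
  for s :: "'f::field \<Rightarrow> 'k \<Rightarrow> 'k::comm_ring_1" and R S :: "('f, 'u) module" and a +
  fixes f :: "'u \<Rightarrow> 'u"
  assumes hom: "comm_alg_hom R S f"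
begin

sublocale F: ring_hom_cring R S f
  using hom A.is_cring B.is_cring by (intro ring_hom_cring.intro ring_hom_cring_axioms.intro) (auto simp: comm_alg_hom_def)

lemma f_smult: "r \<in> carrier R \<Longrightarrow> f (c \<odot>\<^bsub>R\<^esub> r) = c \<odot>\<^bsub>S\<^esub> f r"
  using hom by (simp add: comm_alg_hom_def)

text \<open>The map from \<open>V \<otimes> R\<close> to \<open>V \<otimes> S\<close> induced by
  \<open>f\<close>, in coordinates.\<close>

definition fext :: "'v set \<Rightarrow> ('v \<Rightarrow> 'u) \<Rightarrow> 'v \<Rightarrow> 'u" where
  "fext D x = (\<lambda>b \<in> D. f (x b))"

lemma fext_closed [simp]: "x \<in> ext_carrier D R \<Longrightarrow> fext D x \<in> ext_carrier D S"
  by (auto simp: fext_def ext_carrier_def)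

lemma fext_add: "\<lbrakk>x \<in> ext_carrier D R; y \<in> ext_carrier D R\<rbrakk> \<Longrightarrow>
    fext D (ext_add D R x y) = ext_add D S (fext D x) (fext D y)"
  by (auto simp: fext_def ext_add_def ext_carrier_def PiE_iff intro!: restrict_ext)

lemma fext_scale: "\<lbrakk>r \<in> carrier R; x \<in> ext_carrier D R\<rbrakk> \<Longrightarrow>
    fext D (ext_scale D R r x) = ext_scale D S (f r) (fext D x)"
  by (auto simp: fext_def ext_scale_def ext_carrier_def PiE_iff intro!: restrict_ext)

lemma fext_pure_tensor: "fext D (pure_tensor s' D R v \<one>\<^bsub>R\<^esub>) = pure_tensor s' D S v \<one>\<^bsub>S\<^esub>"
  by (auto simp: fext_def pure_tensor_def f_smult intro!: restrict_ext)

lemma fext_bilinear: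
  assumes "x \<in> ext_carrier B1 R" "y \<in> ext_carrier B2 R"
  shows "fext D (ext_bilinear B1 B2 s' D R m x y) = ext_bilinear B1 B2 s' D S m (fext B1 x) (fext B2 y)"
proof -
  have "f (finsum R (\<lambda>(b1, b2). coord s' D (m b1 b2) c \<odot>\<^bsub>R\<^esub> (x b1 \<otimes>\<^bsub>R\<^esub> y b2)) (B1 \<times> B2)) =
    finsum S (f \<circ> (\<lambda>(b1, b2). coord s' D (m b1 b2) c \<odot>\<^bsub>R\<^esub> (x b1 \<otimes>\<^bsub>R\<^esub> y b2))) (B1 \<times> B2)" for c
    using assms by (intro F.hom_finsum) (auto simp: ext_carrier_def PiE_iff)
  also have "\<dots> c = finsum S (\<lambda>(b1, b2). coord s' D (m b1 b2) c \<odot>\<^bsub>S\<^esub> (fext B1 x b1 \<otimes>\<^bsub>S\<^esub> fext B2 y b2)) (B1 \<times> B2)" for c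
    using assms by (intro B.finsum_cong') (auto simp: ext_carrier_def PiE_iff fext_def f_smult)
  finally have "f (finsum R (\<lambda>(b1, b2). coord s' D (m b1 b2) c \<odot>\<^bsub>R\<^esub> (x b1 \<otimes>\<^bsub>R\<^esub> y b2)) (B1 \<times> B2)) =
    finsum S (\<lambda>(b1, b2). coord s' D (m b1 b2) c \<odot>\<^bsub>S\<^esub> (fext B1 x b1 \<otimes>\<^bsub>S\<^esub> fext B2 y b2)) (B1 \<times> B2)" for c .
  then show ?thesis unfolding ext_bilinear_def fext_def[of D] by (intro restrict_ext) (simp only: restrict_apply')
qed

lemma fext_linear:
  assumes "x \<in> ext_carrier B1 R"
  shows "fext D (ext_linear B1 s' D R m x) = ext_linear B1 s' D S m (fext B1 x)"
proof -
  have "f (finsum R (\<lambda>b. coord s' D (m b) c \<odot>\<^bsub>R\<^esub> x b) B1) =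
    finsum S (f \<circ> (\<lambda>b. coord s' D (m b) c \<odot>\<^bsub>R\<^esub> x b)) B1" for c
    using assms by (intro F.hom_finsum) (auto simp: ext_carrier_def PiE_iff)
  also have "\<dots> c = finsum S (\<lambda>b. coord s' D (m b) c \<odot>\<^bsub>S\<^esub> fext B1 x b) B1" for c
    using assms by (intro B.finsum_cong') (auto simp: ext_carrier_def PiE_iff fext_def f_smult)
  finally have "f (finsum R (\<lambda>b. coord s' D (m b) c \<odot>\<^bsub>R\<^esub> x b) B1) =
    finsum S (\<lambda>b. coord s' D (m b) c \<odot>\<^bsub>S\<^esub> fext B1 x b) B1" for c .
  then show ?thesis unfolding ext_linear_def fext_def[of D] by (intro restrict_ext) (simp only: restrict_apply')
qed

abbreviation "fK \<equiv> fext (kbasis s)"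
abbreviation "fC \<equiv> fext (cbasis s)"

lemma fK_pt: "fK (A.KE.pt v) = B.KE.pt v"
  by (simp add: A.KE.pt_def B.KE.pt_def fext_pure_tensor)

lemma fC_pt: "fC (A.CE.pt v) = B.CE.pt v"
  by (simp add: A.CE.pt_def B.CE.pt_def fext_pure_tensor)

lemma fK_hom:
  "\<lbrakk>x \<in> KR s R; y \<in> KR s R\<rbrakk> \<Longrightarrow> fK (x \<oplus>\<^bsub>A.KRing\<^esub> y) = fK x \<oplus>\<^bsub>B.KRing\<^esub> fK y"
  "\<lbrakk>x \<in> KR s R; y \<in> KR s R\<rbrakk> \<Longrightarrow> fK (x \<otimes>\<^bsub>A.KRing\<^esub> y) = fK x \<otimes>\<^bsub>B.KRing\<^esub> fK y"
  "fK \<zero>\<^bsub>A.KRing\<^esub> = \<zero>\<^bsub>B.KRing\<^esub>" "fK \<one>\<^bsub>A.KRing\<^esub> = \<one>\<^bsub>B.KRing\<^esub>"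
  "x \<in> KR s R \<Longrightarrow> fK (\<ominus>\<^bsub>A.KRing\<^esub> x) = \<ominus>\<^bsub>B.KRing\<^esub> fK x"
  "\<lbrakk>x \<in> KR s R; y \<in> KR s R\<rbrakk> \<Longrightarrow> fK (x \<ominus>\<^bsub>A.KRing\<^esub> y) = fK x \<ominus>\<^bsub>B.KRing\<^esub> fK y"
  "x \<in> KR s R \<Longrightarrow> fK (A.kbar x) = B.kbar (fK x)"
  "r \<in> carrier R \<Longrightarrow> fK (A.iota r) = B.iota (f r)"
proof -
  show add: "fK (x \<oplus>\<^bsub>A.KRing\<^esub> y) = fK x \<oplus>\<^bsub>B.KRing\<^esub> fK y" if "x \<in> KR s R" "y \<in> KR s R" for x y
    using that by (simp add: A.add_KRing B.add_KRing fext_add)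
  show "\<lbrakk>x \<in> KR s R; y \<in> KR s R\<rbrakk> \<Longrightarrow> fK (x \<otimes>\<^bsub>A.KRing\<^esub> y) = fK x \<otimes>\<^bsub>B.KRing\<^esub> fK y"
    by (simp add: A.mult_KRing B.mult_KRing KR_mult_def fext_bilinear)
  show z: "fK \<zero>\<^bsub>A.KRing\<^esub> = \<zero>\<^bsub>B.KRing\<^esub>"
    by (simp add: A.pt_hom(5) B.pt_hom(5) fK_pt)
  show "fK \<one>\<^bsub>A.KRing\<^esub> = \<one>\<^bsub>B.KRing\<^esub>"
    by (simp add: A.pt_hom(4) B.pt_hom(4) fK_pt)
  show m: "fK (\<ominus>\<^bsub>A.KRing\<^esub> x) = \<ominus>\<^bsub>B.KRing\<^esub> fK x" if "x \<in> KR s R" for x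
  proof (rule B.H.minus_equality[symmetric])
    have "fK (\<ominus>\<^bsub>A.KRing\<^esub> x) \<oplus>\<^bsub>B.KRing\<^esub> fK x = fK (\<ominus>\<^bsub>A.KRing\<^esub> x \<oplus>\<^bsub>A.KRing\<^esub> x)"
      using that by (simp add: add)
    also have "\<dots> = \<zero>\<^bsub>B.KRing\<^esub>" using that by (simp add: A.H.l_neg z)
    finally show "fK (\<ominus>\<^bsub>A.KRing\<^esub> x) \<oplus>\<^bsub>B.KRing\<^esub> fK x = \<zero>\<^bsub>B.KRing\<^esub>" .
  qed (use that in simp_all)
  show "\<lbrakk>x \<in> KR s R; y \<in> KR s R\<rbrakk> \<Longrightarrow> fK (x \<ominus>\<^bsub>A.KRing\<^esub> y) = fK x \<ominus>\<^bsub>B.KRing\<^esub> fK y"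
    by (simp add: A.H.minus_eq B.H.minus_eq add m)
  show "x \<in> KR s R \<Longrightarrow> fK (A.kbar x) = B.kbar (fK x)"
    by (simp add: A.kbar_def B.kbar_def fext_linear)
  show "r \<in> carrier R \<Longrightarrow> fK (A.iota r) = B.iota (f r)"
    by (simp add: A.iota_def B.iota_def fext_scale fK_pt)
qed

definition f4 :: "('k \<Rightarrow> 'u) cayley \<Rightarrow> ('k \<Rightarrow> 'u) cayley" where
  "f4 = (\<lambda>(x0, x1, x2, x3). (fK x0, fK x1, fK x2, fK x3))"

lemma upk_fC: "x \<in> CR s R \<Longrightarrow> B.upk (fC x) = f4 (A.upk x)"
  by (auto simp: A.upk_def B.upk_def f4_def A.uc_def B.uc_def fext_def intro!: restrict_ext)

lemma f4_closed [simp]: "x \<in> A.H.hcar \<Longrightarrow> f4 x \<in> B.H.hcar"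
  by (auto simp: f4_def elim!: A.H.hcar_cases)

lemma fC_mult: "\<lbrakk>x \<in> CR s R; y \<in> CR s R\<rbrakk> \<Longrightarrow> fC (CR_mult s a R x y) = CR_mult s a S (fC x) (fC y)"
  by (simp add: CR_mult_def fext_bilinear)

lemma fC_tau: "x \<in> CR s R \<Longrightarrow> fC (CR_tau s R x) = CR_tau s S (fC x)"
  by (simp add: CR_tau_def fext_linear)

lemma f_polar: "\<lbrakk>x \<in> ext_carrier D R; y \<in> ext_carrier D R\<rbrakk> \<Longrightarrow>
    f (A.polar D q x y) = B.polar D q (fext D x) (fext D y)"
  using fun_cong[OF fext_bilinear[of x D y D "{1}" "(*)" "\<lambda>b c. (q (b + c) - q b - q c) / 2"], of 1]
  by (simp add: A.polar_def B.polar_def fext_def[of "{1}"])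

abbreviation bc where "bc \<equiv> base_change (cscale s) (cbasis s) R S f"

definition lin :: "('f, 'u) module \<Rightarrow> (('k cayley \<Rightarrow> 'u) \<Rightarrow> 'k cayley \<Rightarrow> 'u) \<Rightarrow> bool" where
  "lin Q g \<longleftrightarrow> (\<forall>x \<in> CR s Q. g x \<in> CR s Q) \<and>
     (\<forall>x \<in> CR s Q. \<forall>y \<in> CR s Q. g (ext_add (cbasis s) Q x y) = ext_add (cbasis s) Q (g x) (g y)) \<and>
     (\<forall>r \<in> carrier Q. \<forall>x \<in> CR s Q. g (ext_scale (cbasis s) Q r x) = ext_scale (cbasis s) Q r (g x))"

lemma bc_lin:
  assumes g: "lin R g"
  shows "lin S (bc g)"
proof -
  have c: "f (g (pure_tensor (cscale s) (cbasis s) R b \<one>\<^bsub>R\<^esub>) c) \<in> carrier S" if "c \<in> cbasis s" for b c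
    using g A.CE.extD[of "g (A.CE.pt b)" c] that by (simp add: lin_def A.CE.pt_def[symmetric])
  note fin = A.E.C.finite_basis
  have 1: "bc g x \<in> CR s S" if "x \<in> CR s S" for x
    using that c by (auto simp: base_change_def ext_carrier_def PiE_iff intro!: B.finsum_closed)
  have 2: "bc g (B.CE.add_ext x y) = B.CE.add_ext (bc g x) (bc g y)" if xy: "x \<in> CR s S" "y \<in> CR s S" for x y
  proof -
    have "finsum S (\<lambda>b. f (g (pure_tensor (cscale s) (cbasis s) R b \<one>\<^bsub>R\<^esub>) c) \<otimes>\<^bsub>S\<^esub> B.CE.add_ext x y b) (cbasis s) =
      finsum S (\<lambda>b. f (g (pure_tensor (cscale s) (cbasis s) R b \<one>\<^bsub>R\<^esub>) c) \<otimes>\<^bsub>S\<^esub> x b \<oplus>\<^bsub>S\<^esub>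
        f (g (pure_tensor (cscale s) (cbasis s) R b \<one>\<^bsub>R\<^esub>) c) \<otimes>\<^bsub>S\<^esub> y b) (cbasis s)" if "c \<in> cbasis s" for c
      using xy that c by (intro B.finsum_cong') (auto simp: ext_add_def B.r_distr)
    also have "\<dots> c = finsum S (\<lambda>b. f (g (pure_tensor (cscale s) (cbasis s) R b \<one>\<^bsub>R\<^esub>) c) \<otimes>\<^bsub>S\<^esub> x b) (cbasis s) \<oplus>\<^bsub>S\<^esub>
      finsum S (\<lambda>b. f (g (pure_tensor (cscale s) (cbasis s) R b \<one>\<^bsub>R\<^esub>) c) \<otimes>\<^bsub>S\<^esub> y b) (cbasis s)" if "c \<in> cbasis s" for c
      using xy that c by (intro B.finsum_addf) auto
    finally show ?thesis using xy by (auto simp: base_change_def ext_add_def[of _ _ "restrict _ _"] intro!: restrict_ext)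
  qed
  have 3: "bc g (B.CE.scale_ext r x) = B.CE.scale_ext r (bc g x)" if r: "r \<in> carrier S" and x: "x \<in> CR s S" for r x
  proof -
    have "finsum S (\<lambda>b. f (g (pure_tensor (cscale s) (cbasis s) R b \<one>\<^bsub>R\<^esub>) c) \<otimes>\<^bsub>S\<^esub> B.CE.scale_ext r x b) (cbasis s) =
      finsum S (\<lambda>b. r \<otimes>\<^bsub>S\<^esub> (f (g (pure_tensor (cscale s) (cbasis s) R b \<one>\<^bsub>R\<^esub>) c) \<otimes>\<^bsub>S\<^esub> x b)) (cbasis s)"
      if "c \<in> cbasis s" for c
      using x r that c by (intro B.finsum_cong') (auto simp: ext_scale_def B.m_lcomm)
    also have "\<dots> c = r \<otimes>\<^bsub>S\<^esub> finsum S (\<lambda>b. f (g (pure_tensor (cscale s) (cbasis s) R b \<one>\<^bsub>R\<^esub>) c) \<otimes>\<^bsub>S\<^esub> x b) (cbasis s)"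
      if "c \<in> cbasis s" for c
      using x r that c fin by (intro B.finsum_rdistr[symmetric]) auto
    finally show ?thesis using x r by (auto simp: base_change_def ext_scale_def[of _ _ _ "restrict _ _"] intro!: restrict_ext)
  qed
  show ?thesis unfolding lin_def using 1 2 3 by blast
qed

lemma lin_zero: "lin R g \<Longrightarrow> g A.CE.ext_zero = A.CE.ext_zero" "lin S h \<Longrightarrow> h B.CE.ext_zero = B.CE.ext_zero"
proof -
  show "g A.CE.ext_zero = A.CE.ext_zero" if "lin R g"
    using that A.CE.scale_zero(1)[of "g A.CE.ext_zero"] A.CE.scale_zero(1)[of A.CE.ext_zero] unfolding lin_def
    by (metis A.CE.ext_closed(3) A.zero_closed)
  show "h B.CE.ext_zero = B.CE.ext_zero" if "lin S h"
    using that B.CE.scale_zero(1)[of "h B.CE.ext_zero"] B.CE.scale_zero(1)[of B.CE.ext_zero] unfolding lin_def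
    by (metis B.CE.ext_closed(3) B.zero_closed)
qed

lemma lin_eqI:
  assumes "lin S g" "lin S h" "\<And>b. b \<in> cbasis s \<Longrightarrow> g (B.CE.pt b) = h (B.CE.pt b)" "x \<in> CR s S"
  shows "g x = h x"
  using assms(4)
proof (induction x rule: B.CE.ext_induct)
  case zero
  show ?case using assms(1,2) by (simp add: lin_zero)
qed (use assms(1-3) in \<open>simp_all add: lin_def\<close>)

lemma bc_pt:
  assumes g: "lin R g" and b: "b \<in> cbasis s"
  shows "bc g (B.CE.pt b) = fC (g (A.CE.pt b))"
proof -
  have gc: "g (A.CE.pt b') c \<in> carrier R" if "c \<in> cbasis s" for b' c
    using g that by (auto simp: lin_def)
  have "finsum S (\<lambda>b'. f (g (A.CE.pt b') c) \<otimes>\<^bsub>S\<^esub> B.CE.pt b b') (cbasis s) =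
      finsum S (\<lambda>b'. if b = b' then f (g (A.CE.pt b') c) else \<zero>\<^bsub>S\<^esub>) (cbasis s)" if c: "c \<in> cbasis s" for c
    using gc[OF c] b by (intro B.finsum_cong') (auto simp: B.CE.pt_basis)
  also have "\<dots> c = f (g (A.CE.pt b) c)" if c: "c \<in> cbasis s" for c
    by (rule B.finsum_singleton) (use b gc[OF c] in auto)
  finally show ?thesis
    by (auto simp: base_change_def fext_def A.CE.pt_def[symmetric] intro!: restrict_ext)
qed

lemma bc_fC:
  assumes g: "lin R g" and x: "x \<in> CR s R"
  shows "bc g (fC x) = fC (g x)"
  using x
proof (induction x rule: A.CE.ext_induct)
  case (add x y)
  then show ?case using g bc_lin[OF g] unfolding lin_def by (simp add: fext_add)
next
  case (scale r x)
  then show ?case using g bc_lin[OF g] unfolding lin_def by (simp add: fext_scale)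
next
  case zero
  have "fC A.CE.ext_zero = B.CE.ext_zero" by (auto simp: fext_def A.CE.ext_zero_def B.CE.ext_zero_def intro!: restrict_ext)
  then show ?case using lin_zero(1)[OF g] lin_zero(2)[OF bc_lin[OF g]] by simp
next
  case (basis b)
  then show ?case by (simp add: fC_pt bc_pt[OF g])
qed

text \<open>The image of \<open>fC\<close> contains the basis tensors, so an \<open>S\<close>-linear
  map is determined by its restriction to it. Functoriality and all explicit base changes below are
  instances of this uniqueness.\<close>

lemma bc_unique:
  assumes g: "lin R g" and h: "lin S h" "h \<in> extensional (CR s S)"
    and eq: "\<And>x. x \<in> CR s R \<Longrightarrow> h (fC x) = fC (g x)"
  shows "bc g = h"
proof (rule extensionalityI[OF _ h(2)])
  show "bc g \<in> extensional (CR s S)" by (simp add: base_change_def)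
  show "bc g x = h x" if "x \<in> CR s S" for x
    by (rule lin_eqI[OF bc_lin[OF g] h(1) _ that]) (use eq bc_pt[OF g] in \<open>simp add: fC_pt[symmetric]\<close>)
qed

lemma cent_lin: "g \<in> carrier A.HG \<Longrightarrow> lin R g" "h \<in> carrier B.HG \<Longrightarrow> lin S h"
  using A.centD[of g] B.centD[of h] by (simp_all add: lin_def)

lemma bc_compose:
  assumes g: "lin R g" and h: "lin R h"
  shows "bc (compose (CR s R) g h) = compose (CR s S) (bc g) (bc h)"
proof (rule bc_unique)
  show "lin R (compose (CR s R) g h)" using g h by (simp add: lin_def compose_def)
  show "lin S (compose (CR s S) (bc g) (bc h))"
    using bc_lin[OF g] bc_lin[OF h] by (simp add: lin_def compose_def)
  fix x assume x: "x \<in> CR s R"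
  then show "compose (CR s S) (bc g) (bc h) (fC x) = fC (compose (CR s R) g h x)"
    using bc_fC[OF g, of "h x"] bc_fC[OF h x] h by (simp add: compose_def lin_def)
qed simp

lemma bc_id: "bc (\<lambda>x \<in> CR s R. x) = (\<lambda>x \<in> CR s S. x)"
  by (rule bc_unique) (auto simp: lin_def)

text \<open>Compatibility with product, polar form and shift is multilinear over \<open>S\<close>,
  so it can be tested on tensors coming from \<open>R\<close>; bijectivity is obtained by base
  changing the inverse.\<close>

lemma bc_cent:
  assumes g: "g \<in> carrier A.HG"
  shows "bc g \<in> carrier B.HG"
proof -
  note gl = cent_lin(1)[OF g]
  have L: "lin S (bc g)" by (rule bc_lin[OF gl])
  interpret G: group A.HG by (rule A.cent_group)
  define h where "h = inv\<^bsub>A.HG\<^esub> g"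
  have h: "h \<in> carrier A.HG" using g by (simp add: h_def)
  have one: "\<one>\<^bsub>A.HG\<^esub> = (\<lambda>x \<in> CR s R. x)" by (simp add: cent_functor_def aut_functor_def BijGroup_def)
  have "compose (CR s R) g h = (\<lambda>x \<in> CR s R. x)" "compose (CR s R) h g = (\<lambda>x \<in> CR s R. x)"
    using G.r_inv[OF g] G.l_inv[OF g] g h by (simp_all add: h_def A.cent_mult one)
  then have c: "compose (CR s S) (bc g) (bc h) = (\<lambda>x \<in> CR s S. x)" "compose (CR s S) (bc h) (bc g) = (\<lambda>x \<in> CR s S. x)"
    using bc_compose[OF gl cent_lin(1)[OF h]] bc_compose[OF cent_lin(1)[OF h] gl] bc_id by simp_all
  have "bij_betw (bc g) (CR s S) (CR s S)"
  proof (rule bij_betw_byWitness[where f' = "bc h"])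
    show "\<forall>x \<in> CR s S. bc h (bc g x) = x"
    proof
      show "bc h (bc g x) = x" if "x \<in> CR s S" for x using fun_cong[OF c(2), of x] that by (simp add: compose_def)
    qed
    show "\<forall>x \<in> CR s S. bc g (bc h x) = x"
    proof
      show "bc g (bc h x) = x" if "x \<in> CR s S" for x using fun_cong[OF c(1), of x] that by (simp add: compose_def)
    qed
    show "bc g ` CR s S \<subseteq> CR s S" "bc h ` CR s S \<subseteq> CR s S"
      using L bc_lin[OF cent_lin(1)[OF h]] by (auto simp: lin_def)
  qed
  then have "bc g \<in> Bij (CR s S)" by (simp add: Bij_def base_change_def)
  moreover have "bc g (CR_mult s a S x y) = CR_mult s a S (bc g x) (bc g y)"
    if x: "x \<in> CR s S" and y: "y \<in> CR s S" for x y
    using x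
  proof (induction x rule: B.CE.ext_induct)
    case (basis b)
    from y show ?case
    proof (induction y rule: B.CE.ext_induct)
      case (basis c)
      show ?case using A.centD[OF g]
        by (simp add: bc_fC[OF gl] flip: fC_pt fC_mult)
    qed (use L in \<open>simp_all add: lin_def B.CR_mult_add B.CR_mult_scale B.CR_mult_zero lin_zero(2)[OF L]\<close>)
  qed (use y L in \<open>simp_all add: lin_def B.CR_mult_add B.CR_mult_scale B.CR_mult_zero lin_zero(2)[OF L]\<close>)
  moreover have "bc g (CR_tau s S x) = CR_tau s S (bc g x)" if "x \<in> CR s S" for x
    using that
  proof (induction x rule: B.CE.ext_induct)
    case (basis c)
    show ?case using A.centD[OF g] A.CR_tau_simps(1) by (simp add: bc_fC[OF gl] flip: fC_pt fC_tau)
  qed (use L in \<open>simp_all add: lin_def B.CR_tau_simps B.CR_tau_zero lin_zero(2)[OF L]\<close>)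
  moreover have "B.polar (cbasis s) (cnorm s) (bc g x) (bc g y) = B.polar (cbasis s) (cnorm s) x y"
    if x: "x \<in> CR s S" and y: "y \<in> CR s S" for x y
  proof -
    note fin = A.E.C.finite_basis
    note rules = B.polar_simps[OF fin] lin_zero(2)[OF L]
    have z: "B.polar (cbasis s) (cnorm s) B.CE.ext_zero z = \<zero>\<^bsub>S\<^esub>" "B.polar (cbasis s) (cnorm s) z B.CE.ext_zero = \<zero>\<^bsub>S\<^esub>"
      if "z \<in> CR s S" for z
      using rules(4)[of "\<zero>\<^bsub>S\<^esub>" B.CE.ext_zero z] rules(5)[of "\<zero>\<^bsub>S\<^esub>" z B.CE.ext_zero] that
      by (simp_all add: B.CE.scale_zero rules)
    \<comment> \<open>Preservation of the norm is turned into preservation of its polar form, to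
      which induction over tensors applies.\<close>
    have pol: "A.polar (cbasis s) (cnorm s) (g u) (g v) = A.polar (cbasis s) (cnorm s) u v"
      if "u \<in> CR s R" "v \<in> CR s R" for u v
    proof (rule A.iota_inj)
      have n: "A.H.hnorm (A.upk (g w)) = A.H.hnorm (A.upk w)" if "w \<in> CR s R" for w
        using A.cnorm_eq_iff[of "g w" w] A.centD[OF g] that by simp
      show "A.iota (A.polar (cbasis s) (cnorm s) (g u) (g v)) = A.iota (A.polar (cbasis s) (cnorm s) u v)"
        using n[of u] n[of v] n[of "A.CE.add_ext u v"] that A.centD[OF g]
        by (simp add: A.iota_polar A.hpol_def flip: A.upk_add)
    qed (use that A.centD[OF g] in \<open>simp_all add: A.polar_simps[OF fin]\<close>)
    show ?thesis using x
    proof (induction x rule: B.CE.ext_induct)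
      case (basis b)
      from y show ?case
      proof (induction y rule: B.CE.ext_induct)
        case (basis c)
        show ?case using A.centD[OF g] pol
          by (simp add: bc_fC[OF gl] flip: fC_pt f_polar)
      qed (use L in \<open>simp_all add: lin_def rules z\<close>)
    qed (use y L in \<open>simp_all add: lin_def rules z\<close>)
  qed
  ultimately show ?thesis unfolding B.cent_carrier
    using L by (auto simp: lin_def B.ext_quadratic_polar)
qed

lemma bc_hom: "\<lbrakk>g \<in> carrier A.HG; h \<in> carrier A.HG\<rbrakk> \<Longrightarrow> bc (g \<otimes>\<^bsub>A.HG\<^esub> h) = bc g \<otimes>\<^bsub>B.HG\<^esub> bc h"
  by (simp add: A.cent_mult B.cent_mult bc_cent bc_compose cent_lin)

lemma bc_lift:
  assumes "A.H.hcent g" "B.H.hcent h" "\<And>V. V \<in> A.H.hcar \<Longrightarrow> h (f4 V) = f4 (g V)"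
  shows "bc (A.lift g) = B.lift h"
proof (rule bc_unique)
  show "lin R (A.lift g)" "lin S (B.lift h)" using cent_lin A.lift_in B.lift_in assms by blast+
  show "B.lift h \<in> extensional (CR s S)" by (simp add: B.lift_def)
  fix x assume x: "x \<in> CR s R"
  have "B.upk (B.lift h (fC x)) = B.upk (fC (A.lift g x))"
    using x assms(3)[of "A.upk x"] A.H.hcentD(1)[OF assms(1), of "A.upk x"] B.H.hcentD(1)[OF assms(2), of "f4 (A.upk x)"]
    by (simp add: B.lift_def A.lift_def upk_fC)
  then show "B.lift h (fC x) = fC (A.lift g x)"
    using x A.H.hcentD(1)[OF assms(1), of "A.upk x"] B.H.hcentD(1)[OF assms(2), of "f4 (A.upk x)"]
    by (intro B.upk_inj) (simp_all add: B.lift_def A.lift_def upk_fC)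
qed

text \<open>The formula for \<open>hexp\<close> involves only ring operations, the involution and
  the constant \<open>a\<close>, all of which base change respects; the same holds for the two
  families that follow.\<close>

lemma bc_hexp: "z \<in> KR s R \<Longrightarrow> bc (A.lift (A.H.hexp z)) = B.lift (B.H.hexp (fK z))"
  by (rule bc_lift, simp add: A.hcent_hexp', simp add: B.hcent_hexp')
    (auto simp: f4_def A.H.hexp_def B.H.hexp_def A.H.hexp_coord_def B.H.hexp_coord_def fK_hom fK_pt
      elim!: A.H.hcar_cases)

lemma fK_mu: "r \<in> carrier (pts (mu_functor s) R) \<Longrightarrow> fK r \<in> carrier (pts (mu_functor s) S)"
  unfolding A.mu_carrier B.mu_carrier by (auto simp flip: fK_hom)

lemma bc_hmu: "r \<in> carrier (pts (mu_functor s) R) \<Longrightarrow> bc (A.lift (A.H.hmu r)) = B.lift (B.H.hmu (fK r))"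
  by (rule bc_lift, simp add: A.hcent_hmu', simp add: B.hcent_hmu' fK_mu)
    (auto simp: f4_def A.H.hmu_def B.H.hmu_def fK_hom A.mu_carrier elim!: A.H.hcar_cases)

lemma bc_nilp: "\<lbrakk>m \<in> carrier R; n \<in> carrier R\<rbrakk> \<Longrightarrow> bc (A.lift (A.nilp m n)) = B.lift (B.nilp (f m) (f n))"
  by (rule bc_lift, simp add: A.hcent_nilp, simp add: B.hcent_nilp)
    (auto simp: f4_def A.nilp_def B.nilp_def A.H.hnil_def B.H.hnil_def
      A.H.hcirc_def B.H.hcirc_def fK_hom fK_pt elim!: A.H.hcar_cases)

end

section \<open>Group functors\<close>

lemma comm_alg_hom_cring: "comm_alg_hom R S f \<Longrightarrow> ring_hom_cring R S f"
  by (intro ring_hom_cring.intro ring_hom_cring_axioms.intro)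
    (auto simp: comm_alg_hom_def comm_alg_over_def dest: algebra.M_cring)

lemma comm_alg_homD:
  assumes "comm_alg_hom R S f"
  shows "comm_alg R" "comm_alg S"
  using assms by (simp_all add: comm_alg_hom_def)

lemma group_functorD:
  assumes "group_functor G"
  shows "comm_alg R \<Longrightarrow> group (pts G R)"
    and "comm_alg_hom R S f \<Longrightarrow> mor G R S f \<in> hom (pts G R) (pts G S)"
    and "comm_alg_hom R S f \<Longrightarrow> x \<in> carrier (pts G R) \<Longrightarrow> mor G R S f x \<in> carrier (pts G S)"
    and "\<lbrakk>comm_alg_hom R S f; x \<in> carrier (pts G R); y \<in> carrier (pts G R)\<rbrakk> \<Longrightarrow>
      mor G R S f (x \<otimes>\<^bsub>pts G R\<^esub> y) = mor G R S f x \<otimes>\<^bsub>pts G S\<^esub> mor G R S f y"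
    and "\<lbrakk>comm_alg R; x \<in> carrier (pts G R)\<rbrakk> \<Longrightarrow> mor G R R (\<lambda>r. r) x = x"
    and "\<lbrakk>comm_alg_hom R S f; comm_alg_hom S T h; x \<in> carrier (pts G R)\<rbrakk> \<Longrightarrow>
      mor G R T (\<lambda>r. h (f r)) x = mor G S T h (mor G R S f x)"
    and "\<lbrakk>comm_alg_hom R S f; comm_alg_hom R S f'; \<And>r. r \<in> carrier R \<Longrightarrow> f r = f' r; x \<in> carrier (pts G R)\<rbrakk> \<Longrightarrow>
      mor G R S f x = mor G R S f' x"
proof -
  note D = assms[unfolded group_functor_def]
  show "comm_alg R \<Longrightarrow> group (pts G R)" using D by blast
  show h: "mor G R S f \<in> hom (pts G R) (pts G S)" if "comm_alg_hom R S f" for R S f using D that by blast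
  show "comm_alg_hom R S f \<Longrightarrow> x \<in> carrier (pts G R) \<Longrightarrow> mor G R S f x \<in> carrier (pts G S)"
    using h by (rule hom_in_carrier)
  show "\<lbrakk>comm_alg_hom R S f; x \<in> carrier (pts G R); y \<in> carrier (pts G R)\<rbrakk> \<Longrightarrow>
      mor G R S f (x \<otimes>\<^bsub>pts G R\<^esub> y) = mor G R S f x \<otimes>\<^bsub>pts G S\<^esub> mor G R S f y"
    using h by (rule hom_mult)
  show "\<lbrakk>comm_alg R; x \<in> carrier (pts G R)\<rbrakk> \<Longrightarrow> mor G R R (\<lambda>r. r) x = x" using D by blast
  show "\<lbrakk>comm_alg_hom R S f; comm_alg_hom S T h; x \<in> carrier (pts G R)\<rbrakk> \<Longrightarrow>
      mor G R T (\<lambda>r. h (f r)) x = mor G S T h (mor G R S f x)" using D by blast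
  show "\<lbrakk>comm_alg_hom R S f; comm_alg_hom R S f'; \<And>r. r \<in> carrier R \<Longrightarrow> f r = f' r; x \<in> carrier (pts G R)\<rbrakk> \<Longrightarrow>
      mor G R S f x = mor G R S f' x"
    by (rule D[THEN conjunct2, THEN conjunct2, THEN conjunct2, THEN conjunct2, rule_format])
qed

lemma subgroup_functorI:
  assumes H: "group_functor H"
    and G: "\<And>R. comm_alg R \<Longrightarrow> pts G R = (pts H R)\<lparr>carrier := carrier (pts G R)\<rparr>"
    and sub: "\<And>R. comm_alg R \<Longrightarrow> subgroup (carrier (pts G R)) (pts H R)"
    and mor: "mor G = mor H"
    and closed: "\<And>R S f x. \<lbrakk>comm_alg_hom R S f; x \<in> carrier (pts G R)\<rbrakk> \<Longrightarrow> mor H R S f x \<in> carrier (pts G S)"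
  shows "subgroup_functor G H"
proof -
  note D = group_functorD[OF H]
  have in_H: "x \<in> carrier (pts H R)" if "comm_alg R" "x \<in> carrier (pts G R)" for R x
    using subgroup.subset[OF sub[OF that(1)]] that(2) by blast
  have mult: "x \<otimes>\<^bsub>pts G R\<^esub> y = x \<otimes>\<^bsub>pts H R\<^esub> y" if "comm_alg R" for R x y
    by (subst G[OF that]) simp
  have "group (pts G R)" if "comm_alg R" for R
    using subgroup.subgroup_is_group[OF sub[OF that] D(1)[OF that]] G[OF that] by simp
  moreover have "mor G R S f \<in> hom (pts G R) (pts G S)" if f: "comm_alg_hom R S f" for R S f
    using comm_alg_homD[OF f] closed[OF f] D(4)[OF f] in_H by (auto simp: hom_def mult mor)
  moreover have "mor G R R (\<lambda>r. r) x = x" if "comm_alg R" "x \<in> carrier (pts G R)" for R x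
    using D(5)[OF that(1)] in_H[OF that] by (simp add: mor)
  moreover have "mor G R T (\<lambda>r. h (f r)) x = mor G S T h (mor G R S f x)"
    if "comm_alg_hom R S f" "comm_alg_hom S T h" "x \<in> carrier (pts G R)" for R S T f h x
    using D(6)[OF that(1,2)] in_H that(3) comm_alg_homD[OF that(1)] by (simp add: mor)
  moreover have "mor G R S f x = mor G R S f' x"
    if "comm_alg_hom R S f" "comm_alg_hom R S f'" "\<forall>r\<in>carrier R. f r = f' r" "x \<in> carrier (pts G R)" for R S f f' x
    using D(7)[OF that(1,2)] in_H that(3,4) comm_alg_homD[OF that(1)] by (simp add: mor)
  ultimately have "group_functor G" unfolding group_functor_def by blast
  then show ?thesis unfolding subgroup_functor_def
    by (intro conjI allI impI ballI) (assumption | rule G sub H | simp add: mor)+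
qed

text \<open>The transformation is taken in the opposite direction, from parameters to automorphisms,
  where it can be written down; naturality passes to the pointwise inverses.\<close>

lemma functor_isomorphicI:
  assumes G: "group_functor G" and H: "group_functor H" and t: "functor_hom H G t"
    and iso: "\<And>R. comm_alg R \<Longrightarrow> t R \<in> iso (pts H R) (pts G R)"
  shows "functor_isomorphic G H"
proof -
  define t' where "t' R = inv_into (carrier (pts H R)) (t R)" for R
  have t': "t' R \<in> iso (pts G R) (pts H R)" if "comm_alg R" for R
    unfolding t'_def using group.iso_set_sym[OF group_functorD(1)[OF H that] iso[OF that]] .
  have "t' S (mor G R S f x) = mor H R S f (t' R x)"
    if f: "comm_alg_hom R S f" and x: "x \<in> carrier (pts G R)" for R S f x
  proof -
    note a = comm_alg_homD[OF f]
    have b: "bij_betw (t R) (carrier (pts H R)) (carrier (pts G R))"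
      "bij_betw (t S) (carrier (pts H S)) (carrier (pts G S))"
      using iso[OF a(1)] iso[OF a(2)] by (simp_all add: iso_def)
    have y: "t' R x \<in> carrier (pts H R)" "t R (t' R x) = x"
      using x b(1) by (auto simp: t'_def bij_betw_def f_inv_into_f inv_into_into)
    have "mor G R S f x = t S (mor H R S f (t' R x))"
      using t f y unfolding functor_hom_def by metis
    then show ?thesis
      using b(2) group_functorD(3)[OF H f y(1)] by (simp add: t'_def[of S] bij_betw_def inv_into_f_f)
  qed
  then have "functor_hom G H t'" using t' by (auto simp: functor_hom_def iso_def)
  then show ?thesis using G H t' unfolding functor_isomorphic_def by blast
qed

lemma direct_functor_group_functor:
  assumes G: "group_functor G" and H: "group_functor H"
  shows "group_functor (direct_functor G H)"
proof -
  note D = group_functorD[OF G] and D' = group_functorD[OF H]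
  show ?thesis unfolding group_functor_def direct_functor_def
    by (intro conjI allI impI ballI; auto simp: DirProd_group D(1) D'(1) hom_def D(3-6) D'(3-6); rule D(7) D'(7); auto)
qed

section \<open>Semidirect products inside a group\<close>

context group
begin

abbreviation conj_by where "conj_by x k \<equiv> x \<otimes> k \<otimes> inv x"

lemma inv_cancel: "\<lbrakk>x \<in> carrier G; y \<in> carrier G\<rbrakk> \<Longrightarrow> inv x \<otimes> (x \<otimes> y) = y"
  "\<lbrakk>x \<in> carrier G; y \<in> carrier G\<rbrakk> \<Longrightarrow> x \<otimes> (inv x \<otimes> y) = y"
  by (simp_all flip: m_assoc)

lemma conj_by_simps:
  "\<lbrakk>x \<in> carrier G; k \<in> carrier G; l \<in> carrier G\<rbrakk> \<Longrightarrow> conj_by x (k \<otimes> l) = conj_by x k \<otimes> conj_by x l"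
  "\<lbrakk>x \<in> carrier G; y \<in> carrier G; k \<in> carrier G\<rbrakk> \<Longrightarrow> conj_by (x \<otimes> y) k = conj_by x (conj_by y k)"
  "k \<in> carrier G \<Longrightarrow> conj_by \<one> k = k"
  by (simp_all add: m_assoc inv_cancel inv_mult_group)

definition semidirect where
  "semidirect i K M = \<lparr>carrier = carrier K \<times> carrier M,
     monoid.mult = (\<lambda>(k, r) (k', r'). (k \<otimes>\<^bsub>K\<^esub> conj_by (i r) k', r \<otimes>\<^bsub>M\<^esub> r')),
     one = (\<one>\<^bsub>K\<^esub>, \<one>\<^bsub>M\<^esub>)\<rparr>"

context
  fixes K :: "('a, 'b) monoid_scheme" and M :: "'m monoid" and i
  assumes K: "subgroup (carrier K) G" "K = G\<lparr>carrier := carrier K\<rparr>" and M: "group M" and i: "i \<in> hom M G"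
    and conj_closed: "\<And>r k. \<lbrakk>r \<in> carrier M; k \<in> carrier K\<rbrakk> \<Longrightarrow> conj_by (i r) k \<in> carrier K"
begin

interpretation M: group M by (rule M)
interpretation i: group_hom M G i by (intro group_hom.intro group_hom_axioms.intro M i is_group)

lemma K_eq: "x \<otimes>\<^bsub>K\<^esub> y = x \<otimes> y" "\<one>\<^bsub>K\<^esub> = \<one>"
  by (subst K(2), simp)+

lemma K_mem [simp]: "k \<in> carrier K \<Longrightarrow> k \<in> carrier G"
  using subgroup.subset[OF K(1)] by blast

lemma semidirect_group: "group (semidirect i K M)"
proof (rule groupI)
  fix p q u assume "p \<in> carrier (semidirect i K M)" "q \<in> carrier (semidirect i K M)" "u \<in> carrier (semidirect i K M)"
  then obtain k r k' r' k'' r'' where e: "p = (k, r)" "q = (k', r')" "u = (k'', r'')"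
    and c: "k \<in> carrier K" "k' \<in> carrier K" "k'' \<in> carrier K" "r \<in> carrier M" "r' \<in> carrier M" "r'' \<in> carrier M"
    by (auto simp: semidirect_def)
  show "p \<otimes>\<^bsub>semidirect i K M\<^esub> q \<in> carrier (semidirect i K M)"
    using c subgroup.m_closed[OF K(1)] conj_closed by (simp add: e semidirect_def K_eq)
  show "p \<otimes>\<^bsub>semidirect i K M\<^esub> q \<otimes>\<^bsub>semidirect i K M\<^esub> u = p \<otimes>\<^bsub>semidirect i K M\<^esub> (q \<otimes>\<^bsub>semidirect i K M\<^esub> u)"
    using c by (simp add: e semidirect_def K_eq conj_by_simps M.m_assoc m_assoc inv_cancel inv_mult_group)
next
  show "\<one>\<^bsub>semidirect i K M\<^esub> \<in> carrier (semidirect i K M)"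
    using subgroup.one_closed[OF K(1)] by (simp add: semidirect_def K_eq)
next
  fix p assume "p \<in> carrier (semidirect i K M)"
  then obtain k r where e: "p = (k, r)" and c: "k \<in> carrier K" "r \<in> carrier M" by (auto simp: semidirect_def)
  show "\<one>\<^bsub>semidirect i K M\<^esub> \<otimes>\<^bsub>semidirect i K M\<^esub> p = p"
    using c by (simp add: e semidirect_def K_eq)
  have 1: "conj_by (i (inv\<^bsub>M\<^esub> r)) (inv k) \<in> carrier K"
    using c by (intro conj_closed) (simp_all add: subgroup.m_inv_closed[OF K(1)])
  have 2: "conj_by (i (inv\<^bsub>M\<^esub> r)) (inv k) \<otimes> conj_by (i (inv\<^bsub>M\<^esub> r)) k = \<one>"
    using c by (simp add: m_assoc inv_cancel)
  show "\<exists>q \<in> carrier (semidirect i K M). q \<otimes>\<^bsub>semidirect i K M\<^esub> p = \<one>\<^bsub>semidirect i K M\<^esub>"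
    using 1 2 c by (intro bexI[of _ "(conj_by (i (inv\<^bsub>M\<^esub> r)) (inv k), inv\<^bsub>M\<^esub> r)"]) (simp_all add: e semidirect_def K_eq)
qed

text \<open>The element \<open>g\<close> of \<open>N\<close> is moved past \<open>k'\<close> and
  \<open>i r'\<close>; the remaining exchange of \<open>i r\<close> with \<open>k'\<close> is
  exactly what the conjugation in the semidirect product provides.\<close>

lemma semidirect_commuting_hom:
  assumes N: "carrier N \<subseteq> carrier G" "monoid.mult N = monoid.mult G"
    and comm: "\<And>g k. \<lbrakk>g \<in> carrier N; k \<in> carrier K\<rbrakk> \<Longrightarrow> g \<otimes> k = k \<otimes> g"
      "\<And>g r. \<lbrakk>g \<in> carrier N; r \<in> carrier M\<rbrakk> \<Longrightarrow> g \<otimes> i r = i r \<otimes> g"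
  shows "(\<lambda>((k, r), g). k \<otimes> i r \<otimes> g) \<in> hom (semidirect i K M \<times>\<times> N) G"
proof (rule homI)
  fix p assume "p \<in> carrier (semidirect i K M \<times>\<times> N)"
  then show "(case p of (x, g) \<Rightarrow> (case x of (k, r) \<Rightarrow> \<lambda>g. k \<otimes> i r \<otimes> g) g) \<in> carrier G"
    using N by (auto simp: semidirect_def)
next
  fix p q assume "p \<in> carrier (semidirect i K M \<times>\<times> N)" "q \<in> carrier (semidirect i K M \<times>\<times> N)"
  then obtain k r g k' r' g' where e: "p = ((k, r), g)" "q = ((k', r'), g')"
    and c: "k \<in> carrier K" "k' \<in> carrier K" "r \<in> carrier M" "r' \<in> carrier M" "g \<in> carrier N" "g' \<in> carrier N"
    by (auto simp: semidirect_def)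
  have g: "g \<in> carrier G" "g' \<in> carrier G" using c N by auto
  have "g \<otimes> (k' \<otimes> (i r' \<otimes> g')) = k' \<otimes> (g \<otimes> (i r' \<otimes> g'))"
    using comm(1)[OF c(5,2)] c g by (metis K_mem i.hom_closed m_assoc m_closed)
  also have "g \<otimes> (i r' \<otimes> g') = i r' \<otimes> (g \<otimes> g')"
    using comm(2)[OF c(5,4)] c g by (metis i.hom_closed m_assoc)
  finally show "(case p \<otimes>\<^bsub>semidirect i K M \<times>\<times> N\<^esub> q of (x, g) \<Rightarrow> (case x of (k, r) \<Rightarrow> \<lambda>g. k \<otimes> i r \<otimes> g) g) =
    (case p of (x, g) \<Rightarrow> (case x of (k, r) \<Rightarrow> \<lambda>g. k \<otimes> i r \<otimes> g) g) \<otimes>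
    (case q of (x, g) \<Rightarrow> (case x of (k, r) \<Rightarrow> \<lambda>g. k \<otimes> i r \<otimes> g) g)"
    using c g N(2) by (simp add: e semidirect_def K_eq m_assoc inv_cancel)
qed

end

end

lemma pts_semidirect: "comm_alg R \<Longrightarrow> group_functor H \<Longrightarrow>
    pts (semidirect_functor H i K M) R = group.semidirect (pts H R) (i R) (pts K R) (pts M R)"
  by (simp add: semidirect_functor_def group.semidirect_def[OF group_functorD(1)])

lemma semidirect_functor_group_functor:
  assumes H: "group_functor H" and K: "subgroup_functor K H" and M: "group_functor M" and i: "functor_hom M H i"
    and conj: "\<And>R r k. \<lbrakk>comm_alg R; r \<in> carrier (pts M R); k \<in> carrier (pts K R)\<rbrakk> \<Longrightarrow>
      i R r \<otimes>\<^bsub>pts H R\<^esub> k \<otimes>\<^bsub>pts H R\<^esub> inv\<^bsub>pts H R\<^esub> (i R r) \<in> carrier (pts K R)"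
  shows "group_functor (semidirect_functor H i K M)"
proof -
  have K': "group_functor K" using K by (simp add: subgroup_functor_def)
  note DH = group_functorD[OF H] and DK = group_functorD[OF K'] and DM = group_functorD[OF M]
  have sub: "subgroup (carrier (pts K R)) (pts H R)" "pts K R = (pts H R)\<lparr>carrier := carrier (pts K R)\<rparr>"
    if "comm_alg R" for R using K that unfolding subgroup_functor_def by blast+
  have morK: "mor K R S f x = mor H R S f x" if "comm_alg_hom R S f" "x \<in> carrier (pts K R)" for R S f x
    using K that unfolding subgroup_functor_def by blast
  have mem: "x \<in> carrier (pts H R)" if "comm_alg R" "x \<in> carrier (pts K R)" for R x
    using subgroup.subset[OF sub(1)[OF that(1)]] that(2) by blast
  have ih: "i R \<in> hom (pts M R) (pts H R)" if "comm_alg R" for R using i that by (simp add: functor_hom_def)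
  have nat: "i S (mor M R S f r) = mor H R S f (i R r)" if "comm_alg_hom R S f" "r \<in> carrier (pts M R)" for R S f r
    using i that by (simp add: functor_hom_def)
  have "group (pts (semidirect_functor H i K M) R)" if R: "comm_alg R" for R
    unfolding pts_semidirect[OF R H]
    by (rule group.semidirect_group[OF DH(1)[OF R] sub[OF R] DM(1)[OF R] ih[OF R] conj[OF R]])
  moreover have "mor (semidirect_functor H i K M) R S f \<in>
      hom (pts (semidirect_functor H i K M) R) (pts (semidirect_functor H i K M) S)" if f: "comm_alg_hom R S f" for R S f
  proof -
    note a = comm_alg_homD[OF f]
    have c: "mor H R S f (i R r \<otimes>\<^bsub>pts H R\<^esub> k \<otimes>\<^bsub>pts H R\<^esub> inv\<^bsub>pts H R\<^esub> (i R r)) =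
        i S (mor M R S f r) \<otimes>\<^bsub>pts H S\<^esub> mor K R S f k \<otimes>\<^bsub>pts H S\<^esub> inv\<^bsub>pts H S\<^esub> (i S (mor M R S f r))"
      if "r \<in> carrier (pts M R)" "k \<in> carrier (pts K R)" for r k
    proof -
      interpret h: group_hom "pts H R" "pts H S" "mor H R S f"
        by (intro group_hom.intro group_hom_axioms.intro DH(1)[OF a(1)] DH(1)[OF a(2)] DH(2)[OF f])
      show ?thesis using that mem[OF a(1)] hom_in_carrier[OF ih[OF a(1)]]
        by (simp add: nat[OF f] morK[OF f] h.hom_mult h.hom_inv)
    qed
    have "mor K R S f (k \<otimes>\<^bsub>pts K R\<^esub> (i R r \<otimes>\<^bsub>pts H R\<^esub> k' \<otimes>\<^bsub>pts H R\<^esub> inv\<^bsub>pts H R\<^esub> (i R r))) =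
        mor K R S f k \<otimes>\<^bsub>pts K S\<^esub> (i S (mor M R S f r) \<otimes>\<^bsub>pts H S\<^esub> mor K R S f k' \<otimes>\<^bsub>pts H S\<^esub> inv\<^bsub>pts H S\<^esub> (i S (mor M R S f r)))"
      if "r \<in> carrier (pts M R)" "k \<in> carrier (pts K R)" "k' \<in> carrier (pts K R)" for r k k'
      using that DK(4)[OF f that(2) conj[OF a(1) that(1,3)]] c[OF that(1,3)] morK[OF f conj[OF a(1) that(1,3)]] by simp
    then show ?thesis
      using DK(3)[OF f] DM(3,4)[OF f] by (auto simp: hom_def semidirect_functor_def)
  qed
  moreover have "mor (semidirect_functor H i K M) R R (\<lambda>r. r) x = x"
    if "comm_alg R" "x \<in> carrier (pts (semidirect_functor H i K M) R)" for R x
    using that DK(5) DM(5) by (auto simp: semidirect_functor_def)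
  moreover have "mor (semidirect_functor H i K M) R T (\<lambda>r. h (f r)) x =
      mor (semidirect_functor H i K M) S T h (mor (semidirect_functor H i K M) R S f x)"
    if "comm_alg_hom R S f" "comm_alg_hom S T h" "x \<in> carrier (pts (semidirect_functor H i K M) R)" for R S T f h x
    using that DK(6)[OF that(1,2)] DM(6)[OF that(1,2)] by (auto simp: semidirect_functor_def)
  moreover have "mor (semidirect_functor H i K M) R S f x = mor (semidirect_functor H i K M) R S f' x"
    if "comm_alg_hom R S f" "comm_alg_hom R S f'" "\<forall>r\<in>carrier R. f r = f' r"
      "x \<in> carrier (pts (semidirect_functor H i K M) R)" for R S f f' x
    using that DK(7)[OF that(1,2)] DM(7)[OF that(1,2)] by (auto simp: semidirect_functor_def)
  ultimately show ?thesis unfolding group_functor_def by blast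
qed

lemma mu3_functor_group_functor: "group_functor (mu3_functor :: ('f::field, 'u, 'u) grp_functor)"
proof -
  have "group (pts mu3_functor R)" if "comm_alg R" for R :: "('f, 'u) module"
  proof -
    interpret comm_alg_over R using that by (rule comm_alg_over.intro)
    show ?thesis
    proof (rule groupI)
      fix x y z assume xyz: "x \<in> carrier (pts mu3_functor R)" "y \<in> carrier (pts mu3_functor R)" "z \<in> carrier (pts mu3_functor R)"
      then have c: "x \<in> carrier R" "y \<in> carrier R" "z \<in> carrier R" by (auto simp: mu3_functor_def)
      have "x \<otimes>\<^bsub>R\<^esub> y \<otimes>\<^bsub>R\<^esub> (x \<otimes>\<^bsub>R\<^esub> y) \<otimes>\<^bsub>R\<^esub> (x \<otimes>\<^bsub>R\<^esub> y) = (x \<otimes>\<^bsub>R\<^esub> x \<otimes>\<^bsub>R\<^esub> x) \<otimes>\<^bsub>R\<^esub> (y \<otimes>\<^bsub>R\<^esub> y \<otimes>\<^bsub>R\<^esub> y)"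
        using c by (simp add: m_ac)
      then show "x \<otimes>\<^bsub>pts mu3_functor R\<^esub> y \<in> carrier (pts mu3_functor R)"
        using xyz c by (simp add: mu3_functor_def)
      show "x \<otimes>\<^bsub>pts mu3_functor R\<^esub> y \<otimes>\<^bsub>pts mu3_functor R\<^esub> z = x \<otimes>\<^bsub>pts mu3_functor R\<^esub> (y \<otimes>\<^bsub>pts mu3_functor R\<^esub> z)"
        using c by (simp add: mu3_functor_def m_assoc)
    next
      show "\<one>\<^bsub>pts mu3_functor R\<^esub> \<in> carrier (pts mu3_functor R)" by (simp add: mu3_functor_def)
    next
      fix x assume "x \<in> carrier (pts mu3_functor R)"
      then have x: "x \<in> carrier R" "x \<otimes>\<^bsub>R\<^esub> x \<otimes>\<^bsub>R\<^esub> x = \<one>\<^bsub>R\<^esub>" by (auto simp: mu3_functor_def)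
      show "\<one>\<^bsub>pts mu3_functor R\<^esub> \<otimes>\<^bsub>pts mu3_functor R\<^esub> x = x" using x by (simp add: mu3_functor_def)
      have "(x \<otimes>\<^bsub>R\<^esub> x) \<otimes>\<^bsub>R\<^esub> (x \<otimes>\<^bsub>R\<^esub> x) \<otimes>\<^bsub>R\<^esub> (x \<otimes>\<^bsub>R\<^esub> x) = (x \<otimes>\<^bsub>R\<^esub> x \<otimes>\<^bsub>R\<^esub> x) \<otimes>\<^bsub>R\<^esub> (x \<otimes>\<^bsub>R\<^esub> x \<otimes>\<^bsub>R\<^esub> x)"
        using x(1) by (simp add: m_ac)
      then show "\<exists>y \<in> carrier (pts mu3_functor R). y \<otimes>\<^bsub>pts mu3_functor R\<^esub> x = \<one>\<^bsub>pts mu3_functor R\<^esub>"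
        using x by (intro bexI[of _ "x \<otimes>\<^bsub>R\<^esub> x"]) (simp_all add: mu3_functor_def)
    qed
  qed
  moreover have "mor mu3_functor R S f \<in> hom (pts mu3_functor R) (pts mu3_functor S)"
    if "comm_alg_hom R S f" for R S :: "('f, 'u) module" and f
  proof -
    interpret ring_hom_cring R S f by (rule comm_alg_hom_cring[OF that])
    show ?thesis by (auto simp: hom_def mu3_functor_def simp flip: hom_mult)
  qed
  ultimately show ?thesis unfolding group_functor_def by (auto simp: mu3_functor_def)
qed

lemma add_square_functor_group_functor: "group_functor (add_square_functor :: ('f::field, 'u, 'u \<times> 'u) grp_functor)"
proof -
  have "group (add_monoid R)" if "comm_alg R" for R :: "('f, 'u) module"
  proof -
    interpret comm_alg_over R using that by (rule comm_alg_over.intro)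
    show ?thesis by (rule add.is_group)
  qed
  moreover have "f \<in> hom (add_monoid R) (add_monoid S)" if "comm_alg_hom R S f" for R S :: "('f, 'u) module" and f
  proof -
    interpret ring_hom_cring R S f by (rule comm_alg_hom_cring[OF that])
    show ?thesis by (auto simp: hom_def)
  qed
  ultimately show ?thesis unfolding group_functor_def
    by (auto simp: add_square_functor_def DirProd_group hom_def Pi_iff)
qed

section \<open>Copies of algebras in the universe\<close>

text \<open>Transport of structure along an injection, to realise algebras on other types inside the
  universe \<open>'u\<close>.\<close>

definition copy_alg :: "('v \<Rightarrow> 'u) \<Rightarrow> ('f, 'v) module \<Rightarrow> ('f, 'u) module" where
  "copy_alg e A = (let d = inv_into (carrier A) e in
     \<lparr>carrier = e ` carrier A, monoid.mult = (\<lambda>x y. e (d x \<otimes>\<^bsub>A\<^esub> d y)), one = e \<one>\<^bsub>A\<^esub>,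
      ring.zero = e \<zero>\<^bsub>A\<^esub>, ring.add = (\<lambda>x y. e (d x \<oplus>\<^bsub>A\<^esub> d y)), module.smult = (\<lambda>c x. e (c \<odot>\<^bsub>A\<^esub> d x))\<rparr>)"

lemma copy_alg_simps:
  assumes "inj_on e (carrier A)"
  shows "carrier (copy_alg e A) = e ` carrier A" "\<one>\<^bsub>copy_alg e A\<^esub> = e \<one>\<^bsub>A\<^esub>" "\<zero>\<^bsub>copy_alg e A\<^esub> = e \<zero>\<^bsub>A\<^esub>"
    "\<lbrakk>x \<in> carrier A; y \<in> carrier A\<rbrakk> \<Longrightarrow> e x \<otimes>\<^bsub>copy_alg e A\<^esub> e y = e (x \<otimes>\<^bsub>A\<^esub> y)"
    "\<lbrakk>x \<in> carrier A; y \<in> carrier A\<rbrakk> \<Longrightarrow> e x \<oplus>\<^bsub>copy_alg e A\<^esub> e y = e (x \<oplus>\<^bsub>A\<^esub> y)"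
    "x \<in> carrier A \<Longrightarrow> c \<odot>\<^bsub>copy_alg e A\<^esub> e x = e (c \<odot>\<^bsub>A\<^esub> x)"
  using assms by (simp_all add: copy_alg_def Let_def inv_into_f_f)

lemma comm_algI:
  fixes R :: "('f::field, 'u) module" (structure)
  assumes "cring R" "\<And>c x. x \<in> carrier R \<Longrightarrow> c \<odot> x \<in> carrier R"
    "\<And>c d x. x \<in> carrier R \<Longrightarrow> (c + d) \<odot> x = c \<odot> x \<oplus> d \<odot> x"
    "\<And>c x y. \<lbrakk>x \<in> carrier R; y \<in> carrier R\<rbrakk> \<Longrightarrow> c \<odot> (x \<oplus> y) = c \<odot> x \<oplus> c \<odot> y"
    "\<And>c d x. x \<in> carrier R \<Longrightarrow> (c * d) \<odot> x = c \<odot> (d \<odot> x)"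
    "\<And>x. x \<in> carrier R \<Longrightarrow> 1 \<odot> x = x"
    "\<And>c x y. \<lbrakk>x \<in> carrier R; y \<in> carrier R\<rbrakk> \<Longrightarrow> (c \<odot> x) \<otimes> y = c \<odot> (x \<otimes> y)"
  shows "comm_alg R"
  by (rule algebraI, rule cring_from_type_algebra)
    (use assms in \<open>auto simp: ring_of_type_algebra_def[where 'a = 'f]\<close>)

lemma copy_alg_comm_alg:
  fixes A :: "('f::field, 'v) module"
  assumes e: "inj_on e (carrier A)" and A: "comm_alg A"
  shows "comm_alg (copy_alg e A)"
proof -
  interpret A: comm_alg_over A using A by (rule comm_alg_over.intro)
  note S = copy_alg_simps[OF e]
  have "cring (copy_alg e A)"
  proof (rule cringI)
    show "abelian_group (copy_alg e A)"
    proof (rule abelian_groupI)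
      fix x assume "x \<in> carrier (copy_alg e A)"
      then obtain x' where x': "x = e x'" "x' \<in> carrier A" by (auto simp: S)
      then show "\<exists>y \<in> carrier (copy_alg e A). y \<oplus>\<^bsub>copy_alg e A\<^esub> x = \<zero>\<^bsub>copy_alg e A\<^esub>"
        by (intro bexI[of _ "e (\<ominus>\<^bsub>A\<^esub> x')"]) (simp_all add: S A.l_neg)
    qed (auto simp: S A.a_ac)
    show "comm_monoid (copy_alg e A)"
      by (rule comm_monoidI) (auto simp: S A.m_ac)
  qed (auto simp: S A.l_distr)
  then show ?thesis
    by (rule comm_algI) (auto simp: S A.smult_distrib)
qed

lemma copy_alg_field:
  assumes e: "inj_on e (carrier A)" and A: "comm_alg A" "\<one>\<^bsub>A\<^esub> \<noteq> \<zero>\<^bsub>A\<^esub>"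
    and inv: "\<And>x. \<lbrakk>x \<in> carrier A; x \<noteq> \<zero>\<^bsub>A\<^esub>\<rbrakk> \<Longrightarrow> \<exists>y \<in> carrier A. x \<otimes>\<^bsub>A\<^esub> y = \<one>\<^bsub>A\<^esub>"
  shows "field (copy_alg e A)"
proof -
  interpret A: comm_alg_over A using A(1) by (rule comm_alg_over.intro)
  interpret comm_alg_over "copy_alg e A" using copy_alg_comm_alg[OF e A(1)] by (rule comm_alg_over.intro)
  note S = copy_alg_simps[OF e]
  show ?thesis
  proof (rule cring_fieldI2)
    show "\<zero>\<^bsub>copy_alg e A\<^esub> \<noteq> \<one>\<^bsub>copy_alg e A\<^esub>"
      using A(2) inj_onD[OF e, of "\<zero>\<^bsub>A\<^esub>" "\<one>\<^bsub>A\<^esub>"] by (auto simp: S)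
    fix x assume "x \<in> carrier (copy_alg e A)" "x \<noteq> \<zero>\<^bsub>copy_alg e A\<^esub>"
    then obtain x' where x': "x = e x'" "x' \<in> carrier A" "x' \<noteq> \<zero>\<^bsub>A\<^esub>" by (auto simp: S)
    then obtain y where "y \<in> carrier A" "x' \<otimes>\<^bsub>A\<^esub> y = \<one>\<^bsub>A\<^esub>" using inv by blast
    then show "\<exists>y \<in> carrier (copy_alg e A). x \<otimes>\<^bsub>copy_alg e A\<^esub> y = \<one>\<^bsub>copy_alg e A\<^esub>"
      using x' by (intro bexI[of _ "e y"]) (simp_all add: S)
  qed
qed

definition ac_alg :: "('f::field, 'f alg_closure) module" where
  "ac_alg = \<lparr>carrier = UNIV, monoid.mult = (*), one = 1, ring.zero = 0, ring.add = (+), module.smult = (\<lambda>c x. to_ac c * x)\<rparr>"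

text \<open>The coordinate algebra of the constant group of order 2: the functions from that group
  to the ground field.\<close>

definition square_alg :: "('f::field, 'f \<times> 'f) module" where
  "square_alg = \<lparr>carrier = UNIV, monoid.mult = (\<lambda>x y. (fst x * fst y, snd x * snd y)), one = (1, 1), ring.zero = (0, 0),
     ring.add = (\<lambda>x y. (fst x + fst y, snd x + snd y)), module.smult = (\<lambda>c x. (c * fst x, c * snd x))\<rparr>"

lemma ac_alg_simps [simp]: "carrier ac_alg = UNIV" "\<one>\<^bsub>ac_alg\<^esub> = 1" "\<zero>\<^bsub>ac_alg\<^esub> = 0"
  "x \<otimes>\<^bsub>ac_alg\<^esub> y = x * y" "x \<oplus>\<^bsub>ac_alg\<^esub> y = x + y" "c \<odot>\<^bsub>ac_alg\<^esub> x = to_ac c * x"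
  by (simp_all add: ac_alg_def)

lemma square_alg_simps [simp]: "carrier square_alg = UNIV" "\<one>\<^bsub>square_alg\<^esub> = (1, 1)" "\<zero>\<^bsub>square_alg\<^esub> = (0, 0)"
  "x \<otimes>\<^bsub>square_alg\<^esub> y = (fst x * fst y, snd x * snd y)" "x \<oplus>\<^bsub>square_alg\<^esub> y = (fst x + fst y, snd x + snd y)"
  "c \<odot>\<^bsub>square_alg\<^esub> x = (c * fst x, c * snd x)"
  by (simp_all add: square_alg_def)

lemma ac_alg_comm_alg: "comm_alg ac_alg"
proof (rule comm_algI)
  show "cring ac_alg"
  proof (rule cringI)
    show "abelian_group ac_alg"
      by (rule abelian_groupI) (auto simp: algebra_simps intro: exI[of _ "- x" for x])
  qed (auto simp: algebra_simps intro!: comm_monoidI)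
qed (auto simp: algebra_simps)

lemma square_alg_comm_alg: "comm_alg (square_alg :: ('f::field, 'f \<times> 'f) module)"
proof (rule comm_algI)
  show "cring (square_alg :: ('f, 'f \<times> 'f) module)"
  proof (rule cringI)
    show "abelian_group (square_alg :: ('f, 'f \<times> 'f) module)"
    proof (rule abelian_groupI)
      show "\<exists>y \<in> carrier square_alg. y \<oplus>\<^bsub>square_alg\<^esub> x = \<zero>\<^bsub>square_alg\<^esub>" for x :: "'f \<times> 'f"
        by (rule bexI[of _ "(- fst x, - snd x)"]) simp_all
    qed (auto simp: algebra_simps)
  qed (auto simp: algebra_simps intro!: comm_monoidI)
qed (auto simp: algebra_simps)

lemma inj_pairs:
  assumes "infinite (UNIV :: 'u set)"
  obtains p :: "'u \<times> 'u \<Rightarrow> 'u" where "inj p"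
proof -
  have "|UNIV \<times> UNIV :: ('u \<times> 'u) set| =o |UNIV :: 'u set|"
    by (rule card_of_Times_same_infinite) (use assms in simp)
  then obtain p where "bij_betw p (UNIV \<times> UNIV :: ('u \<times> 'u) set) (UNIV :: 'u set)"
    using card_of_ordIso by blast
  then show ?thesis using that[of p] by (auto simp: bij_betw_def)
qed

text \<open>Iterated pairing separates lists of equal length, so the length is recorded as
  well.\<close>

lemma inj_lists:
  assumes "infinite (UNIV :: 'u set)"
  obtains e :: "'u list \<Rightarrow> 'u" where "inj e"
proof -
  obtain p :: "'u \<times> 'u \<Rightarrow> 'u" where p: "inj p" using assms by (rule inj_pairs)
  obtain \<nu> :: "nat \<Rightarrow> 'u" where n: "inj \<nu>" using infinite_countable_subset[OF assms] by blast
  define q where "q xs = foldr (\<lambda>x y. p (x, y)) xs undefined" for xs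
  have q: "q xs = q ys \<Longrightarrow> xs = ys" if "length xs = length ys" for xs ys
    using that by (induction rule: list_induct2) (auto simp: q_def dest: injD[OF p])
  have "inj (\<lambda>xs. p (\<nu> (length xs), q xs))"
    by (rule injI) (auto dest!: injD[OF p] injD[OF n] intro: q)
  then show ?thesis by (rule that)
qed

text \<open>An algebraic element is coded by the coefficients of a polynomial that it annihilates,
  together with its index among the finitely many roots. So the closure fits into any infinite type
  that contains the field.\<close>

lemma inj_alg_closure:
  fixes j :: "'f::field \<Rightarrow> 'u"
  assumes inf: "infinite (UNIV :: 'u set)" and j: "inj j"
  obtains e :: "'f alg_closure \<Rightarrow> 'u" where "inj e"
proof -
  obtain p :: "'u \<times> 'u \<Rightarrow> 'u" where p: "inj p" using inf by (rule inj_pairs)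
  obtain l :: "'u list \<Rightarrow> 'u" where l: "inj l" using inf by (rule inj_lists)
  obtain \<nu> :: "nat \<Rightarrow> 'u" where n: "inj \<nu>" using infinite_countable_subset[OF inf] by blast
  let ?Z = "\<lambda>P. {x. poly (map_poly to_ac P) x = 0} :: 'f alg_closure set"
  have "\<exists>P :: 'f poly. P \<noteq> 0 \<and> x \<in> ?Z P" for x by (rule alg_closure_algebraic[of x]) auto
  then obtain P :: "'f alg_closure \<Rightarrow> 'f poly" where P: "\<And>x. P x \<noteq> 0" "\<And>x. x \<in> ?Z (P x)" by metis
  have "\<exists>h :: 'f alg_closure \<Rightarrow> nat. inj_on h (?Z Q)" if "Q \<noteq> 0" for Q
  proof -
    have "map_poly to_ac Q \<noteq> (0 :: 'f alg_closure poly)" using that by (simp add: map_poly_eq_0_iff)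
    then have "finite (?Z Q)" by (rule poly_roots_finite)
    then show ?thesis using finite_imp_inj_to_nat_seg by blast
  qed
  then obtain h :: "'f poly \<Rightarrow> 'f alg_closure \<Rightarrow> nat" where h: "\<And>Q. Q \<noteq> 0 \<Longrightarrow> inj_on (h Q) (?Z Q)" by metis
  have "inj (\<lambda>x. p (l (map j (coeffs (P x))), \<nu> (h (P x) x)))"
  proof (rule injI)
    fix x y assume "p (l (map j (coeffs (P x))), \<nu> (h (P x) x)) = p (l (map j (coeffs (P y))), \<nu> (h (P y) y))"
    then have "l (map j (coeffs (P x))) = l (map j (coeffs (P y)))" and e: "h (P x) x = h (P y) y"
      using injD[OF p] injD[OF n] by blast+
    then have "coeffs (P x) = coeffs (P y)" using injD[OF l] injD[OF inj_mapI[OF j]] by blast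
    then have "P x = P y" by (simp add: coeffs_eq_iff)
    then show "x = y" using e h[OF P(1)[of x]] P(2) by (metis inj_onD)
  qed
  then show ?thesis by (rule that)
qed

lemma inj_square:
  assumes inf: "infinite (UNIV :: 'u set)" and j: "inj (j :: 'f \<Rightarrow> 'u)"
  obtains e :: "'f \<times> 'f \<Rightarrow> 'u" where "inj e"
proof -
  obtain p :: "'u \<times> 'u \<Rightarrow> 'u" where p: "inj p" using inf by (rule inj_pairs)
  have "inj (\<lambda>(x, y). p (j x, j y))" by (rule injI) (auto dest!: injD[OF p] injD[OF j])
  then show ?thesis by (rule that)
qed

section \<open>Square roots of 1 and the constant group of order 2\<close>

context herm_ring
begin

lemma sign_identities:
  assumes "y \<in> carrier A" "z \<in> carrier A"
  shows "\<ominus> (\<one> \<oplus> y) \<otimes> \<ominus> (\<one> \<oplus> y) = \<ominus> (\<one> \<oplus> y) \<oplus> (y \<otimes> y \<ominus> \<one>)"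
    and "\<ominus> (\<one> \<oplus> y) \<otimes> \<ominus> (\<one> \<oplus> \<ominus> y) = \<one> \<ominus> y \<otimes> y"
    and "\<ominus> (\<one> \<oplus> y) \<oplus> \<ominus> (\<one> \<oplus> \<ominus> y) = \<one>"
    and "\<ominus> (\<one> \<oplus> y) \<otimes> \<ominus> (\<one> \<oplus> z) \<oplus> \<ominus> (\<one> \<oplus> \<ominus> y) \<otimes> \<ominus> (\<one> \<oplus> \<ominus> z) = \<ominus> (\<one> \<oplus> y \<otimes> z)"
    and "\<ominus> ((y \<oplus> z) \<oplus> (y \<ominus> z)) = y"
    and "\<ominus> ((y \<oplus> z) \<oplus> \<ominus> (y \<ominus> z)) = z"
    and "(y \<ominus> z) \<otimes> (y \<ominus> z) = y \<otimes> y \<oplus> z \<otimes> z \<oplus> y \<otimes> z"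
    and "\<ominus> (\<ominus> (\<one> \<oplus> y)) \<ominus> \<one> = y"
proof -
  obtain y' z' where e: "y = hev y'" "z = hev z'" using assms hev_surj by metis
  show "\<ominus> (\<one> \<oplus> y) \<otimes> \<ominus> (\<one> \<oplus> y) = \<ominus> (\<one> \<oplus> y) \<oplus> (y \<otimes> y \<ominus> \<one>)"
    "\<ominus> (\<one> \<oplus> y) \<otimes> \<ominus> (\<one> \<oplus> \<ominus> y) = \<one> \<ominus> y \<otimes> y"
    "\<ominus> (\<one> \<oplus> y) \<oplus> \<ominus> (\<one> \<oplus> \<ominus> y) = \<one>"
    "\<ominus> (\<one> \<oplus> y) \<otimes> \<ominus> (\<one> \<oplus> z) \<oplus> \<ominus> (\<one> \<oplus> \<ominus> y) \<otimes> \<ominus> (\<one> \<oplus> \<ominus> z) = \<ominus> (\<one> \<oplus> y \<otimes> z)"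
    "\<ominus> ((y \<oplus> z) \<oplus> (y \<ominus> z)) = y"
    "\<ominus> ((y \<oplus> z) \<oplus> \<ominus> (y \<ominus> z)) = z"
    "(y \<ominus> z) \<otimes> (y \<ominus> z) = y \<otimes> y \<oplus> z \<otimes> z \<oplus> y \<otimes> z"
    "\<ominus> (\<ominus> (\<one> \<oplus> y)) \<ominus> \<one> = y"
    unfolding e by (simp_all only: hev_simps)
      (rule arg_cong[of _ _ hev]; (simp only: herm_expand)?; (simp only: herm_collect)?)+
qed

end

text \<open>For \<open>y\<^sup>2 = 1\<close>, the orthogonal idempotents \<open>(1 + y) / 2\<close> and \<open>(1 - y) / 2\<close>; note that \<open>1 / 2 = -1\<close>.\<close>

definition sign_pt :: "('f::field, 'u) module \<Rightarrow> 'u \<Rightarrow> int \<Rightarrow> 'u" where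
  "sign_pt R y = (\<lambda>g \<in> {0, 1}. \<ominus>\<^bsub>R\<^esub> (\<one>\<^bsub>R\<^esub> \<oplus>\<^bsub>R\<^esub> (if g = 0 then y else \<ominus>\<^bsub>R\<^esub> y)))"

lemma carrier_C2: "carrier (integer_mod_group 2) = {0, 1}"
  by (auto simp: carrier_integer_mod_group)

abbreviation C2 :: "('f::field, 'u, int \<Rightarrow> 'u) grp_functor" where
  "C2 \<equiv> constant_functor (integer_mod_group 2)"

context etale_over
begin

text \<open>\<open>R\<close> embeds into \<open>K \<otimes> R\<close> by \<open>iota\<close> and
  inherits the identities from there.\<close>

lemma sign_R:
  assumes y: "y \<in> carrier R" and z: "z \<in> carrier R"
  shows "\<ominus> (\<one> \<oplus> y) \<otimes> \<ominus> (\<one> \<oplus> y) = \<ominus> (\<one> \<oplus> y) \<oplus> (y \<otimes> y \<ominus> \<one>)"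
    and "\<ominus> (\<one> \<oplus> y) \<otimes> \<ominus> (\<one> \<oplus> \<ominus> y) = \<one> \<ominus> y \<otimes> y"
    and "\<ominus> (\<one> \<oplus> y) \<oplus> \<ominus> (\<one> \<oplus> \<ominus> y) = \<one>"
    and "\<ominus> (\<one> \<oplus> y) \<otimes> \<ominus> (\<one> \<oplus> z) \<oplus> \<ominus> (\<one> \<oplus> \<ominus> y) \<otimes> \<ominus> (\<one> \<oplus> \<ominus> z) = \<ominus> (\<one> \<oplus> y \<otimes> z)"
    and "\<ominus> ((y \<oplus> z) \<oplus> (y \<ominus> z)) = y"
    and "\<ominus> ((y \<oplus> z) \<oplus> \<ominus> (y \<ominus> z)) = z"
    and "(y \<ominus> z) \<otimes> (y \<ominus> z) = y \<otimes> y \<oplus> z \<otimes> z \<oplus> y \<otimes> z"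
    and "\<ominus> (\<ominus> (\<one> \<oplus> y)) \<ominus> \<one> = y"
proof -
  note H = H.sign_identities[of "iota y" "iota z"]
  have c: "iota y \<in> carrier KRing" "iota z \<in> carrier KRing" using y z by simp_all
  show "\<ominus> (\<one> \<oplus> y) \<otimes> \<ominus> (\<one> \<oplus> y) = \<ominus> (\<one> \<oplus> y) \<oplus> (y \<otimes> y \<ominus> \<one>)"
    by (rule iota_inj) (use H(1)[OF c] y z in \<open>simp_all only: iota_hom one_closed add.m_closed m_closed a_inv_closed minus_closed\<close>)
  show "\<ominus> (\<one> \<oplus> y) \<otimes> \<ominus> (\<one> \<oplus> \<ominus> y) = \<one> \<ominus> y \<otimes> y"
    by (rule iota_inj) (use H(2)[OF c] y z in \<open>simp_all only: iota_hom one_closed add.m_closed m_closed a_inv_closed minus_closed\<close>)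
  show "\<ominus> (\<one> \<oplus> y) \<oplus> \<ominus> (\<one> \<oplus> \<ominus> y) = \<one>"
    by (rule iota_inj) (use H(3)[OF c] y z in \<open>simp_all only: iota_hom one_closed add.m_closed m_closed a_inv_closed minus_closed\<close>)
  show "\<ominus> (\<one> \<oplus> y) \<otimes> \<ominus> (\<one> \<oplus> z) \<oplus> \<ominus> (\<one> \<oplus> \<ominus> y) \<otimes> \<ominus> (\<one> \<oplus> \<ominus> z) = \<ominus> (\<one> \<oplus> y \<otimes> z)"
    by (rule iota_inj) (use H(4)[OF c] y z in \<open>simp_all only: iota_hom one_closed add.m_closed m_closed a_inv_closed minus_closed\<close>)
  show "\<ominus> ((y \<oplus> z) \<oplus> (y \<ominus> z)) = y"
    by (rule iota_inj) (use H(5)[OF c] y z in \<open>simp_all only: iota_hom one_closed add.m_closed m_closed a_inv_closed minus_closed\<close>)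
  show "\<ominus> ((y \<oplus> z) \<oplus> \<ominus> (y \<ominus> z)) = z"
    by (rule iota_inj) (use H(6)[OF c] y z in \<open>simp_all only: iota_hom one_closed add.m_closed m_closed a_inv_closed minus_closed\<close>)
  show "(y \<ominus> z) \<otimes> (y \<ominus> z) = y \<otimes> y \<oplus> z \<otimes> z \<oplus> y \<otimes> z"
    by (rule iota_inj) (use H(7)[OF c] y z in \<open>simp_all only: iota_hom one_closed add.m_closed m_closed a_inv_closed minus_closed\<close>)
  show "\<ominus> (\<ominus> (\<one> \<oplus> y)) \<ominus> \<one> = y"
    by (rule iota_inj) (use H(8)[OF c] y z in \<open>simp_all only: iota_hom one_closed add.m_closed m_closed a_inv_closed minus_closed\<close>)
qed

lemma sign_pt_inj:
  assumes "sign_pt R y = sign_pt R z" "y \<in> carrier R" "z \<in> carrier R"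
  shows "y = z"
proof -
  have "\<ominus> (\<one> \<oplus> y) = \<ominus> (\<one> \<oplus> z)" using fun_cong[OF assms(1), of 0] by (simp add: sign_pt_def)
  then show ?thesis using sign_R(8)[of y y] sign_R(8)[of z z] assms by simp
qed

lemma sign_pt_in:
  assumes y: "y \<in> carrier R" "y \<otimes> y = \<one>"
  shows "sign_pt R y \<in> carrier (pts C2 R)"
proof -
  have "\<ominus> y \<otimes> \<ominus> y = \<one>" using y by (simp add: l_minus r_minus)
  then have "\<ominus> (\<one> \<oplus> y) \<otimes> \<ominus> (\<one> \<oplus> y) = \<ominus> (\<one> \<oplus> y)"
    "\<ominus> (\<one> \<oplus> \<ominus> y) \<otimes> \<ominus> (\<one> \<oplus> \<ominus> y) = \<ominus> (\<one> \<oplus> \<ominus> y)"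
    "\<ominus> (\<one> \<oplus> y) \<otimes> \<ominus> (\<one> \<oplus> \<ominus> y) = \<zero>"
    using sign_R(1)[of y y] sign_R(1)[of "\<ominus> y" y] sign_R(2)[of y y] y by (simp_all add: minus_eq r_neg)
  moreover from this(3) have "\<ominus> (\<one> \<oplus> \<ominus> y) \<otimes> \<ominus> (\<one> \<oplus> y) = \<zero>" using y by (subst m_comm) simp_all
  ultimately show ?thesis
    using sign_R(3)[of y y] y by (auto simp: constant_functor_def carrier_C2 sign_pt_def)
qed

text \<open>As 2 is invertible, a pair of complementary orthogonal idempotents \<open>b\<close>,
  \<open>c\<close> is the same as a square root of 1, namely \<open>b - c\<close>. The constant
  group is handled through these square roots.\<close>

lemma sign_pt_cases:
  assumes "e \<in> carrier (pts C2 R)"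
  obtains y where "y \<in> carrier R" "y \<otimes> y = \<one>" "e = sign_pt R y"
proof -
  define b c where "b = e 0" and "c = e 1"
  have e: "b \<in> carrier R" "c \<in> carrier R" "b \<otimes> b = b" "b \<otimes> c = \<zero>" "c \<otimes> c = c" "b \<oplus> c = \<one>" "e \<in> extensional {0, 1}"
    using assms by (auto simp: constant_functor_def carrier_C2 b_def c_def PiE_iff)
  show ?thesis
  proof (rule that[of "b \<ominus> c"])
    show "(b \<ominus> c) \<otimes> (b \<ominus> c) = \<one>" using sign_R(7)[of b c] e by simp
    show "e = sign_pt R (b \<ominus> c)"
    proof (rule extensionalityI[OF e(7)])
      show "e g = sign_pt R (b \<ominus> c) g" if "g \<in> {0, 1}" for g
        using that sign_R(5,6)[of b c] e(1,2,6) by (auto simp: sign_pt_def b_def c_def)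
    qed (simp add: sign_pt_def)
  qed (use e in simp)
qed

text \<open>The convolution over \<open>h + k = g\<close> in the group of order 2 becomes the
  product of the square roots of 1.\<close>

lemma sign_pt_mult:
  assumes y: "y \<in> carrier R" and z: "z \<in> carrier R"
  shows "sign_pt R y \<otimes>\<^bsub>pts C2 R\<^esub> sign_pt R z = sign_pt R (y \<otimes> z)"
proof -
  let ?C = "integer_mod_group 2"
  have s: "{(h, k) \<in> carrier ?C \<times> carrier ?C. h \<otimes>\<^bsub>?C\<^esub> k = 0} = {(0, 0), (1, 1)}"
    "{(h, k) \<in> carrier ?C \<times> carrier ?C. h \<otimes>\<^bsub>?C\<^esub> k = 1} = {(0, 1), (1, 0)}" by (auto simp: carrier_C2)
  have ev: "(sign_pt R y \<otimes>\<^bsub>pts C2 R\<^esub> sign_pt R z) g = finsum R (\<lambda>(h, k). sign_pt R y h \<otimes> sign_pt R z k)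
      {(h, k) \<in> carrier ?C \<times> carrier ?C. h \<otimes>\<^bsub>?C\<^esub> k = g}" if "g \<in> carrier ?C" for g
    using that by (simp only: constant_functor_def grp_functor.simps monoid.simps restrict_apply')
  have 1: "\<ominus> (\<one> \<oplus> y) \<otimes> \<ominus> (\<one> \<oplus> \<ominus> z) \<oplus> \<ominus> (\<one> \<oplus> \<ominus> y) \<otimes> \<ominus> (\<one> \<oplus> z) = \<ominus> (\<one> \<oplus> \<ominus> (y \<otimes> z))"
    using sign_R(4)[of y "\<ominus> z"] y z by (simp add: r_minus)
  have "finsum R (\<lambda>(h, k). sign_pt R y h \<otimes> sign_pt R z k) {(0, 0), (1, 1)} = \<ominus> (\<one> \<oplus> y \<otimes> z)"
    "finsum R (\<lambda>(h, k). sign_pt R y h \<otimes> sign_pt R z k) {(0, 1), (1, 0)} = \<ominus> (\<one> \<oplus> \<ominus> (y \<otimes> z))"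
    using sign_R(4)[OF y z] 1 y z by (simp_all add: sign_pt_def)
  then have "(sign_pt R y \<otimes>\<^bsub>pts C2 R\<^esub> sign_pt R z) g = sign_pt R (y \<otimes> z) g" if "g \<in> {0, 1}" for g
    using that ev[of g, unfolded carrier_C2[symmetric]] s
    by (auto simp only: carrier_C2 insert_iff empty_iff sign_pt_def[of R "y \<otimes> z"] restrict_apply' simp_thms if_True if_False zero_neq_one one_neq_zero)
  moreover have "sign_pt R y \<otimes>\<^bsub>pts C2 R\<^esub> sign_pt R z \<in> extensional {0, 1}"
    by (simp add: constant_functor_def carrier_C2)
  ultimately show ?thesis by (intro extensionalityI[of _ "{0, 1}"]) (simp_all add: sign_pt_def)
qed

lemma sign_pt_one: "\<one>\<^bsub>pts C2 R\<^esub> = sign_pt R \<one>"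
  using sign_R(3)[of \<zero> \<zero>]
  by (auto simp: constant_functor_def carrier_C2 sign_pt_def r_neg l_neg minus_add intro!: restrict_ext)

lemma C2_group: "group (pts C2 R)"
proof (rule groupI)
  fix e e' e'' assume "e \<in> carrier (pts C2 R)" "e' \<in> carrier (pts C2 R)" "e'' \<in> carrier (pts C2 R)"
  then obtain y y' y'' where y: "y \<in> carrier R" "y \<otimes> y = \<one>" "e = sign_pt R y"
    "y' \<in> carrier R" "y' \<otimes> y' = \<one>" "e' = sign_pt R y'" "y'' \<in> carrier R" "y'' \<otimes> y'' = \<one>" "e'' = sign_pt R y''"
    using sign_pt_cases by metis
  have "(y \<otimes> y') \<otimes> (y \<otimes> y') = (y \<otimes> y) \<otimes> (y' \<otimes> y')" using y(1,4) by (simp add: m_ac)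
  then show "e \<otimes>\<^bsub>pts C2 R\<^esub> e' \<in> carrier (pts C2 R)" using y by (simp add: sign_pt_mult sign_pt_in)
  show "e \<otimes>\<^bsub>pts C2 R\<^esub> e' \<otimes>\<^bsub>pts C2 R\<^esub> e'' = e \<otimes>\<^bsub>pts C2 R\<^esub> (e' \<otimes>\<^bsub>pts C2 R\<^esub> e'')"
    using y by (simp add: sign_pt_mult m_assoc)
next
  show "\<one>\<^bsub>pts C2 R\<^esub> \<in> carrier (pts C2 R)" by (simp add: sign_pt_one sign_pt_in)
next
  fix e assume e: "e \<in> carrier (pts C2 R)"
  then obtain y where y: "y \<in> carrier R" "y \<otimes> y = \<one>" "e = sign_pt R y" by (rule sign_pt_cases)
  show "\<one>\<^bsub>pts C2 R\<^esub> \<otimes>\<^bsub>pts C2 R\<^esub> e = e" using y by (simp add: sign_pt_mult sign_pt_one)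
  show "\<exists>e' \<in> carrier (pts C2 R). e' \<otimes>\<^bsub>pts C2 R\<^esub> e = \<one>\<^bsub>pts C2 R\<^esub>"
    using e y by (intro bexI[of _ e]) (simp_all add: sign_pt_mult sign_pt_one)
qed

definition sign :: "(('k cayley \<Rightarrow> 'u) \<Rightarrow> 'k cayley \<Rightarrow> 'u) \<Rightarrow> 'u" where
  "sign g = (THE y. y \<in> carrier R \<and> fst (low g (HS.hK theta)) = iota y \<otimes>\<^bsub>KRing\<^esub> theta)"

lemma theta_closed [simp]: "theta \<in> KR s R" "theta \<in> carrier KRing" by simp_all

lemma sign_eqI: "\<lbrakk>y \<in> carrier R; fst (low g (HS.hK theta)) = iota y \<otimes>\<^bsub>KRing\<^esub> theta\<rbrakk> \<Longrightarrow> sign g = y"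
  unfolding sign_def by (rule the_equality) (auto intro: iota_inj dest: theta_cancel)

lemma sign_props:
  assumes g: "g \<in> carrier HG"
  obtains z where "low g (HS.hK theta) = (iota (sign g) \<otimes>\<^bsub>KRing\<^esub> theta, z, z, z)" "z \<in> KR s R"
    "sign g \<in> carrier R" "sign g \<otimes> sign g = \<one>"
proof -
  obtain y z where yz: "low g (HS.hK theta) = (y \<otimes>\<^bsub>KRing\<^esub> theta, z, z, z)" "y \<in> carrier KRing" "z \<in> carrier KRing"
    "kbar y = y" "y \<otimes>\<^bsub>KRing\<^esub> y = \<one>\<^bsub>KRing\<^esub>"
    using HS.hcent_th[OF hcent_low[OF g]] by metis
  obtain t where t: "t \<in> carrier R" "y = iota t" using symmetric_iota[of y] yz by auto
  have "sign g = t" by (rule sign_eqI) (use t yz in simp_all)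
  moreover have "t \<otimes> t = \<one>" by (rule iota_inj) (use t yz in \<open>simp_all add: iota_hom\<close>)
  ultimately show ?thesis using that[of z] yz t by simp
qed

text \<open>Let \<open>h\<close> send \<open>\<theta>\<close> to \<open>y \<theta> + w u\<close>.
  After applying \<open>g\<close> the second summand stays in the radical and adds nothing to the
  \<open>K\<close>-component, so the signs multiply.\<close>

lemma sign_mult:
  assumes g: "g \<in> carrier HG" and h: "h \<in> carrier HG"
  shows "sign (g \<otimes>\<^bsub>HG\<^esub> h) = sign g \<otimes> sign h"
proof (rule sign_eqI)
  obtain z where z: "low g (HS.hK theta) = (iota (sign g) \<otimes>\<^bsub>KRing\<^esub> theta, z, z, z)" "z \<in> KR s R" "sign g \<in> carrier R"
    using sign_props[OF g] by metis
  obtain w where w: "low h (HS.hK theta) = (iota (sign h) \<otimes>\<^bsub>KRing\<^esub> theta, w, w, w)" "w \<in> KR s R" "sign h \<in> carrier R"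
    using sign_props[OF h] by metis
  obtain v where v: "low g (HS.hU w) = HS.hU v" "v \<in> carrier KRing" using HS.hcent_hU[OF hcent_low[OF g]] w(2) by auto
  show "sign g \<otimes> sign h \<in> carrier R" using z w by simp
  have sc: "H.hscale (iota (sign h)) (HS.hK theta) \<in> H.hcar"
    using w by (simp add: H.hscale_def HS.hK_def)
  have "low h (HS.hK theta) = H.hadd (H.hscale (iota (sign h)) (HS.hK theta)) (HS.hU w)"
    using w by (simp add: H.hadd_def H.hscale_def HS.hK_def HS.hU_def)
  then have "low (g \<otimes>\<^bsub>HG\<^esub> h) (HS.hK theta) = H.hadd (H.hscale (iota (sign h)) (low g (HS.hK theta))) (HS.hU v)"
    using g h w v H.hcentD(1-3)[OF hcent_low[OF g]] sc by (simp add: low_mult)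
  then show "fst (low (g \<otimes>\<^bsub>HG\<^esub> h) (HS.hK theta)) = iota (sign g \<otimes> sign h) \<otimes>\<^bsub>KRing\<^esub> theta"
    using z w v by (simp add: H.hadd_def H.hscale_def HS.hU_def iota_hom H.m_ac)
qed

lemma hexp_hom: "(\<lambda>z. lift (H.hexp z)) \<in> hom (add_monoid KRing) HG"
  by (rule homI) (auto simp: lift_in hcent_hexp' lift_mult H.hexp_exp intro!: lift_cong)

lemma mu_hom: "mu_embed s R \<in> hom (pts (mu_functor s) R) HG"
proof (rule homI)
  fix r t assume rt: "r \<in> carrier (pts (mu_functor s) R)" "t \<in> carrier (pts (mu_functor s) R)"
  have "r \<otimes>\<^bsub>KRing\<^esub> t \<in> KR s R" "r \<in> KR s R" "t \<in> KR s R" using rt by (simp_all add: mu_carrier)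
  moreover from this have "lift (H.hmu (r \<otimes>\<^bsub>KRing\<^esub> t)) = lift (\<lambda>V. H.hmu r (H.hmu t V))"
    by (intro lift_cong) (rule H.hmu_simps(3)[symmetric], simp_all)
  ultimately show "mu_embed s R (r \<otimes>\<^bsub>pts (mu_functor s) R\<^esub> t) = mu_embed s R r \<otimes>\<^bsub>HG\<^esub> mu_embed s R t"
    using rt by (simp add: mu_embed_lift mu_mult lift_mult hcent_hmu')
qed (simp add: mu_embed_lift mu_carrier lift_in hcent_hmu')

lemma nilp_hom: "(\<lambda>(m, n). lift (nilp m n)) \<in> hom (add_monoid R \<times>\<times> add_monoid R) HG"
  by (rule homI) (auto simp: lift_in hcent_nilp lift_mult nilp_nilp intro!: lift_cong)

lemma structure_lift:
  assumes "z \<in> KR s R" "r \<in> carrier (pts (mu_functor s) R)" "m \<in> carrier R" "n \<in> carrier R"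
  shows "lift (H.hexp z) \<otimes>\<^bsub>HG\<^esub> mu_embed s R r \<otimes>\<^bsub>HG\<^esub> lift (nilp m n) = lift (\<lambda>V. H.hexp z (H.hmu r (nilp m n V)))"
  using assms by (simp add: mu_embed_lift mu_carrier lift_mult hcent_hexp' hcent_hmu' hcent_nilp H.hcent_compose)

lemma hexp_lift_inj: "inj_on (\<lambda>z. lift (H.hexp z)) (KR s R)"
proof (rule inj_onI)
  fix z z' assume z: "z \<in> KR s R" "z' \<in> KR s R" and e: "lift (H.hexp z) = lift (H.hexp z')"
  have o: "\<one>\<^bsub>KRing\<^esub> \<in> carrier (pts (mu_functor s) R)" by (simp add: mu_carrier)
  have "lift (\<lambda>V. H.hexp z (H.hmu \<one>\<^bsub>KRing\<^esub> (nilp \<zero> \<zero> V))) = lift (\<lambda>V. H.hexp z' (H.hmu \<one>\<^bsub>KRing\<^esub> (nilp \<zero> \<zero> V)))"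
    using structure_lift[OF z(1) o zero_closed zero_closed] structure_lift[OF z(2) o zero_closed zero_closed] e by simp
  then show "z = z'" using structure_unique[OF z(1) o zero_closed zero_closed z(2) o zero_closed zero_closed] by blast
qed

lemma mu_embed_inj: "inj_on (mu_embed s R) (carrier (pts (mu_functor s) R))"
proof (rule inj_onI)
  fix r r' assume r: "r \<in> carrier (pts (mu_functor s) R)" "r' \<in> carrier (pts (mu_functor s) R)"
    and e: "mu_embed s R r = mu_embed s R r'"
  have o: "\<zero>\<^bsub>KRing\<^esub> \<in> KR s R" by simp
  have "lift (\<lambda>V. H.hexp \<zero>\<^bsub>KRing\<^esub> (H.hmu r (nilp \<zero> \<zero> V))) = lift (\<lambda>V. H.hexp \<zero>\<^bsub>KRing\<^esub> (H.hmu r' (nilp \<zero> \<zero> V)))"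
    using structure_lift[OF o r(1) zero_closed zero_closed] structure_lift[OF o r(2) zero_closed zero_closed] e by simp
  then show "r = r'" using structure_unique[OF o r(1) zero_closed zero_closed o r(2) zero_closed zero_closed] by blast
qed

lemma nilp_lift_inj: "inj_on (\<lambda>(m, n). lift (nilp m n)) (carrier R \<times> carrier R)"
proof (rule inj_onI, clarify)
  fix m n m' n' assume c: "m \<in> carrier R" "n \<in> carrier R" "m' \<in> carrier R" "n' \<in> carrier R"
    and e: "lift (nilp m n) = lift (nilp m' n')"
  have o: "\<zero>\<^bsub>KRing\<^esub> \<in> KR s R" "\<one>\<^bsub>KRing\<^esub> \<in> carrier (pts (mu_functor s) R)" by (simp_all add: mu_carrier)
  have "lift (\<lambda>V. H.hexp \<zero>\<^bsub>KRing\<^esub> (H.hmu \<one>\<^bsub>KRing\<^esub> (nilp m n V))) = lift (\<lambda>V. H.hexp \<zero>\<^bsub>KRing\<^esub> (H.hmu \<one>\<^bsub>KRing\<^esub> (nilp m' n' V)))"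
    using structure_lift[OF o c(1,2)] structure_lift[OF o c(3,4)] e by simp
  then show "m = m' \<and> n = n'" using structure_unique[OF o c(1,2) o c(3,4)] by blast
qed

lemma K_subgroup: "subgroup (carrier (pts (K_functor s a) R)) HG"
proof -
  interpret h: group_hom "add_monoid KRing" HG "\<lambda>z. lift (H.hexp z)"
    by (intro group_hom.intro group_hom_axioms.intro H.add.is_group cent_group hexp_hom)
  show ?thesis using h.img_is_subgroup by (simp add: K_carrier)
qed

lemma N_subgroup: "subgroup (carrier (pts (N_functor s a) R)) HG"
proof -
  interpret h: group_hom "add_monoid R \<times>\<times> add_monoid R" HG "\<lambda>(m, n). lift (nilp m n)"
    by (intro group_hom.intro group_hom_axioms.intro DirProd_group add.is_group cent_group nilp_hom)
  have "carrier (pts (N_functor s a) R) = (\<lambda>(m, n). lift (nilp m n)) ` carrier (add_monoid R \<times>\<times> add_monoid R)"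
    by (auto simp: N_carrier)
  then show ?thesis using h.img_is_subgroup by simp
qed

lemma K_eq_HG: "pts (K_functor s a) R = HG\<lparr>carrier := carrier (pts (K_functor s a) R)\<rparr>"
  and N_eq_HG: "pts (N_functor s a) R = HG\<lparr>carrier := carrier (pts (N_functor s a) R)\<rparr>"
  by (simp_all add: K_functor_def N_functor_def)

lemma K_mult: "x \<otimes>\<^bsub>pts (K_functor s a) R\<^esub> y = x \<otimes>\<^bsub>HG\<^esub> y"
  and N_mult: "x \<otimes>\<^bsub>pts (N_functor s a) R\<^esub> y = x \<otimes>\<^bsub>HG\<^esub> y"
  by (subst K_eq_HG, simp, subst N_eq_HG, simp)

lemma K_comm_group: "comm_group (pts (K_functor s a) R)"
proof -
  have g: "group (pts (K_functor s a) R)"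
    using subgroup.subgroup_is_group[OF K_subgroup cent_group] K_eq_HG by simp
  show ?thesis
  proof (rule group.group_comm_groupI[OF g])
    fix x y assume "x \<in> carrier (pts (K_functor s a) R)" "y \<in> carrier (pts (K_functor s a) R)"
    then obtain z w where "x = lift (H.hexp z)" "y = lift (H.hexp w)" "z \<in> KR s R" "w \<in> KR s R"
      by (auto simp: K_carrier)
    then show "x \<otimes>\<^bsub>pts (K_functor s a) R\<^esub> y = y \<otimes>\<^bsub>pts (K_functor s a) R\<^esub> x"
      using hom_mult[OF hexp_hom, of z w] hom_mult[OF hexp_hom, of w z] H.a_comm[of z w] by (simp add: K_mult)
  qed
qed

text \<open>Scaling by \<open>r\<close> sends the vector \<open>z (w1 + w2 + w3)\<close> to
  \<open>r z (w1 + w2 + w3)\<close>, so conjugation acts on the parameter of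
  \<open>K_functor\<close> by multiplication with \<open>r\<close>.\<close>

lemma mu_hexp:
  assumes r: "r \<in> carrier (pts (mu_functor s) R)" and z: "z \<in> KR s R"
  shows "mu_embed s R r \<otimes>\<^bsub>HG\<^esub> lift (H.hexp z) = lift (H.hexp (r \<otimes>\<^bsub>KRing\<^esub> z)) \<otimes>\<^bsub>HG\<^esub> mu_embed s R r"
proof -
  have rc: "r \<in> KR s R" using r by (simp add: mu_carrier)
  have "H.hmu r (H.hexp z V) = H.hexp (r \<otimes>\<^bsub>KRing\<^esub> z) (H.hmu r V)" if "V \<in> H.hcar" for V
    by (rule H.hcent_hexp_conj[OF hcent_hmu'[OF r]]) (use rc z that in \<open>simp_all add: H.hmu_def\<close>)
  then show ?thesis using r rc z by (auto simp: mu_embed_lift lift_mult hcent_hmu' hcent_hexp' intro!: lift_cong)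
qed

lemma K_normalized:
  assumes r: "r \<in> carrier (pts (mu_functor s) R)" and k: "k \<in> carrier (pts (K_functor s a) R)"
  shows "mu_embed s R r \<otimes>\<^bsub>HG\<^esub> k \<otimes>\<^bsub>HG\<^esub> inv\<^bsub>HG\<^esub> (mu_embed s R r) \<in> carrier (pts (K_functor s a) R)"
proof -
  interpret G: group HG by (rule cent_group)
  obtain z where z: "z \<in> KR s R" "k = lift (H.hexp z)" using k by (auto simp: K_carrier)
  have rc: "r \<in> KR s R" using r by (simp add: mu_carrier)
  have c: "mu_embed s R r \<in> carrier HG" "lift (H.hexp (r \<otimes>\<^bsub>KRing\<^esub> z)) \<in> carrier HG"
    using hom_in_carrier[OF mu_hom r] z rc by (simp_all add: lift_in hcent_hexp')
  have "mu_embed s R r \<otimes>\<^bsub>HG\<^esub> k \<otimes>\<^bsub>HG\<^esub> inv\<^bsub>HG\<^esub> (mu_embed s R r) = lift (H.hexp (r \<otimes>\<^bsub>KRing\<^esub> z))"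
    using mu_hexp[OF r z(1)] c z by (simp add: G.m_assoc)
  then show ?thesis using rc z by (auto simp: K_carrier)
qed

text \<open>Elements of \<open>N_functor\<close> fix the radical, hence commute with its
  exponentials; being \<open>K\<close>-linear on \<open>W\<close>, they also commute with scaling by
  \<open>r\<close>.\<close>

lemma N_commutes:
  assumes g: "g \<in> carrier (pts (N_functor s a) R)"
  shows "k \<in> carrier (pts (K_functor s a) R) \<Longrightarrow> g \<otimes>\<^bsub>HG\<^esub> k = k \<otimes>\<^bsub>HG\<^esub> g"
    and "r \<in> carrier (pts (mu_functor s) R) \<Longrightarrow> g \<otimes>\<^bsub>HG\<^esub> mu_embed s R r = mu_embed s R r \<otimes>\<^bsub>HG\<^esub> g"
proof -
  obtain m n where mn: "m \<in> carrier R" "n \<in> carrier R" "g = lift (nilp m n)" using g by (auto simp: N_carrier)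
  show "g \<otimes>\<^bsub>HG\<^esub> k = k \<otimes>\<^bsub>HG\<^esub> g" if k: "k \<in> carrier (pts (K_functor s a) R)"
  proof -
    obtain z where z: "z \<in> KR s R" "k = lift (H.hexp z)" using k by (auto simp: K_carrier)
    have "nilp m n (H.hexp z V) = H.hexp z (nilp m n V)" if "V \<in> H.hcar" for V
      by (rule H.hcent_hexp_conj[OF hcent_nilp[OF mn(1,2)]]) (use mn z that in \<open>simp_all add: nilp_fixes\<close>)
    then show ?thesis using mn z by (auto simp: lift_mult hcent_nilp hcent_hexp' intro!: lift_cong)
  qed
  show "g \<otimes>\<^bsub>HG\<^esub> mu_embed s R r = mu_embed s R r \<otimes>\<^bsub>HG\<^esub> g" if r: "r \<in> carrier (pts (mu_functor s) R)"
  proof -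
    have rc: "r \<in> KR s R" using r by (simp add: mu_carrier)
    have "nilp m n (H.hmu r V) = H.hmu r (nilp m n V)" if "V \<in> H.hcar" for V
      unfolding nilp_def by (rule H.hnil_hmu) (use mn rc that in simp_all)
    then show ?thesis using mn r rc by (auto simp: mu_embed_lift lift_mult hcent_nilp hcent_hmu' intro!: lift_cong)
  qed
qed

lemma sign_structure:
  assumes "z \<in> KR s R" "r \<in> carrier (pts (mu_functor s) R)" "m \<in> carrier R" "n \<in> carrier R"
  shows "sign (lift (\<lambda>V. H.hexp z (H.hmu r (nilp m n V)))) = \<one>"
proof (rule sign_eqI)
  have r: "r \<in> KR s R" using assms by (simp add: mu_carrier)
  have "H.hcent (\<lambda>V. H.hexp z (H.hmu r (nilp m n V)))"
    by (rule H.hcent_compose[OF hcent_hexp' H.hcent_compose[OF hcent_hmu' hcent_nilp]]) (use assms in simp_all)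
  then show "fst (low (lift (\<lambda>V. H.hexp z (H.hmu r (nilp m n V)))) (HS.hK theta)) = iota \<one> \<otimes>\<^bsub>KRing\<^esub> theta"
    using HS.structure_values(1)[of z r "iota m" "iota n \<otimes>\<^bsub>KRing\<^esub> theta"] assms r
    by (simp add: low_lift nilp_def iota_hom)
qed simp

lemma FixR_closed:
  assumes "x \<in> FixR s R" "y \<in> FixR s R"
  shows "CE.add_ext x y \<in> FixR s R" "r \<in> carrier R \<Longrightarrow> CE.scale_ext r x \<in> FixR s R" "CR_mult s a R x y \<in> FixR s R"
proof -
  obtain b z c w where x: "x \<in> CR s R" "b \<in> KR s R" "z \<in> KR s R" "upk x = (b, z, z, z)"
    and y: "y \<in> CR s R" "c \<in> KR s R" "w \<in> KR s R" "upk y = (c, w, w, w)"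
    using assms unfolding FixR_iff by blast
  show "CE.add_ext x y \<in> FixR s R" using x y by (simp add: FixR_iff upk_add H.hadd_def)
  show "CE.scale_ext r x \<in> FixR s R" if "r \<in> carrier R" using x that by (simp add: FixR_iff upk_scale H.hscale_def)
  have "CR_mult s a R x y \<in> CR s R" using x y by (simp add: CR_mult_closed)
  then show "CR_mult s a R x y \<in> FixR s R" using x y HS.hmul_fix[of b c z w] by (simp add: FixR_iff upk_mult)
qed

lemma FixR_tau: "x \<in> FixR s R \<longleftrightarrow> x \<in> CR s R \<and> CR_tau s R x = x"
proof
  assume "x \<in> FixR s R"
  then obtain b z where x: "x \<in> CR s R" "b \<in> KR s R" "z \<in> KR s R" "upk x = (b, z, z, z)"
    unfolding FixR_iff by blast
  then have "CR_tau s R x = x" by (intro upk_inj) (simp_all add: upk_tau CR_tau_simps H.htau_def)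
  with x show "x \<in> CR s R \<and> CR_tau s R x = x" by simp
next
  assume x: "x \<in> CR s R \<and> CR_tau s R x = x"
  then have "H.htau (upk x) = upk x" using upk_tau[of x] by simp
  then show "x \<in> FixR s R" using HS.htau_fixed[of "upk x"] x by (metis FixR_iff upk_closed carrier_KRing)
qed

lemma restrict_FixR_hom: "(\<lambda>g. restrict g (FixR s R)) \<in> hom HG (aut_fix s a R)"
proof (rule homI)
  have sub: "x \<in> CR s R" if "x \<in> FixR s R" for x using that by (simp add: FixR_iff)
  have im: "g x \<in> FixR s R" if g: "g \<in> carrier HG" and x: "x \<in> FixR s R" for g x
  proof -
    have "CR_tau s R (g x) = g (CR_tau s R x)" using g sub[OF x] by (simp add: cent_carrier)
    then show ?thesis using x centD(3)[OF g] by (simp add: FixR_tau)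
  qed
  have bij: "restrict g (FixR s R) \<in> Bij (FixR s R)" if g: "g \<in> carrier HG" for g
  proof -
    have b: "bij_betw g (CR s R) (CR s R)" using centD(1)[OF g] by (simp add: Bij_def)
    have "g ` FixR s R = FixR s R"
    proof
      show "g ` FixR s R \<subseteq> FixR s R" using im[OF g] by blast
      show "FixR s R \<subseteq> g ` FixR s R"
      proof
        fix y assume y: "y \<in> FixR s R"
        obtain x where x: "x \<in> CR s R" "y = g x" using b sub[OF y] by (auto simp: bij_betw_def)
        \<comment> \<open>The preimage of a fixed point is fixed, because \<open>g\<close> is
          injective and commutes with the shift.\<close>
        have "g (CR_tau s R x) = g x" using g x y by (simp add: cent_carrier FixR_tau)
        then have "CR_tau s R x = x" using b x CR_tau_simps(1)[OF x(1)] by (auto simp: bij_betw_def dest: inj_onD)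
        then show "y \<in> g ` FixR s R" using x by (simp add: FixR_tau)
      qed
    qed
    moreover have "inj_on g (FixR s R)" using b by (auto simp: bij_betw_def intro: inj_on_subset dest: sub)
    ultimately show ?thesis by (simp add: Bij_def bij_betw_def)
  qed
  show "restrict g (FixR s R) \<in> carrier (aut_fix s a R)" if g: "g \<in> carrier HG" for g
    using bij[OF g] centD[OF g] by (simp add: aut_fix_def ext_algebra_auts_def FixR_closed sub)
  show "restrict (g \<otimes>\<^bsub>HG\<^esub> h) (FixR s R) = restrict g (FixR s R) \<otimes>\<^bsub>aut_fix s a R\<^esub> restrict h (FixR s R)"
    if g: "g \<in> carrier HG" and h: "h \<in> carrier HG" for g h
    using bij[OF g] bij[OF h] im[OF h] sub g h
    by (auto simp: aut_fix_def BijGroup_def cent_mult compose_def intro!: restrict_ext)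
qed

end

context etale_hom
begin

lemma low_bc:
  assumes g: "g \<in> carrier A.HG" and V: "V \<in> A.H.hcar"
  shows "B.low (bc g) (f4 V) = f4 (A.low g V)"
proof -
  have "B.pk (f4 V) = fC (A.pk V)"
    by (rule B.upk_inj) (use V in \<open>simp_all add: upk_fC\<close>)
  then show ?thesis using V bc_fC[OF cent_lin(1)[OF g], of "A.pk V"] A.centD(3)[OF g, of "A.pk V"]
    by (simp add: B.low_def A.low_def upk_fC)
qed

lemma sign_bc:
  assumes g: "g \<in> carrier A.HG"
  shows "B.sign (bc g) = f (A.sign g)"
proof (rule B.sign_eqI)
  obtain z where z: "A.low g (A.HS.hK A.theta) = (A.iota (A.sign g) \<otimes>\<^bsub>A.KRing\<^esub> A.theta, z, z, z)" "A.sign g \<in> carrier R"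
    using A.sign_props[OF g] by metis
  have "B.HS.hK B.theta = f4 (A.HS.hK A.theta)"
    by (simp add: f4_def A.HS.hK_def B.HS.hK_def fK_hom fK_pt)
  then have "B.low (bc g) (B.HS.hK B.theta) = f4 (A.low g (A.HS.hK A.theta))"
    using low_bc[OF g, of "A.HS.hK A.theta"] by simp
  then show "fst (B.low (bc g) (B.HS.hK B.theta)) = B.iota (f (A.sign g)) \<otimes>\<^bsub>B.KRing\<^esub> B.theta"
    using z by (simp add: f4_def fK_hom fK_pt)
  show "f (A.sign g) \<in> carrier S" using z by simp
qed

lemma sign_pt_f: "y \<in> carrier R \<Longrightarrow> mor C2 R S f (sign_pt R y) = sign_pt S (f y)"
  by (auto simp: constant_functor_def carrier_C2 sign_pt_def intro!: restrict_ext)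

end

section \<open>Splitting K, and realising the sign -1\<close>

lemma (in cring) quad_mult:
  "\<lbrakk>p \<in> carrier R; q \<in> carrier R; p' \<in> carrier R; q' \<in> carrier R; t \<in> carrier R\<rbrakk> \<Longrightarrow>
    (p \<oplus> q \<otimes> t) \<otimes> (p' \<oplus> q' \<otimes> t) = (p \<otimes> p' \<oplus> q \<otimes> q' \<otimes> (t \<otimes> t)) \<oplus> (p \<otimes> q' \<oplus> q \<otimes> p') \<otimes> t"
  by (simp add: l_distr r_distr m_ac a_ac)

context herm_ring
begin

text \<open>Frobenius in characteristic 3; it lets cube roots in \<open>K \<otimes> R\<close> be
  extracted componentwise with respect to 1 and \<open>theta\<close>.\<close>

lemma cube_add:
  assumes "p \<in> carrier A" "q \<in> carrier A"
  shows "(p \<oplus> q) \<otimes> ((p \<oplus> q) \<otimes> (p \<oplus> q)) = p \<otimes> (p \<otimes> p) \<oplus> q \<otimes> (q \<otimes> q)"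
proof -
  obtain p' q' where e: "p = hev p'" "q = hev q'" using assms hev_surj by metis
  show ?thesis unfolding e by (simp only: hev_simps)
      (rule arg_cong[of _ _ hev]; (simp only: herm_expand)?; (simp only: herm_collect)?)
qed

lemma htwist_minus_one:
  assumes "b \<in> carrier A"
  shows "htwist (\<ominus> \<one>) b = bar b"
proof -
  obtain b' where e: "b = hev b'" using assms hev_surj by metis
  show ?thesis unfolding e htwist_def by (simp only: hev_simps)
      (rule arg_cong[of _ _ hev]; (simp only: herm_expand)?; (simp only: herm_collect)?)
qed

end

context etale_over
begin

lemma iota_smult: "iota (c \<odot> \<one>) = KE.pt (s c 1)"
  by (simp add: iota_def KE.pt_scale)

lemma theta_square: "theta \<otimes>\<^bsub>KRing\<^esub> theta = iota (E.kdisc \<odot> \<one>)"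
  by (simp add: mult_KRing KR_mult_pt E.kgen(1) iota_smult)

lemma pt_decomp: "KE.pt (s m 1 + s n E.kgen) = iota (m \<odot> \<one>) \<oplus>\<^bsub>KRing\<^esub> iota (n \<odot> \<one>) \<otimes>\<^bsub>KRing\<^esub> theta"
proof -
  have "iota (n \<odot> \<one>) \<otimes>\<^bsub>KRing\<^esub> theta = KE.pt (s n E.kgen)" by (simp add: iota_mult KE.pt_scale)
  then show ?thesis by (simp add: KE.pt_add add_KRing iota_smult)
qed

abbreviation kcomb :: "'u \<Rightarrow> 'u \<Rightarrow> 'k \<Rightarrow> 'u" where
  "kcomb m n \<equiv> iota m \<oplus>\<^bsub>KRing\<^esub> iota n \<otimes>\<^bsub>KRing\<^esub> theta"

lemma kbar_kcomb: "\<lbrakk>m \<in> carrier R; n \<in> carrier R\<rbrakk> \<Longrightarrow> kbar (kcomb m n) = iota m \<ominus>\<^bsub>KRing\<^esub> iota n \<otimes>\<^bsub>KRing\<^esub> theta"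
  using H.bar_add[of "iota m" "iota n \<otimes>\<^bsub>KRing\<^esub> theta"] skew_theta[of n] by (simp add: H.minus_eq)

text \<open>Applying the involution separates the symmetric from the skew part.\<close>

lemma kcomb_unique:
  assumes c: "m \<in> carrier R" "n \<in> carrier R" "m' \<in> carrier R" "n' \<in> carrier R" and e: "kcomb m n = kcomb m' n'"
  shows "m = m' \<and> n = n'"
proof -
  have k: "iota m \<ominus>\<^bsub>KRing\<^esub> iota n \<otimes>\<^bsub>KRing\<^esub> theta = iota m' \<ominus>\<^bsub>KRing\<^esub> iota n' \<otimes>\<^bsub>KRing\<^esub> theta"
    using kbar_kcomb c e by metis
  have "iota m = iota m'" "iota n \<otimes>\<^bsub>KRing\<^esub> theta = iota n' \<otimes>\<^bsub>KRing\<^esub> theta"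
    using H.sign_identities(5,6)[of "iota m" "iota n \<otimes>\<^bsub>KRing\<^esub> theta"] H.sign_identities(5,6)[of "iota m'" "iota n' \<otimes>\<^bsub>KRing\<^esub> theta"]
      c e k by simp_all
  then show ?thesis using c iota_inj theta_cancel by (metis iota_closed)
qed

text \<open>The \<open>R\<close>-algebra homomorphism to \<open>R\<close> with \<open>\<theta> \<mapsto> w\<close>, where \<open>w\<^sup>2 = \<theta>\<^sup>2\<close>.\<close>

definition kev :: "'u \<Rightarrow> ('k \<Rightarrow> 'u) \<Rightarrow> 'u" where
  "kev w x = (THE c. \<exists>m \<in> carrier R. \<exists>n \<in> carrier R. x = kcomb m n \<and> c = m \<oplus> n \<otimes> w)"

lemma kev_kcomb: "\<lbrakk>m \<in> carrier R; n \<in> carrier R\<rbrakk> \<Longrightarrow> kev w (kcomb m n) = m \<oplus> n \<otimes> w"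
  unfolding kev_def
proof (rule the_equality)
  assume c: "m \<in> carrier R" "n \<in> carrier R"
  show "\<exists>m' \<in> carrier R. \<exists>n' \<in> carrier R. kcomb m n = kcomb m' n' \<and> m \<oplus> n \<otimes> w = m' \<oplus> n' \<otimes> w"
    using c by blast
  fix d assume "\<exists>m' \<in> carrier R. \<exists>n' \<in> carrier R. kcomb m n = kcomb m' n' \<and> d = m' \<oplus> n' \<otimes> w"
  then obtain m' n' where d: "m' \<in> carrier R" "n' \<in> carrier R" "kcomb m n = kcomb m' n'" "d = m' \<oplus> n' \<otimes> w" by blast
  show "d = m \<oplus> n \<otimes> w" using kcomb_unique[OF c d(1-3)] d(4) by simp
qed

context
  fixes w assumes w: "w \<in> carrier R" "w \<otimes> w = E.kdisc \<odot> \<one>"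
begin

lemma kev_closed: "x \<in> KR s R \<Longrightarrow> kev w x \<in> carrier R"
  using KR_decomp[of x] w by (auto simp: kev_kcomb)

lemma kev_mult:
  assumes "x \<in> KR s R" "y \<in> KR s R"
  shows "kev w (x \<otimes>\<^bsub>KRing\<^esub> y) = kev w x \<otimes> kev w y"
proof -
  obtain m n where x: "m \<in> carrier R" "n \<in> carrier R" "x = kcomb m n" using KR_decomp[OF assms(1)] by blast
  obtain m' n' where y: "m' \<in> carrier R" "n' \<in> carrier R" "y = kcomb m' n'" using KR_decomp[OF assms(2)] by blast
  have "x \<otimes>\<^bsub>KRing\<^esub> y = kcomb (m \<otimes> m' \<oplus> n \<otimes> n' \<otimes> (E.kdisc \<odot> \<one>)) (m \<otimes> n' \<oplus> n \<otimes> m')"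
    using H.quad_mult[of "iota m" "iota n" "iota m'" "iota n'" theta] x y by (simp add: theta_square iota_hom)
  then show ?thesis using quad_mult[of m n m' n' w] x y w by (simp add: kev_kcomb)
qed

lemma kev_one: "kev w \<one>\<^bsub>KRing\<^esub> = \<one>"
  using kev_kcomb[of \<one> \<zero> w] w by (simp add: iota_hom)

lemma kdisc_inv: "(1 / E.kdisc) \<odot> (E.kdisc \<odot> x) = x" if "x \<in> carrier R"
  using that E.kgen(2) by (simp flip: smult_distrib'(3))

lemma w_cancel: "\<lbrakk>x \<otimes> w = y \<otimes> w; x \<in> carrier R; y \<in> carrier R\<rbrakk> \<Longrightarrow> x = y"
proof -
  assume e: "x \<otimes> w = y \<otimes> w" and c: "x \<in> carrier R" "y \<in> carrier R"
  have "z = (1 / E.kdisc) \<odot> (z \<otimes> w \<otimes> w)" if "z \<in> carrier R" for z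
    using that w kdisc_inv[OF that] by (simp add: m_assoc smult_right)
  then show "x = y" using e c by metis
qed

text \<open>Sending \<open>theta\<close> to \<open>w\<close> or to \<open>- w\<close> splits
  \<open>K \<otimes> R\<close> into two copies of \<open>R\<close> that \<open>kbar\<close>
  exchanges. On cube roots of unity of norm 1 one has \<open>kbar r = r^2\<close>, so the second
  component is the square of the first, and the first can be any cube root of unity.\<close>

lemma kev_mu_iso: "kev w \<in> iso (pts (mu_functor s) R) (pts mu3_functor R)"
proof -
  have mu: "kev w r \<otimes> (kev w r \<otimes> kev w r) = \<one>" "kev w (kbar r) = kev w r \<otimes> kev w r" "r \<in> KR s R"
    if "r \<in> carrier (pts (mu_functor s) R)" for r
  proof -
    show r: "r \<in> KR s R" using that by (simp add: mu_carrier)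
    have r3: "r \<otimes>\<^bsub>KRing\<^esub> (r \<otimes>\<^bsub>KRing\<^esub> r) = \<one>\<^bsub>KRing\<^esub>" "r \<otimes>\<^bsub>KRing\<^esub> kbar r = \<one>\<^bsub>KRing\<^esub>"
      using that by (simp_all add: mu_carrier)
    show 1: "kev w r \<otimes> (kev w r \<otimes> kev w r) = \<one>" using r3(1) r kev_one by (simp flip: kev_mult)
    have "kbar r = (r \<otimes>\<^bsub>KRing\<^esub> (r \<otimes>\<^bsub>KRing\<^esub> r)) \<otimes>\<^bsub>KRing\<^esub> kbar r" using r r3(1) by simp
    also have "\<dots> = (r \<otimes>\<^bsub>KRing\<^esub> r) \<otimes>\<^bsub>KRing\<^esub> (r \<otimes>\<^bsub>KRing\<^esub> kbar r)" using r by (simp add: H.m_ac)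
    finally have "kbar r = r \<otimes>\<^bsub>KRing\<^esub> r" using r r3(2) by simp
    then show "kev w (kbar r) = kev w r \<otimes> kev w r" using r by (simp add: kev_mult)
  qed
  have bar: "kev w (kbar (kcomb m n)) = m \<ominus> n \<otimes> w" if c: "m \<in> carrier R" "n \<in> carrier R" for m n
    using kev_kcomb[of m "\<ominus> n" w] c w H.l_minus[of "iota n" theta]
    by (simp add: kbar_kcomb iota_hom H.minus_eq minus_eq l_minus)
  have "kev w \<in> hom (pts (mu_functor s) R) (pts mu3_functor R)"
    using mu kev_closed by (intro homI) (auto simp: mu3_functor_def mu_mult kev_mult m_assoc)
  moreover have "inj_on (kev w) (carrier (pts (mu_functor s) R))"
  proof (rule inj_onI)
    fix r t assume r: "r \<in> carrier (pts (mu_functor s) R)" and t: "t \<in> carrier (pts (mu_functor s) R)"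
      and e: "kev w r = kev w t"
    obtain m n where mn: "m \<in> carrier R" "n \<in> carrier R" "r = kcomb m n" using KR_decomp[OF mu(3)[OF r]] by blast
    obtain m' n' where mn': "m' \<in> carrier R" "n' \<in> carrier R" "t = kcomb m' n'" using KR_decomp[OF mu(3)[OF t]] by blast
    have 1: "m \<oplus> n \<otimes> w = m' \<oplus> n' \<otimes> w" using e mn mn' by (simp add: kev_kcomb)
    have 2: "m \<ominus> n \<otimes> w = m' \<ominus> n' \<otimes> w" using mu(2)[OF r] mu(2)[OF t] e mn mn' bar by simp
    have "m = m'" "n \<otimes> w = n' \<otimes> w"
      using sign_R(5,6)[of m "n \<otimes> w"] sign_R(5,6)[of m' "n' \<otimes> w"] 1 2 mn mn' w by simp_all
    then show "r = t" using w_cancel[of n n'] mn mn' by simp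
  qed
  moreover have "\<exists>r \<in> carrier (pts (mu_functor s) R). kev w r = z" if "z \<in> carrier (pts mu3_functor R)" for z
  proof -
    have z: "z \<in> carrier R" "z \<otimes> (z \<otimes> z) = \<one>" using that by (auto simp: mu3_functor_def m_assoc)
    \<comment> \<open>The solution of \<open>m + n w = z\<close> and \<open>m - n w = z^2\<close>,
      with \<open>1 / 2 = -1\<close>. Here \<open>v\<close> is \<open>n w\<close>, and
      \<open>w\<close> is inverted through \<open>w^2 = kdisc\<close>.\<close>
    define m where "m = \<ominus> (z \<oplus> z \<otimes> z)"
    define v where "v = \<ominus> (z \<oplus> \<ominus> (z \<otimes> z))"
    define n where "n = (1 / E.kdisc) \<odot> (v \<otimes> w)"
    have c: "m \<in> carrier R" "v \<in> carrier R" "n \<in> carrier R" using z w by (simp_all add: m_def v_def n_def)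
    have nw: "n \<otimes> w = v" using kdisc_inv[OF c(2)] c w by (simp add: n_def smult_distrib' m_assoc smult_right)
    let ?r = "kcomb m n"
    have i: "iota (m \<oplus> v) = iota z" "iota (m \<ominus> v) = iota (z \<otimes> z)" "m \<oplus> v = z" "m \<ominus> v = z \<otimes> z"
    proof -
      have "m \<oplus> v = z" "m \<ominus> v = z \<otimes> z"
      proof -
        have a: "m \<oplus> v = \<ominus> ((z \<oplus> z \<otimes> z) \<oplus> (z \<ominus> z \<otimes> z))" "m \<ominus> v = \<ominus> ((z \<oplus> z \<otimes> z) \<oplus> \<ominus> (z \<ominus> z \<otimes> z))"
          using z by (simp_all add: m_def v_def minus_eq minus_add)
        show "m \<oplus> v = z" "m \<ominus> v = z \<otimes> z" unfolding a using sign_R(5,6)[of z "z \<otimes> z"] z by simp_all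
      qed
      then show "iota (m \<oplus> v) = iota z" "iota (m \<ominus> v) = iota (z \<otimes> z)" "m \<oplus> v = z" "m \<ominus> v = z \<otimes> z" by simp_all
    qed
    have cube: "(p \<oplus> q) \<otimes> ((p \<oplus> q) \<otimes> (p \<oplus> q)) = p \<otimes> (p \<otimes> p) \<oplus> q \<otimes> (q \<otimes> q)"
      if pq: "p \<in> carrier R" "q \<in> carrier R" for p q
      by (rule iota_inj) (use H.cube_add[of "iota p" "iota q"] pq in \<open>simp_all add: iota_hom\<close>)
    have z6: "(z \<otimes> z) \<otimes> ((z \<otimes> z) \<otimes> (z \<otimes> z)) = \<one>"
    proof -
      have "(z \<otimes> z) \<otimes> ((z \<otimes> z) \<otimes> (z \<otimes> z)) = (z \<otimes> (z \<otimes> z)) \<otimes> (z \<otimes> (z \<otimes> z))" using z(1) by (simp add: m_ac)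
      then show ?thesis using z by simp
    qed
    \<comment> \<open>By Frobenius \<open>m^3 = - (z^3 + z^6) = - 2 = 1\<close> and
      \<open>v^3 = - (z^3 - z^6) = 0\<close>, so \<open>n^3 = 0\<close> and the cube of
      \<open>m + n theta\<close> is 1.\<close>
    have m3: "m \<otimes> (m \<otimes> m) = \<one>"
      using cube[of "\<ominus> z" "\<ominus> (z \<otimes> z)"] z z6 sign_R(3)[of \<zero> \<zero>] by (simp add: m_def minus_add l_minus r_minus)
    have v3: "v \<otimes> (v \<otimes> v) = \<zero>"
      using cube[of "\<ominus> z" "z \<otimes> z"] z z6 by (simp add: v_def minus_add l_minus r_minus l_neg)
    have "n \<otimes> (n \<otimes> n) \<otimes> w \<otimes> w \<otimes> w = (n \<otimes> w) \<otimes> ((n \<otimes> w) \<otimes> (n \<otimes> w))" using c w(1) by (simp add: m_ac)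
    then have "n \<otimes> (n \<otimes> n) \<otimes> w \<otimes> w \<otimes> w = \<zero> \<otimes> w \<otimes> w \<otimes> w" using v3 nw w by simp
    then have n3: "n \<otimes> (n \<otimes> n) = \<zero>" using w_cancel c w by (metis m_closed zero_closed)
    have "(iota n \<otimes>\<^bsub>KRing\<^esub> theta) \<otimes>\<^bsub>KRing\<^esub> ((iota n \<otimes>\<^bsub>KRing\<^esub> theta) \<otimes>\<^bsub>KRing\<^esub> (iota n \<otimes>\<^bsub>KRing\<^esub> theta)) =
        iota (n \<otimes> (n \<otimes> n)) \<otimes>\<^bsub>KRing\<^esub> (theta \<otimes>\<^bsub>KRing\<^esub> (theta \<otimes>\<^bsub>KRing\<^esub> theta))"
      using c by (simp add: iota_hom H.m_ac)
    also have "\<dots> = \<zero>\<^bsub>KRing\<^esub>" unfolding n3 by (simp add: iota_hom)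
    finally have "?r \<otimes>\<^bsub>KRing\<^esub> (?r \<otimes>\<^bsub>KRing\<^esub> ?r) = \<one>\<^bsub>KRing\<^esub>"
      using H.cube_add[of "iota m" "iota n \<otimes>\<^bsub>KRing\<^esub> theta"] c m3 by (simp add: iota_hom flip: iota_hom(2))
    moreover have "?r \<otimes>\<^bsub>KRing\<^esub> kbar ?r = \<one>\<^bsub>KRing\<^esub>"
    proof -
      have "kbar ?r = kcomb m (\<ominus> n)" using c H.l_minus[of "iota n" theta] by (simp add: kbar_kcomb iota_hom H.minus_eq)
      then have "?r \<otimes>\<^bsub>KRing\<^esub> kbar ?r = kcomb (m \<otimes> m \<oplus> n \<otimes> \<ominus> n \<otimes> (E.kdisc \<odot> \<one>)) (m \<otimes> \<ominus> n \<oplus> n \<otimes> m)"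
        using H.quad_mult[of "iota m" "iota n" "iota m" "iota (\<ominus> n)" theta] c by (simp add: theta_square iota_hom)
      moreover have "m \<otimes> \<ominus> n \<oplus> n \<otimes> m = \<zero>" using c by (simp add: r_minus m_comm l_neg)
      moreover have "m \<otimes> m \<oplus> n \<otimes> \<ominus> n \<otimes> (E.kdisc \<odot> \<one>) = \<one>"
      proof -
        have "m \<otimes> m \<oplus> n \<otimes> \<ominus> n \<otimes> (w \<otimes> w) = m \<otimes> m \<ominus> (n \<otimes> w) \<otimes> (n \<otimes> w)"
          using c w(1) by (simp add: minus_eq r_minus l_minus m_ac)
        also have "\<dots> = (m \<oplus> v) \<otimes> (m \<ominus> v)"
          using c by (simp add: nw minus_eq l_distr r_distr r_minus l_minus minus_add a_ac m_comm[of v m] r_neg1 r_neg2)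
        finally show ?thesis using i z w(2) by simp
      qed
      ultimately show ?thesis by (simp add: iota_hom)
    qed
    ultimately have "?r \<in> carrier (pts (mu_functor s) R)" using c by (simp add: mu_carrier)
    moreover have "kev w ?r = z" using c nw i by (simp add: kev_kcomb)
    ultimately show ?thesis by blast
  qed
  ultimately show ?thesis unfolding iso_def bij_betw_def
    using hom_in_carrier[of "kev w" "pts (mu_functor s) R" "pts mu3_functor R"] by auto
qed

end

text \<open>The universal property of \<open>F \<times> F\<close>: a square root \<open>y\<close> of
  1 is the image of \<open>(1, -1)\<close>, and the idempotents \<open>(1, 0)\<close> and
  \<open>(0, 1)\<close> go to \<open>(1 + y) / 2\<close> and \<open>(1 - y) / 2\<close>.\<close>

lemma square_hom:
  assumes e: "inj (e :: 'f \<times> 'f \<Rightarrow> 'u)" and y: "y \<in> carrier R" "y \<otimes> y = \<one>"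
  obtains h where "comm_alg_hom (copy_alg e square_alg) R h"
    "\<And>c d. h (e (c, d)) = c \<odot> \<ominus> (\<one> \<oplus> y) \<oplus> d \<odot> \<ominus> (\<one> \<oplus> \<ominus> y)" "h (e (1, - 1)) = y"
proof -
  define b c where "b = \<ominus> (\<one> \<oplus> y)" and "c = \<ominus> (\<one> \<oplus> \<ominus> y)"
  have bc: "b \<in> carrier R" "c \<in> carrier R" using y by (simp_all add: b_def c_def)
  have "b = sign_pt R y 0" "c = sign_pt R y 1" by (simp_all add: b_def c_def sign_pt_def)
  then have id: "b \<otimes> b = b" "b \<otimes> c = \<zero>" "c \<otimes> b = \<zero>" "c \<otimes> c = c"
    using sign_pt_in[OF y] by (auto simp: constant_functor_def carrier_C2)
  have sum: "b \<oplus> c = \<one>" using sign_R(3)[of y y] y by (simp add: b_def c_def)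
  have "\<ominus> (\<one> \<oplus> (b \<ominus> c)) = b" using sign_R(5)[OF bc] sum by simp
  then have diff: "b \<ominus> c = y"
    using sign_R(8)[of "b \<ominus> c" y] sign_R(8)[of y y] bc y by (simp add: b_def)
  define h where "h x = fst (inv_into UNIV e x) \<odot> b \<oplus> snd (inv_into UNIV e x) \<odot> c" for x
  have h: "h (e p) = fst p \<odot> b \<oplus> snd p \<odot> c" for p using e by (simp add: h_def inv_f_f)
  have sm: "(m \<odot> x) \<otimes> (n \<odot> z) = (m * n) \<odot> (x \<otimes> z)" if "x \<in> carrier R" "z \<in> carrier R" for m n x z
    using that smult_distrib'(4)[of x "n \<odot> z" m] smult_right[of x z n] smult_distrib'(3)[of "x \<otimes> z" m n]
    by (simp only: smult_simps m_closed)
  have zz: "m \<odot> \<zero> = \<zero>" for m by simp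
  note S = copy_alg_simps[of e square_alg, simplified, OF e]
  have "h \<in> ring_hom (copy_alg e square_alg) R"
  proof (rule ring_hom_memI)
    fix x x' assume "x \<in> carrier (copy_alg e square_alg)" "x' \<in> carrier (copy_alg e square_alg)"
    then obtain p p' where p: "x = e p" "x' = e p'" by (auto simp: S)
    show "h x \<in> carrier R" using bc by (simp add: p h)
    show "h (x \<otimes>\<^bsub>copy_alg e square_alg\<^esub> x') = h x \<otimes> h x'"
      using bc by (simp add: p S h l_distr r_distr sm id)
    show "h (x \<oplus>\<^bsub>copy_alg e square_alg\<^esub> x') = h x \<oplus> h x'"
      using bc by (simp add: p S h smult_distrib'(1) a_ac)
  next
    show "h \<one>\<^bsub>copy_alg e square_alg\<^esub> = \<one>" using bc sum by (simp add: S h)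
  qed
  moreover have "h (k \<odot>\<^bsub>copy_alg e square_alg\<^esub> x) = k \<odot> h x" if "x \<in> carrier (copy_alg e square_alg)" for k x
    using that bc by (auto simp: S h smult_distrib')
  ultimately have "comm_alg_hom (copy_alg e square_alg) R h"
    using copy_alg_comm_alg[of e square_alg] square_alg_comm_alg e comm_alg by (simp add: comm_alg_hom_def)
  then show ?thesis
  proof (rule that)
    show "h (e (c', d)) = c' \<odot> \<ominus> (\<one> \<oplus> y) \<oplus> d \<odot> \<ominus> (\<one> \<oplus> \<ominus> y)" for c' d by (simp add: h b_def c_def)
    show "h (e (1, - 1)) = y" using bc diff by (simp add: h smult_uminus minus_eq)
  qed
qed

lemma sign_one: "sign \<one>\<^bsub>HG\<^esub> = \<one>"
  by (rule sign_eqI) (simp_all add: cent_one low_lift H.hcent_id iota_hom, simp add: HS.hK_def)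

text \<open>A flip with \<open>y = -1\<close> needs \<open>r^3 a = bar a\<close> and
  \<open>r bar r = 1\<close>. If \<open>(bar a)^2 = m + n theta\<close>, then cube roots of
  \<open>m\<close> and of \<open>n / kdisc\<close> are the components of an \<open>r\<close> with
  \<open>r^3 = (bar a)^2\<close>; its norm has cube 1, and \<open>red\<close> makes it 1.\<close>

lemma sign_minus_one:
  assumes cube: "\<And>m. \<exists>x \<in> carrier R. x \<otimes> (x \<otimes> x) = m \<odot> \<one>"
    and red: "\<And>q. \<lbrakk>q \<in> carrier R; q \<otimes> (q \<otimes> q) = \<one>\<rbrakk> \<Longrightarrow> q = \<one>"
  obtains g where "g \<in> carrier HG" "sign g = \<ominus> \<one>"
proof -
  obtain m n where mn: "kconj s a * kconj s a = s m 1 + s n E.kgen" using E.kgen(3) by blast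
  obtain x where x: "x \<in> carrier R" "x \<otimes> (x \<otimes> x) = m \<odot> \<one>" using cube by blast
  obtain w where w: "w \<in> carrier R" "w \<otimes> (w \<otimes> w) = (n / E.kdisc) \<odot> \<one>" using cube by blast
  define r where "r = kcomb x w"
  let ?a = "KE.pt a"
  let ?m = "monoid.mult KRing"
  have rc: "r \<in> carrier KRing" using x w by (simp add: r_def)
  have aa: "?m (kbar ?a) (kbar ?a) = KE.pt (kconj s a * kconj s a)" by (simp add: kbar_pt mult_KRing KR_mult_pt)
  have "?m (?m (iota w) theta) (?m (?m (iota w) theta) (?m (iota w) theta)) = ?m (?m (iota (w \<otimes> (w \<otimes> w))) (?m theta theta)) theta"
    using w(1) by (simp add: iota_hom H.m_ac)
  also have "?m (iota (w \<otimes> (w \<otimes> w))) (?m theta theta) = iota (n \<odot> \<one>)"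
    using E.kgen(2) w by (simp add: theta_square flip: iota_hom(2)) (simp add: smult_distrib'(4) flip: smult_distrib'(3))
  finally have r3: "?m r (?m r r) = ?m (kbar ?a) (kbar ?a)"
    unfolding aa mn pt_decomp r_def using H.cube_add[of "iota x" "?m (iota w) theta"] x w by (simp flip: iota_hom(2))
  have an: "?m ?a (kbar ?a) = \<one>\<^bsub>KRing\<^esub>" "?m (kbar ?a) ?a = \<one>\<^bsub>KRing\<^esub>"
    using H.a_norm H.m_comm[of ?a "kbar ?a"] by simp_all
  have r3a: "?m (?m r (?m r r)) ?a = H.htwist (\<ominus>\<^bsub>KRing\<^esub> \<one>\<^bsub>KRing\<^esub>) ?a"
    using an by (simp add: r3 H.htwist_minus_one H.m_assoc)
  have "kbar (?m r (kbar r)) = ?m r (kbar r)" using rc by (simp add: H.bar_mult H.m_comm)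
  then obtain q where q: "q \<in> carrier R" "?m r (kbar r) = iota q" using symmetric_iota[of "?m r (kbar r)"] rc by auto
  have "iota (q \<otimes> (q \<otimes> q)) = ?m (?m r (?m r r)) (kbar (?m r (?m r r)))"
    using q rc by (simp add: iota_hom H.bar_mult flip: q(2)) (simp add: H.m_ac)
  also have "\<dots> = ?m (?m (kbar ?a) ?a) (?m (kbar ?a) ?a)" unfolding r3 by (simp add: H.bar_mult H.m_ac)
  also have "\<dots> = iota \<one>" using an by (simp add: iota_hom)
  finally have "q \<otimes> (q \<otimes> q) = \<one>" using iota_inj[of "q \<otimes> (q \<otimes> q)" \<one>] q by simp
  then have "q = \<one>" using red q by blast
  then have rr: "?m r (kbar r) = \<one>\<^bsub>KRing\<^esub>" using q by (simp add: iota_hom)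
  have y: "kbar (\<ominus>\<^bsub>KRing\<^esub> \<one>\<^bsub>KRing\<^esub>) = \<ominus>\<^bsub>KRing\<^esub> \<one>\<^bsub>KRing\<^esub>" using H.bar_minus[of "\<one>\<^bsub>KRing\<^esub>"] by simp
  have c: "H.hcent (H.hflip (\<ominus>\<^bsub>KRing\<^esub> \<one>\<^bsub>KRing\<^esub>) r)"
    by (rule H.hcent_hflip) (use rc y rr r3a in \<open>simp_all add: H.l_minus\<close>)
  show ?thesis
  proof (rule that)
    show "lift (H.hflip (\<ominus>\<^bsub>KRing\<^esub> \<one>\<^bsub>KRing\<^esub>) r) \<in> carrier HG" by (rule lift_in[OF c])
    show "sign (lift (H.hflip (\<ominus>\<^bsub>KRing\<^esub> \<one>\<^bsub>KRing\<^esub>) r)) = \<ominus> \<one>"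
      using HS.hflip_th[of "\<ominus>\<^bsub>KRing\<^esub> \<one>\<^bsub>KRing\<^esub>" r] rc by (intro sign_eqI) (simp_all add: low_lift[OF c] iota_hom)
  qed
qed

end

context etale_hom
begin

lemma kev_f:
  assumes "x \<in> KR s R" "w \<in> carrier R"
  shows "B.kev (f w) (fK x) = f (A.kev w x)"
proof -
  obtain m n where x: "m \<in> carrier R" "n \<in> carrier R" "x = A.kcomb m n" using A.KR_decomp[OF assms(1)] by blast
  have "fK x = B.kcomb (f m) (f n)" using x by (simp add: fK_hom fK_pt)
  then show ?thesis using x assms(2) by (simp add: A.kev_kcomb B.kev_kcomb)
qed

end

section \<open>The centralizer as a group functor\<close>

lemma comm_alg_hom_comp:
  assumes f: "comm_alg_hom R S f" and h: "comm_alg_hom S T h"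
  shows "comm_alg_hom R T (\<lambda>r. h (f r))"
proof -
  interpret f: ring_hom_cring R S f by (rule comm_alg_hom_cring[OF f])
  show ?thesis using assms ring_hom_trans[of f R S h T] f.hom_closed by (simp add: comm_alg_hom_def comp_def)
qed

lemma comm_alg_hom_id: "comm_alg R \<Longrightarrow> comm_alg_hom R R (\<lambda>r. r)"
  by (simp add: comm_alg_hom_def ring_hom_def)

locale cayley_setup = quad_etale s for s :: "'f::field \<Rightarrow> 'k \<Rightarrow> 'k::comm_ring_1" +
  fixes a :: 'k
  assumes norm1: "knorm s a = 1"
begin

lemma over: "comm_alg R \<Longrightarrow> etale_over s R a"
  by (intro etale_over.intro comm_alg_over.intro etale_over_axioms.intro quad_etale_axioms norm1)

lemma over_hom: "comm_alg_hom R S f \<Longrightarrow> etale_hom s R S a f"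
  by (intro etale_hom.intro etale_hom_axioms.intro over) (simp_all add: comm_alg_hom_def)

lemma mor_cent: "mor (cent_functor s a) = base_change (cscale s) (cbasis s)"
  by (simp add: cent_functor_def aut_functor_def)

text \<open>Compatibility with identities and composites, and independence from the values of
  homomorphisms off the carrier, all follow from the uniqueness of base change.\<close>

lemma cent_functor_group_functor: "group_functor (cent_functor s a :: ('f, 'k, 'u) cayley_functor)"
  unfolding group_functor_def mor_cent
proof (intro conjI allI impI ballI)
  fix R :: "('f, 'u) module" assume R: "comm_alg R"
  then interpret A: etale_over s R a by (rule over)
  interpret h: etale_hom s R R a "\<lambda>r. r" by (rule over_hom[OF comm_alg_hom_id[OF R]])
  show "group (pts (cent_functor s a) R)" by (rule A.cent_group)
  fix g assume g: "g \<in> carrier (pts (cent_functor s a) R)"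
  have id: "h.fC x = x" if "x \<in> CR s R" for x
    using that unfolding ext_carrier_def PiE_iff h.fext_def by (simp only: extensional_restrict)
  show "base_change (cscale s) (cbasis s) R R (\<lambda>r. r) g = g"
  proof (rule h.bc_unique[OF h.cent_lin(1)[OF g] h.cent_lin(2)[OF g] A.centD(2)[OF g]])
    show "g (h.fC x) = h.fC (g x)" if "x \<in> CR s R" for x
      by (simp only: id[OF that] id[OF A.centD(3)[OF g that]])
  qed
next
  fix R S :: "('f, 'u) module" and f assume f: "comm_alg_hom R S f"
  then interpret h: etale_hom s R S a f by (rule over_hom)
  show "base_change (cscale s) (cbasis s) R S f \<in> hom (pts (cent_functor s a) R) (pts (cent_functor s a) S)"
    by (rule homI) (simp_all add: h.bc_cent h.bc_hom)
  fix f' g assume f': "comm_alg_hom R S f'" and e: "\<forall>r \<in> carrier R. f r = f' r"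
    and g: "g \<in> carrier (pts (cent_functor s a) R)"
  interpret h': etale_hom s R S a f' by (rule over_hom[OF f'])
  have ff: "h.fC x = h'.fC x" if "x \<in> CR s R" for x
    using that e by (auto simp: h.fext_def h'.fext_def ext_carrier_def PiE_iff intro!: restrict_ext)
  note gl = h.cent_lin(1)[OF g]
  show "base_change (cscale s) (cbasis s) R S f g = base_change (cscale s) (cbasis s) R S f' g"
  proof (rule h.bc_unique[OF gl h'.bc_lin[OF gl]])
    show "h'.bc g \<in> extensional (CR s S)" by (simp add: base_change_def)
    show "h'.bc g (h.fC x) = h.fC (g x)" if "x \<in> CR s R" for x
      using h'.bc_fC[OF gl that] h.A.centD(3)[OF g that] that by (simp add: ff)
  qed
next
  fix R S T :: "('f, 'u) module" and f h g
  assume f: "comm_alg_hom R S f" and h: "comm_alg_hom S T h" and g: "g \<in> carrier (pts (cent_functor s a) R)"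
  interpret f: etale_hom s R S a f by (rule over_hom[OF f])
  interpret h: etale_hom s S T a h by (rule over_hom[OF h])
  interpret c: etale_hom s R T a "\<lambda>r. h (f r)" by (rule over_hom[OF comm_alg_hom_comp[OF f h]])
  note gl = f.cent_lin(1)[OF g]
  have ff: "c.fC x = h.fC (f.fC x)" for x
    by (auto simp: h.fext_def c.fext_def f.fext_def intro!: restrict_ext)
  show "base_change (cscale s) (cbasis s) R T (\<lambda>r. h (f r)) g =
      base_change (cscale s) (cbasis s) S T h (base_change (cscale s) (cbasis s) R S f g)"
  proof (rule c.bc_unique[OF gl h.bc_lin[OF f.bc_lin[OF gl]]])
    show "h.bc (f.bc g) \<in> extensional (CR s T)" by (simp add: base_change_def[of _ _ S T])
    show "h.bc (f.bc g) (c.fC x) = c.fC (g x)" if "x \<in> CR s R" for x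
      using that h.bc_fC[OF f.bc_lin[OF gl], of "f.fC x"] f.bc_fC[OF gl that] by (simp add: ff)
  qed
qed

lemma mu_functor_group_functor: "group_functor (mu_functor s :: ('f, 'u, 'k \<Rightarrow> 'u) grp_functor)"
  unfolding group_functor_def
proof (intro conjI allI impI ballI)
  fix R :: "('f, 'u) module" assume R: "comm_alg R"
  then interpret A: etale_over s R a by (rule over)
  show "group (pts (mu_functor s) R)" by (rule A.mu_group)
  fix r assume "r \<in> carrier (pts (mu_functor s) R)"
  then show "mor (mu_functor s) R R (\<lambda>r. r) r = r"
    unfolding A.mu_carrier ext_carrier_def PiE_iff by (simp add: mu_functor_def extensional_restrict)
next
  fix R S :: "('f, 'u) module" and f assume f: "comm_alg_hom R S f"
  then interpret h: etale_hom s R S a f by (rule over_hom)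
  have m: "mor (mu_functor s) R S f = h.fK" by (simp add: mu_functor_def h.fext_def fun_eq_iff)
  show "mor (mu_functor s) R S f \<in> hom (pts (mu_functor s) R) (pts (mu_functor s) S)"
    unfolding m
  proof (rule homI)
    show "h.fK r \<in> carrier (pts (mu_functor s) S)" if "r \<in> carrier (pts (mu_functor s) R)" for r
      using that by (rule h.fK_mu)
    show "h.fK (r \<otimes>\<^bsub>pts (mu_functor s) R\<^esub> t) = h.fK r \<otimes>\<^bsub>pts (mu_functor s) S\<^esub> h.fK t"
      if "r \<in> carrier (pts (mu_functor s) R)" "t \<in> carrier (pts (mu_functor s) R)" for r t
      using that by (simp add: h.A.mu_mult h.B.mu_mult h.A.mu_carrier h.fK_hom)
  qed
  fix f' r assume f': "comm_alg_hom R S f'" and e: "\<forall>r \<in> carrier R. f r = f' r"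
    and g: "r \<in> carrier (pts (mu_functor s) R)"
  then show "mor (mu_functor s) R S f r = mor (mu_functor s) R S f' r"
    by (auto simp: mu_functor_def ext_carrier_def PiE_iff intro!: restrict_ext)
qed (auto simp: mu_functor_def intro!: restrict_ext)

lemma C2_functor_group_functor: "group_functor (C2 :: ('f, 'u, int \<Rightarrow> 'u) grp_functor)"
  unfolding group_functor_def
proof (intro conjI allI impI ballI)
  fix R :: "('f, 'u) module" assume R: "comm_alg R"
  then interpret A: etale_over s R a by (rule over)
  show "group (pts C2 R)" by (rule A.C2_group)
  fix e assume "e \<in> carrier (pts C2 R)"
  then show "mor C2 R R (\<lambda>r. r) e = e"
    by (simp add: constant_functor_def PiE_iff extensional_restrict)
next
  fix R S :: "('f, 'u) module" and f assume f: "comm_alg_hom R S f"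
  then interpret h: etale_hom s R S a f by (rule over_hom)
  show "mor C2 R S f \<in> hom (pts C2 R) (pts C2 S)"
  proof (rule homI)
    fix e assume "e \<in> carrier (pts C2 R)"
    then obtain y where "y \<in> carrier R" "y \<otimes>\<^bsub>R\<^esub> y = \<one>\<^bsub>R\<^esub>" "e = sign_pt R y" by (rule h.A.sign_pt_cases)
    then show "mor C2 R S f e \<in> carrier (pts C2 S)"
      using h.B.sign_pt_in[of "f y"] by (simp add: h.sign_pt_f flip: h.F.hom_mult)
  next
    fix e e' assume "e \<in> carrier (pts C2 R)" "e' \<in> carrier (pts C2 R)"
    then obtain y y' where "y \<in> carrier R" "e = sign_pt R y" "y' \<in> carrier R" "e' = sign_pt R y'"
      using h.A.sign_pt_cases by metis
    then show "mor C2 R S f (e \<otimes>\<^bsub>pts C2 R\<^esub> e') = mor C2 R S f e \<otimes>\<^bsub>pts C2 S\<^esub> mor C2 R S f e'"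
      by (simp add: h.A.sign_pt_mult h.B.sign_pt_mult h.sign_pt_f)
  qed
  fix f' e assume "comm_alg_hom R S f'" "\<forall>r \<in> carrier R. f r = f' r" "e \<in> carrier (pts C2 R)"
  then show "mor C2 R S f e = mor C2 R S f' e"
    by (auto simp: constant_functor_def PiE_iff intro!: restrict_ext)
qed (auto simp: constant_functor_def intro!: restrict_ext)

lemma K_subgroup_functor: "subgroup_functor (K_functor s a :: ('f, 'k, 'u) cayley_functor) (cent_functor s a)"
proof (rule subgroup_functorI[OF cent_functor_group_functor])
  fix R :: "('f, 'u) module" assume "comm_alg R"
  then interpret A: etale_over s R a by (rule over)
  show "pts (K_functor s a) R = (pts (cent_functor s a) R)\<lparr>carrier := carrier (pts (K_functor s a) R)\<rparr>"
    by (rule A.K_eq_HG)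
  show "subgroup (carrier (pts (K_functor s a) R)) (pts (cent_functor s a) R)" by (rule A.K_subgroup)
next
  fix R S :: "('f, 'u) module" and f x assume f: "comm_alg_hom R S f" and x: "x \<in> carrier (pts (K_functor s a) R)"
  interpret h: etale_hom s R S a f by (rule over_hom[OF f])
  obtain z where "z \<in> KR s R" "x = h.A.lift (h.A.H.hexp z)" using x by (auto simp: h.A.K_carrier)
  then show "mor (cent_functor s a) R S f x \<in> carrier (pts (K_functor s a) S)"
    by (auto simp: mor_cent h.bc_hexp h.B.K_carrier)
qed (simp add: K_functor_def)

lemma N_subgroup_functor: "subgroup_functor (N_functor s a :: ('f, 'k, 'u) cayley_functor) (cent_functor s a)"
proof (rule subgroup_functorI[OF cent_functor_group_functor])
  fix R :: "('f, 'u) module" assume "comm_alg R"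
  then interpret A: etale_over s R a by (rule over)
  show "pts (N_functor s a) R = (pts (cent_functor s a) R)\<lparr>carrier := carrier (pts (N_functor s a) R)\<rparr>"
    by (rule A.N_eq_HG)
  show "subgroup (carrier (pts (N_functor s a) R)) (pts (cent_functor s a) R)" by (rule A.N_subgroup)
next
  fix R S :: "('f, 'u) module" and f x assume f: "comm_alg_hom R S f" and x: "x \<in> carrier (pts (N_functor s a) R)"
  interpret h: etale_hom s R S a f by (rule over_hom[OF f])
  obtain m n where "m \<in> carrier R" "n \<in> carrier R" "x = h.A.lift (h.A.nilp m n)" using x by (auto simp: h.A.N_carrier)
  then show "mor (cent_functor s a) R S f x \<in> carrier (pts (N_functor s a) S)"
    by (auto simp: mor_cent h.bc_nilp h.B.N_carrier)
qed (simp add: N_functor_def)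

lemma K_isomorphic: "functor_isomorphic (K_functor s a :: ('f, 'k, 'u) cayley_functor) add_square_functor"
proof -
  obtain b1 b2 where b: "kbasis s = {b1, b2}" "b1 \<noteq> b2" using kbasis_props(3) by (auto simp: card_2_iff)
  \<comment> \<open>The parameter in \<open>K \<otimes> R\<close> is given by its coordinates in a
    basis of \<open>K\<close>; the basis is the same for all \<open>R\<close>, which makes the
    isomorphism natural.\<close>
  define vec where "vec = (\<lambda>x :: 'u \<times> 'u. \<lambda>c \<in> kbasis s. if c = b1 then fst x else snd x)"
  \<comment> \<open>The locale constants carry explicit parameters because \<open>R\<close>
    varies.\<close>
  define t where "t R x = etale_over.lift s R (herm_ring.hexp (etale_over.KRing s R) (etale_over.kbar s R)
      (ext_space.pt s (kbasis s) R a) (vec x))" for R :: "('f, 'u) module" and x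
  show ?thesis
  proof (rule functor_isomorphicI[where t = t])
    show "group_functor (K_functor s a :: ('f, 'k, 'u) cayley_functor)"
      by (rule K_subgroup_functor[unfolded subgroup_functor_def, THEN conjunct1])
    show "group_functor (add_square_functor :: ('f, 'u, 'u \<times> 'u) grp_functor)"
      by (rule add_square_functor_group_functor)
    show iso: "t R \<in> iso (pts add_square_functor R) (pts (K_functor s a) R)" if "comm_alg R" for R :: "('f, 'u) module"
    proof -
      interpret A: etale_over s R a using that by (rule over)
      have vc: "vec x \<in> KR s R" if "x \<in> carrier R \<times> carrier R" for x
        using that by (auto simp: vec_def ext_carrier_def)
      have va: "vec (fst x \<oplus>\<^bsub>R\<^esub> fst y, snd x \<oplus>\<^bsub>R\<^esub> snd y) = vec x \<oplus>\<^bsub>A.KRing\<^esub> vec y" for x y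
        by (auto simp: vec_def A.add_KRing ext_add_def intro!: restrict_ext)
      have "t R \<in> hom (pts add_square_functor R) (pts (K_functor s a) R)"
      proof (rule homI)
        show "t R x \<in> carrier (pts (K_functor s a) R)" if "x \<in> carrier (pts add_square_functor R)" for x
          using that vc[of x] by (auto simp: add_square_functor_def t_def A.K_carrier)
        show "t R (x \<otimes>\<^bsub>pts add_square_functor R\<^esub> y) = t R x \<otimes>\<^bsub>pts (K_functor s a) R\<^esub> t R y"
          if "x \<in> carrier (pts add_square_functor R)" "y \<in> carrier (pts add_square_functor R)" for x y
        proof -
          have xy: "x \<in> carrier R \<times> carrier R" "y \<in> carrier R \<times> carrier R" using that by (auto simp: add_square_functor_def)
          have "x \<otimes>\<^bsub>pts add_square_functor R\<^esub> y = (fst x \<oplus>\<^bsub>R\<^esub> fst y, snd x \<oplus>\<^bsub>R\<^esub> snd y)"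
            by (cases x; cases y) (simp add: add_square_functor_def)
          then show ?thesis
            using hom_mult[OF A.hexp_hom, of "vec x" "vec y"] vc[OF xy(1)] vc[OF xy(2)] by (simp add: t_def A.K_mult va)
        qed
      qed
      moreover have "bij_betw (t R) (carrier R \<times> carrier R) (carrier (pts (K_functor s a) R))"
      proof -
        have "bij_betw vec (carrier R \<times> carrier R) (KR s R)"
        proof (rule bij_betw_byWitness[where f' = "\<lambda>z. (z b1, z b2)"])
          have bm: "b1 \<in> kbasis s" "b2 \<in> kbasis s" using b(1) by simp_all
          show "\<forall>x \<in> carrier R \<times> carrier R. (vec x b1, vec x b2) = x" using b by (auto simp: vec_def)
          show "\<forall>z \<in> KR s R. vec (z b1, z b2) = z"
          proof
            fix z assume z: "z \<in> KR s R"
            show "vec (z b1, z b2) = z"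
            proof (rule extensionalityI)
              show "vec (z b1, z b2) \<in> extensional (kbasis s)" by (simp add: vec_def)
              show "z \<in> extensional (kbasis s)" using z unfolding ext_carrier_def PiE_iff by blast
              fix c assume c: "c \<in> kbasis s"
              then have "c = b1 \<or> c = b2" using b(1) by simp
              then show "vec (z b1, z b2) c = z c" using b(2) c by (elim disjE) (simp_all add: vec_def)
            qed
          qed
          show "vec ` (carrier R \<times> carrier R) \<subseteq> KR s R" by (intro image_subsetI vc)
          show "(\<lambda>z. (z b1, z b2)) ` KR s R \<subseteq> carrier R \<times> carrier R"
            by (intro image_subsetI) (simp add: bm)
        qed
        moreover have "bij_betw (\<lambda>z. A.lift (A.H.hexp z)) (KR s R) (carrier (pts (K_functor s a) R))"
          using A.hexp_lift_inj by (simp add: bij_betw_def A.K_carrier)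
        ultimately have "bij_betw ((\<lambda>z. A.lift (A.H.hexp z)) \<circ> vec) (carrier R \<times> carrier R) (carrier (pts (K_functor s a) R))"
          by (rule bij_betw_trans)
        then show ?thesis by (simp add: t_def[abs_def] comp_def)
      qed
      ultimately show ?thesis by (simp add: iso_def add_square_functor_def)
    qed
    show "functor_hom add_square_functor (K_functor s a) t"
      unfolding functor_hom_def
    proof (intro conjI allI impI ballI)
      show "t R \<in> hom (pts add_square_functor R) (pts (K_functor s a) R)" if "comm_alg R" for R
        using iso[OF that] by (simp add: iso_def)
      fix R S :: "('f, 'u) module" and f x assume f: "comm_alg_hom R S f" and x: "x \<in> carrier (pts add_square_functor R)"
      interpret h: etale_hom s R S a f by (rule over_hom[OF f])
      have "vec x \<in> KR s R" using x by (auto simp: add_square_functor_def vec_def ext_carrier_def)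
      moreover have "h.fK (vec x) = vec (map_prod f f x)" by (auto simp: h.fext_def vec_def intro!: restrict_ext)
      ultimately show "t S (mor add_square_functor R S f x) = mor (K_functor s a) R S f (t R x)"
        by (simp add: t_def K_functor_def mor_cent h.bc_hexp add_square_functor_def)
    qed
  qed
qed

lemma N_isomorphic: "functor_isomorphic (N_functor s a :: ('f, 'k, 'u) cayley_functor) add_square_functor"
proof -
  define t where "t R x = etale_over.lift s R (etale_over.nilp s R (fst x) (snd x))" for R :: "('f, 'u) module" and x
  show ?thesis
  proof (rule functor_isomorphicI[where t = t])
    show "group_functor (N_functor s a :: ('f, 'k, 'u) cayley_functor)"
      by (rule N_subgroup_functor[unfolded subgroup_functor_def, THEN conjunct1])
    show "group_functor (add_square_functor :: ('f, 'u, 'u \<times> 'u) grp_functor)"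
      by (rule add_square_functor_group_functor)
    show iso: "t R \<in> iso (pts add_square_functor R) (pts (N_functor s a) R)" if "comm_alg R" for R :: "('f, 'u) module"
    proof -
      interpret A: etale_over s R a using that by (rule over)
      have t: "t R = (\<lambda>(m, n). A.lift (A.nilp m n))" by (simp add: t_def fun_eq_iff)
      have "t R \<in> hom (pts add_square_functor R) (pts (N_functor s a) R)"
        using A.nilp_hom by (auto simp: t hom_def add_square_functor_def A.N_mult A.N_carrier)
      moreover have "bij_betw (t R) (carrier R \<times> carrier R) (carrier (pts (N_functor s a) R))"
        using A.nilp_lift_inj by (auto simp: bij_betw_def t A.N_carrier)
      ultimately show ?thesis by (simp add: iso_def add_square_functor_def)
    qed
    show "functor_hom add_square_functor (N_functor s a) t"
      unfolding functor_hom_def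
    proof (intro conjI allI impI ballI)
      show "t R \<in> hom (pts add_square_functor R) (pts (N_functor s a) R)" if "comm_alg R" for R
        using iso[OF that] by (simp add: iso_def)
      fix R S :: "('f, 'u) module" and f x assume f: "comm_alg_hom R S f" and x: "x \<in> carrier (pts add_square_functor R)"
      interpret h: etale_hom s R S a f by (rule over_hom[OF f])
      show "t S (mor add_square_functor R S f x) = mor (N_functor s a) R S f (t R x)"
        using x by (auto simp: t_def N_functor_def mor_cent h.bc_nilp add_square_functor_def)
    qed
  qed
qed

lemma mu_embed_hom: "functor_hom (mu_functor s) (cent_functor s a :: ('f, 'k, 'u) cayley_functor) (mu_embed s)"
  unfolding functor_hom_def
proof (intro conjI allI impI ballI)
  fix R :: "('f, 'u) module" assume "comm_alg R"
  then interpret A: etale_over s R a by (rule over)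
  show "mu_embed s R \<in> hom (pts (mu_functor s) R) (pts (cent_functor s a) R)" by (rule A.mu_hom)
next
  fix R S :: "('f, 'u) module" and f r assume f: "comm_alg_hom R S f" and r: "r \<in> carrier (pts (mu_functor s) R)"
  interpret h: etale_hom s R S a f by (rule over_hom[OF f])
  have m: "mor (mu_functor s) R S f = h.fK" by (simp add: mu_functor_def h.fext_def fun_eq_iff)
  have "r \<in> KR s R" using r by (simp add: h.A.mu_carrier)
  then show "mu_embed s S (mor (mu_functor s) R S f r) = mor (cent_functor s a) R S f (mu_embed s R r)"
    using r by (simp add: m mor_cent h.A.mu_embed_lift h.B.mu_embed_lift h.bc_hmu)
qed

lemma mu_embed_mono: "functor_mono (mu_functor s) (cent_functor s a :: ('f, 'k, 'u) cayley_functor) (mu_embed s)"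
  unfolding functor_mono_def by (intro conjI allI impI mu_embed_hom etale_over.mu_embed_inj[OF over])

text \<open>Over an algebraic closure, a square root of \<open>\<theta>\<^sup>2\<close> splits \<open>K\<close>.\<close>

lemma mu_twisted_form:
  assumes inf: "infinite (UNIV :: 'u set)" and j: "inj (j :: 'f \<Rightarrow> 'u)"
  shows "twisted_form (mu_functor s :: ('f, 'u, 'k \<Rightarrow> 'u) grp_functor) mu3_functor"
proof -
  obtain e :: "'f alg_closure \<Rightarrow> 'u" where e: "inj e" using inj_alg_closure[OF inf j] by metis
  define L where "L = copy_alg e (ac_alg :: ('f, 'f alg_closure) module)"
  note S = copy_alg_simps[of e "ac_alg :: ('f, 'f alg_closure) module", simplified, OF e, folded L_def]
  have L: "comm_alg L" unfolding L_def by (rule copy_alg_comm_alg) (use e ac_alg_comm_alg in simp_all)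
  have F: "field L" unfolding L_def
  proof (rule copy_alg_field)
    show "\<exists>y \<in> carrier ac_alg. x \<otimes>\<^bsub>ac_alg\<^esub> y = \<one>\<^bsub>ac_alg\<^esub>" if "x \<noteq> \<zero>\<^bsub>ac_alg\<^esub>" for x :: "'f alg_closure"
      using that by (intro bexI[of _ "inverse x"]) simp_all
  qed (use e ac_alg_comm_alg in simp_all)
  obtain v :: "'f alg_closure" where v: "v ^ 2 = to_ac kdisc" using nth_root_exists[of 2 "to_ac kdisc"] by auto
  have w: "e v \<in> carrier L" "e v \<otimes>\<^bsub>L\<^esub> e v = kdisc \<odot>\<^bsub>L\<^esub> \<one>\<^bsub>L\<^esub>"
    using v by (simp_all add: S power2_eq_square)
  have wj: "k (e v) \<in> carrier R" "k (e v) \<otimes>\<^bsub>R\<^esub> k (e v) = kdisc \<odot>\<^bsub>R\<^esub> \<one>\<^bsub>R\<^esub>" if k: "comm_alg_hom L R k" for R k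
  proof -
    interpret k: ring_hom_cring L R k by (rule comm_alg_hom_cring[OF k])
    show "k (e v) \<in> carrier R" using w by simp
    have "k (e v) \<otimes>\<^bsub>R\<^esub> k (e v) = k (kdisc \<odot>\<^bsub>L\<^esub> \<one>\<^bsub>L\<^esub>)" using k.hom_mult[OF w(1) w(1)] w(2) by simp
    then show "k (e v) \<otimes>\<^bsub>R\<^esub> k (e v) = kdisc \<odot>\<^bsub>R\<^esub> \<one>\<^bsub>R\<^esub>" using k by (simp add: comm_alg_hom_def)
  qed
  define t where "t R k = etale_over.kev s R (k (e v))" for R :: "('f, 'u) module" and k :: "'u \<Rightarrow> 'u"
  have iso: "t R k \<in> iso (pts (mu_functor s) R) (pts mu3_functor R)" if "comm_alg_hom L R k" for R k
    unfolding t_def by (rule etale_over.kev_mu_iso[OF over[OF comm_alg_homD(2)[OF that]] wj[OF that]])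
  have nat: "t S l (mor (mu_functor s) R S f x) = mor mu3_functor R S f (t R k x)"
    if k: "comm_alg_hom L R k" and l: "comm_alg_hom L S l" and f: "comm_alg_hom R S f"
      and kl: "\<forall>x \<in> carrier L. l x = f (k x)" and x: "x \<in> carrier (pts (mu_functor s) R)" for R S k l f x
  proof -
    interpret h: etale_hom s R S a f by (rule over_hom[OF f])
    have m: "mor (mu_functor s) R S f = h.fK" by (simp add: mu_functor_def h.fext_def fun_eq_iff)
    show ?thesis using x kl w(1) h.kev_f[of x "k (e v)"] wj(1)[OF k]
      by (simp add: t_def m mu3_functor_def h.A.mu_carrier)
  qed
  show ?thesis unfolding twisted_form_def
    by (intro conjI mu_functor_group_functor mu3_functor_group_functor exI[of _ L] exI[of _ t] allI impI ballI L F)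
      (rule iso nat; assumption)+
qed

definition cent_sign :: "('f, 'u) module \<Rightarrow> (('k cayley \<Rightarrow> 'u) \<Rightarrow> 'k cayley \<Rightarrow> 'u) \<Rightarrow> int \<Rightarrow> 'u" where
  "cent_sign R g = sign_pt R (etale_over.sign s R g)"

lemma cent_sign_hom: "functor_hom (cent_functor s a :: ('f, 'k, 'u) cayley_functor) C2 cent_sign"
  unfolding functor_hom_def
proof (intro conjI allI impI ballI)
  fix R :: "('f, 'u) module" assume "comm_alg R"
  then interpret A: etale_over s R a by (rule over)
  have c: "A.sign g \<in> carrier R" "A.sign g \<otimes>\<^bsub>R\<^esub> A.sign g = \<one>\<^bsub>R\<^esub>" if g: "g \<in> carrier A.HG" for g
    using A.sign_props[OF g] by metis+
  show "cent_sign R \<in> hom (pts (cent_functor s a) R) (pts C2 R)"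
  proof (rule homI)
    show "cent_sign R g \<in> carrier (pts C2 R)" if "g \<in> carrier (pts (cent_functor s a) R)" for g
      using A.sign_pt_in c[OF that] by (simp add: cent_sign_def)
    show "cent_sign R (g \<otimes>\<^bsub>pts (cent_functor s a) R\<^esub> h) = cent_sign R g \<otimes>\<^bsub>pts C2 R\<^esub> cent_sign R h"
      if "g \<in> carrier (pts (cent_functor s a) R)" "h \<in> carrier (pts (cent_functor s a) R)" for g h
      using A.sign_mult[OF that] A.sign_pt_mult c(1)[OF that(1)] c(1)[OF that(2)] by (simp add: cent_sign_def)
  qed
next
  fix R S :: "('f, 'u) module" and f g assume f: "comm_alg_hom R S f" and g: "g \<in> carrier (pts (cent_functor s a) R)"
  interpret h: etale_hom s R S a f by (rule over_hom[OF f])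
  have "h.A.sign g \<in> carrier R" using h.A.sign_props[OF g] by metis
  then show "cent_sign S (mor (cent_functor s a) R S f g) = mor C2 R S f (cent_sign R g)"
    using g by (simp add: cent_sign_def mor_cent h.sign_bc h.sign_pt_f)
qed

text \<open>
  A regular function on \<open>C2\<close> is determined by its value at the universal point over \<open>F \<times> F\<close>,
  and hence by its values at the points \<open>1\<close> and \<open>-1\<close> over any extension field of \<open>F\<close>. Over an
  algebraic closure, both are signs of elements of the centralizer.
\<close>

lemma cent_sign_quotient:
  assumes inf: "infinite (UNIV :: 'u set)" and j: "inj (j :: 'f \<Rightarrow> 'u)"
  shows "functor_quotient (cent_functor s a :: ('f, 'k, 'u) cayley_functor) C2 cent_sign"
  unfolding functor_quotient_def
proof (intro conjI allI impI ballI)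
  fix u v :: "('f, 'u) module \<Rightarrow> (int \<Rightarrow> 'u) \<Rightarrow> 'u" and R :: "('f, 'u) module" and y
  assume u: "regular_fun C2 u" and v: "regular_fun C2 v"
    and uv: "\<forall>R. comm_alg R \<longrightarrow> (\<forall>x \<in> carrier (pts (cent_functor s a) R). u R (cent_sign R x) = v R (cent_sign R x))"
    and R: "comm_alg R" and y: "y \<in> carrier (pts C2 R)"
  obtain e :: "'f alg_closure \<Rightarrow> 'u" where e: "inj e" using inj_alg_closure[OF inf j] by metis
  define L where "L = copy_alg e (ac_alg :: ('f, 'f alg_closure) module)"
  note S = copy_alg_simps[of e "ac_alg :: ('f, 'f alg_closure) module", simplified, OF e, folded L_def]
  have L: "comm_alg L" unfolding L_def by (rule copy_alg_comm_alg) (use e ac_alg_comm_alg in simp_all)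
  interpret L: etale_over s L a by (rule over[OF L])
  obtain e2 :: "'f \<times> 'f \<Rightarrow> 'u" where e2: "inj e2" using inj_square[OF inf j] by metis
  define E where "E = copy_alg e2 (square_alg :: ('f, 'f \<times> 'f) module)"
  note SE = copy_alg_simps[of e2 "square_alg :: ('f, 'f \<times> 'f) module", simplified, OF e2, folded E_def]
  have E: "comm_alg E" unfolding E_def by (rule copy_alg_comm_alg) (use e2 square_alg_comm_alg in simp_all)
  interpret E: etale_over s E a by (rule over[OF E])
  have y1: "e2 (1, - 1) \<in> carrier E" "e2 (1, - 1) \<otimes>\<^bsub>E\<^esub> e2 (1, - 1) = \<one>\<^bsub>E\<^esub>" by (simp_all add: SE)
  define p where "p = sign_pt E (e2 (1, - 1))"
  have pC: "p \<in> carrier (pts C2 E)" unfolding p_def by (rule E.sign_pt_in[OF y1])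
  \<comment> \<open>Naturality turns the value of a regular function at any point into the image
    under \<open>h\<close> of its value at the universal point \<open>p\<close>. The formula for
    \<open>h\<close> shows which component of that value is seen when \<open>z\<close> is 1 or
    -1.\<close>
  have val: "\<exists>h. (\<forall>c d. h (e2 (c, d)) = c \<odot>\<^bsub>T\<^esub> \<ominus>\<^bsub>T\<^esub> (\<one>\<^bsub>T\<^esub> \<oplus>\<^bsub>T\<^esub> z) \<oplus>\<^bsub>T\<^esub> d \<odot>\<^bsub>T\<^esub> \<ominus>\<^bsub>T\<^esub> (\<one>\<^bsub>T\<^esub> \<oplus>\<^bsub>T\<^esub> \<ominus>\<^bsub>T\<^esub> z)) \<and>
      (\<forall>q. regular_fun C2 q \<longrightarrow> q T (sign_pt T z) = h (q E p))"
    if T: "comm_alg T" and z: "z \<in> carrier T" "z \<otimes>\<^bsub>T\<^esub> z = \<one>\<^bsub>T\<^esub>" for T z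
  proof -
    interpret T: etale_over s T a by (rule over[OF T])
    have "\<exists>h. comm_alg_hom E T h \<and> (\<forall>c d. h (e2 (c, d)) = c \<odot>\<^bsub>T\<^esub> \<ominus>\<^bsub>T\<^esub> (\<one>\<^bsub>T\<^esub> \<oplus>\<^bsub>T\<^esub> z) \<oplus>\<^bsub>T\<^esub> d \<odot>\<^bsub>T\<^esub> \<ominus>\<^bsub>T\<^esub> (\<one>\<^bsub>T\<^esub> \<oplus>\<^bsub>T\<^esub> \<ominus>\<^bsub>T\<^esub> z)) \<and> h (e2 (1, - 1)) = z"
    proof (rule T.square_hom[OF e2 z, folded E_def])
      fix h assume h: "comm_alg_hom E T h" "\<And>c d. h (e2 (c, d)) = c \<odot>\<^bsub>T\<^esub> \<ominus>\<^bsub>T\<^esub> (\<one>\<^bsub>T\<^esub> \<oplus>\<^bsub>T\<^esub> z) \<oplus>\<^bsub>T\<^esub> d \<odot>\<^bsub>T\<^esub> \<ominus>\<^bsub>T\<^esub> (\<one>\<^bsub>T\<^esub> \<oplus>\<^bsub>T\<^esub> \<ominus>\<^bsub>T\<^esub> z)" "h (e2 (1, - 1)) = z"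
      show ?thesis by (intro exI[of _ h] conjI allI h)
    qed
    then obtain h where h: "comm_alg_hom E T h" "\<forall>c d. h (e2 (c, d)) = c \<odot>\<^bsub>T\<^esub> \<ominus>\<^bsub>T\<^esub> (\<one>\<^bsub>T\<^esub> \<oplus>\<^bsub>T\<^esub> z) \<oplus>\<^bsub>T\<^esub> d \<odot>\<^bsub>T\<^esub> \<ominus>\<^bsub>T\<^esub> (\<one>\<^bsub>T\<^esub> \<oplus>\<^bsub>T\<^esub> \<ominus>\<^bsub>T\<^esub> z)" "h (e2 (1, - 1)) = z" by blast
    interpret h: etale_hom s E T a h by (rule over_hom[OF h(1)])
    have m: "mor C2 E T h p = sign_pt T z" unfolding p_def using h.sign_pt_f[OF y1(1)] h(3) by simp
    have "q T (sign_pt T z) = h (q E p)" if "regular_fun C2 q" for q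
    proof -
      have "q T (mor C2 E T h p) = h (q E p)" using that h(1) pC unfolding regular_fun_def by blast
      then show ?thesis by (simp only: m)
    qed
    then show ?thesis using h(2) by blast
  qed
  have "u E p \<in> carrier E" "v E p \<in> carrier E" using u v E pC unfolding regular_fun_def by blast+
  then obtain c d c' d' where uE: "u E p = e2 (c, d)" and vE: "v E p = e2 (c', d')" unfolding SE by force
  have "to_ac (3 :: 'f) = (3 :: 'f alg_closure)" by (rule to_ac_numeral)
  then have ac3: "(3 :: 'f alg_closure) = 0" by (simp only: three_f to_ac_0)
  have one: "\<ominus>\<^bsub>L\<^esub> (\<one>\<^bsub>L\<^esub> \<oplus>\<^bsub>L\<^esub> \<one>\<^bsub>L\<^esub>) = \<one>\<^bsub>L\<^esub>" using L.sign_R(3)[of "\<zero>\<^bsub>L\<^esub>" "\<zero>\<^bsub>L\<^esub>"] by (simp add: L.minus_add)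
  have zero: "\<ominus>\<^bsub>L\<^esub> (\<one>\<^bsub>L\<^esub> \<oplus>\<^bsub>L\<^esub> \<ominus>\<^bsub>L\<^esub> \<one>\<^bsub>L\<^esub>) = \<zero>\<^bsub>L\<^esub>" by (simp add: L.r_neg)
  have inj1: "x = z" if "x \<odot>\<^bsub>L\<^esub> \<one>\<^bsub>L\<^esub> = z \<odot>\<^bsub>L\<^esub> \<one>\<^bsub>L\<^esub>" for x z
    using that injD[OF e, of "to_ac x" "to_ac z"] by (simp add: S)
  have "\<one>\<^bsub>L.HG\<^esub> \<in> carrier L.HG" by (rule monoid.one_closed[OF group.is_monoid[OF L.cent_group]])
  then have eq1: "u L (sign_pt L \<one>\<^bsub>L\<^esub>) = v L (sign_pt L \<one>\<^bsub>L\<^esub>)"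
    using uv L L.sign_one unfolding cent_sign_def by metis
  obtain h where h: "\<And>c d. h (e2 (c, d)) = c \<odot>\<^bsub>L\<^esub> \<ominus>\<^bsub>L\<^esub> (\<one>\<^bsub>L\<^esub> \<oplus>\<^bsub>L\<^esub> \<one>\<^bsub>L\<^esub>) \<oplus>\<^bsub>L\<^esub> d \<odot>\<^bsub>L\<^esub> \<ominus>\<^bsub>L\<^esub> (\<one>\<^bsub>L\<^esub> \<oplus>\<^bsub>L\<^esub> \<ominus>\<^bsub>L\<^esub> \<one>\<^bsub>L\<^esub>)"
      "\<And>q. regular_fun C2 q \<Longrightarrow> q L (sign_pt L \<one>\<^bsub>L\<^esub>) = h (q E p)"
    using val[OF L, of "\<one>\<^bsub>L\<^esub>"] by auto
  have "c \<odot>\<^bsub>L\<^esub> \<one>\<^bsub>L\<^esub> = c' \<odot>\<^bsub>L\<^esub> \<one>\<^bsub>L\<^esub>"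
    using eq1 unfolding h(2)[OF u] h(2)[OF v] uE vE h(1) one zero by simp
  then have c: "c = c'" by (rule inj1)
  \<comment> \<open>The functions \<open>u\<close> and \<open>v\<close> are known to agree only at
    signs of points of the centralizer, so a point of sign -1 is required; over the closure it
    exists.\<close>
  obtain g where g: "g \<in> carrier L.HG" "L.sign g = \<ominus>\<^bsub>L\<^esub> \<one>\<^bsub>L\<^esub>"
  proof (rule L.sign_minus_one)
    fix m :: 'f
    obtain x :: "'f alg_closure" where "x ^ 3 = to_ac m" using nth_root_exists[of 3 "to_ac m"] by auto
    then show "\<exists>x \<in> carrier L. x \<otimes>\<^bsub>L\<^esub> (x \<otimes>\<^bsub>L\<^esub> x) = m \<odot>\<^bsub>L\<^esub> \<one>\<^bsub>L\<^esub>"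
      by (intro bexI[of _ "e x"]) (simp_all add: S power3_eq_cube mult.assoc)
  next
    fix q assume "q \<in> carrier L" and q3: "q \<otimes>\<^bsub>L\<^esub> (q \<otimes>\<^bsub>L\<^esub> q) = \<one>\<^bsub>L\<^esub>"
    then obtain x where q: "q = e x" by (auto simp: S)
    have "x * (x * x) = 1" using q3 injD[OF e, of "x * (x * x)" 1] by (simp add: S q)
    \<comment> \<open>In characteristic 3 the cube of \<open>x - 1\<close> is
      \<open>x^3 - 1\<close>, so 1 is the only cube root of 1 in a field.\<close>
    moreover have "(x - 1) ^ 3 = x * (x * x) - 1 - 3 * (x * x - x)" by (simp add: power3_eq_cube algebra_simps)
    ultimately have "(x - 1) ^ 3 = 0" by (simp add: ac3)
    then show "q = \<one>\<^bsub>L\<^esub>" by (simp add: q S)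
  qed
  have eq2: "u L (sign_pt L (\<ominus>\<^bsub>L\<^esub> \<one>\<^bsub>L\<^esub>)) = v L (sign_pt L (\<ominus>\<^bsub>L\<^esub> \<one>\<^bsub>L\<^esub>))"
    using uv L g unfolding cent_sign_def by metis
  have sq: "\<ominus>\<^bsub>L\<^esub> \<one>\<^bsub>L\<^esub> \<otimes>\<^bsub>L\<^esub> \<ominus>\<^bsub>L\<^esub> \<one>\<^bsub>L\<^esub> = \<one>\<^bsub>L\<^esub>" by (simp add: L.l_minus)
  have mm: "\<ominus>\<^bsub>L\<^esub> (\<ominus>\<^bsub>L\<^esub> \<one>\<^bsub>L\<^esub>) = \<one>\<^bsub>L\<^esub>" by simp
  obtain h where h: "\<And>c d. h (e2 (c, d)) = c \<odot>\<^bsub>L\<^esub> \<ominus>\<^bsub>L\<^esub> (\<one>\<^bsub>L\<^esub> \<oplus>\<^bsub>L\<^esub> \<ominus>\<^bsub>L\<^esub> \<one>\<^bsub>L\<^esub>) \<oplus>\<^bsub>L\<^esub> d \<odot>\<^bsub>L\<^esub> \<ominus>\<^bsub>L\<^esub> (\<one>\<^bsub>L\<^esub> \<oplus>\<^bsub>L\<^esub> \<ominus>\<^bsub>L\<^esub> (\<ominus>\<^bsub>L\<^esub> \<one>\<^bsub>L\<^esub>))"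
      "\<And>q. regular_fun C2 q \<Longrightarrow> q L (sign_pt L (\<ominus>\<^bsub>L\<^esub> \<one>\<^bsub>L\<^esub>)) = h (q E p)"
    using val[OF L _ sq] by auto
  have "d \<odot>\<^bsub>L\<^esub> \<one>\<^bsub>L\<^esub> = d' \<odot>\<^bsub>L\<^esub> \<one>\<^bsub>L\<^esub>"
    using eq2 unfolding h(2)[OF u] h(2)[OF v] uE vE h(1) mm one zero by simp
  then have d: "d = d'" by (rule inj1)
  interpret R: etale_over s R a by (rule over[OF R])
  obtain z where z: "z \<in> carrier R" "z \<otimes>\<^bsub>R\<^esub> z = \<one>\<^bsub>R\<^esub>" "y = sign_pt R z" using y by (rule R.sign_pt_cases)
  show "u R y = v R y" using val[OF R z(1,2)] u v uE vE c d z(3) by metis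
qed (rule cent_sign_hom)

text \<open>Injectivity is the uniqueness, and exactness in the middle the existence, of the normal
  form with factors \<open>hexp z\<close>, \<open>hmu r\<close> and \<open>nilp m n\<close>: a point
  has sign 1 exactly when it changes \<open>theta\<close> by an element of the radical only.\<close>

lemma exact_sequence:
  assumes inf: "infinite (UNIV :: 'u set)" and j: "inj (j :: 'f \<Rightarrow> 'u)"
  shows "short_exact (direct_functor
      (semidirect_functor (cent_functor s a) (mu_embed s) (K_functor s a) (mu_functor s)) (N_functor s a))
    (cent_functor s a :: ('f, 'k, 'u) cayley_functor) C2 (KMN_embed s a) cent_sign"
proof -
  let ?H = "cent_functor s a :: ('f, 'k, 'u) cayley_functor"
  let ?S = "semidirect_functor ?H (mu_embed s) (K_functor s a) (mu_functor s)"
  let ?G = "direct_functor ?S (N_functor s a)"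
  have S: "group_functor ?S"
    by (rule semidirect_functor_group_functor[OF cent_functor_group_functor K_subgroup_functor mu_functor_group_functor mu_embed_hom])
      (rule etale_over.K_normalized[OF over])
  have G: "group_functor ?G"
    by (rule direct_functor_group_functor[OF S N_subgroup_functor[unfolded subgroup_functor_def, THEN conjunct1]])
  have car: "carrier (pts ?G R) = (carrier (pts (K_functor s a) R) \<times> carrier (pts (mu_functor s) R)) \<times> carrier (pts (N_functor s a) R)"
    for R by (simp add: direct_functor_def semidirect_functor_def)
  have hom: "KMN_embed s a R \<in> hom (pts ?G R) (pts ?H R)" if R: "comm_alg R" for R
  proof -
    interpret A: etale_over s R a by (rule over[OF R])
    have "KMN_embed s a R = (\<lambda>((k, r), g). k \<otimes>\<^bsub>A.HG\<^esub> mu_embed s R r \<otimes>\<^bsub>A.HG\<^esub> g)"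
      by (simp add: KMN_embed_def)
    moreover have "pts ?G R = group.semidirect A.HG (mu_embed s R) (pts (K_functor s a) R) (pts (mu_functor s) R) \<times>\<times> pts (N_functor s a) R"
      by (simp add: direct_functor_def pts_semidirect[OF R cent_functor_group_functor])
    moreover have "monoid.mult (pts (N_functor s a) R) = monoid.mult A.HG" by (simp add: N_functor_def)
    ultimately show ?thesis
      using group.semidirect_commuting_hom[OF A.cent_group A.K_subgroup A.K_eq_HG A.mu_group A.mu_hom A.K_normalized
          subgroup.subset[OF A.N_subgroup] _ A.N_commutes] by simp
  qed
  have nat: "KMN_embed s a S (mor ?G R S f x) = mor ?H R S f (KMN_embed s a R x)"
    if f: "comm_alg_hom R S f" and x: "x \<in> carrier (pts ?G R)" for R S f x
  proof -
    interpret h: etale_hom s R S a f by (rule over_hom[OF f])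
    obtain k r g where e: "x = ((k, r), g)" by (metis surj_pair)
    have x': "k \<in> carrier (pts (K_functor s a) R)" "r \<in> carrier (pts (mu_functor s) R)"
      "g \<in> carrier (pts (N_functor s a) R)" using x unfolding car e by (simp_all only: mem_Times_iff fst_conv snd_conv)
    have c: "k \<in> carrier h.A.HG" "g \<in> carrier h.A.HG" "mu_embed s R r \<in> carrier h.A.HG"
      by (rule subsetD[OF subgroup.subset[OF h.A.K_subgroup] x'(1)], rule subsetD[OF subgroup.subset[OF h.A.N_subgroup] x'(3)],
          rule hom_in_carrier[OF h.A.mu_hom x'(2)])
    have "k \<otimes>\<^bsub>h.A.HG\<^esub> mu_embed s R r \<in> carrier h.A.HG"
      by (rule monoid.m_closed[OF group.is_monoid[OF h.A.cent_group] c(1,3)])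
    then have "mor ?H R S f (KMN_embed s a R x) = mor ?H R S f k \<otimes>\<^bsub>h.B.HG\<^esub> mor ?H R S f (mu_embed s R r) \<otimes>\<^bsub>h.B.HG\<^esub> mor ?H R S f g"
      using c by (simp add: e KMN_embed_def mor_cent h.bc_hom)
    also have "mor ?H R S f (mu_embed s R r) = mu_embed s S (mor (mu_functor s) R S f r)"
      by (rule mu_embed_hom[unfolded functor_hom_def, THEN conjunct2, rule_format, symmetric, OF f x'(2)])
    finally show ?thesis
      by (simp add: e KMN_embed_def direct_functor_def semidirect_functor_def K_functor_def N_functor_def)
  qed
  have inj: "inj_on (KMN_embed s a R) (carrier (pts ?G R))"
    and ex: "KMN_embed s a R ` carrier (pts ?G R) = kernel (pts ?H R) (pts C2 R) (cent_sign R)" if R: "comm_alg R" for R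
  proof -
    interpret A: etale_over s R a by (rule over[OF R])
    define el where "el z r m n = ((A.lift (A.H.hexp z), r), A.lift (A.nilp m n))" for z and r :: "'k \<Rightarrow> 'u" and m n
    have embed: "KMN_embed s a R (el z r m n) = A.lift (\<lambda>V. A.H.hexp z (A.H.hmu r (A.nilp m n V)))"
      if "z \<in> KR s R" "r \<in> carrier (pts (mu_functor s) R)" "m \<in> carrier R" "n \<in> carrier R" for z r m n
      using A.structure_lift[OF that] by (simp add: KMN_embed_def el_def)
    have form: "\<exists>z r m n. z \<in> KR s R \<and> r \<in> carrier (pts (mu_functor s) R) \<and> m \<in> carrier R \<and> n \<in> carrier R \<and> x = el z r m n"
      if "x \<in> carrier (pts ?G R)" for x
      using that unfolding car A.K_carrier A.N_carrier el_def by blast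
    show "inj_on (KMN_embed s a R) (carrier (pts ?G R))"
    proof (rule inj_onI)
      fix x y assume x: "x \<in> carrier (pts ?G R)" and y: "y \<in> carrier (pts ?G R)" and e: "KMN_embed s a R x = KMN_embed s a R y"
      obtain z r m n where 1: "z \<in> KR s R" "r \<in> carrier (pts (mu_functor s) R)" "m \<in> carrier R" "n \<in> carrier R"
        "x = el z r m n" using form[OF x] by blast
      obtain z' r' m' n' where 2: "z' \<in> KR s R" "r' \<in> carrier (pts (mu_functor s) R)" "m' \<in> carrier R" "n' \<in> carrier R"
        "y = el z' r' m' n'" using form[OF y] by blast
      have "z = z' \<and> r = r' \<and> m = m' \<and> n = n'"
        by (rule A.structure_unique[OF 1(1-4) 2(1-4)]) (use embed[OF 1(1-4)] embed[OF 2(1-4)] e 1(5) 2(5) in simp)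
      then show "x = y" using 1(5) 2(5) by simp
    qed
    have ker: "g \<in> kernel (pts ?H R) (pts C2 R) (cent_sign R) \<longleftrightarrow> g \<in> carrier A.HG \<and> A.sign g = \<one>\<^bsub>R\<^esub>" for g
    proof -
      have "A.sign g \<in> carrier R" if g: "g \<in> carrier A.HG" using A.sign_props[OF g] by metis
      then show ?thesis using A.sign_pt_inj[of "A.sign g" "\<one>\<^bsub>R\<^esub>"]
        by (auto simp: kernel_def cent_sign_def A.sign_pt_one)
    qed
    show "KMN_embed s a R ` carrier (pts ?G R) = kernel (pts ?H R) (pts C2 R) (cent_sign R)"
    proof (intro subset_antisym subsetI)
      fix g assume "g \<in> KMN_embed s a R ` carrier (pts ?G R)"
      then obtain x where x: "x \<in> carrier (pts ?G R)" "g = KMN_embed s a R x" by blast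
      obtain z r m n where 1: "z \<in> KR s R" "r \<in> carrier (pts (mu_functor s) R)" "m \<in> carrier R" "n \<in> carrier R"
        "x = el z r m n" using form[OF x(1)] by blast
      show "g \<in> kernel (pts ?H R) (pts C2 R) (cent_sign R)"
        unfolding ker using hom_in_carrier[OF hom[OF R] x(1)] A.sign_structure[OF 1(1-4)] embed[OF 1(1-4)] x(2) 1(5) by simp
    next
      fix g assume "g \<in> kernel (pts ?H R) (pts C2 R) (cent_sign R)"
      then have g: "g \<in> carrier A.HG" "A.sign g = \<one>\<^bsub>R\<^esub>" by (simp_all add: ker)
      obtain v where "A.low g (A.HS.hK A.theta) = (A.iota (A.sign g) \<otimes>\<^bsub>A.KRing\<^esub> A.theta, v, v, v)"
        using A.sign_props[OF g(1)] by metis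
      then have th: "fst (A.low g (A.HS.hK A.theta)) = A.theta" using g(2) by (simp add: A.iota_hom)
      obtain z r m n where 1: "z \<in> KR s R" "r \<in> carrier (pts (mu_functor s) R)" "m \<in> carrier R" "n \<in> carrier R"
        "g = A.lift (\<lambda>V. A.H.hexp z (A.H.hmu r (A.nilp m n V)))" using A.cent_structure[OF g(1) th] by metis
      have "el z r m n \<in> carrier (pts ?G R)"
        unfolding car el_def A.K_carrier A.N_carrier using 1(1-4) by blast
      moreover have "g = KMN_embed s a R (el z r m n)" using embed[OF 1(1-4)] 1(5) by simp
      ultimately show "g \<in> KMN_embed s a R ` carrier (pts ?G R)" by blast
    qed
  qed
  have "functor_mono ?G ?H (KMN_embed s a)" unfolding functor_mono_def functor_hom_def
    by (intro conjI allI impI ballI hom nat inj)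
  then show ?thesis unfolding short_exact_def
    by (intro conjI allI impI G cent_functor_group_functor C2_functor_group_functor cent_sign_quotient[OF inf j] ex)
qed

end

theorem theorem7p5:
  fixes s :: "'f::field \<Rightarrow> 'k \<Rightarrow> 'k::comm_ring_1" and a :: 'k
  assumes char3: "CHAR('f) = 3"
    and etale: "quadratic_etale s"
    and norm1: "knorm s a = 1"
    and universe: "infinite (UNIV :: 'u set)" "\<exists>j :: 'f \<Rightarrow> 'u. inj j"
  shows
    "(\<exists>p. short_exact
        (direct_functor
           (semidirect_functor (cent_functor s a) (mu_embed s) (K_functor s a) (mu_functor s))
           (N_functor s a))
        (cent_functor s a :: ('f, 'k, 'u) cayley_functor)
        (constant_functor (integer_mod_group 2))
        (KMN_embed s a) p)
     \<and> twisted_form (mu_functor s :: ('f, 'u, 'k \<Rightarrow> 'u) grp_functor) mu3_functor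
     \<and> functor_mono (mu_functor s) (cent_functor s a :: ('f, 'k, 'u) cayley_functor) (mu_embed s)
     \<and> subgroup_functor (K_functor s a :: ('f, 'k, 'u) cayley_functor) (cent_functor s a)
     \<and> (\<forall>R :: ('f, 'u) module. comm_alg R \<longrightarrow> comm_group (pts (K_functor s a) R))
     \<and> functor_isomorphic (K_functor s a :: ('f, 'k, 'u) cayley_functor) add_square_functor
     \<and> (\<forall>R :: ('f, 'u) module. comm_alg R \<longrightarrow>
          (\<lambda>g. restrict g (FixR s R)) \<in> hom (pts (cent_functor s a) R) (aut_fix s a R))
     \<and> subgroup_functor (N_functor s a :: ('f, 'k, 'u) cayley_functor) (cent_functor s a)
     \<and> functor_isomorphic (N_functor s a :: ('f, 'k, 'u) cayley_functor) add_square_functor"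
proof -
  interpret cayley_setup s a
    by (intro cayley_setup.intro quad_etale.intro cayley_setup_axioms.intro char3 etale norm1)
  \<comment> \<open>An embedding of the field into the infinite universe type makes room there for
    copies of \<open>F \<times> F\<close> and of an algebraic closure.\<close>
  obtain j :: "'f \<Rightarrow> 'u" where j: "inj j" using universe(2) by blast
  show ?thesis
    by (intro conjI allI impI exI[of _ cent_sign] exact_sequence[OF universe(1) j] mu_twisted_form[OF universe(1) j]
        mu_embed_mono K_subgroup_functor K_isomorphic N_subgroup_functor N_isomorphic
        etale_over.K_comm_group[OF over] etale_over.restrict_FixR_hom[OF over])
qed

end
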